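(* Let $N\ge2$ and let $A,B>0$. If $K\in C^2(\mathbb{R}^N\setminus\{0\})$ is a real-valued function such that $$|K(x)|\le\frac{A}{|x|^{N-1}}\quad\text{and}\quad|D^2K(x)|\le\frac{B}{|x|^{N+1}}\quad\text{for every }x\in\mathbb{R}^N\setminus\{0\},$$ and $\mu$ is a finite (possibly signed) Borel measure in $\mathbb{R}^N$, then $K*\mu$ is weak-$L^{\frac{N}{N-1}}$ differentiable at almost every point $y\in\mathbb{R}^N$ in the sense that $$\lim_{r\to0}\frac1r\,\frac{[K*\mu-T^1_y(K*\mu)]_{L^{\frac{N}{N-1}}_{\mathrm w}(B_r(y))}}{[1]_{L^{\frac{N}{N-1}}_{\mathrm w}(B_r(y))}}=0 .$$
   Context: $K*\mu(x)=\int K(x-y)\,\mathrm{d}\mu(y)$ is defined for a.e. $x$, namely whenever $\int|K(x-y)|\,\mathrm{d}|\mu|(y)<\infty$. For $1\le p<\infty$ and an open set $U$, $[f]_{L^p_{\mathrm w}(U)}:=\sup_{t>0}t\,|\{x\in U:|f(x)|>t\}|^{1/p}$, with $|E|$ the Lebesgue measure of $E$; thus $[1]_{L^{N/(N-1)}_{\mathrm w}(B_r(y))}=|B_r(y)|^{\frac{N-1}{N}}$. The approximate derivative of $v$ at $y$ is the linear map $D_{\mathrm{ap}}v(y)$ such that $\operatorname{ap\,lim}_{x\to y}\frac{v(x)-v(y)-D_{\mathrm{ap}}v(y)[x-y]}{|x-y|}=0$, where $\operatorname{ap\,lim}_{x\to y}w=c$ means that for every $\epsilon>0$, $\lim_{r\to0}|\{x:|w(x)-c|>\epsilon\}\cap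 B_r(y)|/|B_r(y)|=0$. When $D_{\mathrm{ap}}v(y)$ exists, $T^1_yv(x):=v(y)+D_{\mathrm{ap}}v(y)[x-y]$ for $x\in\mathbb{R}^N$ is the first-order Taylor approximation of $v$ at $y$. (Under the hypotheses, $K*\mu$ is approximately differentiable almost everywhere in $\mathbb{R}^N$.) *)

theory Defs
  imports "HOL-Analysis.Analysis"
begin

text \<open>A finite signed Borel measure is a countably additive real-valued set function on the Borel
  sets. Its values on other sets are irrelevant.\<close>

definition finite_signed_measure :: "('a::topological_space set \<Rightarrow> real) \<Rightarrow> bool" where
  "finite_signed_measure \<mu> \<longleftrightarrow>
     \<mu> {} = 0 \<and>
     (\<forall>E. range E \<subseteq> sets borel \<longrightarrow> disjoint_family E \<longrightarrow> (\<lambda>i. \<mu> (E i)) sums \<mu> (\<Union>i. E i))"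

text \<open>The Jordan decomposition: \<open>\<mu>\<^sup>+(E)\<close> is the supremum of \<open>\<mu>(F)\<close> over Borel sets \<open>F \<subseteq> E\<close>. The
  coercion \<open>ennreal\<close> sends negative values to 0, which is harmless because \<open>F = {}\<close> is allowed.\<close>

definition pos_variation :: "('a::topological_space set \<Rightarrow> real) \<Rightarrow> 'a measure" where
  "pos_variation \<mu> =
     measure_of UNIV (sets borel) (\<lambda>E. SUP F\<in>{F \<in> sets borel. F \<subseteq> E}. ennreal (\<mu> F))"

definition neg_variation :: "('a::topological_space set \<Rightarrow> real) \<Rightarrow> 'a measure" where
  "neg_variation \<mu> = pos_variation (\<lambda>E. - \<mu> E)"

definition total_variation :: "('a::topological_space set \<Rightarrow> real) \<Rightarrow> 'a measure" where
  "total_variation \<mu> =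
     measure_of UNIV (sets borel)
       (\<lambda>E. emeasure (pos_variation \<mu>) E + emeasure (neg_variation \<mu>) E)"

definition signed_integral :: "('a::topological_space set \<Rightarrow> real) \<Rightarrow> ('a \<Rightarrow> real) \<Rightarrow> real" where
  "signed_integral \<mu> f = (LINT y|pos_variation \<mu>. f y) - (LINT y|neg_variation \<mu>. f y)"

text \<open>At points where the convolution is not defined, \<open>convolve K \<mu>\<close> takes an arbitrary
  value; its domain of definition is \<open>convolution_defined K \<mu>\<close>.\<close>

definition convolution_defined ::
  "('a::real_normed_vector \<Rightarrow> real) \<Rightarrow> ('a set \<Rightarrow> real) \<Rightarrow> 'a \<Rightarrow> bool" where
  "convolution_defined K \<mu> x \<longleftrightarrow> (\<integral>\<^sup>+ y. ennreal \<bar>K (x - y)\<bar> \<partial>total_variation \<mu>) < \<infinity>"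

definition convolve ::
  "('a::real_normed_vector \<Rightarrow> real) \<Rightarrow> ('a set \<Rightarrow> real) \<Rightarrow> 'a \<Rightarrow> real" where
  "convolve K \<mu> x = signed_integral \<mu> (\<lambda>y. K (x - y))"

definition ennreal_powr :: "ennreal \<Rightarrow> real \<Rightarrow> ennreal" where
  "ennreal_powr x a = (if x = \<infinity> then \<infinity> else ennreal (enn2real x powr a))"

definition weak_Lp_seminorm :: "real \<Rightarrow> 'a::euclidean_space set \<Rightarrow> ('a \<Rightarrow> real) \<Rightarrow> ennreal" where
  "weak_Lp_seminorm p U f =
     (SUP t\<in>{0<..}. ennreal t * ennreal_powr (emeasure lebesgue {x \<in> U. t < \<bar>f x\<bar>}) (1 / p))"

definition ap_lim :: "('a::euclidean_space \<Rightarrow> real) \<Rightarrow> 'a \<Rightarrow> real \<Rightarrow> bool" where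
  "ap_lim w y c \<longleftrightarrow>
     (\<forall>\<epsilon>>0. ((\<lambda>r. measure lebesgue ({x. \<epsilon> < \<bar>w x - c\<bar>} \<inter> ball y r) / measure lebesgue (ball y r))
                \<longlongrightarrow> 0) (at_right 0))"

definition has_ap_derivative ::
  "('a::euclidean_space \<Rightarrow> real) \<Rightarrow> ('a \<Rightarrow> real) \<Rightarrow> 'a \<Rightarrow> bool" where
  "has_ap_derivative v D y \<longleftrightarrow>
     linear D \<and> ap_lim (\<lambda>x. (v x - v y - D (x - y)) / norm (x - y)) y 0"

definition ap_differentiable :: "('a::euclidean_space \<Rightarrow> real) \<Rightarrow> 'a \<Rightarrow> bool" where
  "ap_differentiable v y \<longleftrightarrow> (\<exists>D. has_ap_derivative v D y)"

definition ap_derivative :: "('a::euclidean_space \<Rightarrow> real) \<Rightarrow> 'a \<Rightarrow> 'a \<Rightarrow> real" where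
  "ap_derivative v y = (SOME D. has_ap_derivative v D y)"

definition ap_taylor1 :: "('a::euclidean_space \<Rightarrow> real) \<Rightarrow> 'a \<Rightarrow> 'a \<Rightarrow> real" where
  "ap_taylor1 v y x = v y + ap_derivative v y (x - y)"

text \<open>Weak-\<open>L\<^sup>p\<close> differentiability of \<open>v\<close> at \<open>y\<close>. The weak quasinorms, hence the quotient, live in
  \<open>[0, \<infinity>]\<close>; existence of the approximate derivative is required for the Taylor polynomial to be
  meaningful.\<close>

definition weak_Lp_differentiable ::
  "real \<Rightarrow> ('a::euclidean_space \<Rightarrow> real) \<Rightarrow> 'a \<Rightarrow> bool" where
  "weak_Lp_differentiable p v y \<longleftrightarrow>
     ap_differentiable v y \<and>
     ((\<lambda>r. ennreal (1 / r) *
           (weak_Lp_seminorm p (ball y r) (\<lambda>x. v x - ap_taylor1 v y x) /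
            weak_Lp_seminorm p (ball y r) (\<lambda>x. 1))) \<longlongrightarrow> 0) (at_right 0)"

end

theory Submission
  imports Defs
begin

text \<open>
  By the Jordan decomposition one may take \<open>\<mu> \<ge> 0\<close>. For \<open>t > 0\<close> let \<open>\<Omega>\<close> be the open set where the
  maximal function of \<open>\<mu>\<close> exceeds \<open>t\<close>; its volume is \<open>O(1/t)\<close>, so it is enough to treat almost every
  point \<open>y\<close> of the complement \<open>F\<close>. In place of a Whitney decomposition, the mass of \<open>\<mu>\<close> at \<open>z\<close> is spread
  uniformly over the ball of radius \<open>dist(z, F)/4\<close> about \<open>z\<close>. The resulting measure \<open>\<gamma>\<close> has a bounded
  density \<open>g\<close>, and \<open>K*\<mu> = K*g + K*(\<mu> - \<gamma>)\<close>.

  For \<open>K*g\<close>, truncating \<open>K\<close> smoothly at the scales \<open>2\<^sup>-\<^sup>n\<close> writes the gradient as a series of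
  convolutions with mean-zero dyadic kernels. These are almost orthogonal, so the series converges in
  \<open>L\<^sup>2\<close>; the maximal inequality and Borel-Cantelli turn this into an \<open>L\<^sup>2\<close> Taylor expansion at almost
  every point along a sparse sequence of scales. For \<open>K*(\<mu> - \<gamma>)\<close> the second-order bound on \<open>K\<close> controls
  the mass far from \<open>y\<close> by the Marcinkiewicz integral of \<open>dist(z, F) / |y - z|\<^sup>N\<^sup>+\<^sup>1\<close>, which is finite for
  almost every \<open>y\<close> in \<open>F\<close>, while the mass of \<open>\<Omega>\<close> in \<open>B\<^sub>2\<^sub>r(y)\<close> is \<open>o(r\<^sup>N)\<close> at density points of \<open>F\<close> and
  enters through the weak-type bound for \<open>|x|\<^sup>1\<^sup>-\<^sup>N\<close>.
\<close>

section \<open>Vitali coverings, large balls and density points\<close>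

text \<open>The gradient of \<open>K\<close> decays exactly like |x|^-N, so the gradient of K*g is a
  singular integral. Its cancellation is automatic: the dyadic pieces are derivatives of compactly
  supported functions and therefore have mean zero. The L^2 bound is obtained in physical space, by
  estimating the best constant for n scales in terms of its own square root. Convergence in L^2
  alone says nothing at a fixed point; the expansion at y needs gradient increments with small
  averages over all balls about y, and sparse scales make the exceptional sets summable. For the bad
  part, moving mass by at most a quarter of its distance to \<open>F\<close> brings in that distance
  as a factor. What is left cannot be bounded pointwise, because x may meet the poles; this is where
  the weak norm enters. Weak quasinorms do not integrate well over the poles, whereas integrals over
  sets of given volume do, so weak-type bounds are always derived from such integrals.\<close>

lemmas borel_ball [measurable] = borel_open[OF open_ball]

lemma emeasure_UN_le_nn_integral_count_space:
  assumes "countable I" and [measurable]: "\<And>i. i \<in> I \<Longrightarrow> X i \<in> sets M"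
  shows "emeasure M (\<Union>i\<in>I. X i) \<le> (\<integral>\<^sup>+i. emeasure M (X i) \<partial>count_space I)"
proof (cases "finite I")
  case True
  then show ?thesis
    by (subst nn_integral_count_space_finite) (auto intro!: emeasure_subadditive_finite simp: assms(2))
next
  case False
  define g where "g = from_nat_into I"
  have g: "bij_betw g UNIV I"
    unfolding g_def by (rule bij_betw_from_nat_into) (use False assms in auto)
  have "(\<Union>i\<in>I. X i) = (\<Union>n. X (g n))"
    using bij_betw_imp_surj_on[OF g] by auto
  also have "emeasure M \<dots> \<le> (\<Sum>n. emeasure M (X (g n)))"
    using g by (intro emeasure_subadditive_countably) (auto simp: bij_betw_def assms(2) image_subset_iff)
  also have "\<dots> = (\<integral>\<^sup>+n. emeasure M (X (g n)) \<partial>count_space UNIV)"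
    by (rule nn_integral_count_space_nat[symmetric])
  also have "\<dots> = (\<integral>\<^sup>+i. emeasure M (X i) \<partial>count_space I)"
    by (rule nn_integral_bij_count_space[OF g])
  finally show ?thesis .
qed

text \<open>The enlarged balls of a disjoint Vitali subfamily cover \<open>S\<close>, and the
  disjoint balls fit in \<open>V\<close>. The comparison serves twice with the roles exchanged:
  Lebesgue measure against \<nu> in the maximal inequality, and \<mu> against Lebesgue measure off
  the set of large balls. \<open>S\<close> may be any set, since \<open>emeasure\<close> is 0 on
  non-measurable ones.\<close>

lemma vitali_compare:
  fixes M1 M2 :: "'a::euclidean_space measure"
  assumes [measurable_cong]: "sets M1 = sets borel" "sets M2 = sets borel"
    and V[measurable]: "V \<in> sets borel"
    and r: "\<And>x. x \<in> S \<Longrightarrow> 0 < r x \<and> r x \<le> B"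
    and sub: "\<And>x. x \<in> S \<Longrightarrow> ball x (r x) \<subseteq> V"
    and le: "\<And>x. x \<in> S \<Longrightarrow> emeasure M1 (ball x (5 * r x)) \<le> c * emeasure M2 (ball x (r x))"
  shows "emeasure M1 S \<le> c * emeasure M2 V"
proof -
  have "S \<subseteq> (\<Union>x\<in>S. ball x (r x))"
    using r by (auto intro!: centre_in_ball[THEN iffD2])
  from Vitali_covering_lemma_balls[OF this r]
  obtain C where C: "countable C" "C \<subseteq> S"
    and disj: "pairwise (\<lambda>i j. disjnt (ball i (r i)) (ball j (r j))) C"
    and cov: "S \<subseteq> (\<Union>i\<in>C. ball i (5 * r i))" by blast
  have "emeasure M1 S \<le> emeasure M1 (\<Union>i\<in>C. ball i (5 * r i))"
    using cov C by (intro emeasure_mono) (auto intro!: sets.countable_UN')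
  also have "\<dots> \<le> (\<integral>\<^sup>+i. emeasure M1 (ball i (5 * r i)) \<partial>count_space C)"
    by (intro emeasure_UN_le_nn_integral_count_space C) simp
  also have "\<dots> \<le> (\<integral>\<^sup>+i. c * emeasure M2 (ball i (r i)) \<partial>count_space C)"
    using C by (intro nn_integral_mono) (auto intro!: le)
  also have "\<dots> = c * (\<integral>\<^sup>+i. emeasure M2 (ball i (r i)) \<partial>count_space C)"
    by (rule nn_integral_cmult) simp
  also have "(\<integral>\<^sup>+i. emeasure M2 (ball i (r i)) \<partial>count_space C) = emeasure M2 (\<Union>i\<in>C. ball i (r i))"
    using disj by (intro emeasure_UN_countable[symmetric] C)
      (auto simp: disjoint_family_on_def pairwise_def disjnt_def)
  also have "\<dots> \<le> emeasure M2 V"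
    using sub C by (intro emeasure_mono) auto
  finally show ?thesis by (simp add: mult_left_mono)
qed

text \<open>The superlevel set at \<open>s\<close> of the centred maximal function of \<nu>, with
  balls normalised by r^N instead of by volume.\<close>

definition large_ball_set :: "'a::euclidean_space measure \<Rightarrow> real \<Rightarrow> 'a set" where
  "large_ball_set \<nu> s = {y. \<exists>r>0. ennreal (s * r ^ DIM('a)) < emeasure \<nu> (ball y r)}"

text \<open>A strict inequality at radius \<open>r\<close> persists at a slightly larger radius
  \<open>q\<close>, and the margin q - r absorbs a displacement of the centre.\<close>

lemma open_large_ball_set:
  fixes \<nu> :: "'a::euclidean_space measure"
  assumes sets: "sets \<nu> = sets borel"
  shows "open (large_ball_set \<nu> s)"
  unfolding open_dist
proof
  fix y assume "y \<in> large_ball_set \<nu> s"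
  then obtain r where r: "r > 0" "ennreal (s * r ^ DIM('a)) < emeasure \<nu> (ball y r)"
    by (auto simp: large_ball_set_def)
  have "((\<lambda>q. ennreal (s * q ^ DIM('a))) \<longlongrightarrow> ennreal (s * r ^ DIM('a))) (at_right r)"
    by (intro tendsto_intros tendsto_ennrealI)
  from order_tendstoD(2)[OF this r(2)]
  obtain q where q: "q > r" "ennreal (s * q ^ DIM('a)) < emeasure \<nu> (ball y r)"
    by (metis (mono_tags, lifting) dense eventually_at_right_field gt_ex)
  show "\<exists>e>0. \<forall>y'. dist y' y < e \<longrightarrow> y' \<in> large_ball_set \<nu> s"
  proof (intro exI[of _ "q - r"] conjI allI impI)
    fix y' assume "dist y' y < q - r"
    then have "ball y r \<subseteq> ball y' q"
      by (intro subsetI) (metric)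
    then have "emeasure \<nu> (ball y r) \<le> emeasure \<nu> (ball y' q)"
      by (intro emeasure_mono) (auto simp: sets)
    with q r show "y' \<in> large_ball_set \<nu> s"
      by (auto simp: large_ball_set_def intro!: exI[of _ q])
  qed (use q in auto)
qed

text \<open>The weak-type (1,1) maximal inequality: for a large ball, |B_5r| = c r^N <= (c/s)
  \<nu>(B_r), which is what the Vitali comparison asks for.\<close>

lemma emeasure_large_ball_set:
  fixes \<nu> :: "'a::euclidean_space measure"
  assumes sets: "sets \<nu> = sets borel" and fin: "finite_measure \<nu>" and s: "s > 0"
  shows "emeasure lborel (large_ball_set \<nu> s)
           \<le> ennreal (unit_ball_vol (real DIM('a)) * 5 ^ DIM('a) / s) * emeasure \<nu> UNIV"
proof -
  interpret finite_measure \<nu> by fact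
  have "\<exists>r>0. ennreal (s * r ^ DIM('a)) < emeasure \<nu> (ball y r)" if "y \<in> large_ball_set \<nu> s" for y
    using that by (auto simp: large_ball_set_def)
  then obtain r where r: "\<And>y. y \<in> large_ball_set \<nu> s \<Longrightarrow> r y > 0"
      "\<And>y. y \<in> large_ball_set \<nu> s \<Longrightarrow> ennreal (s * r y ^ DIM('a)) < emeasure \<nu> (ball y (r y))"
    by metis
  show ?thesis
  proof (rule vitali_compare)
    \<comment> \<open>Finite total mass bounds the radii, as the covering lemma requires; for r > 1
      a bound on r^N is a bound on r.\<close>
    show "0 < r y \<and> r y \<le> max 1 (measure \<nu> UNIV / s)" if "y \<in> large_ball_set \<nu> s" for y
    proof -
      have "ennreal (s * r y ^ DIM('a)) < emeasure \<nu> UNIV"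
        using r(2)[OF that] emeasure_mono[of "ball y (r y)" UNIV \<nu>] sets by auto
      then have "s * r y ^ DIM('a) < measure \<nu> UNIV"
        by (simp add: emeasure_eq_measure ennreal_less_iff s r(1)[OF that] less_imp_le)
      then have *: "r y ^ DIM('a) < measure \<nu> UNIV / s"
        using s by (simp add: field_simps)
      show ?thesis
      proof (cases "r y \<le> 1")
        case False
        then have "r y \<le> r y ^ DIM('a)" by (intro self_le_power) auto
        with * r(1)[OF that] show ?thesis by auto
      qed (use r(1)[OF that] in auto)
    qed
    show "emeasure lborel (ball y (5 * r y))
        \<le> ennreal (unit_ball_vol (real DIM('a)) * 5 ^ DIM('a) / s) * emeasure \<nu> (ball y (r y))"
      if y: "y \<in> large_ball_set \<nu> s" for y
    proof -
      have "emeasure lborel (ball y (5 * r y))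
          = ennreal (unit_ball_vol (real DIM('a)) * 5 ^ DIM('a) / s) * ennreal (s * r y ^ DIM('a))"
        using r(1)[OF y] s by (simp add: emeasure_ball ennreal_mult[symmetric] power_mult_distrib)
      also have "\<dots> \<le> ennreal (unit_ball_vol (real DIM('a)) * 5 ^ DIM('a) / s) * emeasure \<nu> (ball y (r y))"
        using r(2)[OF y] by (intro mult_left_mono) auto
      finally show ?thesis .
    qed
  qed (use sets in auto)
qed

text \<open>Density points are obtained from the maximal inequality. The complement of
  \<open>E\<close> is enclosed in open sets U_n with excess below 1/(n+1), and \<nu>_n is Lebesgue
  measure on the excess. The points that are large for every \<nu>_n at a fixed level form a null
  set; at any other point outside \<open>E\<close>, small balls lie in some U_n and meet
  \<open>E\<close> only inside the excess.\<close>

lemma AE_density_point: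
  fixes E :: "'a::euclidean_space set"
  assumes E[measurable]: "E \<in> sets borel"
  shows "AE y in lborel. y \<notin> E \<longrightarrow> (\<forall>\<epsilon>>0. \<exists>\<delta>>0. \<forall>r. 0 < r \<and> r < \<delta> \<longrightarrow>
           emeasure lborel (ball y r \<inter> E) \<le> ennreal (\<epsilon> * r ^ DIM('a)))"
proof -
  let ?c = "unit_ball_vol (real DIM('a)) * 5 ^ DIM('a)"
  have "\<exists>U. open U \<and> - E \<subseteq> U \<and> emeasure lborel (U - (- E)) < ennreal (1 / Suc n)" for n
  proof -
    obtain T where T: "open T" "- E \<subseteq> T" "emeasure lebesgue (T - (- E)) < ennreal (1 / Suc n)"
      using sets_lebesgue_outer_open[of "- E" "1 / Suc n"] E by auto
    moreover have "T - (- E) \<in> sets lborel"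
      using T(1) E by auto
    ultimately show ?thesis by auto
  qed
  then obtain U where U: "\<And>n. open (U n)" "\<And>n. - E \<subseteq> U n"
      "\<And>n::nat. emeasure lborel (U n - (- E)) < ennreal (1 / Suc n)" by metis
  have [measurable]: "U n \<in> sets borel" for n using U by auto
  define \<nu> where "\<nu> n = density lborel (indicator (U n - (- E)))" for n
  have emn: "emeasure (\<nu> n) A = emeasure lborel ((U n - (- E)) \<inter> A)" if "A \<in> sets borel" for n A
    unfolding \<nu>_def by (rule emeasure_restricted) (use that in auto)
  have setsn: "sets (\<nu> n) = sets borel" for n by (simp add: \<nu>_def)
  have finn: "finite_measure (\<nu> n)" for n
    using U(3)[of n] by (intro finite_measureI) (auto simp: emn \<nu>_def space_density emeasure_restricted top_unique)
  have [measurable, simp]: "large_ball_set (\<nu> n) s \<in> sets borel" for n s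
    by (intro borel_open open_large_ball_set setsn)
  have "(\<Inter>n. large_ball_set (\<nu> n) (1 / Suc k)) \<in> null_sets lborel" for k
  proof -
    have "emeasure lborel (\<Inter>n. large_ball_set (\<nu> n) (1 / Suc k)) \<le> ennreal (?c * (real (Suc k)) * (1 / Suc n))" for n
    proof -
      have "emeasure lborel (\<Inter>n. large_ball_set (\<nu> n) (1 / Suc k)) \<le> emeasure lborel (large_ball_set (\<nu> n) (1 / Suc k))"
        by (intro emeasure_mono) auto
      also have "\<dots> \<le> ennreal (?c / (1 / Suc k)) * emeasure (\<nu> n) UNIV"
        by (intro emeasure_large_ball_set setsn finn) auto
      also have "\<dots> \<le> ennreal (?c / (1 / Suc k)) * ennreal (1 / Suc n)"
        using U(3)[of n] by (intro mult_left_mono) (auto simp: emn)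
      also have "\<dots> = ennreal (?c * (real (Suc k)) * (1 / Suc n))"
        by (subst ennreal_mult[symmetric]) (auto)
      finally show ?thesis .
    qed
    moreover have "(\<lambda>n. ennreal (?c * (real (Suc k)) * (1 / Suc n))) \<longlonglongrightarrow> ennreal (?c * (real (Suc k)) * 0)"
      by (intro tendsto_intros tendsto_ennrealI LIMSEQ_Suc[OF lim_1_over_n])
    ultimately have "emeasure lborel (\<Inter>n. large_ball_set (\<nu> n) (1 / Suc k)) \<le> 0"
      by (intro LIMSEQ_le_const) auto
    moreover have "(\<Inter>n. large_ball_set (\<nu> n) (1 / Suc k)) \<in> sets lborel"
      by measurable
    ultimately show ?thesis
      by (intro null_setsI) auto
  qed
  then have "(\<Union>k. \<Inter>n. large_ball_set (\<nu> n) (1 / Suc k)) \<in> null_sets lborel"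
    by (intro null_sets_UN)
  then have "AE y in lborel. y \<notin> (\<Union>k. \<Inter>n. large_ball_set (\<nu> n) (1 / Suc k))"
    by (rule AE_not_in)
  then show ?thesis
  proof (rule AE_mp, intro AE_I2 impI allI)
    fix y and \<epsilon> :: real
    assume y: "y \<notin> (\<Union>k. \<Inter>n. large_ball_set (\<nu> n) (1 / Suc k))" "y \<notin> E" and \<epsilon>: "\<epsilon> > 0"
    obtain k where k: "1 / Suc k < \<epsilon>" using \<epsilon> nat_approx_posE by blast
    from y obtain n where n: "y \<notin> large_ball_set (\<nu> n) (1 / Suc k)" by auto
    have "y \<in> U n" using U(2)[of n] y by auto
    then obtain \<delta> where \<delta>: "\<delta> > 0" "ball y \<delta> \<subseteq> U n" using U(1)[of n] openE by blast
    show "\<exists>\<delta>>0. \<forall>r. 0 < r \<and> r < \<delta> \<longrightarrow> emeasure lborel (ball y r \<inter> E) \<le> ennreal (\<epsilon> * r ^ DIM('a))"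
    proof (intro exI conjI allI impI)
      fix r assume r: "0 < r \<and> r < \<delta>"
      then have "ball y r \<inter> E = (U n - (- E)) \<inter> ball y r" using \<delta> by auto
      then have "emeasure lborel (ball y r \<inter> E) = emeasure (\<nu> n) (ball y r)" by (simp add: emn)
      also have "\<dots> \<le> ennreal (1 / Suc k * r ^ DIM('a))"
        using n r unfolding large_ball_set_def mem_Collect_eq not_ex de_Morgan_conj not_less by (metis not_le)
      also have "\<dots> \<le> ennreal (\<epsilon> * r ^ DIM('a))"
        using k r by (intro ennreal_leI mult_right_mono) auto
      finally show "emeasure lborel (ball y r \<inter> E) \<le> ennreal (\<epsilon> * r ^ DIM('a))" .
    qed fact
  qed
qed

section \<open>Integrals of radial kernels and weak-type estimates\<close>

text \<open>A majorant by constants on concentric balls replaces polar coordinates; geometric radii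
  then turn power singularities into geometric series.\<close>

lemma nn_integral_radial_le:
  fixes f :: "'a::euclidean_space \<Rightarrow> ennreal"
  assumes le: "\<And>x. f x \<noteq> 0 \<Longrightarrow> \<exists>k. x \<in> ball z (\<rho> k) \<and> f x \<le> ennreal (a k)"
    and nonneg: "\<And>k. 0 \<le> a k" "\<And>k. 0 \<le> \<rho> k"
    and S: "(\<lambda>k::nat. a k * (unit_ball_vol (real DIM('a)) * \<rho> k ^ DIM('a))) sums S"
  shows "(\<integral>\<^sup>+x. f x \<partial>lborel) \<le> ennreal S"
proof -
  have "(\<integral>\<^sup>+x. f x \<partial>lborel) \<le> (\<integral>\<^sup>+x. (\<Sum>k. ennreal (a k) * indicator (ball z (\<rho> k)) x) \<partial>lborel)"
  proof (intro nn_integral_mono)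
    fix x
    show "f x \<le> (\<Sum>k. ennreal (a k) * indicator (ball z (\<rho> k)) x)"
    proof (cases "f x = 0")
      case False
      then obtain k where k: "x \<in> ball z (\<rho> k)" "f x \<le> ennreal (a k)" using le by blast
      then have "f x \<le> (\<Sum>k\<in>{k}. ennreal (a k) * indicator (ball z (\<rho> k)) x)" by simp
      also have "\<dots> \<le> (\<Sum>k. ennreal (a k) * indicator (ball z (\<rho> k)) x)"
        by (intro sum_le_suminf) auto
      finally show ?thesis .
    qed simp
  qed
  also have "\<dots> = (\<Sum>k. \<integral>\<^sup>+x. ennreal (a k) * indicator (ball z (\<rho> k)) x \<partial>lborel)"
    by (intro nn_integral_suminf) auto
  also have "\<dots> = (\<Sum>k. ennreal (a k * (unit_ball_vol (real DIM('a)) * \<rho> k ^ DIM('a))))"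
    using nonneg by (simp add: nn_integral_cmult_indicator emeasure_ball ennreal_mult)
  also have "\<dots> = ennreal S"
    using nonneg S by (intro suminf_ennreal_eq) auto
  finally show ?thesis .
qed

text \<open>On the shell \<rho>/2^(k+1) <= |x - z| < \<rho>/2^k the integrand is at most
  (2^(k+1)/\<rho>)^(N-1); the resulting bound halves with each k.\<close>

lemma nn_integral_inverse_power_ball_le:
  fixes z :: "'a::euclidean_space"
  assumes "\<rho> > 0"
  shows "(\<integral>\<^sup>+x. ennreal (1 / norm (x - z) ^ (DIM('a) - 1)) * indicator (ball z \<rho>) x \<partial>lborel)
          \<le> ennreal (unit_ball_vol (real DIM('a)) * 2 ^ DIM('a) * \<rho>)"
proof -
  obtain m where m: "DIM('a) = Suc m" using DIM_positive[where 'a='a] gr0_implies_Suc by blast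
  let ?\<omega> = "unit_ball_vol (real DIM('a))"
  have "(\<lambda>k. ?\<omega> * 2 ^ m * \<rho> * (1/2) ^ k) sums (?\<omega> * 2 ^ m * \<rho> * (1 / (1 - 1/2)))"
    by (intro sums_mult geometric_sums) auto
  moreover have "(2 ^ Suc k / \<rho>) ^ m * (?\<omega> * (\<rho> / 2 ^ k) ^ DIM('a)) = ?\<omega> * 2 ^ m * \<rho> * (1/2) ^ k" for k
    using assms by (simp add: m power_mult_distrib power_divide field_simps)
  ultimately have S: "(\<lambda>k. (2 ^ Suc k / \<rho>) ^ m * (?\<omega> * (\<rho> / 2 ^ k) ^ DIM('a))) sums (?\<omega> * 2 ^ DIM('a) * \<rho>)"
    by (simp add: m mult_ac)
  show ?thesis
  proof (rule nn_integral_radial_le[OF _ _ _ S])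
    fix x assume "ennreal (1 / norm (x - z) ^ (DIM('a) - 1)) * indicator (ball z \<rho>) x \<noteq> 0"
    then have x: "dist z x < \<rho>" by (auto split: split_indicator_asm)
    show "\<exists>k. x \<in> ball z (\<rho> / 2 ^ k) \<and>
             ennreal (1 / norm (x - z) ^ (DIM('a) - 1)) * indicator (ball z \<rho>) x \<le> ennreal ((2 ^ Suc k / \<rho>) ^ m)"
    proof (cases "x = z")
      \<comment> \<open>At the pole, division by zero gives 0 when N > 1; when N = 1 both sides are
        1.\<close>
      case True
      show ?thesis
        using True assms m by (intro exI[of _ 0]) (cases "m = 0"; simp add: power_0_left)
    next
      case False
      obtain k where "(1/2) ^ k < dist z x / \<rho>"
        using real_arch_pow_inv[of "dist z x / \<rho>" "1/2"] False assms by auto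
      then have ex: "\<rho> / 2 ^ k \<le> dist z x"
        using assms by (simp add: field_simps)
      define n where "n = (LEAST k. \<rho> / 2 ^ k \<le> dist z x)"
      have n: "\<rho> / 2 ^ n \<le> dist z x" unfolding n_def by (rule LeastI) (rule ex)
      have "n \<noteq> 0" using n x by (intro notI) auto
      then obtain k where k: "n = Suc k" by (cases n) auto
      have k2: "dist z x < \<rho> / 2 ^ k"
        using not_less_Least[of k "\<lambda>k. \<rho> / 2 ^ k \<le> dist z x"] unfolding n_def[symmetric] k by auto
      have "1 / norm (x - z) \<le> 2 ^ Suc k / \<rho>"
        using n assms False unfolding k by (simp add: dist_norm norm_minus_commute field_simps)
      then have "(1 / norm (x - z)) ^ m \<le> (2 ^ Suc k / \<rho>) ^ m"
        by (intro power_mono) auto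
      then show ?thesis using k2
        by (intro exI[of _ k]) (auto simp: m power_divide split: split_indicator intro!: ennreal_leI)
    qed
  qed (use assms in auto)
qed

text \<open>The tail counterpart, of order 1/\<open>a\<close>. With \<open>a\<close> proportional to
  the distance of z from a closed set, it compensates exactly that distance in the numerator of the
  Marcinkiewicz integral.\<close>

lemma nn_integral_inverse_power_outside_le:
  fixes z :: "'a::euclidean_space"
  assumes "a > 0"
  shows "(\<integral>\<^sup>+x. ennreal (1 / norm (x - z) ^ (DIM('a) + 1)) * indicator (- ball z a) x \<partial>lborel)
          \<le> ennreal (unit_ball_vol (real DIM('a)) * 2 ^ (DIM('a) + 1) / a)"
proof -
  let ?\<omega> = "unit_ball_vol (real DIM('a))"
  have "(\<lambda>k. ?\<omega> * 2 ^ DIM('a) / a * (1/2) ^ k) sums (?\<omega> * 2 ^ DIM('a) / a * (1 / (1 - 1/2)))"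
    by (intro sums_mult geometric_sums) auto
  moreover have "(1 / (2 ^ k * a)) ^ (DIM('a) + 1) * (?\<omega> * (2 ^ Suc k * a) ^ DIM('a)) = ?\<omega> * 2 ^ DIM('a) / a * (1/2) ^ k" for k
    using assms by (simp add: power_mult_distrib power_divide field_simps)
  ultimately have S: "(\<lambda>k. (1 / (2 ^ k * a)) ^ (DIM('a) + 1) * (?\<omega> * (2 ^ Suc k * a) ^ DIM('a))) sums (?\<omega> * 2 ^ (DIM('a) + 1) / a)"
    by (simp add: mult_ac)
  show ?thesis
  proof (rule nn_integral_radial_le[OF _ _ _ S])
    fix x assume "ennreal (1 / norm (x - z) ^ (DIM('a) + 1)) * indicator (- ball z a) x \<noteq> 0"
    then have x: "dist z x \<ge> a" by (auto split: split_indicator_asm)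
    obtain k where k: "dist z x / a < 2 ^ k" using real_arch_pow[of 2] by auto
    define n where "n = (LEAST k. dist z x / a < 2 ^ k)"
    have n: "dist z x / a < 2 ^ n" unfolding n_def by (rule LeastI) (rule k)
    have "n \<noteq> 0" using n x assms by (intro notI) (auto simp: field_simps)
    then obtain k where k: "n = Suc k" by (cases n) auto
    have k2: "2 ^ k \<le> dist z x / a"
      using not_less_Least[of k "\<lambda>k. dist z x / a < 2 ^ k"] unfolding n_def[symmetric] k by auto
    have "1 / norm (x - z) \<le> 1 / (2 ^ k * a)"
      using k2 assms x by (intro divide_left_mono mult_pos_pos) (auto simp: dist_norm norm_minus_commute field_simps)
    then have "(1 / norm (x - z)) ^ (DIM('a) + 1) \<le> (1 / (2 ^ k * a)) ^ (DIM('a) + 1)"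
      by (intro power_mono) auto
    then show "\<exists>k. x \<in> ball z (2 ^ Suc k * a) \<and>
             ennreal (1 / norm (x - z) ^ (DIM('a) + 1)) * indicator (- ball z a) x \<le> ennreal ((1 / (2 ^ k * a)) ^ (DIM('a) + 1))"
      using n assms unfolding k
      by (intro exI[of _ k]) (auto simp: power_divide field_simps split: split_indicator intro!: ennreal_leI)
  qed (use assms in auto)
qed

text \<open>Splitting at the radius with \<rho>^N = |E| balances the two parts: inside the ball the
  kernel integrates to a multiple of \<rho>, and outside it is at most \<rho>^(1-N), contributing
  \<rho>^(1-N) |E| = \<rho>.\<close>

lemma nn_integral_inverse_power_set_le:
  fixes z :: "'a::euclidean_space"
  assumes [measurable]: "E \<in> sets borel" and e: "emeasure lborel E = ennreal e" "e > 0"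
  shows "(\<integral>\<^sup>+x. ennreal (1 / norm (x - z) ^ (DIM('a) - 1)) * indicator E x \<partial>lborel)
          \<le> ennreal ((unit_ball_vol (real DIM('a)) * 2 ^ DIM('a) + 1) * e powr (1 / real DIM('a)))"
proof -
  let ?N = "real DIM('a)"
  obtain m where m: "DIM('a) = Suc m" using DIM_positive[where 'a='a] gr0_implies_Suc by blast
  define \<rho> where "\<rho> = e powr (1 / real DIM('a))"
  have \<rho>: "\<rho> > 0" "\<rho> ^ DIM('a) = e" using e by (auto simp: \<rho>_def powr_realpow[symmetric] powr_powr)
  have "(\<integral>\<^sup>+x. ennreal (1 / norm (x - z) ^ (DIM('a) - 1)) * indicator E x \<partial>lborel) \<le>
     (\<integral>\<^sup>+x. ennreal (1 / norm (x - z) ^ (DIM('a) - 1)) * indicator (ball z \<rho>) x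
           + ennreal (1 / \<rho> ^ (DIM('a) - 1)) * indicator E x \<partial>lborel)"
  proof (intro nn_integral_mono)
    fix x
    show "ennreal (1 / norm (x - z) ^ (DIM('a) - 1)) * indicator E x \<le>
       ennreal (1 / norm (x - z) ^ (DIM('a) - 1)) * indicator (ball z \<rho>) x + ennreal (1 / \<rho> ^ (DIM('a) - 1)) * indicator E x"
    proof (cases "x \<in> ball z \<rho>")
      case False
      then have "\<rho> \<le> norm (x - z)" by (auto simp: dist_norm norm_minus_commute)
      then have "1 / norm (x - z) ^ (DIM('a) - 1) \<le> 1 / \<rho> ^ (DIM('a) - 1)"
        using \<rho>(1) by (intro divide_left_mono power_mono mult_pos_pos zero_less_power) auto
      then show ?thesis using False by (auto split: split_indicator intro!: ennreal_leI)
    qed (auto split: split_indicator)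
  qed
  also have "\<dots> = (\<integral>\<^sup>+x. ennreal (1 / norm (x - z) ^ (DIM('a) - 1)) * indicator (ball z \<rho>) x \<partial>lborel)
       + ennreal (1 / \<rho> ^ (DIM('a) - 1)) * emeasure lborel E"
    by (subst nn_integral_add) (auto simp: nn_integral_cmult_indicator)
  also have "\<dots> \<le> ennreal (unit_ball_vol (real DIM('a)) * 2 ^ DIM('a) * \<rho>) + ennreal (1 / \<rho> ^ (DIM('a) - 1)) * ennreal e"
    unfolding e by (intro add_right_mono nn_integral_inverse_power_ball_le \<rho>)
  also have "ennreal (1 / \<rho> ^ (DIM('a) - 1)) * ennreal e = ennreal \<rho>"
    using \<rho> e(2) by (subst ennreal_mult[symmetric]) (auto simp: \<rho>(2)[symmetric] m)
  finally show ?thesis using \<rho>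
    by (simp add: \<rho>_def[symmetric] ennreal_plus[symmetric] algebra_simps del: ennreal_plus)
qed

text \<open>Testing the hypothesis on E = {f > s} gives s |E| <= C |E|^(1/N), which is solved for
  |E|. The hypothesis is the form of the weak norm that is stable under integration over poles,
  because it is linear in \<open>f\<close> and Tonelli applies to it.\<close>

lemma weak_type_of_restricted_type:
  fixes f :: "'a::euclidean_space \<Rightarrow> ennreal"
  assumes [measurable]: "f \<in> borel_measurable borel" and N: "DIM('a) \<ge> 2" and C: "C \<ge> 0" and s: "s > 0"
    and bd: "\<And>E e. E \<in> sets borel \<Longrightarrow> emeasure lborel E = ennreal e \<Longrightarrow> e > 0 \<Longrightarrow>
         (\<integral>\<^sup>+x. f x * indicator E x \<partial>lborel) \<le> ennreal (C * e powr (1 / real DIM('a)))"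
  shows "emeasure lborel {x. ennreal s < f x} \<le> ennreal ((C / s) powr (real DIM('a) / (real DIM('a) - 1)))"
proof -
  let ?N = "real DIM('a)"
  \<comment> \<open>Cutting with balls makes the volume finite, so that it can be divided out;
    continuity from below removes the cut at the end.\<close>
  have "emeasure lborel ({x. ennreal s < f x} \<inter> ball 0 (real n)) \<le> ennreal ((C / s) powr (?N / (?N - 1)))" for n
  proof -
    define E where "E = {x. ennreal s < f x} \<inter> ball 0 (real n)"
    have E[measurable]: "E \<in> sets borel" unfolding E_def by measurable
    have "emeasure lborel E \<le> emeasure lborel (ball (0::'a) (real n))" unfolding E_def by (intro emeasure_mono) auto
    then have "emeasure lborel E < \<infinity>" using emeasure_lborel_ball_finite[of 0 "real n"] by (rule le_less_trans)
    then obtain e where e: "emeasure lborel E = ennreal e" "e \<ge> 0" by (cases "emeasure lborel E") auto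
    have "e \<le> (C / s) powr (?N / (?N - 1))"
    proof (cases "e = 0")
      case False
      with e have e0: "e > 0" by simp
      have "ennreal s * ennreal e = (\<integral>\<^sup>+x. ennreal s * indicator E x \<partial>lborel)"
        by (simp add: nn_integral_cmult_indicator e)
      also have "\<dots> \<le> (\<integral>\<^sup>+x. f x * indicator E x \<partial>lborel)"
        by (intro nn_integral_mono) (auto simp: E_def split: split_indicator)
      also have "\<dots> \<le> ennreal (C * e powr (1 / ?N))" by (intro bd e e0 E)
      finally have "s * e \<le> C * e powr (1 / ?N)"
        using s e0 C by (simp add: ennreal_mult[symmetric] ennreal_le_iff)
      then have "e / e powr (1 / ?N) \<le> C / s" using s e0 by (simp add: field_simps)
      then have "e powr (1 - 1 / ?N) \<le> C / s" using e0 by (simp add: powr_diff)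
      then have "(e powr (1 - 1 / ?N)) powr (?N / (?N - 1)) \<le> (C / s) powr (?N / (?N - 1))"
        using N by (intro powr_mono2) auto
      moreover have "(1 - 1 / ?N) * (?N / (?N - 1)) = 1" using N by (simp add: field_simps)
      ultimately show ?thesis using e0 by (simp add: powr_powr)
    qed simp
    then show ?thesis by (simp add: E_def[symmetric] e ennreal_leI)
  qed
  moreover have "emeasure lborel {x. ennreal s < f x} = (SUP n. emeasure lborel ({x. ennreal s < f x} \<inter> ball 0 (real n)))"
  proof -
    have "{x. ennreal s < f x} = (\<Union>n. {x. ennreal s < f x} \<inter> ball 0 (real n))"
      by (auto simp: reals_Archimedean2)
    moreover have "emeasure lborel (\<Union>n. {x. ennreal s < f x} \<inter> ball 0 (real n)) =
        (SUP n. emeasure lborel ({x. ennreal s < f x} \<inter> ball 0 (real n)))"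
      by (rule SUP_emeasure_incseq[symmetric]) (auto simp: incseq_def)
    ultimately show ?thesis by simp
  qed
  ultimately show ?thesis by (simp add: SUP_least)
qed

text \<open>The bound encodes \<open>[u - u(y) - L(\<cdot> - y)] \<le> \<epsilon> r \<cdot> r\<^sup>N\<^sup>-\<^sup>1\<close> in weak \<open>L\<^sup>N\<^sup>/\<^sup>(\<^sup>N\<^sup>-\<^sup>1\<^sup>)\<close> of \<open>B\<^sub>r(y)\<close>. The superlevel sets
  are only required to be covered by Borel sets because \<open>emeasure\<close> is 0 on non-measurable sets.\<close>

definition weakly_diff :: "('a::euclidean_space \<Rightarrow> real) \<Rightarrow> 'a \<Rightarrow> ('a \<Rightarrow> real) \<Rightarrow> bool" where
  "weakly_diff u y L \<longleftrightarrow> (\<forall>\<epsilon>>0. \<exists>\<delta>>0. \<forall>r s. 0 < r \<longrightarrow> r < \<delta> \<longrightarrow> 0 < s \<longrightarrow>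
     (\<exists>S\<in>sets borel. {x \<in> ball y r. s < \<bar>u x - u y - L (x - y)\<bar>} \<subseteq> S \<and>
        emeasure lborel S \<le> ennreal ((\<epsilon> * r ^ DIM('a) / s) powr (real DIM('a) / (real DIM('a) - 1)))))"

section \<open>Weak expansions at the critical exponent p = N/(N-1)\<close>

lemma critical_exponent_ge_1:
  assumes "DIM('a::euclidean_space) \<ge> 2"
  shows "1 \<le> real DIM('a) / (real DIM('a) - 1)" "real DIM('a) / (real DIM('a) - 1) \<le> 2"
  using assms by (auto simp: field_simps)

text \<open>Since (N-1) p = N, a factor r^(N-1) leaves the power as r^N. In terms of the slope s/r
  the bound becomes a multiple of the volume of the ball.\<close>

lemma critical_scaling:
  assumes "DIM('a::euclidean_space) \<ge> 2" "r > 0" "\<epsilon> \<ge> 0" "s > 0"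
  shows "(\<epsilon> * r ^ DIM('a) / s) powr (real DIM('a) / (real DIM('a) - 1)) =
         r ^ DIM('a) * (\<epsilon> / (s / r)) powr (real DIM('a) / (real DIM('a) - 1))"
proof -
  obtain m where m: "DIM('a) = Suc m" "m > 0" using assms(1) by (cases "DIM('a)") auto
  have "\<epsilon> * r ^ DIM('a) / s = r ^ m * (\<epsilon> / (s / r))"
    using assms by (simp add: m)
  moreover have "(r ^ m) powr (real DIM('a) / (real DIM('a) - 1)) = r ^ DIM('a)"
    using assms m by (simp add: powr_realpow[symmetric] powr_powr del: power_Suc of_nat_Suc) simp
  ultimately show ?thesis
    by (simp only: powr_mult)
qed

text \<open>The level is split in halves. Replacing \<epsilon> by \<epsilon>/4 pays for this and
  leaves a factor 2^p, which is at least 2 because p >= 1 and absorbs the union of two sets. The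
  decomposition may fail on a null set but must hold at \<open>y\<close>, whose value enters every
  increment.\<close>

lemma weakly_diff_add:
  fixes u u1 u2 :: "'a::euclidean_space \<Rightarrow> real"
  assumes N: "DIM('a) \<ge> 2" and n1: "weakly_diff u1 y L1" and n2: "weakly_diff u2 y L2"
    and Z: "Z \<in> null_sets lborel" "y \<notin> Z" "\<And>x. x \<notin> Z \<Longrightarrow> u x = u1 x + u2 x"
  shows "weakly_diff u y (\<lambda>h. L1 h + L2 h)"
  unfolding weakly_diff_def
proof (intro allI impI)
  let ?p = "real DIM('a) / (real DIM('a) - 1)"
  fix \<epsilon> :: real assume \<epsilon>: "\<epsilon> > 0"
  obtain \<delta>1 where \<delta>1: "\<delta>1 > 0" "\<And>r s. 0 < r \<Longrightarrow> r < \<delta>1 \<Longrightarrow> 0 < s \<Longrightarrow>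
     (\<exists>S\<in>sets borel. {x \<in> ball y r. s < \<bar>u1 x - u1 y - L1 (x - y)\<bar>} \<subseteq> S \<and>
        emeasure lborel S \<le> ennreal ((\<epsilon> / 4 * r ^ DIM('a) / s) powr ?p))"
    using n1[unfolded weakly_diff_def, rule_format, of "\<epsilon> / 4"] \<epsilon> by auto
  obtain \<delta>2 where \<delta>2: "\<delta>2 > 0" "\<And>r s. 0 < r \<Longrightarrow> r < \<delta>2 \<Longrightarrow> 0 < s \<Longrightarrow>
     (\<exists>S\<in>sets borel. {x \<in> ball y r. s < \<bar>u2 x - u2 y - L2 (x - y)\<bar>} \<subseteq> S \<and>
        emeasure lborel S \<le> ennreal ((\<epsilon> / 4 * r ^ DIM('a) / s) powr ?p))"
    using n2[unfolded weakly_diff_def, rule_format, of "\<epsilon> / 4"] \<epsilon> by auto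
  show "\<exists>\<delta>>0. \<forall>r s. 0 < r \<longrightarrow> r < \<delta> \<longrightarrow> 0 < s \<longrightarrow>
     (\<exists>S\<in>sets borel. {x \<in> ball y r. s < \<bar>u x - u y - (L1 (x - y) + L2 (x - y))\<bar>} \<subseteq> S \<and>
        emeasure lborel S \<le> ennreal ((\<epsilon> * r ^ DIM('a) / s) powr ?p))"
  proof (intro exI[of _ "min \<delta>1 \<delta>2"] conjI allI impI)
    fix r s :: real assume r: "0 < r" "r < min \<delta>1 \<delta>2" and s: "0 < s"
    obtain S1 where S1: "S1 \<in> sets borel" "{x \<in> ball y r. s/2 < \<bar>u1 x - u1 y - L1 (x - y)\<bar>} \<subseteq> S1"
        "emeasure lborel S1 \<le> ennreal ((\<epsilon> / 4 * r ^ DIM('a) / (s/2)) powr ?p)"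
      using \<delta>1(2)[of r "s/2"] r s by auto
    obtain S2 where S2: "S2 \<in> sets borel" "{x \<in> ball y r. s/2 < \<bar>u2 x - u2 y - L2 (x - y)\<bar>} \<subseteq> S2"
        "emeasure lborel S2 \<le> ennreal ((\<epsilon> / 4 * r ^ DIM('a) / (s/2)) powr ?p)"
      using \<delta>2(2)[of r "s/2"] r s by auto
    have Zb: "Z \<in> sets borel" "emeasure lborel Z = 0" using Z by auto
    show "\<exists>S\<in>sets borel. {x \<in> ball y r. s < \<bar>u x - u y - (L1 (x - y) + L2 (x - y))\<bar>} \<subseteq> S \<and>
        emeasure lborel S \<le> ennreal ((\<epsilon> * r ^ DIM('a) / s) powr ?p)"
    proof (intro bexI conjI)
      show "{x \<in> ball y r. s < \<bar>u x - u y - (L1 (x - y) + L2 (x - y))\<bar>} \<subseteq> (S1 \<union> S2) \<union> Z"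
      proof
        fix x assume x: "x \<in> {x \<in> ball y r. s < \<bar>u x - u y - (L1 (x - y) + L2 (x - y))\<bar>}"
        show "x \<in> (S1 \<union> S2) \<union> Z"
        proof (rule ccontr)
          assume n: "x \<notin> (S1 \<union> S2) \<union> Z"
          have "\<bar>u1 x - u1 y - L1 (x - y)\<bar> \<le> s/2" using S1(2) n x by fastforce
          moreover have "\<bar>u2 x - u2 y - L2 (x - y)\<bar> \<le> s/2" using S2(2) n x by fastforce
          moreover have "u x = u1 x + u2 x" "u y = u1 y + u2 y" using n Z by auto
          ultimately show False using x unfolding mem_Collect_eq by linarith
        qed
      qed
      have "emeasure lborel ((S1 \<union> S2) \<union> Z) \<le> emeasure lborel S1 + emeasure lborel S2 + emeasure lborel Z"
        using S1(1) S2(1) Zb by (intro order_trans[OF emeasure_subadditive] add_right_mono emeasure_subadditive) auto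
      also have "\<dots> \<le> ennreal ((\<epsilon> / 4 * r ^ DIM('a) / (s/2)) powr ?p) + ennreal ((\<epsilon> / 4 * r ^ DIM('a) / (s/2)) powr ?p)"
        using S1 S2 Zb by (auto intro: add_mono)
      also have "\<dots> = ennreal (2 * (\<epsilon> / 4 * r ^ DIM('a) / (s/2)) powr ?p)"
        by (simp add: ennreal_plus[symmetric] del: ennreal_plus)
      also have "\<dots> \<le> ennreal ((\<epsilon> * r ^ DIM('a) / s) powr ?p)"
      proof (intro ennreal_leI)
        have "2 * (\<epsilon> / 4 * r ^ DIM('a) / (s/2)) powr ?p \<le> 2 powr ?p * (\<epsilon> / 4 * r ^ DIM('a) / (s/2)) powr ?p"
          using powr_mono[of 1 ?p 2] critical_exponent_ge_1[OF N] by (intro mult_right_mono) auto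
        also have "\<dots> = (2 * (\<epsilon> / 4 * r ^ DIM('a) / (s/2))) powr ?p"
          using \<epsilon> r s by (intro powr_mult[symmetric]) 
        also have "2 * (\<epsilon> / 4 * r ^ DIM('a) / (s/2)) = \<epsilon> * r ^ DIM('a) / s" by simp
        finally show "2 * (\<epsilon> / 4 * r ^ DIM('a) / (s/2)) powr ?p \<le> (\<epsilon> * r ^ DIM('a) / s) powr ?p" .
      qed
      finally show "emeasure lborel ((S1 \<union> S2) \<union> Z) \<le> ennreal ((\<epsilon> * r ^ DIM('a) / s) powr ?p)" .
    qed (use S1(1) S2(1) Zb in auto)
  qed (use \<delta>1 \<delta>2 in auto)
qed

lemma weakly_diff_uminus: "weakly_diff u y L \<Longrightarrow> weakly_diff (\<lambda>x. - u x) y (\<lambda>h. - L h)"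
proof -
  have "\<bar>- u x - - u y - - L (x - y)\<bar> = \<bar>u x - u y - L (x - y)\<bar>" for x by linarith
  then show "weakly_diff u y L \<Longrightarrow> weakly_diff (\<lambda>x. - u x) y (\<lambda>h. - L h)" unfolding weakly_diff_def by simp
qed

text \<open>Since p <= 2, an L^2 tail bound is stronger than the weak L^p one at levels of order r
  or more, while at lower levels the volume of the whole ball is small enough. Only levels s >=
  \<epsilon> r are therefore asked for, which leaves room to absorb linear errors of size \<epsilon>
  r.\<close>

lemma weakly_diffI_L2:
  fixes u :: "'a::euclidean_space \<Rightarrow> real"
  assumes N: "DIM('a) \<ge> 2"
    and h: "\<And>\<epsilon>. \<epsilon> > 0 \<Longrightarrow> \<exists>\<delta>>0. \<forall>r s. 0 < r \<longrightarrow> r < \<delta> \<longrightarrow> \<epsilon> * r \<le> s \<longrightarrow>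
     (\<exists>S\<in>sets borel. {x \<in> ball y r. s < \<bar>u x - u y - L (x - y)\<bar>} \<subseteq> S \<and>
        emeasure lborel S \<le> ennreal (\<epsilon> * r ^ (DIM('a) + 2) / s\<^sup>2))"
  shows "weakly_diff u y L"
  unfolding weakly_diff_def
proof (intro allI impI)
  let ?p = "real DIM('a) / (real DIM('a) - 1)" and ?\<omega> = "unit_ball_vol (real DIM('a))"
  fix \<epsilon> :: real assume \<epsilon>: "\<epsilon> > 0"
  \<comment> \<open>Below the slope \<sigma>0 the volume of the whole ball already satisfies the
    required bound.\<close>
  define \<sigma>0 where "\<sigma>0 = \<epsilon> / max 1 ?\<omega>"
  have \<sigma>0: "\<sigma>0 > 0" using \<epsilon> by (auto simp: \<sigma>0_def)
  \<comment> \<open>The second entry gives \<epsilon>'/\<sigma>^2 <= (\<epsilon>/\<sigma>)^p for all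
    \<sigma> >= \<sigma>0; as 2 - p >= 0, the worst case is \<sigma> = \<sigma>0.\<close>
  define \<epsilon>' where "\<epsilon>' = min \<sigma>0 (\<epsilon> powr ?p * \<sigma>0 powr (2 - ?p))"
  have \<epsilon>': "\<epsilon>' > 0" using \<epsilon> \<sigma>0 by (auto simp: \<epsilon>'_def)
  obtain \<delta> where \<delta>: "\<delta> > 0" "\<And>r s. 0 < r \<Longrightarrow> r < \<delta> \<Longrightarrow> \<epsilon>' * r \<le> s \<Longrightarrow>
     (\<exists>S\<in>sets borel. {x \<in> ball y r. s < \<bar>u x - u y - L (x - y)\<bar>} \<subseteq> S \<and>
        emeasure lborel S \<le> ennreal (\<epsilon>' * r ^ (DIM('a) + 2) / s\<^sup>2))"
    using h[OF \<epsilon>'] by blast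
  show "\<exists>\<delta>>0. \<forall>r s. 0 < r \<longrightarrow> r < \<delta> \<longrightarrow> 0 < s \<longrightarrow>
     (\<exists>S\<in>sets borel. {x \<in> ball y r. s < \<bar>u x - u y - L (x - y)\<bar>} \<subseteq> S \<and>
        emeasure lborel S \<le> ennreal ((\<epsilon> * r ^ DIM('a) / s) powr ?p))"
  proof (intro exI[of _ \<delta>] conjI allI impI)
    fix r s :: real assume r: "0 < r" "r < \<delta>" and s: "0 < s"
    define \<sigma> where "\<sigma> = s / r"
    have \<sigma>: "\<sigma> > 0" using r s by (simp add: \<sigma>_def)
    have sc: "(\<epsilon> * r ^ DIM('a) / s) powr ?p = r ^ DIM('a) * (\<epsilon> / \<sigma>) powr ?p"
      unfolding \<sigma>_def by (rule critical_scaling[OF N]) (use r s \<epsilon> in auto)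
    show "\<exists>S\<in>sets borel. {x \<in> ball y r. s < \<bar>u x - u y - L (x - y)\<bar>} \<subseteq> S \<and>
        emeasure lborel S \<le> ennreal ((\<epsilon> * r ^ DIM('a) / s) powr ?p)"
    proof (cases "\<sigma> \<ge> \<sigma>0")
      case True
      then have "\<sigma>0 * r \<le> s" using r by (simp add: \<sigma>_def field_simps)
      moreover have "\<epsilon>' * r \<le> \<sigma>0 * r" using r by (intro mult_right_mono) (auto simp: \<epsilon>'_def)
      ultimately have "\<epsilon>' * r \<le> s" by simp
      then obtain S where S: "S \<in> sets borel" "{x \<in> ball y r. s < \<bar>u x - u y - L (x - y)\<bar>} \<subseteq> S"
          "emeasure lborel S \<le> ennreal (\<epsilon>' * r ^ (DIM('a) + 2) / s\<^sup>2)"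
        using \<delta>(2)[of r s] r s by blast
      have "\<epsilon>' * r ^ (DIM('a) + 2) / s\<^sup>2 = r ^ DIM('a) * (\<epsilon>' / \<sigma>\<^sup>2)"
        using r s by (simp add: \<sigma>_def power_divide power_add power2_eq_square)
      also have "\<epsilon>' / \<sigma>\<^sup>2 \<le> (\<epsilon> / \<sigma>) powr ?p"
      proof -
        have "\<epsilon>' \<le> \<epsilon> powr ?p * \<sigma>0 powr (2 - ?p)" by (simp add: \<epsilon>'_def)
        also have "\<dots> \<le> \<epsilon> powr ?p * \<sigma> powr (2 - ?p)"
          using True \<sigma>0 critical_exponent_ge_1[OF N] by (intro mult_left_mono powr_mono2) auto
        also have "\<dots> = (\<epsilon> / \<sigma>) powr ?p * \<sigma>\<^sup>2"
          using \<epsilon> \<sigma> by (simp add: powr_diff powr_divide)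
        finally show ?thesis using \<sigma> by (simp add: field_simps)
      qed
      finally have "\<epsilon>' * r ^ (DIM('a) + 2) / s\<^sup>2 \<le> r ^ DIM('a) * (\<epsilon> / \<sigma>) powr ?p" using r by simp
      then show ?thesis unfolding sc using S by (meson ennreal_leI order_trans)
    next
      case False
      have "?\<omega> \<le> max 1 ?\<omega> powr ?p"
        using powr_mono[of 1 ?p "max 1 ?\<omega>"] critical_exponent_ge_1[OF N] by auto
      also have "max 1 ?\<omega> \<le> \<epsilon> / \<sigma>"
        using False \<sigma> \<epsilon> unfolding \<sigma>0_def not_le by (subst pos_le_divide_eq) (auto simp: pos_less_divide_eq max_def mult.commute split: if_splits)
      then have "max 1 ?\<omega> powr ?p \<le> (\<epsilon> / \<sigma>) powr ?p"
        using critical_exponent_ge_1[OF N] by (intro powr_mono2) auto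
      finally have "?\<omega> * r ^ DIM('a) \<le> r ^ DIM('a) * (\<epsilon> / \<sigma>) powr ?p"
        using r by (simp add: mult.commute)
      then show ?thesis unfolding sc using r
        by (intro bexI[of _ "ball y r"]) (auto simp: emeasure_ball ennreal_leI)
    qed
  qed (use \<delta> in auto)
qed

section \<open>Convolution operators and the inner product of $L^2$\<close>

lemma nn_integral_lborel_affine:
  fixes f :: "'a::euclidean_space \<Rightarrow> ennreal"
  assumes c: "c \<noteq> 0" and [measurable]: "f \<in> borel_measurable borel"
  shows "(\<integral>\<^sup>+x. f x \<partial>lborel) = ennreal (\<bar>c\<bar> ^ DIM('a)) * (\<integral>\<^sup>+x. f (t + c *\<^sub>R x) \<partial>lborel)"
  by (subst lborel_affine[OF c, of t]) (simp add: nn_integral_density nn_integral_distr nn_integral_cmult)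

lemma
  fixes f :: "'a::euclidean_space \<Rightarrow> real"
  assumes [measurable]: "f \<in> borel_measurable borel"
  shows integrable_lborel_shift: "integrable lborel (\<lambda>x. f (x - y)) \<longleftrightarrow> integrable lborel f"
    and integrable_lborel_reflect: "integrable lborel (\<lambda>x. f (y - x)) \<longleftrightarrow> integrable lborel f"
    and integral_lborel_shift: "(\<integral>x. f (x - y) \<partial>lborel) = (\<integral>x. f x \<partial>lborel)"
    and integral_lborel_reflect: "(\<integral>x. f (y - x) \<partial>lborel) = (\<integral>x. f x \<partial>lborel)"
proof -
  have 1: "lborel = distr lborel borel (\<lambda>x::'a. x - y)"
    using lborel_affine[of 1 "- y"] by (simp add: density_1)
  have 2: "lborel = distr lborel borel (\<lambda>x::'a. y - x)"
    using lborel_affine[of "-1" "y"] by (simp add: density_1)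
  show "integrable lborel (\<lambda>x. f (x - y)) \<longleftrightarrow> integrable lborel f"
    by (subst (2) 1) (simp add: integrable_distr_eq)
  show "integrable lborel (\<lambda>x. f (y - x)) \<longleftrightarrow> integrable lborel f"
    by (subst (2) 2) (simp add: integrable_distr_eq)
  show "(\<integral>x. f (x - y) \<partial>lborel) = (\<integral>x. f x \<partial>lborel)"
    by (subst (2) 1) (simp add: integral_distr)
  show "(\<integral>x. f (y - x) \<partial>lborel) = (\<integral>x. f x \<partial>lborel)"
    by (subst (2) 2) (simp add: integral_distr)
qed

text \<open>L^1 \<inter> L^\<infinity> as a class of everywhere defined functions. It is stable
  under convolution, its products are integrable, and the interchanges of integrals below converge
  absolutely on it.\<close>

definition bdd_int :: "('a::euclidean_space \<Rightarrow> real) set" where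
  "bdd_int = {f \<in> borel_measurable borel. integrable lborel f \<and> (\<exists>M. \<forall>x. \<bar>f x\<bar> \<le> M)}"

lemma bdd_intD:
  assumes "f \<in> bdd_int"
  shows "f \<in> borel_measurable borel" "integrable lborel f" "\<exists>M\<ge>0. \<forall>x. \<bar>f x\<bar> \<le> M"
  using assms unfolding bdd_int_def by (auto intro: order_trans[OF abs_ge_zero])

lemma integrable_mult_bounded:
  fixes f g :: "'a \<Rightarrow> real"
  assumes f: "integrable M f" and g: "g \<in> borel_measurable M" "\<And>x. \<bar>g x\<bar> \<le> C"
  shows "integrable M (\<lambda>x. f x * g x)" "integrable M (\<lambda>x. g x * f x)"
proof -
  have [measurable]: "f \<in> borel_measurable M" using f by auto
  show 1: "integrable M (\<lambda>x. f x * g x)"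
  proof (rule Bochner_Integration.integrable_bound[of M "\<lambda>x. C * f x"])
    show "AE x in M. norm (f x * g x) \<le> norm (C * f x)"
      using mult_right_mono[OF g(2) abs_ge_zero] by (intro AE_I2) (fastforce simp: abs_mult mult.commute intro: order_trans mult_right_mono)
  qed (use f g in auto)
  then show "integrable M (\<lambda>x. g x * f x)" by (simp add: mult.commute)
qed

lemma bdd_int_mult_integrable:
  assumes "f \<in> bdd_int" "g \<in> bdd_int"
  shows "integrable lborel (\<lambda>x. f x * g x)"
  using bdd_intD[OF assms(1)] bdd_intD[OF assms(2)] by (auto intro: integrable_mult_bounded(1))

lemma bdd_int_add: "f \<in> bdd_int \<Longrightarrow> g \<in> bdd_int \<Longrightarrow> (\<lambda>x. f x + g x) \<in> bdd_int"
  unfolding bdd_int_def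
proof clarsimp
  fix M1 M2 assume "\<forall>x. \<bar>f x\<bar> \<le> M1" "\<forall>x. \<bar>g x\<bar> \<le> M2"
  then show "\<exists>M. \<forall>x. \<bar>f x + g x\<bar> \<le> M"
    by (intro exI[of _ "M1 + M2"]) (meson abs_triangle_ineq add_mono order_trans)
qed

lemma bdd_int_cmult: "f \<in> bdd_int \<Longrightarrow> (\<lambda>x. c * f x) \<in> bdd_int"
  unfolding bdd_int_def
proof (clarsimp)
  fix M1 assume "\<forall>x. \<bar>f x\<bar> \<le> M1"
  then show "\<exists>M. \<forall>x. \<bar>c * f x\<bar> \<le> M"
    by (intro exI[of _ "\<bar>c\<bar> * M1"]) (auto simp: abs_mult intro!: mult_left_mono)
qed

lemma bdd_int_sum: "(\<And>i. i \<in> I \<Longrightarrow> f i \<in> bdd_int) \<Longrightarrow> (\<lambda>x. \<Sum>i\<in>I. f i x) \<in> bdd_int"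
proof (induction I rule: infinite_finite_induct)
  case (insert i I)
  then show ?case by (auto intro!: bdd_int_add)
qed (auto simp: bdd_int_def intro!: exI[of _ 0])

section \<open>The L^2 pairing on bounded integrable functions\<close>

definition ip :: "('a::euclidean_space \<Rightarrow> real) \<Rightarrow> ('a \<Rightarrow> real) \<Rightarrow> real" where
  "ip f g = (\<integral>x. f x * g x \<partial>lborel)"

lemma ip_commute: "ip f g = ip g f"
  by (simp add: ip_def mult.commute)

lemma ip_self_nonneg [simp]: "0 \<le> ip f f"
  by (auto simp: ip_def)

lemma ip_add: "f \<in> bdd_int \<Longrightarrow> g \<in> bdd_int \<Longrightarrow> h \<in> bdd_int \<Longrightarrow> ip f (\<lambda>x. g x + h x) = ip f g + ip f h"
  by (simp add: ip_def ring_distribs bdd_int_mult_integrable)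

lemma ip_cmult: "ip f (\<lambda>x. c * g x) = c * ip f g"
  by (simp add: ip_def mult.left_commute)

lemma ip_sum:
  assumes "f \<in> bdd_int" "\<And>i. i \<in> I \<Longrightarrow> g i \<in> bdd_int"
  shows "ip f (\<lambda>x. \<Sum>i\<in>I. g i x) = (\<Sum>i\<in>I. ip f (g i))"
  using assms by (simp add: ip_def sum_distrib_left bdd_int_mult_integrable)

lemma ip_Cauchy_Schwarz:
  assumes f: "f \<in> bdd_int" and g: "g \<in> bdd_int"
  shows "\<bar>ip f g\<bar> \<le> sqrt (ip f f) * sqrt (ip g g)"
proof -
  have q: "0 \<le> ip f f - 2 * t * ip f g + t\<^sup>2 * ip g g" for t
  proof -
    have tg: "(\<lambda>x. (- t) * g x) \<in> bdd_int" by (rule bdd_int_cmult) fact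
    have s: "(\<lambda>x. f x + (- t) * g x) \<in> bdd_int" by (rule bdd_int_add) fact+
    have "0 \<le> ip (\<lambda>x. f x + (- t) * g x) (\<lambda>x. f x + (- t) * g x)" by simp
    also have "\<dots> = ip (\<lambda>x. f x + (- t) * g x) f + (- t) * ip (\<lambda>x. f x + (- t) * g x) g"
      by (simp only: ip_add[OF s f tg] ip_cmult)
    also have "ip (\<lambda>x. f x + (- t) * g x) f = ip f f + (- t) * ip f g"
      by (subst ip_commute) (simp only: ip_add[OF f f tg] ip_cmult)
    also have "ip (\<lambda>x. f x + (- t) * g x) g = ip f g + (- t) * ip g g"
      by (subst ip_commute) (simp only: ip_add[OF g f tg] ip_cmult ip_commute[of g f])
    finally show ?thesis by (simp add: algebra_simps power2_eq_square)
  qed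
  have "(ip f g)\<^sup>2 \<le> ip f f * ip g g"
  proof (cases "ip g g = 0")
    case True
    have "ip f g = 0"
    proof (rule ccontr)
      assume n: "ip f g \<noteq> 0"
      \<comment> \<open>For ip g g = 0 the quadratic is affine in t, and this t gives it the value
        -1.\<close>
      show False using q[of "(ip f f + 1) / (2 * ip f g)"] n True by (simp add: field_simps)
    qed
    then show ?thesis using True by simp
  next
    case False
    then have "ip g g > 0" using ip_self_nonneg[of g] by linarith
    then show ?thesis using q[of "ip f g / ip g g"] by (simp add: field_simps power2_eq_square)
  qed
  then have "sqrt ((ip f g)\<^sup>2) \<le> sqrt (ip f f * ip g g)" by (rule real_sqrt_le_mono)
  then show ?thesis by (simp add: real_sqrt_mult)
qed

section \<open>Convolution operators, their adjoints and compositions\<close>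

definition conv :: "('a::euclidean_space \<Rightarrow> real) \<Rightarrow> ('a \<Rightarrow> real) \<Rightarrow> 'a \<Rightarrow> real" where
  "conv k f x = (\<integral>y. k (x - y) * f y \<partial>lborel)"

text \<open>The adjoint of \<open>conv k\<close> for the pairing \<open>ip\<close>. Applied to a
  second kernel it also yields the kernel of the composition of that adjoint with a
  convolution.\<close>

definition corr :: "('a::euclidean_space \<Rightarrow> real) \<Rightarrow> ('a \<Rightarrow> real) \<Rightarrow> 'a \<Rightarrow> real" where
  "corr k g y = (\<integral>x. k (x - y) * g x \<partial>lborel)"

text \<open>Integrating in x first, translation invariance leaves the product of \<open>C\<close>
  with the L^1 norms of \<open>k\<close> and \<open>f\<close>. The weight \<open>a\<close> stands
  for 1, for a test function or for a second kernel in the applications of Fubini.\<close>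

lemma integrable_conv_pair:
  fixes k f a :: "'a::euclidean_space \<Rightarrow> real"
  assumes k: "k \<in> bdd_int" and f: "f \<in> bdd_int" and a: "a \<in> borel_measurable borel" "\<And>x. \<bar>a x\<bar> \<le> C"
  shows "integrable (lborel \<Otimes>\<^sub>M lborel) (\<lambda>(y, x). k (x - y) * f y * a x)"
proof -
  note [measurable] = bdd_intD(1)[OF k] bdd_intD(1)[OF f] a(1)
  have ik: "integrable lborel (\<lambda>x. k (x - y))" for y
    using bdd_intD(2)[OF k] by (simp add: integrable_lborel_shift)
  have i: "integrable lborel (\<lambda>x. k (x - y) * f y * a x)" for y
    using integrable_mult_bounded(1)[OF Bochner_Integration.integrable_mult_left[OF ik, where c="f y"], of a C] a by simp
  have "integrable (lborel \<Otimes>\<^sub>M lborel) (\<lambda>p. k (snd p - fst p) * f (fst p) * a (snd p))"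
  proof (rule lborel_pair.Fubini_integrable)
    show "integrable lborel (\<lambda>y. \<integral>x. norm (k (snd (y, x) - fst (y, x)) * f (fst (y, x)) * a (snd (y, x))) \<partial>lborel)"
    proof (rule Bochner_Integration.integrable_bound)
      show "integrable lborel (\<lambda>y. (C * (\<integral>x. \<bar>k x\<bar> \<partial>lborel)) * f y)"
        using bdd_intD(2)[OF f] by simp
      show "AE y in lborel. norm (\<integral>x. norm (k (snd (y, x) - fst (y, x)) * f (fst (y, x)) * a (snd (y, x))) \<partial>lborel)
          \<le> norm ((C * (\<integral>x. \<bar>k x\<bar> \<partial>lborel)) * f y)"
      proof (rule AE_I2)
        fix y
        have "(\<integral>x. \<bar>k (x - y) * f y * a x\<bar> \<partial>lborel) \<le> (\<integral>x. \<bar>f y\<bar> * C * \<bar>k (x - y)\<bar> \<partial>lborel)"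
        proof (rule integral_mono)
          show "\<bar>k (x - y) * f y * a x\<bar> \<le> \<bar>f y\<bar> * C * \<bar>k (x - y)\<bar>" for x
            using mult_left_mono[OF a(2)[of x], of "\<bar>f y\<bar> * \<bar>k (x - y)\<bar>"] by (simp add: abs_mult mult_ac)
        qed (use i ik in auto)
        also have "\<dots> = \<bar>f y\<bar> * C * (\<integral>x. \<bar>k x\<bar> \<partial>lborel)"
          using integral_lborel_shift[of "\<lambda>x. \<bar>k x\<bar>" y] by simp
        finally show "norm (\<integral>x. norm (k (snd (y, x) - fst (y, x)) * f (fst (y, x)) * a (snd (y, x))) \<partial>lborel)
          \<le> norm ((C * (\<integral>x. \<bar>k x\<bar> \<partial>lborel)) * f y)"
          using order_trans[OF abs_ge_zero a(2)] by (simp add: abs_mult mult_ac)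
      qed
    qed measurable
    show "AE y in lborel. integrable lborel (\<lambda>x. k (snd (y, x) - fst (y, x)) * f (fst (y, x)) * a (snd (y, x)))"
      using i by simp
  qed measurable
  then show ?thesis by (simp add: case_prod_beta')
qed

lemma conv_integrable:
  assumes k: "k \<in> bdd_int" and f: "f \<in> bdd_int"
  shows "integrable lborel (\<lambda>y. k (x - y) * f y)"
proof -
  note [measurable] = bdd_intD(1)[OF k]
  obtain M where "\<And>x. \<bar>k x\<bar> \<le> M" using bdd_intD(3)[OF k] by blast
  then show ?thesis
    by (intro integrable_mult_bounded(2)[OF bdd_intD(2)[OF f], of _ M]) auto
qed

lemma conv_bdd_int:
  assumes k: "k \<in> bdd_int" and f: "f \<in> bdd_int"
  shows "conv k f \<in> bdd_int"
proof -
  note [measurable] = bdd_intD(1)[OF k] bdd_intD(1)[OF f]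
  obtain M where M: "\<And>x. \<bar>k x\<bar> \<le> M" using bdd_intD(3)[OF k] by blast
  have "(\<lambda>x. \<integral>y. k (x - y) * f y \<partial>lborel) \<in> borel_measurable borel"
    by measurable
  moreover have "integrable lborel (\<lambda>x. \<integral>y. k (x - y) * f y \<partial>lborel)"
    using lborel_pair.integrable_snd[OF integrable_conv_pair[OF k f, of "\<lambda>_. 1" 1]] by simp
  moreover have "\<bar>conv k f x\<bar> \<le> M * (\<integral>y. \<bar>f y\<bar> \<partial>lborel)" for x
  proof -
    have "\<bar>conv k f x\<bar> \<le> (\<integral>y. \<bar>k (x - y) * f y\<bar> \<partial>lborel)"
      unfolding conv_def by (rule integral_abs_bound)
    also have "\<dots> \<le> (\<integral>y. M * \<bar>f y\<bar> \<partial>lborel)"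
      using integrable_abs[OF conv_integrable[OF k f, of x]] bdd_intD(2)[OF f] M
      by (intro integral_mono) (auto simp: abs_mult intro!: mult_right_mono)
    finally show ?thesis by simp
  qed
  ultimately show ?thesis unfolding bdd_int_def conv_def[abs_def] by blast
qed

lemma conv_cmult: "conv (\<lambda>x. c * k x) f x = c * conv k f x"
  by (simp add: conv_def mult.assoc)

lemma ip_conv:
  assumes k: "k \<in> bdd_int" and f: "f \<in> bdd_int" and g: "g \<in> bdd_int"
  shows "ip (conv k f) g = ip f (corr k g)"
proof -
  obtain M where M: "\<And>x. \<bar>g x\<bar> \<le> M" using bdd_intD(3)[OF g] by blast
  note i = integrable_conv_pair[OF k f bdd_intD(1)[OF g] M]
  have "ip (conv k f) g = (\<integral>x. (\<integral>y. k (x - y) * f y * g x \<partial>lborel) \<partial>lborel)"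
    by (simp add: ip_def conv_def)
  also have "\<dots> = (\<integral>y. (\<integral>x. k (x - y) * f y * g x \<partial>lborel) \<partial>lborel)"
    by (rule lborel_pair.Fubini_integral) fact
  also have "\<dots> = (\<integral>y. f y * (\<integral>x. k (x - y) * g x \<partial>lborel) \<partial>lborel)"
    by (subst integral_mult_right_zero[symmetric]) (simp add: mult_ac)
  finally show ?thesis by (simp add: ip_def corr_def)
qed

lemma corr_conv:
  assumes k: "k \<in> bdd_int" and k': "k' \<in> bdd_int" and f: "f \<in> bdd_int"
  shows "corr k (conv k' f) = conv (corr k k') f"
proof
  fix y
  note [measurable] = bdd_intD(1)[OF k] bdd_intD(1)[OF k']
  obtain M where M: "\<And>x. \<bar>k x\<bar> \<le> M" using bdd_intD(3)[OF k] by blast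
  have "integrable (lborel \<Otimes>\<^sub>M lborel) (\<lambda>(z, x). k' (x - z) * f z * k (x - y))"
    by (rule integrable_conv_pair[OF k' f, of _ M]) (use M in auto)
  note i = lborel_pair.Fubini_integral[OF this]
  have "corr k (conv k' f) y = (\<integral>x. (\<integral>z. k' (x - z) * f z * k (x - y) \<partial>lborel) \<partial>lborel)"
    unfolding corr_def conv_def by (subst integral_mult_right_zero[symmetric]) (simp add: mult_ac)
  also have "\<dots> = (\<integral>z. (\<integral>x. k' (x - z) * f z * k (x - y) \<partial>lborel) \<partial>lborel)"
    by (rule i)
  also have "\<dots> = (\<integral>z. corr k k' (y - z) * f z \<partial>lborel)"
  proof (intro Bochner_Integration.integral_cong refl)
    fix z
    have "(\<integral>x. k' (x - z) * f z * k (x - y) \<partial>lborel) = f z * (\<integral>x. k' (x - z) * k (x - y) \<partial>lborel)"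
      by (subst integral_mult_right_zero[symmetric]) (simp add: mult_ac)
    also have "(\<integral>x. k' (x - z) * k (x - y) \<partial>lborel) = (\<integral>x. k' x * k (x - (y - z)) \<partial>lborel)"
      using integral_lborel_shift[of "\<lambda>x. k' x * k (x - (y - z))" z] by simp
    finally show "(\<integral>x. k' (x - z) * f z * k (x - y) \<partial>lborel) = corr k k' (y - z) * f z"
      by (simp add: corr_def mult_ac)
  qed
  finally show "corr k (conv k' f) y = conv (corr k k') f y" by (simp add: conv_def)
qed

lemma ip_conv_conv:
  assumes k: "k \<in> bdd_int" and k': "k' \<in> bdd_int" and f: "f \<in> bdd_int"
  shows "ip (conv k f) (conv k' f) = ip f (conv (corr k k') f)"
  using ip_conv[OF k f conv_bdd_int[OF k' f]] by (simp add: corr_conv[OF k k' f])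

text \<open>Schur's test in symmetric form: |f(y) f(x)| <= (f(y)^2 + f(x)^2)/2, and each square
  integrates against |k(x - y)| to the L^1 norm of \<open>k\<close> times
  \<open>ip f f\<close>.\<close>

lemma ip_conv_le:
  assumes k: "k \<in> bdd_int" and f: "f \<in> bdd_int"
  shows "\<bar>ip f (conv k f)\<bar> \<le> (\<integral>x. \<bar>k x\<bar> \<partial>lborel) * ip f f"
proof -
  note [measurable] = bdd_intD(1)[OF k] bdd_intD(1)[OF f]
  obtain M where M: "\<And>x. \<bar>f x\<bar> \<le> M" using bdd_intD(3)[OF f] by blast
  have k': "(\<lambda>x. \<bar>k x\<bar>) \<in> bdd_int" and f': "(\<lambda>x. (f x)\<^sup>2) \<in> bdd_int" and fa: "(\<lambda>x. \<bar>f x\<bar>) \<in> bdd_int"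
  proof -
    have "(f x)\<^sup>2 \<le> M\<^sup>2" for x using M[of x] by (metis abs_ge_zero power_mono power2_abs)
    then show "(\<lambda>x. (f x)\<^sup>2) \<in> bdd_int"
      unfolding bdd_int_def using bdd_int_mult_integrable[OF f f]
      by (auto simp: power2_eq_square intro!: exI[of _ "M\<^sup>2"])
  qed (use bdd_intD[OF k] bdd_intD[OF f] in \<open>auto simp: bdd_int_def\<close>)
  have i1: "integrable (lborel \<Otimes>\<^sub>M lborel) (\<lambda>(y, x). k (x - y) * f y * f x)"
    by (rule integrable_conv_pair[OF k f, of f M]) (use M in auto)
  have i2: "integrable (lborel \<Otimes>\<^sub>M lborel) (\<lambda>(y, x). \<bar>k (x - y)\<bar> * (f y)\<^sup>2 * 1)"
    by (rule integrable_conv_pair[OF k' f', of _ 1]) auto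
  have "integrable (lborel \<Otimes>\<^sub>M lborel) (\<lambda>(y, x). \<bar>k (- (x - y))\<bar> * (f y)\<^sup>2 * 1)"
    by (rule integrable_conv_pair[OF _ f', of "\<lambda>x. \<bar>k (- x)\<bar>" _ 1])
       (use bdd_intD[OF k'] integrable_lborel_reflect[of "\<lambda>x. \<bar>k x\<bar>" 0] in \<open>auto simp: bdd_int_def\<close>)
  from lborel_pair.integrable_product_swap[OF this]
  have i3: "integrable (lborel \<Otimes>\<^sub>M lborel) (\<lambda>(y, x). \<bar>k (x - y)\<bar> * (f x)\<^sup>2 * 1)"
    by (simp add: case_prod_beta')
  have "ip f (conv k f) = (\<integral>x. (\<integral>y. k (x - y) * f y * f x \<partial>lborel) \<partial>lborel)"
    by (subst ip_commute) (simp add: ip_def conv_def)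
  also have "\<dots> = (\<integral>p. (case p of (y, x) \<Rightarrow> k (x - y) * f y * f x) \<partial>(lborel \<Otimes>\<^sub>M lborel))"
    by (rule lborel_pair.integral_snd[OF i1])
  also have "\<bar>\<dots>\<bar> \<le> (\<integral>p. \<bar>case p of (y, x) \<Rightarrow> k (x - y) * f y * f x\<bar> \<partial>(lborel \<Otimes>\<^sub>M lborel))"
    by (rule integral_abs_bound)
  also have "\<dots> \<le> (\<integral>p. ((case p of (y, x) \<Rightarrow> \<bar>k (x - y)\<bar> * (f y)\<^sup>2 * 1) + (case p of (y, x) \<Rightarrow> \<bar>k (x - y)\<bar> * (f x)\<^sup>2 * 1)) / 2 \<partial>(lborel \<Otimes>\<^sub>M lborel))"
  proof (rule integral_mono)
    fix p :: "'a \<times> 'a"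
    obtain y x where p: "p = (y, x)" by (cases p)
    have "\<bar>f y * f x\<bar> \<le> ((f y)\<^sup>2 + (f x)\<^sup>2) / 2"
      using sum_squares_bound[of "\<bar>f y\<bar>" "\<bar>f x\<bar>"] by (simp add: abs_mult)
    from mult_left_mono[OF this, of "\<bar>k (x - y)\<bar>"]
    show "\<bar>case p of (y, x) \<Rightarrow> k (x - y) * f y * f x\<bar> \<le> ((case p of (y, x) \<Rightarrow> \<bar>k (x - y)\<bar> * (f y)\<^sup>2 * 1) + (case p of (y, x) \<Rightarrow> \<bar>k (x - y)\<bar> * (f x)\<^sup>2 * 1)) / 2"
      by (simp add: p abs_mult algebra_simps)
  qed (use i1 i2 i3 in auto)
  also have "\<dots> = ((\<integral>p. (case p of (y, x) \<Rightarrow> \<bar>k (x - y)\<bar> * (f y)\<^sup>2 * 1) \<partial>(lborel \<Otimes>\<^sub>M lborel))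
       + (\<integral>p. (case p of (y, x) \<Rightarrow> \<bar>k (x - y)\<bar> * (f x)\<^sup>2 * 1) \<partial>(lborel \<Otimes>\<^sub>M lborel))) / 2"
    using i2 i3 by simp
  also have "(\<integral>p. (case p of (y, x) \<Rightarrow> \<bar>k (x - y)\<bar> * (f y)\<^sup>2 * 1) \<partial>(lborel \<Otimes>\<^sub>M lborel)) = (\<integral>x. \<bar>k x\<bar> \<partial>lborel) * ip f f"
    using lborel_pair.integral_fst[OF i2] integral_lborel_shift[of "\<lambda>x. \<bar>k x\<bar>"]
    by (simp add: ip_def power2_eq_square)
  also have "(\<integral>p. (case p of (y, x) \<Rightarrow> \<bar>k (x - y)\<bar> * (f x)\<^sup>2 * 1) \<partial>(lborel \<Otimes>\<^sub>M lborel)) = (\<integral>x. \<bar>k x\<bar> \<partial>lborel) * ip f f"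
    using lborel_pair.integral_snd[OF i3] integral_lborel_reflect[of "\<lambda>x. \<bar>k x\<bar>"]
    by (simp add: ip_def power2_eq_square)
  finally show ?thesis by (simp add: mult.commute)
qed

section \<open>Almost orthogonality of dyadic oscillating kernels\<close>

text \<open>Support, height and Lipschitz constant scale as for a dilate to radius \<rho>. The size
  \<open>s\<close> enters the height only: the Lipschitz constant stays normalised, so that the
  smallness gained from a correlation is recorded in \<open>s\<close> and the class reproduces
  itself.\<close>

definition osc_kernel :: "real \<Rightarrow> real \<Rightarrow> ('a::euclidean_space \<Rightarrow> real) \<Rightarrow> bool" where
  "osc_kernel \<rho> s k \<longleftrightarrow> (\<forall>x. norm x > \<rho> \<longrightarrow> k x = 0) \<and> (\<forall>x. \<bar>k x\<bar> \<le> s / \<rho> ^ DIM('a)) \<and>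
     (\<forall>x y. \<bar>k x - k y\<bar> \<le> norm (x - y) / \<rho> ^ (DIM('a) + 1)) \<and> (\<integral>x. k x \<partial>lborel) = 0"

lemma continuous_if_lipschitz:
  fixes k :: "'a::real_normed_vector \<Rightarrow> real"
  assumes "\<And>x y. \<bar>k x - k y\<bar> \<le> C * norm (x - y)"
  shows "continuous_on UNIV k"
proof (rule uniformly_continuous_imp_continuous)
  have "(max C 0)-lipschitz_on UNIV k"
  proof (rule lipschitz_onI)
    show "dist (k x) (k y) \<le> max C 0 * dist x y" for x y
      using order_trans[OF assms[of x y] mult_right_mono[of C "max C 0" "norm (x - y)"]]
      by (auto simp: dist_norm)
  qed auto
  then show "uniformly_continuous_on UNIV k" by (rule lipschitz_on_uniformly_continuous)
qed

lemma osc_kernel_measurable: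
  fixes k :: "'a::euclidean_space \<Rightarrow> real"
  assumes "osc_kernel \<rho> s k"
  shows "k \<in> borel_measurable borel"
proof (rule borel_measurable_continuous_onI, rule continuous_if_lipschitz)
  show "\<bar>k x - k y\<bar> \<le> (1 / \<rho> ^ (DIM('a) + 1)) * norm (x - y)" for x y
    using assms unfolding osc_kernel_def by auto
qed

lemma
  fixes k :: "'a::euclidean_space \<Rightarrow> real"
  assumes k[measurable]: "k \<in> borel_measurable borel" and \<rho>: "\<rho> \<ge> 0" and b: "b \<ge> 0"
    and "\<And>x. norm x > \<rho> \<Longrightarrow> k x = 0" "\<And>x. \<bar>k x\<bar> \<le> b"
  shows integrable_bounded_support: "integrable lborel k"
    and integral_abs_bounded_support: "(\<integral>x. \<bar>k x\<bar> \<partial>lborel) \<le> b * (unit_ball_vol (real DIM('a)) * \<rho> ^ DIM('a))"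
proof -
  have i: "integrable lborel (\<lambda>x. b * indicator (cball (0::'a) \<rho>) x)"
    using emeasure_lborel_cball_finite[of "0::'a" \<rho>]
    by (intro integrable_mult_right integrable_real_indicator) auto
  have le: "\<bar>k x\<bar> \<le> b * indicator (cball (0::'a) \<rho>) x" for x
    using assms(4,5)[of x] by (auto split: split_indicator)
  show ik: "integrable lborel k"
    by (rule Bochner_Integration.integrable_bound[OF i]) (use order_trans[OF le abs_ge_self] in auto)
  have "(\<integral>x. \<bar>k x\<bar> \<partial>lborel) \<le> (\<integral>x. b * indicator (cball (0::'a) \<rho>) x \<partial>lborel)"
    by (intro integral_mono i integrable_abs ik le)
  also have "\<dots> = b * (unit_ball_vol (real DIM('a)) * \<rho> ^ DIM('a))"
    using \<rho> by (simp add: content_cball)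
  finally show "(\<integral>x. \<bar>k x\<bar> \<partial>lborel) \<le> b * (unit_ball_vol (real DIM('a)) * \<rho> ^ DIM('a))" .
qed

lemma osc_kernel_bdd_int:
  fixes k :: "'a::euclidean_space \<Rightarrow> real"
  assumes "osc_kernel \<rho> s k" "\<rho> > 0" "s \<ge> 0"
  shows "k \<in> bdd_int" "(\<integral>x. \<bar>k x\<bar> \<partial>lborel) \<le> unit_ball_vol (real DIM('a)) * s"
proof -
  have "integrable lborel k"
    by (rule integrable_bounded_support[of k \<rho> "s / \<rho> ^ DIM('a)"])
       (use assms osc_kernel_measurable[OF assms(1)] in \<open>auto simp: osc_kernel_def\<close>)
  then show "k \<in> bdd_int"
    using assms osc_kernel_measurable[OF assms(1)] unfolding bdd_int_def osc_kernel_def by blast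
  have "(\<integral>x. \<bar>k x\<bar> \<partial>lborel) \<le> s / \<rho> ^ DIM('a) * (unit_ball_vol (real DIM('a)) * \<rho> ^ DIM('a))"
    by (rule integral_abs_bounded_support)
       (use assms osc_kernel_measurable[OF assms(1)] in \<open>auto simp: osc_kernel_def\<close>)
  then show "(\<integral>x. \<bar>k x\<bar> \<partial>lborel) \<le> unit_ball_vol (real DIM('a)) * s"
    using assms by (simp add: mult_ac)
qed

lemma osc_kernel_0: "\<rho> > 0 \<Longrightarrow> s \<ge> 0 \<Longrightarrow> osc_kernel \<rho> s (\<lambda>_. 0)"
  by (simp add: osc_kernel_def)

text \<open>The height of the correlation has two bounds: \<open>s\<close> from the size of
  \<open>k\<close>, and 2^-d by pairing the mean zero of the finer kernel with the Lipschitz bound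
  of the coarser one. The divisor \<omega> is the bound on the L^1 norm of \<open>k'\<close> times
  2^(N+1) for the passage from radius \<rho> to 2 \<rho>; its factor \<open>s\<close> reappears in
  the L^2 bound.\<close>

lemma osc_kernel_corr:
  fixes k k' :: "'a::euclidean_space \<Rightarrow> real"
  assumes k: "osc_kernel \<rho> s k" and k': "osc_kernel (\<rho> / 2 ^ d) s k'" and \<rho>: "\<rho> > 0" and s: "s > 0"
  defines "\<omega> \<equiv> unit_ball_vol (real DIM('a)) * s * 2 ^ (DIM('a) + 1)"
  shows "osc_kernel (2 * \<rho>) (min s ((1/2) ^ d)) (\<lambda>w. corr k k' w / \<omega>)"
proof -
  define \<rho>' where "\<rho>' = \<rho> / 2 ^ d"
  have \<rho>': "\<rho>' > 0" "\<rho>' \<le> \<rho>" using \<rho> by (auto simp: \<rho>'_def field_simps)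
  have \<omega>: "\<omega> > 0" using s by (simp add: \<omega>_def)
  note k' = k'[folded \<rho>'_def]
  have kV: "k \<in> bdd_int" "k' \<in> bdd_int"
    using osc_kernel_bdd_int(1)[OF k \<rho>] osc_kernel_bdd_int(1)[OF k' \<rho>'(1)] s by auto
  note [measurable] = bdd_intD(1)[OF kV(1)] bdd_intD(1)[OF kV(2)]
  have k'1: "(\<integral>x. \<bar>k' x\<bar> \<partial>lborel) \<le> unit_ball_vol (real DIM('a)) * s"
    using osc_kernel_bdd_int(2)[OF k' \<rho>'(1)] s by auto
  have i: "integrable lborel (\<lambda>x. k (x - w) * k' x)" for w
    using k unfolding osc_kernel_def
    by (intro integrable_mult_bounded(2)[OF bdd_intD(2)[OF kV(2)], of _ "s / \<rho> ^ DIM('a)"]) auto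
  have ik': "integrable lborel (\<lambda>x. c * k' x)" for c using bdd_intD(2)[OF kV(2)] by simp
  have bnd: "\<bar>\<integral>x. g x * k' x \<partial>lborel\<bar> \<le> b * (unit_ball_vol (real DIM('a)) * s)"
    if g: "integrable lborel (\<lambda>x. g x * k' x)" and b: "b \<ge> 0" "\<And>x. norm x \<le> \<rho>' \<Longrightarrow> \<bar>g x\<bar> \<le> b" for g b
  proof -
    have "\<bar>\<integral>x. g x * k' x \<partial>lborel\<bar> \<le> (\<integral>x. \<bar>g x * k' x\<bar> \<partial>lborel)" by (rule integral_abs_bound)
    also have "\<dots> \<le> (\<integral>x. b * \<bar>k' x\<bar> \<partial>lborel)"
    proof (rule integral_mono)
      show "\<bar>g x * k' x\<bar> \<le> b * \<bar>k' x\<bar>" for x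
      proof (cases "norm x \<le> \<rho>'")
        case False
        then have "k' x = 0" using k' unfolding osc_kernel_def by auto
        then show ?thesis by simp
      qed (use b in \<open>auto simp: abs_mult intro!: mult_right_mono\<close>)
      show "integrable lborel (\<lambda>x. \<bar>g x * k' x\<bar>)" by (rule integrable_abs) (rule g)
    qed (use bdd_intD(2)[OF kV(2)] in auto)
    also have "\<dots> = b * (\<integral>x. \<bar>k' x\<bar> \<partial>lborel)" by simp
    also have "\<dots> \<le> b * (unit_ball_vol (real DIM('a)) * s)" using b k'1 by (intro mult_left_mono) auto
    finally show ?thesis .
  qed
  have lip: "\<bar>corr k k' w - corr k k' w'\<bar> \<le> norm (w - w') / \<rho> ^ (DIM('a) + 1) * (unit_ball_vol (real DIM('a)) * s)" for w w'
  proof -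
    have "corr k k' w - corr k k' w' = (\<integral>x. (k (x - w) - k (x - w')) * k' x \<partial>lborel)"
      unfolding corr_def by (subst Bochner_Integration.integral_diff[symmetric]) (auto simp: i left_diff_distrib)
    also have "\<bar>\<dots>\<bar> \<le> norm (w - w') / \<rho> ^ (DIM('a) + 1) * (unit_ball_vol (real DIM('a)) * s)"
    proof (rule bnd)
      show "integrable lborel (\<lambda>x. (k (x - w) - k (x - w')) * k' x)"
        using Bochner_Integration.integrable_diff[OF i i] by (simp add: left_diff_distrib)
      have "\<bar>k (x - w) - k (x - w')\<bar> \<le> norm ((x - w) - (x - w')) / \<rho> ^ (DIM('a) + 1)" for x
        using k unfolding osc_kernel_def by blast
      then show "\<bar>k (x - w) - k (x - w')\<bar> \<le> norm (w - w') / \<rho> ^ (DIM('a) + 1)" for x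
        by (simp add: norm_minus_commute)
    qed (use \<rho> in auto)
    finally show ?thesis .
  qed
  have sz1: "\<bar>corr k k' w\<bar> \<le> s / \<rho> ^ DIM('a) * (unit_ball_vol (real DIM('a)) * s)" for w
    unfolding corr_def by (rule bnd[OF i]) (use k s \<rho> in \<open>auto simp: osc_kernel_def\<close>)
  \<comment> \<open>The constant \<open>k (- w)\<close> may be subtracted because \<open>k'\<close>
    has mean zero; on the support of \<open>k'\<close> the difference is at most
    \<rho>'/\<rho>^(N+1).\<close>
  have sz2: "\<bar>corr k k' w\<bar> \<le> \<rho>' / \<rho> ^ (DIM('a) + 1) * (unit_ball_vol (real DIM('a)) * s)" for w
  proof -
    have "(\<integral>x. k (- w) * k' x \<partial>lborel) = 0"
      using k' unfolding osc_kernel_def by simp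
    then have "corr k k' w = (\<integral>x. (k (x - w) - k (- w)) * k' x \<partial>lborel)"
      unfolding corr_def left_diff_distrib by (subst Bochner_Integration.integral_diff[OF i ik']) simp
    also have "\<bar>\<dots>\<bar> \<le> \<rho>' / \<rho> ^ (DIM('a) + 1) * (unit_ball_vol (real DIM('a)) * s)"
    proof (rule bnd)
      show "integrable lborel (\<lambda>x. (k (x - w) - k (- w)) * k' x)"
        using Bochner_Integration.integrable_diff[OF i ik'] by (simp add: left_diff_distrib)
      fix x :: 'a assume x: "norm x \<le> \<rho>'"
      have "\<bar>k (x - w) - k (- w)\<bar> \<le> norm ((x - w) - (- w)) / \<rho> ^ (DIM('a) + 1)"
        using k unfolding osc_kernel_def by blast
      also have "\<dots> \<le> \<rho>' / \<rho> ^ (DIM('a) + 1)" using x \<rho> by (intro divide_right_mono) auto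
      finally show "\<bar>k (x - w) - k (- w)\<bar> \<le> \<rho>' / \<rho> ^ (DIM('a) + 1)" .
    qed (use \<rho> \<rho>' in auto)
    finally show ?thesis .
  qed
  have supp: "corr k k' w = 0" if w: "norm w > 2 * \<rho>" for w
  proof -
    have "k (x - w) * k' x = 0" for x
    proof (cases "norm x \<le> \<rho>'")
      case True
      have "norm w \<le> norm x + norm (x - w)"
        using norm_triangle_ineq4[of x "x - w"] by simp
      then have "norm (x - w) > \<rho>" using w True \<rho>'(2) by linarith
      then show ?thesis using k unfolding osc_kernel_def by auto
    qed (use k' in \<open>auto simp: osc_kernel_def\<close>)
    then show ?thesis by (simp only: corr_def Bochner_Integration.integral_zero)
  qed
  \<comment> \<open>Here it is the mean of the coarser kernel \<open>k\<close> that
    vanishes.\<close>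
  have int0: "(\<integral>w. corr k k' w \<partial>lborel) = 0"
  proof -
    obtain M where M: "\<And>x. \<bar>k' x\<bar> \<le> M" using bdd_intD(3)[OF kV(2)] by blast
    have kr: "(\<lambda>x. k (- x)) \<in> bdd_int"
      using bdd_intD[OF kV(1)] integrable_lborel_reflect[of k 0] by (auto simp: bdd_int_def)
    have "integrable (lborel \<Otimes>\<^sub>M lborel) (\<lambda>(x, w). k (- (w - x)) * k' x * 1)"
      by (rule integrable_conv_pair[OF kr kV(2), of "\<lambda>_. 1" 1]) auto
    then have "integrable (lborel \<Otimes>\<^sub>M lborel) (\<lambda>(x, w). k (x - w) * k' x)" by simp
    from lborel_pair.Fubini_integral[OF this]
    have "(\<integral>w. corr k k' w \<partial>lborel) = (\<integral>x. (\<integral>w. k (x - w) * k' x \<partial>lborel) \<partial>lborel)"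
      by (simp add: corr_def)
    moreover have "(\<integral>w. k (x - w) \<partial>lborel) = 0" for x
      using k integral_lborel_reflect[of k x] unfolding osc_kernel_def by simp
    ultimately show ?thesis by simp
  qed
  have e1: "\<omega> * (c / (2 * \<rho>) ^ DIM('a)) = 2 * (c / \<rho> ^ DIM('a) * (unit_ball_vol (real DIM('a)) * s))" for c
    using \<rho> by (simp add: \<omega>_def power_mult_distrib field_simps)
  have e2: "\<omega> * (c / (2 * \<rho>) ^ (DIM('a) + 1)) = c / \<rho> ^ (DIM('a) + 1) * (unit_ball_vol (real DIM('a)) * s)" for c
    using \<rho> by (simp add: \<omega>_def power_mult_distrib field_simps)
  show ?thesis
    unfolding osc_kernel_def
  proof (intro conjI allI impI)
    fix w :: 'a
    have "\<bar>corr k k' w\<bar> \<le> min s ((1/2) ^ d) / \<rho> ^ DIM('a) * (unit_ball_vol (real DIM('a)) * s)"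
      using sz1[of w] sz2[of w] \<rho> by (auto simp: min_def \<rho>'_def power_divide field_simps)
    also have "\<dots> \<le> 2 * (min s ((1/2) ^ d) / \<rho> ^ DIM('a) * (unit_ball_vol (real DIM('a)) * s))"
      unfolding mult_2 le_add_same_cancel1
      using s \<rho> by (intro mult_nonneg_nonneg divide_nonneg_nonneg) auto
    also have "\<dots> = \<omega> * (min s ((1/2) ^ d) / (2 * \<rho>) ^ DIM('a))" by (rule e1[symmetric])
    finally show "\<bar>corr k k' w / \<omega>\<bar> \<le> min s ((1/2) ^ d) / (2 * \<rho>) ^ DIM('a)"
      using \<omega> by (simp add: pos_divide_le_eq mult.commute)
  next
    fix w w' :: 'a
    have "\<bar>corr k k' w - corr k k' w'\<bar> \<le> \<omega> * (norm (w - w') / (2 * \<rho>) ^ (DIM('a) + 1))"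
      unfolding e2 by (rule lip)
    then have "\<bar>(corr k k' w - corr k k' w') / \<omega>\<bar> \<le> norm (w - w') / (2 * \<rho>) ^ (DIM('a) + 1)"
      using \<omega> by (simp add: pos_divide_le_eq mult.commute)
    then show "\<bar>corr k k' w / \<omega> - corr k k' w' / \<omega>\<bar> \<le> norm (w - w') / (2 * \<rho>) ^ (DIM('a) + 1)"
      by (simp add: diff_divide_distrib)
  qed (use supp int0 in auto)
qed

text \<open>The two diagonals at distance d coincide by symmetry. Absolute values are put around
  whole diagonals only: each diagonal will again be a sum over oscillating kernels, whose internal
  cancellation must survive.\<close>

lemma sum_symmetric_diagonals:
  fixes a :: "nat \<Rightarrow> nat \<Rightarrow> real"
  assumes sym: "\<And>i j. a i j = a j i"
  shows "\<bar>\<Sum>i<n. \<Sum>j<n. a i j\<bar> \<le> 2 * (\<Sum>d<n. \<bar>\<Sum>i<n. if i + d < n then a i (i + d) else 0\<bar>)"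
proof -
  have upper: "(\<Sum>d<n. \<Sum>i<n. if i + d < n \<and> P d then a i (i + d) else 0) = (\<Sum>i<n. \<Sum>j<n. if i \<le> j \<and> P (j - i) then a i j else 0)" for P
  proof -
    have "(\<Sum>d<n. if i + d < n \<and> P d then a i (i + d) else 0) = (\<Sum>j<n. if i \<le> j \<and> P (j - i) then a i j else 0)" if "i < n" for i
    proof -
      have "(\<Sum>j<n. if i \<le> j \<and> P (j - i) then a i j else 0) = (\<Sum>j\<in>{j. j < n \<and> i \<le> j \<and> P (j - i)}. a i j)"
        by (simp add: sum.If_cases Int_def lessThan_def)
      also have "\<dots> = (\<Sum>d\<in>{d. d < n \<and> i + d < n \<and> P d}. a i (i + d))"
        by (rule sum.reindex_bij_witness[of _ "\<lambda>d. i + d" "\<lambda>j. j - i"]) (use that in auto)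
      also have "\<dots> = (\<Sum>d<n. if i + d < n \<and> P d then a i (i + d) else 0)"
        by (simp add: sum.If_cases Int_def lessThan_def)
      finally show ?thesis ..
    qed
    then show ?thesis by (subst sum.swap) simp
  qed
  define b where "b d = (\<Sum>i<n. if i + d < n then a i (i + d) else 0)" for d
  have "(\<Sum>i<n. \<Sum>j<n. a i j) = (\<Sum>i<n. \<Sum>j<n. (if i \<le> j then a i j else 0) + (if j < i then a i j else 0))"
    by (intro sum.cong) auto
  also have "\<dots> = (\<Sum>i<n. \<Sum>j<n. if i \<le> j then a i j else 0) + (\<Sum>i<n. \<Sum>j<n. if j < i then a i j else 0)"
    by (simp add: sum.distrib)
  also have "(\<Sum>i<n. \<Sum>j<n. if j < i then a i j else 0) = (\<Sum>i<n. \<Sum>j<n. if i < j then a i j else 0)"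
    by (subst sum.swap) (intro sum.cong refl if_cong sym)
  also have "\<dots> = (\<Sum>i<n. \<Sum>j<n. if i \<le> j \<and> 0 < j - i then a i j else 0)"
    by (intro sum.cong) auto
  also have "\<dots> = (\<Sum>d<n. \<Sum>i<n. if i + d < n \<and> 0 < d then a i (i + d) else 0)"
    by (rule upper[symmetric])
  also have "\<dots> = (\<Sum>d<n. if 0 < d then b d else 0)"
    unfolding b_def by (intro sum.cong) auto
  also have "(\<Sum>i<n. \<Sum>j<n. if i \<le> j then a i j else 0) = (\<Sum>d<n. b d)"
    using upper[of "\<lambda>_. True"] by (simp add: b_def)
  finally have "\<bar>\<Sum>i<n. \<Sum>j<n. a i j\<bar> \<le> \<bar>\<Sum>d<n. b d\<bar> + \<bar>\<Sum>d<n. if 0 < d then b d else 0\<bar>"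
    by simp
  also have "\<dots> \<le> (\<Sum>d<n. \<bar>b d\<bar>) + (\<Sum>d<n. \<bar>if 0 < d then b d else 0\<bar>)"
    by (intro add_mono sum_abs)
  also have "\<dots> \<le> (\<Sum>d<n. \<bar>b d\<bar>) + (\<Sum>d<n. \<bar>b d\<bar>)"
    by (intro add_mono sum_mono) auto
  finally show ?thesis by (simp add: b_def)
qed

text \<open>The quantification over all sizes \<open>s\<close> matters: the correlation of the kernels at scales \<open>i\<close> and
  \<open>i + d\<close> is again an oscillating kernel, of size \<open>2\<^sup>-\<^sup>d\<close>, so a bound can be applied to the diagonals of
  the square of the sum and improves itself from \<open>Z\<close> to a multiple of \<open>sqrt Z\<close>.\<close>

definition osc_bound :: "'a::euclidean_space itself \<Rightarrow> nat \<Rightarrow> real \<Rightarrow> bool" where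
  "osc_bound _ n Z \<longleftrightarrow> (\<forall>\<rho> s (k :: nat \<Rightarrow> 'a \<Rightarrow> real) f. 0 < \<rho> \<longrightarrow> 0 < s \<longrightarrow> s \<le> 1 \<longrightarrow>
     (\<forall>i<n. osc_kernel (\<rho> / 2 ^ i) s (k i)) \<longrightarrow> f \<in> bdd_int \<longrightarrow>
     ip (\<lambda>x. \<Sum>i<n. conv (k i) f x) (\<lambda>x. \<Sum>i<n. conv (k i) f x) \<le> Z * (s * ip f f))"

text \<open>By the composition rule the d-th diagonal of the square equals \<omega> times the
  pairing of \<open>f\<close> with a sum of convolutions by normalised correlations. These are
  oscillating kernels at the scales 2 \<rho>/2^i, so \<open>osc_bound\<close> applies to each
  diagonal.\<close>

lemma osc_sum_square_le:
  fixes k :: "nat \<Rightarrow> 'a::euclidean_space \<Rightarrow> real"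
  assumes \<rho>: "0 < \<rho>" and s: "0 < s" "s \<le> 1" and k: "\<And>i. i < n \<Longrightarrow> osc_kernel (\<rho> / 2 ^ i) s (k i)"
    and f: "f \<in> bdd_int"
  defines "\<omega> \<equiv> unit_ball_vol (real DIM('a)) * s * 2 ^ (DIM('a) + 1)"
  obtains c where "\<And>d i. d < n \<Longrightarrow> i < n \<Longrightarrow> osc_kernel (2 * \<rho> / 2 ^ i) (min s ((1/2) ^ d)) (c d i)"
    "ip (\<lambda>x. \<Sum>i<n. conv (k i) f x) (\<lambda>x. \<Sum>i<n. conv (k i) f x)
       \<le> 2 * \<omega> * (\<Sum>d<n. \<bar>ip f (\<lambda>x. \<Sum>i<n. conv (c d i) f x)\<bar>)"
proof -
  have \<omega>: "\<omega> > 0" using s by (simp add: \<omega>_def)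
  have kV: "k i \<in> bdd_int" if "i < n" for i
    using osc_kernel_bdd_int(1)[OF k[OF that]] \<rho> s by simp
  have cV: "conv (k i) f \<in> bdd_int" if "i < n" for i
    using conv_bdd_int[OF kV[OF that] f] .
  \<comment> \<open>Zero kernels pad the shorter diagonals to length n, so that the bound for the
    same n can be used.\<close>
  define c where "c d i = (if i + d < n then (\<lambda>w. corr (k i) (k (i + d)) w / \<omega>) else (\<lambda>_. 0))" for d i
  have ck: "osc_kernel (2 * \<rho> / 2 ^ i) (min s ((1/2) ^ d)) (c d i)" if "d < n" "i < n" for d i
  proof (cases "i + d < n")
    case True
    have "osc_kernel (2 * (\<rho> / 2 ^ i)) (min s ((1/2) ^ d)) (\<lambda>w. corr (k i) (k (i + d)) w / \<omega>)"
      unfolding \<omega>_def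
      by (rule osc_kernel_corr) (use k[of i] k[of "i + d"] True \<rho> s in \<open>auto simp: power_add mult.commute\<close>)
    then show ?thesis using True by (simp add: c_def)
  qed (use \<rho> s in \<open>auto simp: c_def intro!: osc_kernel_0\<close>)
  have cdV: "c d i \<in> bdd_int" if "d < n" "i < n" for d i
    using osc_kernel_bdd_int(1)[OF ck[OF that]] \<rho> s by simp
  have "ip (\<lambda>x. \<Sum>i<n. conv (k i) f x) (\<lambda>x. \<Sum>i<n. conv (k i) f x) = (\<Sum>i<n. \<Sum>j<n. ip (conv (k i) f) (conv (k j) f))"
  proof -
    have "ip (\<lambda>x. \<Sum>i<n. conv (k i) f x) (\<lambda>x. \<Sum>i<n. conv (k i) f x) = (\<Sum>j<n. ip (\<lambda>x. \<Sum>i<n. conv (k i) f x) (conv (k j) f))"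
      by (rule ip_sum) (auto intro: bdd_int_sum cV)
    also have "\<dots> = (\<Sum>j<n. \<Sum>i<n. ip (conv (k j) f) (conv (k i) f))"
      by (intro sum.cong refl, subst ip_commute, rule ip_sum) (auto intro: cV)
    finally show ?thesis .
  qed
  also have "\<dots> \<le> 2 * (\<Sum>d<n. \<bar>\<Sum>i<n. if i + d < n then ip (conv (k i) f) (conv (k (i + d)) f) else 0\<bar>)"
    by (rule order_trans[OF abs_ge_self sum_symmetric_diagonals]) (rule ip_commute)
  also have "(\<Sum>d<n. \<bar>\<Sum>i<n. if i + d < n then ip (conv (k i) f) (conv (k (i + d)) f) else 0\<bar>)
     = (\<Sum>d<n. \<omega> * \<bar>ip f (\<lambda>x. \<Sum>i<n. conv (c d i) f x)\<bar>)"
  proof (intro sum.cong refl)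
    fix d assume d: "d \<in> {..<n}"
    have "(if i + d < n then ip (conv (k i) f) (conv (k (i + d)) f) else 0) = \<omega> * ip f (conv (c d i) f)" if "i < n" for i
    proof (cases "i + d < n")
      case True
      have "conv (c d i) f = (\<lambda>x. (1 / \<omega>) * conv (corr (k i) (k (i + d))) f x)"
        using True conv_cmult[of "1 / \<omega>" "corr (k i) (k (i + d))" f] by (auto simp: c_def)
      then show ?thesis
        using True \<omega> ip_conv_conv[OF kV[OF that] kV[OF True] f] by (simp add: ip_cmult del: times_divide_eq_left)
    next
      case False
      then show ?thesis by (simp add: c_def conv_def[abs_def] ip_def)
    qed
    then have "(\<Sum>i<n. if i + d < n then ip (conv (k i) f) (conv (k (i + d)) f) else 0) = \<omega> * (\<Sum>i<n. ip f (conv (c d i) f))"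
      by (simp add: sum_distrib_left)
    also have "(\<Sum>i<n. ip f (conv (c d i) f)) = ip f (\<lambda>x. \<Sum>i<n. conv (c d i) f x)"
      using d by (intro ip_sum[symmetric] f conv_bdd_int cdV) auto
    finally show "\<bar>\<Sum>i<n. if i + d < n then ip (conv (k i) f) (conv (k (i + d)) f) else 0\<bar> = \<omega> * \<bar>ip f (\<lambda>x. \<Sum>i<n. conv (c d i) f x)\<bar>"
      using \<omega> by (simp add: abs_mult)
  qed
  finally have "ip (\<lambda>x. \<Sum>i<n. conv (k i) f x) (\<lambda>x. \<Sum>i<n. conv (k i) f x)
       \<le> 2 * \<omega> * (\<Sum>d<n. \<bar>ip f (\<lambda>x. \<Sum>i<n. conv (c d i) f x)\<bar>)"
    by (simp add: sum_distrib_left mult.assoc)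
  with ck show ?thesis by (rule that)
qed

text \<open>Schur's test on every term. The constant grows with n; its purpose is to provide some
  finite bound from which the improvement can start.\<close>

lemma osc_bound_crude:
  "osc_bound TYPE('a::euclidean_space) n (2 * (unit_ball_vol (real DIM('a)) * 2 ^ (DIM('a) + 1)) * (real n * (real n * unit_ball_vol (real DIM('a)))))"
  unfolding osc_bound_def
proof (intro allI impI)
  let ?v = "unit_ball_vol (real DIM('a))"
  fix \<rho> s :: real and k :: "nat \<Rightarrow> 'a \<Rightarrow> real" and f :: "'a \<Rightarrow> real"
  assume \<rho>: "0 < \<rho>" and s: "0 < s" "s \<le> 1" and k: "\<forall>i<n. osc_kernel (\<rho> / 2 ^ i) s (k i)" and f: "f \<in> bdd_int"
  obtain c where c: "\<And>d i. d < n \<Longrightarrow> i < n \<Longrightarrow> osc_kernel (2 * \<rho> / 2 ^ i) (min s ((1/2) ^ d)) (c d i)"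
    "ip (\<lambda>x. \<Sum>i<n. conv (k i) f x) (\<lambda>x. \<Sum>i<n. conv (k i) f x)
       \<le> 2 * (?v * s * 2 ^ (DIM('a) + 1)) * (\<Sum>d<n. \<bar>ip f (\<lambda>x. \<Sum>i<n. conv (c d i) f x)\<bar>)"
    using osc_sum_square_le[OF \<rho> s _ f, of n k] k by metis
  have "\<bar>ip f (\<lambda>x. \<Sum>i<n. conv (c d i) f x)\<bar> \<le> real n * (?v * ip f f)" if d: "d < n" for d
  proof -
    have b: "c d i \<in> bdd_int" "(\<integral>x. \<bar>c d i x\<bar> \<partial>lborel) \<le> ?v" if i: "i < n" for i
    proof -
      have "(\<integral>x. \<bar>c d i x\<bar> \<partial>lborel) \<le> ?v * min s ((1/2) ^ d)"
        using osc_kernel_bdd_int(2)[OF c(1)[OF d i]] \<rho> s by auto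
      also have "\<dots> \<le> ?v * 1" using s by (intro mult_left_mono) (auto simp: min_def)
      finally show "(\<integral>x. \<bar>c d i x\<bar> \<partial>lborel) \<le> ?v" by simp
      show "c d i \<in> bdd_int" using osc_kernel_bdd_int(1)[OF c(1)[OF d i]] \<rho> s by auto
    qed
    have "ip f (\<lambda>x. \<Sum>i<n. conv (c d i) f x) = (\<Sum>i<n. ip f (conv (c d i) f))"
      by (intro ip_sum f conv_bdd_int b) auto
    also have "\<bar>\<dots>\<bar> \<le> (\<Sum>i<n. \<bar>ip f (conv (c d i) f)\<bar>)" by (rule sum_abs)
    also have "\<dots> \<le> (\<Sum>i<n. ?v * ip f f)"
    proof (rule sum_mono)
      fix i assume i: "i \<in> {..<n}"
      have "\<bar>ip f (conv (c d i) f)\<bar> \<le> (\<integral>x. \<bar>c d i x\<bar> \<partial>lborel) * ip f f"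
        using i by (intro ip_conv_le b f) auto
      also have "\<dots> \<le> ?v * ip f f" using b(2) i by (intro mult_right_mono) auto
      finally show "\<bar>ip f (conv (c d i) f)\<bar> \<le> ?v * ip f f" .
    qed
    finally show ?thesis by simp
  qed
  then have "(\<Sum>d<n. \<bar>ip f (\<lambda>x. \<Sum>i<n. conv (c d i) f x)\<bar>) \<le> (\<Sum>d<n. real n * (?v * ip f f))"
    by (intro sum_mono) auto
  then have "2 * (?v * s * 2 ^ (DIM('a) + 1)) * (\<Sum>d<n. \<bar>ip f (\<lambda>x. \<Sum>i<n. conv (c d i) f x)\<bar>)
      \<le> 2 * (?v * s * 2 ^ (DIM('a) + 1)) * (real n * (real n * (?v * ip f f)))"
    using s by (intro mult_left_mono) auto
  with c(2) show "ip (\<lambda>x. \<Sum>i<n. conv (k i) f x) (\<lambda>x. \<Sum>i<n. conv (k i) f x)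
      \<le> 2 * (?v * 2 ^ (DIM('a) + 1)) * (real n * (real n * ?v)) * (s * ip f f)"
    by (simp add: mult_ac)
qed

text \<open>Cauchy-Schwarz on the d-th diagonal, followed by the assumed bound at size 2^-d, gives
  sqrt Z times 2^(-d/2), which is summable in d. Linearity in \<open>s\<close> comes back through
  the normalisation of the correlations.\<close>

lemma osc_bound_improve:
  assumes Z: "osc_bound TYPE('a::euclidean_space) n Z" "Z \<ge> 0"
  shows "osc_bound TYPE('a) n (unit_ball_vol (real DIM('a)) * 2 ^ (DIM('a) + 4) * sqrt Z)"
  unfolding osc_bound_def
proof (intro allI impI)
  let ?v = "unit_ball_vol (real DIM('a))"
  fix \<rho> s :: real and k :: "nat \<Rightarrow> 'a \<Rightarrow> real" and f :: "'a \<Rightarrow> real"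
  assume \<rho>: "0 < \<rho>" and s: "0 < s" "s \<le> 1" and k: "\<forall>i<n. osc_kernel (\<rho> / 2 ^ i) s (k i)" and f: "f \<in> bdd_int"
  obtain c where c: "\<And>d i. d < n \<Longrightarrow> i < n \<Longrightarrow> osc_kernel (2 * \<rho> / 2 ^ i) (min s ((1/2) ^ d)) (c d i)"
    "ip (\<lambda>x. \<Sum>i<n. conv (k i) f x) (\<lambda>x. \<Sum>i<n. conv (k i) f x)
       \<le> 2 * (?v * s * 2 ^ (DIM('a) + 1)) * (\<Sum>d<n. \<bar>ip f (\<lambda>x. \<Sum>i<n. conv (c d i) f x)\<bar>)"
    using osc_sum_square_le[OF \<rho> s _ f, of n k] k by metis
  have "\<bar>ip f (\<lambda>x. \<Sum>i<n. conv (c d i) f x)\<bar> \<le> sqrt Z * ip f f * sqrt (1/2) ^ d" if d: "d < n" for d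
  proof -
    let ?g = "\<lambda>x. \<Sum>i<n. conv (c d i) f x"
    have cV: "c d i \<in> bdd_int" if i: "i < n" for i
      using osc_kernel_bdd_int(1)[OF c(1)[OF d i]] \<rho> s by auto
    have g: "?g \<in> bdd_int" by (intro bdd_int_sum conv_bdd_int cV f) auto
    have "ip ?g ?g \<le> Z * (min s ((1/2) ^ d) * ip f f)"
      using Z(1)[unfolded osc_bound_def, rule_format, of "2 * \<rho>" "min s ((1/2) ^ d)" "c d" f] c(1)[OF d] \<rho> s f
      by auto
    also have "\<dots> \<le> Z * ((1/2) ^ d * ip f f)"
      using Z(2) by (intro mult_left_mono mult_right_mono) auto
    finally have *: "sqrt (ip ?g ?g) \<le> sqrt Z * (sqrt (1/2) ^ d * sqrt (ip f f))"
      by (metis real_sqrt_le_mono real_sqrt_mult real_sqrt_power)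
    have "\<bar>ip f ?g\<bar> \<le> sqrt (ip f f) * sqrt (ip ?g ?g)" by (rule ip_Cauchy_Schwarz[OF f g])
    also have "\<dots> \<le> sqrt (ip f f) * (sqrt Z * (sqrt (1/2) ^ d * sqrt (ip f f)))"
      using * by (intro mult_left_mono) auto
    also have "\<dots> = sqrt Z * (sqrt (ip f f) * sqrt (ip f f)) * sqrt (1/2) ^ d" by (simp only: mult_ac)
    finally show ?thesis by simp
  qed
  then have "(\<Sum>d<n. \<bar>ip f (\<lambda>x. \<Sum>i<n. conv (c d i) f x)\<bar>) \<le> (\<Sum>d<n. sqrt Z * ip f f * sqrt (1/2) ^ d)"
    by (intro sum_mono) auto
  also have "\<dots> = sqrt Z * ip f f * (\<Sum>d<n. sqrt (1/2) ^ d)" by (simp add: sum_distrib_left)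
  also have "(\<Sum>d<n. sqrt (1/2) ^ d) \<le> 4"
  proof -
    have q: "0 \<le> sqrt (1/2)" by simp
    have q': "sqrt (1/2) \<le> 3/4"
      by (rule real_le_lsqrt) (simp_all add: power2_eq_square)
    have "(\<Sum>d<n. sqrt (1/2) ^ d) \<le> (\<Sum>d<n. (3/4) ^ d)"
      using q q' by (intro sum_mono power_mono)
    also have "\<dots> \<le> 4" by (simp add: geometric_sum)
    finally show ?thesis .
  qed
  finally have "(\<Sum>d<n. \<bar>ip f (\<lambda>x. \<Sum>i<n. conv (c d i) f x)\<bar>) \<le> sqrt Z * ip f f * 4"
    using Z(2) by (simp add: mult_left_mono)
  then have "2 * (?v * s * 2 ^ (DIM('a) + 1)) * (\<Sum>d<n. \<bar>ip f (\<lambda>x. \<Sum>i<n. conv (c d i) f x)\<bar>)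
      \<le> 2 * (?v * s * 2 ^ (DIM('a) + 1)) * (sqrt Z * ip f f * 4)"
    using s by (intro mult_left_mono) auto
  also have "\<dots> = ?v * 2 ^ (DIM('a) + 4) * sqrt Z * (s * ip f f)"
    by (simp add: power_add mult_ac)
  finally show "ip (\<lambda>x. \<Sum>i<n. conv (k i) f x) (\<lambda>x. \<Sum>i<n. conv (k i) f x)
      \<le> ?v * 2 ^ (DIM('a) + 4) * sqrt Z * (s * ip f f)"
    using c(2) by linarith
qed

text \<open>The least admissible constant for n scales is finite by the crude bound and is itself
  admissible. The improvement step gives Z <= C sqrt Z for it, hence Z <= C^2, where C depends on
  the dimension only.\<close>

lemma osc_bound_uniform:
  "osc_bound TYPE('a::euclidean_space) n ((unit_ball_vol (real DIM('a)) * 2 ^ (DIM('a) + 4))\<^sup>2)"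
proof -
  let ?C = "unit_ball_vol (real DIM('a)) * 2 ^ (DIM('a) + 4)"
  define S where "S = {Z. Z \<ge> 0 \<and> osc_bound TYPE('a) n Z}"
  have ne: "S \<noteq> {}" using osc_bound_crude[where 'a='a, of n] unfolding S_def
    by (auto intro!: exI[of _ "2 * (unit_ball_vol (real DIM('a)) * 2 ^ (DIM('a) + 1)) * (real n * (real n * unit_ball_vol (real DIM('a))))"])
  have bb: "bdd_below S" unfolding S_def by (rule bdd_belowI[of _ 0]) auto
  have I0: "0 \<le> Inf S" using ne by (intro cInf_greatest) (auto simp: S_def)
  have mono: "osc_bound TYPE('a) n Z" if "Z' \<le> Z" "osc_bound TYPE('a) n Z'" for Z Z'
    using that unfolding osc_bound_def
    by (meson ip_self_nonneg less_imp_le mult_nonneg_nonneg mult_right_mono order_trans)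
  have IS: "osc_bound TYPE('a) n (Inf S)"
    unfolding osc_bound_def
  proof (intro allI impI)
    fix \<rho> s :: real and k :: "nat \<Rightarrow> 'a \<Rightarrow> real" and f :: "'a \<Rightarrow> real"
    assume h: "0 < \<rho>" "0 < s" "s \<le> 1" "\<forall>i<n. osc_kernel (\<rho> / 2 ^ i) s (k i)" "f \<in> bdd_int"
    let ?q = "ip (\<lambda>x. \<Sum>i<n. conv (k i) f x) (\<lambda>x. \<Sum>i<n. conv (k i) f x)"
    have le: "?q \<le> Z * (s * ip f f)" if "Z \<in> S" for Z
      using that h unfolding S_def osc_bound_def by blast
    show "?q \<le> Inf S * (s * ip f f)"
    proof (cases "ip f f = 0")
      case True
      then show ?thesis using le ne by auto
    next
      case False
      then have p: "s * ip f f > 0" using h ip_self_nonneg[of f] by (simp add: less_le)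
      have "?q / (s * ip f f) \<le> Inf S"
        using ne le p by (intro cInf_greatest) (auto simp: pos_divide_le_eq)
      then show ?thesis using p by (simp add: pos_divide_le_eq)
    qed
  qed
  have "?C * sqrt (Inf S) \<in> S" using osc_bound_improve[OF IS I0] I0 by (auto simp: S_def)
  then have le: "Inf S \<le> ?C * sqrt (Inf S)" using bb by (intro cInf_lower)
  have "Inf S \<le> ?C\<^sup>2"
  proof (cases "Inf S = 0")
    case False
    then have p: "sqrt (Inf S) > 0" using I0 by simp
    have "sqrt (Inf S) * sqrt (Inf S) \<le> ?C * sqrt (Inf S)" using le I0 by simp
    then have "sqrt (Inf S) \<le> ?C" using p by (simp only: mult_le_cancel_right)
    then have "(sqrt (Inf S))\<^sup>2 \<le> ?C\<^sup>2" by (intro power_mono) (auto simp: I0)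
    then show ?thesis using I0 by simp
  qed simp
  from mono[OF this IS] show ?thesis .
qed

section \<open>Truncation of the kernel at a given scale\<close>

lemma C1_lipschitz_derivative_taylor:
  fixes g :: "'a::euclidean_space \<Rightarrow> real"
  assumes g: "\<And>x. (g has_derivative D x) (at x)"
    and lip: "\<And>x y h. \<bar>D x h - D y h\<bar> \<le> L * norm (x - y) * norm h" and L: "L \<ge> 0"
  shows "\<bar>g (x + h) - g x - D x h\<bar> \<le> L * (norm h)\<^sup>2"
proof -
  have "norm (g (x + h) - g x - D x (x + h - x)) \<le> norm (x + h - x) * (L * norm h)"
  proof (rule differentiable_bound_linearization[where S = "cball x (norm h)"])
    show "\<And>t. t \<in> {0..1} \<Longrightarrow> x + t *\<^sub>R (x + h - x) \<in> cball x (norm h)"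
      by (auto simp: dist_norm intro: mult_left_le_one_le)
    show "\<And>y. y \<in> cball x (norm h) \<Longrightarrow> (g has_derivative D y) (at y within cball x (norm h))"
      using g has_derivative_at_withinI by blast
    fix y assume y: "y \<in> cball x (norm h)"
    show "onorm (D y - D x) \<le> L * norm h"
    proof (rule onorm_bound)
      fix v
      have "\<bar>D y v - D x v\<bar> \<le> L * norm (y - x) * norm v" by (rule lip)
      also have "\<dots> \<le> L * norm h * norm v"
        using y L by (intro mult_right_mono mult_left_mono) (auto simp: dist_norm norm_minus_commute)
      finally show "norm ((D y - D x) v) \<le> L * norm h * norm v" by simp
    qed (use L in auto)
  qed auto
  then show ?thesis by (simp add: power2_eq_square mult_ac)
qed

text \<open>Squares of positive parts are combined to a cut-off with Lipschitz derivative, which is all the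
  regularity that the argument needs.\<close>

definition sq_pos :: "real \<Rightarrow> real" where "sq_pos s = (max 0 s)\<^sup>2"

lemma sq_pos_deriv: "(sq_pos has_real_derivative 2 * max 0 s) (at s)"
proof (cases "s = 0")
  case True
  have "((\<lambda>h. sq_pos h / h) \<longlongrightarrow> 0) (at 0)"
  proof (rule Lim_null_comparison)
    show "eventually (\<lambda>h. norm (sq_pos h / h) \<le> \<bar>h\<bar>) (at 0)"
      by (intro always_eventually) (auto simp: sq_pos_def max_def power2_eq_square)
    show "((\<lambda>h::real. \<bar>h\<bar>) \<longlongrightarrow> 0) (at 0)"
      by (intro tendsto_rabs_zero tendsto_ident_at)
  qed
  then show ?thesis by (simp add: True has_field_derivative_iff sq_pos_def)
next
  case False
  then consider "s > 0" | "s < 0" by linarith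
  then show ?thesis
  proof cases
    case 1
    have "((\<lambda>s::real. s\<^sup>2) has_real_derivative 2 * s) (at s)" by (auto intro!: derivative_eq_intros)
    then have "(sq_pos has_real_derivative 2 * s) (at s)"
      by (rule DERIV_cong_ev[THEN iffD1, OF refl _ refl, rotated])
         (use 1 eventually_nhds_in_open[of "{0<..}" s] in \<open>auto simp: sq_pos_def elim!: eventually_mono\<close>)
    with 1 show ?thesis by simp
  next
    case 2
    have "((\<lambda>s::real. 0) has_real_derivative 0) (at s)" by simp
    then have "(sq_pos has_real_derivative 0) (at s)"
      by (rule DERIV_cong_ev[THEN iffD1, OF refl _ refl, rotated])
         (use 2 eventually_nhds_in_open[of "{..<0}" s] in \<open>auto simp: sq_pos_def elim!: eventually_mono\<close>)
    with 2 show ?thesis by simp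
  qed
qed

text \<open>The derivative is the tent on [1, 2] of height 2, hence of integral 1, so
  \<open>ramp\<close> climbs from 0 to 1 there. It will be evaluated at the square of the norm,
  which places the transition between the norms 1 and 2.\<close>

definition ramp :: "real \<Rightarrow> real" where
  "ramp s = 2 * (sq_pos (s - 1) - 2 * sq_pos (s - 3/2) + sq_pos (s - 2))"

definition ramp' :: "real \<Rightarrow> real" where
  "ramp' s = 4 * (max 0 (s - 1) - 2 * max 0 (s - 3/2) + max 0 (s - 2))"

lemma ramp_deriv: "(ramp has_real_derivative ramp' s) (at s)"
  unfolding ramp_def[abs_def] ramp'_def
  by (auto intro!: derivative_eq_intros DERIV_chain'[OF _ sq_pos_deriv] simp: algebra_simps)

lemma ramp_low: "s \<le> 1 \<Longrightarrow> ramp s = 0" "s \<le> 1 \<Longrightarrow> ramp' s = 0"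
  by (auto simp: ramp_def ramp'_def sq_pos_def)

lemma ramp_high: "s \<ge> 2 \<Longrightarrow> ramp s = 1" "s \<ge> 2 \<Longrightarrow> ramp' s = 0"
  by (auto simp: ramp_def ramp'_def sq_pos_def max_def power2_eq_square algebra_simps)

lemma ramp'_bound: "\<bar>ramp' s\<bar> \<le> 2"
  by (auto simp: ramp'_def max_def)

lemma ramp'_lipschitz: "\<bar>ramp' s - ramp' t\<bar> \<le> 16 * \<bar>s - t\<bar>"
  unfolding ramp'_def by (auto simp: max_def abs_if)

lemma ramp_lipschitz: "\<bar>ramp s - ramp t\<bar> \<le> 2 * \<bar>s - t\<bar>"
proof -
  have "norm (ramp s - ramp t) \<le> 2 * norm (s - t)"
    by (rule field_differentiable_bound[of UNIV ramp ramp'])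
       (use ramp'_bound in \<open>auto intro: ramp_deriv\<close>)
  then show ?thesis by simp
qed

lemma ramp_bound: "\<bar>ramp s\<bar> \<le> 2"
proof -
  consider "s \<le> 1" | "s \<ge> 2" | "1 \<le> s" "s \<le> 2" by linarith
  then show ?thesis
  proof cases
    case 3
    then show ?thesis using ramp_lipschitz[of s 1] by (simp add: ramp_low)
  qed (auto simp: ramp_low ramp_high)
qed

text \<open>The second derivative is represented by the Lipschitz bound it implies along segments
  outside the ball of radius m, a form that passes to dilates with the same constants. The size of
  \<open>DK\<close> is a consequence of this first stage; a second locale carries it with its own
  constant.\<close>

locale critical_kernel0 =
  fixes K :: "'a::euclidean_space \<Rightarrow> real" and DK :: "'a \<Rightarrow> 'a \<Rightarrow>\<^sub>L real" and A B :: real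
  assumes dim: "DIM('a) \<ge> 2"
    and AB_nonneg: "A \<ge> 0" "B \<ge> 0"
    and K_deriv: "\<And>x. x \<noteq> 0 \<Longrightarrow> (K has_derivative blinfun_apply (DK x)) (at x)"
    and K_le: "\<And>x. x \<noteq> 0 \<Longrightarrow> \<bar>K x\<bar> \<le> A / norm x ^ (DIM('a) - 1)"
    and DK_lip: "\<And>m x y. m > 0 \<Longrightarrow> (\<And>\<xi>. \<xi> \<in> closed_segment x y \<Longrightarrow> m \<le> norm \<xi>) \<Longrightarrow>
        norm (DK x - DK y) \<le> B / m ^ (DIM('a) + 1) * norm (x - y)"
begin

lemma K_taylor:
  assumes m: "m > 0" and seg: "\<And>\<xi>. \<xi> \<in> closed_segment a b \<Longrightarrow> m \<le> norm \<xi>"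
  shows "\<bar>K b - K a - DK a (b - a)\<bar> \<le> B / m ^ (DIM('a) + 1) * (norm (b - a))\<^sup>2"
proof -
  have sub: "closed_segment a \<xi> \<subseteq> closed_segment a b" if "\<xi> \<in> closed_segment a b" for \<xi>
    using that by (simp add: subset_closed_segment)
  let ?S = "closed_segment a b"
  have 1: "a + t *\<^sub>R (b - a) \<in> ?S" if "t \<in> {0..1}" for t
    using that by (auto simp: in_segment algebra_simps intro!: exI[of _ t])
  have 2: "(K has_derivative blinfun_apply (DK \<xi>)) (at \<xi> within ?S)" if \<xi>: "\<xi> \<in> ?S" for \<xi>
  proof -
    have "\<xi> \<noteq> 0" using seg[OF \<xi>] m by auto
    then show ?thesis by (rule has_derivative_at_withinI[OF K_deriv])
  qed
  have 3: "onorm (blinfun_apply (DK \<xi>) - blinfun_apply (DK a)) \<le> B / m ^ (DIM('a) + 1) * norm (b - a)" if \<xi>: "\<xi> \<in> ?S" for \<xi>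
  proof -
    have "onorm (blinfun_apply (DK \<xi>) - blinfun_apply (DK a)) = norm (DK \<xi> - DK a)"
      by (simp add: norm_blinfun.rep_eq minus_blinfun.rep_eq fun_diff_def)
    also have "\<dots> \<le> B / m ^ (DIM('a) + 1) * norm (\<xi> - a)"
      by (rule DK_lip[OF m]) (use sub[OF \<xi>] seg in \<open>auto simp: closed_segment_commute\<close>)
    also have "\<dots> \<le> B / m ^ (DIM('a) + 1) * norm (b - a)"
      using segment_bound1[OF \<xi>] AB_nonneg m by (intro mult_left_mono) auto
    finally show ?thesis .
  qed
  have 4: "a \<in> ?S" by simp
  show ?thesis
    using differentiable_bound_linearization[where f' = "\<lambda>x. blinfun_apply (DK x)", OF 1 2 3 4]
    by (simp add: power2_eq_square mult_ac)
qed

text \<open>Interpolation: the increment of \<open>K\<close> over a step of length \<open>|x|/2\<close> and the Lipschitz bound on the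
  derivative control the derivative.\<close>

lemma DK_le_interpolated:
  assumes x: "x \<noteq> 0"
  shows "norm (DK x) \<le> (2 * A * (2 ^ (DIM('a) - 1) + 1) + B * 2 ^ DIM('a)) / norm x ^ DIM('a)"
proof (rule norm_blinfun_bound)
  define C where "C = 2 * A * (2 ^ (DIM('a) - 1) + 1) + B * 2 ^ DIM('a)"
  have C0: "C \<ge> 0" using AB_nonneg by (simp add: C_def)
  show "0 \<le> C / norm x ^ DIM('a)" using C0 by simp
  obtain m where m: "DIM('a) = Suc m" using dim by (cases "DIM('a)") auto
  define \<rho> where "\<rho> = norm x"
  have \<rho>: "\<rho> > 0" using x by (simp add: \<rho>_def)
  fix h
  show "norm (DK x h) \<le> C / norm x ^ DIM('a) * norm h"
  proof (cases "h = 0")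
    case False
    define k where "k = (\<rho> / 2 / norm h) *\<^sub>R h"
    have nk: "norm k = \<rho> / 2" using False \<rho> by (simp add: k_def)
    have seg: "\<rho> / 2 \<le> norm \<xi>" if "\<xi> \<in> closed_segment x (x + k)" for \<xi>
    proof -
      have "norm (\<xi> - x) \<le> norm k" using segment_bound1[OF that] by simp
      moreover have "norm x \<le> norm \<xi> + norm (\<xi> - x)" using norm_triangle_sub[of x \<xi>] by (simp add: norm_minus_commute)
      ultimately show ?thesis using nk by (simp add: \<rho>_def)
    qed
    have x1: "\<rho> / 2 \<le> norm (x + k)" by (rule seg) simp
    have xk: "x + k \<noteq> 0" using x1 \<rho> by auto
    have "\<bar>K (x + k) - K x - DK x (x + k - x)\<bar> \<le> B / (\<rho> / 2) ^ (DIM('a) + 1) * (norm (x + k - x))\<^sup>2"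
      by (rule K_taylor[OF _ seg]) (use \<rho> in auto)
    then have 1: "\<bar>K (x + k) - K x - DK x k\<bar> \<le> B * 2 ^ m / \<rho> ^ m"
      using \<rho> by (simp add: nk m power_divide power2_eq_square field_simps)
    have 2: "\<bar>K x\<bar> \<le> A / \<rho> ^ m" using K_le[OF x] by (simp add: m \<rho>_def)
    have "A / norm (x + k) ^ m \<le> A / (\<rho> / 2) ^ m"
      using x1 \<rho> AB_nonneg xk by (intro divide_left_mono power_mono mult_pos_pos zero_less_power) auto
    then have 3: "\<bar>K (x + k)\<bar> \<le> A * 2 ^ m / \<rho> ^ m" using K_le[OF xk] by (simp add: m power_divide)
    have "\<bar>DK x k\<bar> \<le> A * 2 ^ m / \<rho> ^ m + A / \<rho> ^ m + B * 2 ^ m / \<rho> ^ m" using 1 2 3 by linarith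
    also have "\<dots> = (C / \<rho> ^ DIM('a)) * (\<rho> / 2)" using \<rho> by (simp add: C_def m field_simps)
    finally have "\<bar>DK x k\<bar> \<le> (C / \<rho> ^ DIM('a)) * (\<rho> / 2)" .
    moreover have "DK x k = (\<rho> / 2) / norm h * DK x h" by (simp add: k_def blinfun.scaleR_right)
    ultimately have "(\<rho> / 2) * (\<bar>DK x h\<bar> / norm h) \<le> (\<rho> / 2) * (C / \<rho> ^ DIM('a))"
      using \<rho> by (simp add: abs_mult mult_ac)
    then have "\<bar>DK x h\<bar> / norm h \<le> C / \<rho> ^ DIM('a)" by (rule mult_left_le_imp_le) (use \<rho> in simp)
    then show ?thesis using False by (simp add: pos_divide_le_eq \<rho>_def)
  qed simp
qed

end

locale critical_kernel = critical_kernel0 K DK A B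
  for K :: "'a::euclidean_space \<Rightarrow> real" and DK A B +
  fixes C :: real
  assumes C_nonneg: "C \<ge> 0"
    and DK_le: "\<And>x. x \<noteq> 0 \<Longrightarrow> norm (DK x) \<le> C / norm x ^ DIM('a)"
begin

lemmas nonneg = AB_nonneg C_nonneg

lemma K_cont: "continuous_on (- {0}) K"
  by (intro continuous_at_imp_continuous_on ballI has_derivative_continuous[OF K_deriv]) auto

lemma K_measurable [measurable]: "K \<in> borel_measurable borel"
proof -
  have "(\<lambda>x. if x \<in> - {0} then K x else K 0) \<in> borel_measurable borel"
    by (rule borel_measurable_continuous_on_if) (auto intro: K_cont)
  also have "(\<lambda>x. if x \<in> - {0} then K x else K 0) = K" by auto
  finally show ?thesis .
qed

lemma K_lip:
  assumes m: "m > 0" and seg: "\<And>\<xi>. \<xi> \<in> closed_segment x y \<Longrightarrow> m \<le> norm \<xi>"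
  shows "\<bar>K x - K y\<bar> \<le> C / m ^ DIM('a) * norm (x - y)"
proof -
  have "norm (K x - K y) \<le> C / m ^ DIM('a) * norm (x - y)"
  proof (rule differentiable_bound[where S = "closed_segment x y" and f' = "\<lambda>x. blinfun_apply (DK x)"])
    fix \<xi> assume \<xi>: "\<xi> \<in> closed_segment x y"
    then have \<xi>0: "\<xi> \<noteq> 0" "m \<le> norm \<xi>" using seg[OF \<xi>] m by auto
    show "(K has_derivative blinfun_apply (DK \<xi>)) (at \<xi> within closed_segment x y)"
      using K_deriv[OF \<xi>0(1)] by (rule has_derivative_at_withinI)
    have "onorm (blinfun_apply (DK \<xi>)) = norm (DK \<xi>)" by (simp add: norm_blinfun.rep_eq)
    also have "\<dots> \<le> C / norm \<xi> ^ DIM('a)" by (rule DK_le) fact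
    also have "\<dots> \<le> C / m ^ DIM('a)"
      using \<xi>0 m nonneg by (intro divide_left_mono power_mono mult_pos_pos zero_less_power) auto
    finally show "onorm (blinfun_apply (DK \<xi>)) \<le> C / m ^ DIM('a)" .
  qed auto
  then show ?thesis by simp
qed

lemma DK_apply_le: "x \<noteq> 0 \<Longrightarrow> \<bar>DK x h\<bar> \<le> C / norm x ^ DIM('a) * norm h"
  using norm_blinfun[of "DK x" h] DK_le[of x] by (metis mult_right_mono norm_ge_zero order_trans real_norm_def)

text \<open>The truncation is carried out at unit scale only, where all constants are explicit;
  other scales are reached by dilating the kernel.\<close>

definition cut :: "'a \<Rightarrow> real" where "cut x = ramp (x \<bullet> x) * K x"

definition dcut :: "'a \<Rightarrow> 'a \<Rightarrow> real" where
  "dcut x h = ramp (x \<bullet> x) * DK x h + K x * (ramp' (x \<bullet> x) * (2 * (x \<bullet> h)))"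

lemma cut_low: "norm x \<le> 1 \<Longrightarrow> cut x = 0" "norm x \<le> 1 \<Longrightarrow> dcut x h = 0"
proof -
  assume "norm x \<le> 1"
  then have "x \<bullet> x \<le> 1" by (simp add: dot_square_norm power_le_one)
  then show "cut x = 0" "dcut x h = 0" by (simp_all add: cut_def dcut_def ramp_low)
qed

lemma norm_ge_2_imp: "norm (x::'a) \<ge> 2 \<Longrightarrow> x \<bullet> x \<ge> 2"
proof -
  assume "norm x \<ge> 2"
  then have "2\<^sup>2 \<le> (norm x)\<^sup>2" by (intro power_mono) auto
  then show "x \<bullet> x \<ge> 2" by (simp add: dot_square_norm)
qed

lemma cut_high: "norm x \<ge> 2 \<Longrightarrow> cut x = K x" "norm x \<ge> 2 \<Longrightarrow> dcut x h = DK x h"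
  using norm_ge_2_imp[of x] by (auto simp: cut_def dcut_def ramp_high)

lemma cut_deriv: "(cut has_derivative dcut x) (at x)"
proof (cases "x = 0")
  case True
  have "((\<lambda>x::'a. 0::real) has_derivative (\<lambda>h. 0)) (at x)" by simp
  moreover have "dcut x = (\<lambda>h. 0)" using True by (auto simp: cut_low)
  ultimately have "((\<lambda>x. 0) has_derivative dcut x) (at x)" by simp
  then show ?thesis
    by (rule has_derivative_transform_within_open[of _ _ _ _ "ball 0 1"]) (auto simp: True cut_low)
next
  case False
  have d: "((\<lambda>x::'a. x \<bullet> x) has_derivative (\<lambda>h. 2 * (x \<bullet> h))) (at x)"
    by (auto intro!: derivative_eq_intros simp: inner_commute)
  have "((\<lambda>x. ramp (x \<bullet> x)) has_derivative (\<lambda>h. (2 * (x \<bullet> h)) * ramp' (x \<bullet> x))) (at x)"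
    by (rule DERIV_compose_FDERIV[OF ramp_deriv d])
  from has_derivative_mult[OF this K_deriv[OF False]]
  show ?thesis
    unfolding cut_def[abs_def] by (rule has_derivative_eq_rhs) (auto simp: dcut_def fun_eq_iff algebra_simps)
qed

text \<open>The first summand covers pairs of points at distance at least 1/2; the others are the
  four terms of the product rule for nearby points.\<close>

definition Ccut :: real where
  "Ccut = 4 * (2 * C + 8 * A) + 2 * (B * 2 ^ (DIM('a) + 1)) + 10 * (C * 2 ^ DIM('a)) + 8 * (C * 2 ^ DIM('a)) + 404 * (A * 2 ^ (DIM('a) - 1))"

lemma Ccut_nonneg: "Ccut \<ge> 0" "2 * C + 8 * A \<le> Ccut" "4 * (2 * C + 8 * A) \<le> Ccut"
    "2 * (B * 2 ^ (DIM('a) + 1)) + 10 * (C * 2 ^ DIM('a)) + 8 * (C * 2 ^ DIM('a)) + 404 * (A * 2 ^ (DIM('a) - 1)) \<le> Ccut"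
  using nonneg by (auto simp: Ccut_def intro!: add_nonneg_nonneg mult_nonneg_nonneg)

lemma ramp_square_deriv_bound: "\<bar>ramp' (x \<bullet> x) * (2 * (x \<bullet> h))\<bar> \<le> 8 * norm (h::'a)"
proof (cases "norm x \<ge> 2")
  case True
  then show ?thesis using norm_ge_2_imp[of x] by (simp add: ramp_high)
next
  case False
  have "\<bar>x \<bullet> h\<bar> \<le> norm x * norm h" by (rule Cauchy_Schwarz_ineq2)
  also have "\<dots> \<le> 2 * norm h" using False by (intro mult_right_mono) auto
  finally have "\<bar>ramp' (x \<bullet> x)\<bar> * (2 * \<bar>x \<bullet> h\<bar>) \<le> 2 * (2 * (2 * norm h))"
    using ramp'_bound by (intro mult_mono) auto
  then show ?thesis by (simp add: abs_mult)
qed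

lemma dcut_le0: "\<bar>dcut x h\<bar> \<le> (2 * C + 8 * A) * norm h"
proof (cases "norm x \<le> 1")
  case False
  then have x0: "x \<noteq> 0" and x1: "norm x \<ge> 1" by auto
  have D: "\<bar>DK x h\<bar> \<le> C * norm h"
  proof -
    have "C / norm x ^ DIM('a) \<le> C / 1"
      using x1 x0 nonneg by (intro divide_left_mono) (auto simp: one_le_power)
    then show ?thesis using DK_apply_le[OF x0, of h] mult_right_mono[OF _ norm_ge_zero[of h], of "C / norm x ^ DIM('a)" C] by simp
  qed
  have K1: "\<bar>K x\<bar> \<le> A"
  proof -
    have "A / norm x ^ (DIM('a) - 1) \<le> A / 1"
      using x1 x0 nonneg by (intro divide_left_mono) (auto simp: one_le_power)
    then show ?thesis using K_le[OF x0] by simp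
  qed
  have "\<bar>dcut x h\<bar> \<le> \<bar>ramp (x \<bullet> x)\<bar> * \<bar>DK x h\<bar> + \<bar>K x\<bar> * \<bar>ramp' (x \<bullet> x) * (2 * (x \<bullet> h))\<bar>"
    unfolding dcut_def by (rule order_trans[OF abs_triangle_ineq]) (simp add: abs_mult)
  also have "\<dots> \<le> 2 * (C * norm h) + A * (8 * norm h)"
    using ramp_bound D K1 ramp_square_deriv_bound nonneg by (intro add_mono mult_mono) auto
  finally show ?thesis by (simp add: algebra_simps)
qed (use nonneg in \<open>auto simp: cut_low\<close>)

lemma dcut_le: "\<bar>dcut x h\<bar> \<le> Ccut * norm h"
  using dcut_le0[of x h] mult_right_mono[OF Ccut_nonneg(2) norm_ge_zero[of h]] by linarith

text \<open>The segment from x to y stays at distance at least 1/2 from the origin, so the bounds on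
  \<open>K\<close>, on \<open>DK\<close> and on their increments hold with fixed constants. The
  difference is telescoped one factor at a time.\<close>

lemma dcut_lip_aux:
  assumes x1: "norm x \<ge> 1" and near: "norm (x - y) < 1/2"
  shows "\<bar>dcut x h - dcut y h\<bar> \<le> Ccut * norm (x - y) * norm h"
proof -
  define \<delta> where "\<delta> = norm (x - y)"
  have \<delta>: "\<delta> \<ge> 0" by (simp add: \<delta>_def)
  have seg: "1/2 \<le> norm \<xi>" if "\<xi> \<in> closed_segment x y" for \<xi>
  proof -
    have "norm (x - \<xi>) \<le> norm (x - y)"
      using segment_bound1[OF that] by (simp add: norm_minus_commute)
    moreover have "norm x \<le> norm \<xi> + norm (x - \<xi>)" by (metis add.commute norm_triangle_sub)
    ultimately show ?thesis using x1 near by linarith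
  qed
  have y2: "1/2 \<le> norm y" "y \<noteq> 0" using seg[of y] by auto
  have grad_gap: "\<bar>DK x h - DK y h\<bar> \<le> B * 2 ^ (DIM('a) + 1) * \<delta> * norm h"
  proof -
    have "\<bar>DK x h - DK y h\<bar> \<le> norm (DK x - DK y) * norm h"
      using norm_blinfun[of "DK x - DK y" h] by (simp add: blinfun.diff_left)
    also have "\<dots> \<le> (B / (1/2) ^ (DIM('a) + 1) * \<delta>) * norm h"
      unfolding \<delta>_def by (intro mult_right_mono DK_lip seg) auto
    finally show ?thesis by (simp add: power_divide field_simps)
  qed
  have KK: "\<bar>K x - K y\<bar> \<le> C * 2 ^ DIM('a) * \<delta>"
    using K_lip[of "1/2" x y] seg by (simp add: \<delta>_def power_divide)
  have Dy: "\<bar>DK y h\<bar> \<le> C * 2 ^ DIM('a) * norm h"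
  proof -
    have "C / norm y ^ DIM('a) \<le> C / (1/2) ^ DIM('a)"
      using y2 nonneg by (intro divide_left_mono power_mono mult_pos_pos zero_less_power) auto
    then have "C / norm y ^ DIM('a) * norm h \<le> C * 2 ^ DIM('a) * norm h"
      by (intro mult_right_mono) (auto simp: power_divide)
    then show ?thesis using DK_apply_le[OF y2(2), of h] by linarith
  qed
  have Ky: "\<bar>K y\<bar> \<le> A * 2 ^ (DIM('a) - 1)"
  proof -
    have "A / norm y ^ (DIM('a) - 1) \<le> A / (1/2) ^ (DIM('a) - 1)"
      using y2 nonneg by (intro divide_left_mono power_mono mult_pos_pos zero_less_power) auto
    then show ?thesis using K_le[OF y2(2)] by (simp add: power_divide)
  qed
  \<comment> \<open>When both norms are at least 2 the ramp is constant; otherwise both points have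
    norm at most 5/2, and |x|^2 varies by at most 5 \<delta>.\<close>
  have sq: "\<bar>x \<bullet> x - y \<bullet> y\<bar> \<le> 5 * \<delta>" "norm y \<le> 5/2" "norm x \<le> 5/2" if "\<not> (norm x \<ge> 2 \<and> norm y \<ge> 2)"
  proof -
    have 1: "norm x \<le> norm y + \<delta>" "norm y \<le> norm x + \<delta>"
      unfolding \<delta>_def using norm_triangle_sub[of x y] norm_triangle_sub[of y x] by (auto simp: norm_minus_commute)
    then show 2: "norm y \<le> 5/2" "norm x \<le> 5/2" using that near unfolding \<delta>_def by linarith+
    have "x \<bullet> x - y \<bullet> y = (x + y) \<bullet> (x - y)" by (simp add: algebra_simps inner_commute)
    also have "\<bar>\<dots>\<bar> \<le> norm (x + y) * norm (x - y)" by (rule Cauchy_Schwarz_ineq2)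
    also have "\<dots> \<le> 5 * \<delta>" unfolding \<delta>_def
      using norm_triangle_ineq[of x y] 2 by (intro mult_right_mono norm_ge_zero) linarith
    finally show "\<bar>x \<bullet> x - y \<bullet> y\<bar> \<le> 5 * \<delta>" .
  qed
  have rr: "\<bar>ramp (x \<bullet> x) - ramp (y \<bullet> y)\<bar> \<le> 10 * \<delta>"
  proof (cases "norm x \<ge> 2 \<and> norm y \<ge> 2")
    case True
    then show ?thesis using norm_ge_2_imp[of x] norm_ge_2_imp[of y] \<delta> by (simp add: ramp_high)
  next
    case False
    then show ?thesis
      by (intro order_trans[OF ramp_lipschitz]) (use sq(1)[OF False] in simp)
  qed
  \<comment> \<open>404 = 4 + 400: the bound 2 of \<open>ramp'\<close> times 2, and its Lipschitz
    constant 16 times 5 times 2 times 5/2.\<close>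
  have pp: "\<bar>ramp' (x \<bullet> x) * (2 * (x \<bullet> h)) - ramp' (y \<bullet> y) * (2 * (y \<bullet> h))\<bar> \<le> 404 * \<delta> * norm h"
  proof (cases "norm x \<ge> 2 \<and> norm y \<ge> 2")
    case True
    then show ?thesis using norm_ge_2_imp[of x] norm_ge_2_imp[of y] \<delta> by (simp add: ramp_high)
  next
    case False
    note sq = sq[OF False]
    have "ramp' (x \<bullet> x) * (2 * (x \<bullet> h)) - ramp' (y \<bullet> y) * (2 * (y \<bullet> h)) =
       ramp' (x \<bullet> x) * (2 * ((x - y) \<bullet> h)) + (ramp' (x \<bullet> x) - ramp' (y \<bullet> y)) * (2 * (y \<bullet> h))"
      by (simp add: algebra_simps)
    also have "\<bar>\<dots>\<bar> \<le> \<bar>ramp' (x \<bullet> x)\<bar> * (2 * \<bar>(x - y) \<bullet> h\<bar>) + \<bar>ramp' (x \<bullet> x) - ramp' (y \<bullet> y)\<bar> * (2 * \<bar>y \<bullet> h\<bar>)"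
      by (rule order_trans[OF abs_triangle_ineq]) (simp add: abs_mult)
    also have "\<dots> \<le> 2 * (2 * (\<delta> * norm h)) + (16 * (5 * \<delta>)) * (2 * (5/2 * norm h))"
    proof (intro add_mono mult_mono)
      show "\<bar>ramp' (x \<bullet> x) - ramp' (y \<bullet> y)\<bar> \<le> 16 * (5 * \<delta>)"
        by (intro order_trans[OF ramp'_lipschitz]) (use sq(1) in simp)
      show "\<bar>(x - y) \<bullet> h\<bar> \<le> \<delta> * norm h" unfolding \<delta>_def by (rule Cauchy_Schwarz_ineq2)
      show "\<bar>y \<bullet> h\<bar> \<le> 5/2 * norm h"
        using Cauchy_Schwarz_ineq2[of y h] mult_right_mono[OF sq(2) norm_ge_zero[of h]] by linarith
    qed (use ramp'_bound \<delta> in auto)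
    also have "\<dots> = 404 * \<delta> * norm h" by simp
    finally show ?thesis .
  qed
  have split: "dcut x h - dcut y h = ramp (x \<bullet> x) * (DK x h - DK y h) + (ramp (x \<bullet> x) - ramp (y \<bullet> y)) * DK y h
     + (K x - K y) * (ramp' (x \<bullet> x) * (2 * (x \<bullet> h)))
     + K y * (ramp' (x \<bullet> x) * (2 * (x \<bullet> h)) - ramp' (y \<bullet> y) * (2 * (y \<bullet> h)))"
    by (simp add: dcut_def algebra_simps)
  have abs4: "\<bar>p + q + r + s\<bar> \<le> P + Q + R + S" if "\<bar>p\<bar> \<le> P" "\<bar>q\<bar> \<le> Q" "\<bar>r\<bar> \<le> R" "\<bar>s\<bar> \<le> S" for p q r s P Q R S :: real
    using that by linarith
  have "\<bar>dcut x h - dcut y h\<bar> \<le> 2 * (B * 2 ^ (DIM('a) + 1) * \<delta> * norm h) + (10 * \<delta>) * (C * 2 ^ DIM('a) * norm h)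
     + (C * 2 ^ DIM('a) * \<delta>) * (8 * norm h) + (A * 2 ^ (DIM('a) - 1)) * (404 * \<delta> * norm h)"
    unfolding split
  proof (rule abs4)
    show "\<bar>ramp (x \<bullet> x) * (DK x h - DK y h)\<bar> \<le> 2 * (B * 2 ^ (DIM('a) + 1) * \<delta> * norm h)"
      unfolding abs_mult[of "ramp (x \<bullet> x)"] by (intro mult_mono ramp_bound grad_gap) auto
    show "\<bar>(ramp (x \<bullet> x) - ramp (y \<bullet> y)) * DK y h\<bar> \<le> (10 * \<delta>) * (C * 2 ^ DIM('a) * norm h)"
      unfolding abs_mult[of "ramp (x \<bullet> x) - ramp (y \<bullet> y)"] using \<delta> by (intro mult_mono rr Dy) auto
    show "\<bar>(K x - K y) * (ramp' (x \<bullet> x) * (2 * (x \<bullet> h)))\<bar> \<le> (C * 2 ^ DIM('a) * \<delta>) * (8 * norm h)"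
      unfolding abs_mult[of "K x - K y"] using \<delta> nonneg by (intro mult_mono KK ramp_square_deriv_bound) auto
    show "\<bar>K y * (ramp' (x \<bullet> x) * (2 * (x \<bullet> h)) - ramp' (y \<bullet> y) * (2 * (y \<bullet> h)))\<bar> \<le> (A * 2 ^ (DIM('a) - 1)) * (404 * \<delta> * norm h)"
      unfolding abs_mult[of "K y"] using nonneg by (intro mult_mono Ky pp) auto
  qed
  also have "\<dots> = (2 * (B * 2 ^ (DIM('a) + 1)) + 10 * (C * 2 ^ DIM('a)) + 8 * (C * 2 ^ DIM('a)) + 404 * (A * 2 ^ (DIM('a) - 1))) * (\<delta> * norm h)"
    by (simp add: algebra_simps)
  also have "\<dots> \<le> Ccut * (\<delta> * norm h)" by (intro mult_right_mono Ccut_nonneg) (use \<delta> in auto)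
  finally show ?thesis by (simp add: \<delta>_def mult.assoc)
qed

lemma dcut_lip: "\<bar>dcut x h - dcut y h\<bar> \<le> Ccut * norm (x - y) * norm h"
proof (cases "norm (x - y) < 1/2")
  case True
  consider "norm x \<ge> 1" | "norm y \<ge> 1" | "norm x \<le> 1" "norm y \<le> 1" by linarith
  then show ?thesis
  proof cases
    case 1
    then show ?thesis by (rule dcut_lip_aux[OF _ True])
  next
    case 2
    then show ?thesis using dcut_lip_aux[of y x h] True by (simp add: norm_minus_commute abs_minus_commute)
  next
    case 3
    then show ?thesis using Ccut_nonneg(1) by (simp add: cut_low)
  qed
next
  case False
  have "\<bar>dcut x h - dcut y h\<bar> \<le> \<bar>dcut x h\<bar> + \<bar>dcut y h\<bar>" by (rule abs_triangle_ineq4)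
  also have "\<dots> \<le> 2 * ((2 * C + 8 * A) * norm h)" using dcut_le0[of x h] dcut_le0[of y h] by linarith
  also have "\<dots> = 4 * (2 * C + 8 * A) * (1/2) * norm h" by simp
  also have "\<dots> \<le> Ccut * norm (x - y) * norm h"
    using False Ccut_nonneg nonneg by (intro mult_right_mono mult_mono) auto
  finally show ?thesis .
qed

lemma cut_minus_le: "x \<noteq> 0 \<Longrightarrow> \<bar>K x - cut x\<bar> \<le> 3 * (A / norm x ^ (DIM('a) - 1))"
proof -
  assume x: "x \<noteq> 0"
  have "\<bar>K x - cut x\<bar> = \<bar>1 - ramp (x \<bullet> x)\<bar> * \<bar>K x\<bar>" by (simp add: cut_def abs_mult[symmetric] algebra_simps)
  also have "\<dots> \<le> 3 * (A / norm x ^ (DIM('a) - 1))"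
    using ramp_bound[of "x \<bullet> x"] K_le[OF x] by (intro mult_mono) auto
  finally show ?thesis .
qed

end

text \<open>Homogeneity of degree 1 - N: the dilate keeps the constants \<open>A\<close>,
  \<open>B\<close> and \<open>C\<close>, so estimates for the cut at unit scale transfer to every
  scale.\<close>

lemma (in critical_kernel) critical_kernel_scaled:
  assumes a: "a > 0"
  shows "critical_kernel (\<lambda>x. a ^ (DIM('a) - 1) * K (a *\<^sub>R x)) (\<lambda>x. a ^ DIM('a) *\<^sub>R DK (a *\<^sub>R x)) A B C"
proof -
  obtain m where m: "DIM('a) = Suc m" using dim by (cases "DIM('a)") auto
  show ?thesis
  proof unfold_locales
    fix x :: 'a assume x: "x \<noteq> 0"
    have "(K has_derivative blinfun_apply (DK (a *\<^sub>R x))) (at (a *\<^sub>R x))" using x a by (intro K_deriv) auto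
    then have "((\<lambda>x. K (a *\<^sub>R x)) has_derivative (\<lambda>h. DK (a *\<^sub>R x) (a *\<^sub>R h))) (at x)"
      by (intro has_derivative_compose[of "\<lambda>x. a *\<^sub>R x" _ x UNIV K]) (auto intro!: derivative_eq_intros)
    then have "((\<lambda>x. a ^ (DIM('a) - 1) * K (a *\<^sub>R x)) has_derivative (\<lambda>h. a ^ (DIM('a) - 1) * DK (a *\<^sub>R x) (a *\<^sub>R h))) (at x)"
      by (rule has_derivative_mult_right)
    then show "((\<lambda>x. a ^ (DIM('a) - 1) * K (a *\<^sub>R x)) has_derivative blinfun_apply (a ^ DIM('a) *\<^sub>R DK (a *\<^sub>R x))) (at x)"
      by (rule has_derivative_eq_rhs) (auto simp: fun_eq_iff blinfun.scaleR_right blinfun.scaleR_left m)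
    show "\<bar>a ^ (DIM('a) - 1) * K (a *\<^sub>R x)\<bar> \<le> A / norm x ^ (DIM('a) - 1)"
      using mult_left_mono[OF K_le[of "a *\<^sub>R x"], of "a ^ (DIM('a) - 1)"] x a by (simp add: abs_mult power_mult_distrib)
    show "norm (a ^ DIM('a) *\<^sub>R DK (a *\<^sub>R x)) \<le> C / norm x ^ DIM('a)"
      using mult_left_mono[OF DK_le[of "a *\<^sub>R x"], of "a ^ DIM('a)"] x a by (simp add: power_mult_distrib)
  next
    fix \<mu> and x y :: 'a assume \<mu>: "\<mu> > 0" and seg: "\<And>\<xi>. \<xi> \<in> closed_segment x y \<Longrightarrow> \<mu> \<le> norm \<xi>"
    have "norm (DK (a *\<^sub>R x) - DK (a *\<^sub>R y)) \<le> B / (a * \<mu>) ^ (DIM('a) + 1) * norm (a *\<^sub>R x - a *\<^sub>R y)"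
    proof (rule DK_lip)
      fix \<xi> assume "\<xi> \<in> closed_segment (a *\<^sub>R x) (a *\<^sub>R y)"
      then have "\<xi> \<in> (\<lambda>x. a *\<^sub>R x) ` closed_segment x y"
        by (simp add: closed_segment_linear_image[of "\<lambda>x. a *\<^sub>R x"])
      then obtain \<eta> where "\<eta> \<in> closed_segment x y" "\<xi> = a *\<^sub>R \<eta>" by auto
      then show "a * \<mu> \<le> norm \<xi>" using seg[of \<eta>] a by simp
    qed (use a \<mu> in auto)
    also have "norm (a *\<^sub>R x - a *\<^sub>R y) = a * norm (x - y)" using a by (simp add: scaleR_diff_right[symmetric])
    finally have "a ^ DIM('a) * norm (DK (a *\<^sub>R x) - DK (a *\<^sub>R y)) \<le> a ^ DIM('a) * (B / (a * \<mu>) ^ (DIM('a) + 1) * (a * norm (x - y)))"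
      using a by (intro mult_left_mono) auto
    also have "\<dots> = B / \<mu> ^ (DIM('a) + 1) * norm (x - y)"
      using a \<mu> by (simp add: power_mult_distrib field_simps)
    finally show "norm (a ^ DIM('a) *\<^sub>R DK (a *\<^sub>R x) - a ^ DIM('a) *\<^sub>R DK (a *\<^sub>R y)) \<le> B / \<mu> ^ (DIM('a) + 1) * norm (x - y)"
      using a by (simp add: scaleR_diff_right[symmetric])
  qed (use dim nonneg in auto)
qed

text \<open>If the signs \<open>\<epsilon>\<close> nearly maximize the norm of the signed partial sums, then adding a later block with
  either sign increases it by little, and by the parallelogram law the block itself is small.\<close>

lemma osc_series_Cauchy:
  fixes k :: "nat \<Rightarrow> 'a::euclidean_space \<Rightarrow> real"
  assumes \<rho>: "\<rho> > 0" and k: "\<And>i. osc_kernel (\<rho> / 2 ^ i) 1 (k i)" and f: "f \<in> bdd_int" and \<delta>: "\<delta> > 0"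
  shows "\<exists>n0. \<forall>m m'. n0 \<le> m \<longrightarrow>
    ip (\<lambda>x. \<Sum>i\<in>{m..<m'}. conv (k i) f x) (\<lambda>x. \<Sum>i\<in>{m..<m'}. conv (k i) f x) \<le> \<delta>"
proof -
  have cV: "conv (k i) f \<in> bdd_int" for i
    using osc_kernel_bdd_int(1)[OF k] conv_bdd_int f \<rho> by auto
  define F where "F \<epsilon> n x = (\<Sum>i<n. \<epsilon> i * conv (k i) f x)" for \<epsilon> :: "nat \<Rightarrow> real" and n x
  have FV: "F \<epsilon> n \<in> bdd_int" for \<epsilon> n
    unfolding F_def[abs_def] by (intro bdd_int_sum bdd_int_cmult cV)
  define E :: "((nat \<Rightarrow> real) \<times> nat) set" where "E = {(\<epsilon>, n). \<forall>i. \<epsilon> i \<in> {-1, 0, 1}}"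
  define Q where "Q = (\<lambda>(\<epsilon>, n). ip (F \<epsilon> n) (F \<epsilon> n))"
  have bound: "Q p \<le> (unit_ball_vol (real DIM('a)) * 2 ^ (DIM('a) + 4))\<^sup>2 * ip f f" if "p \<in> E" for p
  proof -
    obtain \<epsilon> n where p: "p = (\<epsilon>, n)" by (cases p)
    have \<epsilon>: "\<epsilon> i \<in> {-1, 0, 1}" for i using that by (auto simp: E_def p)
    have "osc_kernel (\<rho> / 2 ^ i) 1 (\<lambda>x. \<epsilon> i * k i x)" for i
      using k[of i] \<epsilon>[of i] \<rho> osc_kernel_0[of "\<rho> / 2 ^ i" 1, where 'a='a]
      unfolding osc_kernel_def by (auto simp: abs_minus_commute norm_minus_commute)
    from osc_bound_uniform[where 'a='a, of n, unfolded osc_bound_def, rule_format, OF \<rho> zero_less_one order_refl this f]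
    show ?thesis by (simp add: p Q_def F_def[abs_def] conv_cmult)
  qed
  have bb: "bdd_above (Q ` E)" using bound by (auto intro!: bdd_aboveI)
  have ne: "E \<noteq> {}" by (auto simp: E_def intro!: exI[of _ "\<lambda>_. 0"])
  have "Sup (Q ` E) - \<delta> < Sup (Q ` E)" using \<delta> by simp
  then have "\<exists>q\<in>Q ` E. Sup (Q ` E) - \<delta> < q"
    by (subst (asm) less_cSup_iff) (use ne bb in auto)
  then obtain p where p: "p \<in> E" "Q p > Sup (Q ` E) - \<delta>" by blast
  obtain \<epsilon> n where pe: "p = (\<epsilon>, n)" by (cases p)
  have \<epsilon>: "\<epsilon> i \<in> {-1, 0, 1}" for i using p by (auto simp: E_def pe)
  show ?thesis
  proof (intro exI[of _ n] allI impI)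
    fix m m' assume m: "n \<le> m"
    define S2 where "S2 = (\<lambda>x. \<Sum>i\<in>{m..<m'}. conv (k i) f x)"
    have S2V: "S2 \<in> bdd_int" unfolding S2_def by (intro bdd_int_sum cV)
    show "ip S2 S2 \<le> \<delta>"
    proof (cases "m \<le> m'")
      case True
      define \<eta> where "\<eta> t i = (if i < n then \<epsilon> i else if m \<le> i then t else 0)" for t :: real and i
      have F\<eta>: "F (\<eta> t) m' x = F \<epsilon> n x + t * S2 x" for t x
      proof -
        have "{..<m'} = {..<n} \<union> {n..<m} \<union> {m..<m'}" using m True by auto
        moreover have "(\<Sum>i\<in>{..<n} \<union> {n..<m} \<union> {m..<m'}. \<eta> t i * conv (k i) f x) =
          (\<Sum>i<n. \<eta> t i * conv (k i) f x) + (\<Sum>i\<in>{n..<m}. \<eta> t i * conv (k i) f x) + (\<Sum>i\<in>{m..<m'}. \<eta> t i * conv (k i) f x)"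
          using m by (subst sum.union_disjoint | auto)+
        moreover have "(\<Sum>i<n. \<eta> t i * conv (k i) f x) = F \<epsilon> n x"
          unfolding F_def by (intro sum.cong) (auto simp: \<eta>_def)
        moreover have "(\<Sum>i\<in>{n..<m}. \<eta> t i * conv (k i) f x) = 0"
          by (intro sum.neutral) (auto simp: \<eta>_def)
        moreover have "(\<Sum>i\<in>{m..<m'}. \<eta> t i * conv (k i) f x) = t * S2 x"
          unfolding S2_def sum_distrib_left using m by (intro sum.cong) (auto simp: \<eta>_def)
        ultimately show ?thesis by (simp add: F_def)
      qed
      have Q\<eta>: "Q (\<eta> t, m') = Q p + 2 * t * ip (F \<epsilon> n) S2 + t\<^sup>2 * ip S2 S2" for t
      proof -
        let ?G = "\<lambda>x. F \<epsilon> n x + t * S2 x"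
        have tS: "(\<lambda>x. t * S2 x) \<in> bdd_int" by (rule bdd_int_cmult) (rule S2V)
        have G: "?G \<in> bdd_int" by (rule bdd_int_add[OF FV tS])
        have "Q (\<eta> t, m') = ip ?G ?G" by (simp add: Q_def F\<eta>[abs_def])
        also have "\<dots> = ip ?G (F \<epsilon> n) + t * ip ?G S2" by (simp only: ip_add[OF G FV tS] ip_cmult)
        also have "ip ?G (F \<epsilon> n) = ip (F \<epsilon> n) (F \<epsilon> n) + t * ip (F \<epsilon> n) S2"
          by (subst ip_commute) (simp only: ip_add[OF FV FV tS] ip_cmult)
        also have "ip ?G S2 = ip S2 (F \<epsilon> n) + t * ip S2 S2"
          by (subst ip_commute) (simp only: ip_add[OF S2V FV tS] ip_cmult)
        finally show ?thesis by (simp add: pe Q_def algebra_simps power2_eq_square ip_commute[of S2 "F \<epsilon> n"])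
      qed
      have "(\<eta> t, m') \<in> E" if "t \<in> {-1, 1}" for t
        using that \<epsilon> by (auto simp: E_def \<eta>_def)
      then have "Q (\<eta> 1, m') \<le> Sup (Q ` E)" "Q (\<eta> (-1), m') \<le> Sup (Q ` E)"
        using bb by (auto intro!: cSup_upper)
      then have "Q p + ip S2 S2 \<le> Sup (Q ` E)" unfolding Q\<eta> by simp
      with p(2) show ?thesis by simp
    qed (use \<delta> in \<open>auto simp: S2_def ip_def\<close>)
  qed
qed

text \<open>The integral of g(x + t e) - g(x) vanishes by translation invariance, so t times the
  integral of the derivative is, up to sign, the integral of a Taylor remainder of order t^2 over a
  bounded set. It remains to divide by t and let t tend to 0.\<close>

lemma integral_derivative_bounded_support:
  fixes g :: "'a::euclidean_space \<Rightarrow> real"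
  assumes g: "\<And>x. (g has_derivative D x) (at x)"
    and lip: "\<And>x y h. \<bar>D x h - D y h\<bar> \<le> L * norm (x - y) * norm h" and L: "L \<ge> 0"
    and R: "R \<ge> 0" "\<And>x. norm x > R \<Longrightarrow> g x = 0" "\<And>x. norm x > R \<Longrightarrow> D x e = 0"
  shows "(\<integral>x. D x e \<partial>lborel) = 0"
proof -
  let ?\<omega> = "unit_ball_vol (real DIM('a))"
  have gc: "continuous_on UNIV g"
    by (intro continuous_at_imp_continuous_on ballI has_derivative_continuous[OF g])
  then have gm[measurable]: "g \<in> borel_measurable borel" by (rule borel_measurable_continuous_onI)
  have Dc: "continuous_on UNIV (\<lambda>x. D x e)"
    by (rule continuous_if_lipschitz[of _ "L * norm e"]) (use lip[of _ e] in \<open>auto simp: mult_ac\<close>)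
  then have Dm[measurable]: "(\<lambda>x. D x e) \<in> borel_measurable borel" by (rule borel_measurable_continuous_onI)
  have bd: "\<exists>b\<ge>0. \<forall>x. \<bar>f x\<bar> \<le> b" if "continuous_on UNIV f" "\<And>x. norm x > R \<Longrightarrow> f x = 0" for f :: "'a \<Rightarrow> real"
  proof -
    have "compact (f ` cball 0 R)"
      by (intro compact_continuous_image) (auto intro: continuous_on_subset[OF that(1)])
    then obtain b where b: "\<And>x. x \<in> cball 0 R \<Longrightarrow> \<bar>f x\<bar> \<le> b"
      using compact_imp_bounded bounded_iff by (metis (no_types, lifting) image_eqI real_norm_def)
    have "\<bar>f x\<bar> \<le> \<bar>b\<bar>" for x using b[of x] that(2)[of x] by (cases "norm x \<le> R") auto
    then show ?thesis by (intro exI[of _ "\<bar>b\<bar>"]) auto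
  qed
  have int: "integrable lborel f" if "continuous_on UNIV f" "\<And>x. norm x > R \<Longrightarrow> f x = 0" for f :: "'a \<Rightarrow> real"
  proof -
    note b = bd[OF that]
    obtain b where "b \<ge> 0" "\<And>x. \<bar>f x\<bar> \<le> b" using b by blast
    then show ?thesis
      using that R(1) by (intro integrable_bounded_support[of f R b] borel_measurable_continuous_onI) auto
  qed
  have ig: "integrable lborel g" by (rule int[OF gc]) (rule R(2))
  have iD: "integrable lborel (\<lambda>x. D x e)" by (rule int[OF Dc]) (rule R(3))
  define M where "M = L * (norm e)\<^sup>2 * (?\<omega> * (R + norm e) ^ DIM('a))"
  have le: "\<bar>\<integral>x. D x e \<partial>lborel\<bar> \<le> t * M" if t: "0 < t" "t \<le> 1" for t
  proof -
    have igt: "integrable lborel (\<lambda>x. g (x - (- t *\<^sub>R e)))" using ig by (simp only: integrable_lborel_shift[OF gm])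
    let ?r = "\<lambda>x. g (x - (- t *\<^sub>R e)) - g x - t * D x e"
    have ir: "integrable lborel ?r"
      by (rule Bochner_Integration.integrable_diff[OF Bochner_Integration.integrable_diff[OF igt ig]]) (intro integrable_mult_right iD)
    have "(\<integral>x. ?r x \<partial>lborel) = (\<integral>x. g (x - (- t *\<^sub>R e)) \<partial>lborel) - (\<integral>x. g x \<partial>lborel) - t * (\<integral>x. D x e \<partial>lborel)"
      using igt ig iD by simp
    then have eq: "(\<integral>x. ?r x \<partial>lborel) = - (t * (\<integral>x. D x e \<partial>lborel))"
      by (simp only: integral_lborel_shift[OF gm])
    have te: "norm (t *\<^sub>R e) \<le> norm e" using t mult_left_le_one_le[of "norm e" t] by simp
    have "(\<integral>x. \<bar>?r x\<bar> \<partial>lborel) \<le> L * (norm (t *\<^sub>R e))\<^sup>2 * (?\<omega> * (R + norm e) ^ DIM('a))"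
    proof (rule integral_abs_bounded_support)
      fix x :: 'a
      have "D x (t *\<^sub>R e) = t * D x e"
        using has_derivative_linear[OF g[of x]] by (simp add: linear_cmul)
      then show "\<bar>?r x\<bar> \<le> L * (norm (t *\<^sub>R e))\<^sup>2"
        using C1_lipschitz_derivative_taylor[OF g lip L, of x "t *\<^sub>R e"] by simp
      assume x: "norm x > R + norm e"
      have "norm x \<le> norm (x + t *\<^sub>R e) + norm (t *\<^sub>R e)" using norm_triangle_ineq4[of "x + t *\<^sub>R e" "t *\<^sub>R e"] by simp
      then have "norm (x + t *\<^sub>R e) > R" using x te by linarith
      moreover have "norm x > R" using x by (smt (verit) norm_ge_zero)
      ultimately show "?r x = 0" using R(2)[of "x + t *\<^sub>R e"] R(2)[of x] R(3)[of x] by simp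
    qed (use R L in auto)
    also have "\<dots> = t * (t * M)" using t by (simp add: M_def power_mult_distrib power2_eq_square)
    finally have "(\<integral>x. \<bar>?r x\<bar> \<partial>lborel) \<le> t * (t * M)" .
    moreover have "t * \<bar>\<integral>x. D x e \<partial>lborel\<bar> \<le> (\<integral>x. \<bar>?r x\<bar> \<partial>lborel)"
      using integral_abs_bound[of lborel ?r] t unfolding eq by (simp add: abs_mult)
    ultimately have "t * \<bar>\<integral>x. D x e \<partial>lborel\<bar> \<le> t * (t * M)" by (rule order_trans[rotated])
    then show ?thesis by (rule mult_left_le_imp_le) (rule t)
  qed
  have "(\<lambda>n. inverse (real (Suc n)) * M) \<longlonglongrightarrow> 0 * M" by (intro tendsto_intros LIMSEQ_inverse_real_of_nat)
  then have "\<bar>\<integral>x. D x e \<partial>lborel\<bar> \<le> 0 * M"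
    by (rule LIMSEQ_le_const) (intro exI[of _ 0] allI impI le, auto simp: field_simps)
  then show ?thesis by simp
qed

section \<open>Truncation at every scale and the dyadic shell kernels\<close>

context critical_kernel begin

definition trunc :: "real \<Rightarrow> 'a \<Rightarrow> real" where
  "trunc a x = critical_kernel.cut (\<lambda>x. a ^ (DIM('a) - 1) * K (a *\<^sub>R x)) ((1 / a) *\<^sub>R x) / a ^ (DIM('a) - 1)"

definition dtrunc :: "real \<Rightarrow> 'a \<Rightarrow> 'a \<Rightarrow> real" where
  "dtrunc a x h = critical_kernel.dcut (\<lambda>x. a ^ (DIM('a) - 1) * K (a *\<^sub>R x)) (\<lambda>x. a ^ DIM('a) *\<^sub>R DK (a *\<^sub>R x))
     ((1 / a) *\<^sub>R x) h / a ^ DIM('a)"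

lemma
  assumes a: "a > 0"
  shows trunc_low: "norm x \<le> a \<Longrightarrow> trunc a x = 0"
    and trunc_high: "norm x \<ge> 2 * a \<Longrightarrow> trunc a x = K x"
    and dtrunc_high: "norm x \<ge> 2 * a \<Longrightarrow> dtrunc a x h = DK x h"
    and trunc_deriv: "(trunc a has_derivative dtrunc a x) (at x)"
    and dtrunc_le: "\<bar>dtrunc a x h\<bar> \<le> Ccut / a ^ DIM('a) * norm h"
    and dtrunc_lip: "\<bar>dtrunc a x h - dtrunc a y h\<bar> \<le> Ccut / a ^ (DIM('a) + 1) * norm (x - y) * norm h"
    and trunc_minus_le: "x \<noteq> 0 \<Longrightarrow> \<bar>K x - trunc a x\<bar> \<le> 3 * (A / norm x ^ (DIM('a) - 1))"
proof -
  obtain m where m: "DIM('a) = Suc m" using dim by (cases "DIM('a)") auto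
  interpret S: critical_kernel "\<lambda>x. a ^ (DIM('a) - 1) * K (a *\<^sub>R x)" "\<lambda>x. a ^ DIM('a) *\<^sub>R DK (a *\<^sub>R x)" A B C
    by (rule critical_kernel_scaled) fact
  have n: "norm ((1 / a) *\<^sub>R x) = norm x / a" for x :: 'a using a by simp
  show "trunc a x = 0" if "norm x \<le> a"
    using S.cut_low(1)[of "(1 / a) *\<^sub>R x"] that a by (simp add: trunc_def field_simps)
  have high: "norm ((1 / a) *\<^sub>R x) \<ge> 2" if "norm x \<ge> 2 * a" using that a by (simp add: field_simps)
  show "trunc a x = K x" if "norm x \<ge> 2 * a"
    using S.cut_high(1)[OF high[OF that]] a by (simp add: trunc_def)
  show "dtrunc a x h = DK x h" if "norm x \<ge> 2 * a"
    using S.cut_high(2)[OF high[OF that], of h] a by (simp add: dtrunc_def blinfun.scaleR_left)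
  have "((\<lambda>x. S.cut ((1 / a) *\<^sub>R x)) has_derivative (\<lambda>h. S.dcut ((1 / a) *\<^sub>R x) ((1 / a) *\<^sub>R h))) (at x)"
    by (intro has_derivative_compose[of "\<lambda>x. (1 / a) *\<^sub>R x" _ x UNIV S.cut] S.cut_deriv) (auto intro!: derivative_eq_intros)
  then have "((\<lambda>x. S.cut ((1 / a) *\<^sub>R x) / a ^ (DIM('a) - 1)) has_derivative (\<lambda>h. S.dcut ((1 / a) *\<^sub>R x) ((1 / a) *\<^sub>R h) / a ^ (DIM('a) - 1))) (at x)"
    unfolding divide_inverse by (rule has_derivative_mult_left)
  moreover have "trunc a = (\<lambda>x. S.cut ((1 / a) *\<^sub>R x) / a ^ (DIM('a) - 1))"
    by (simp add: trunc_def[abs_def])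
  moreover have "(\<lambda>h. S.dcut ((1 / a) *\<^sub>R x) ((1 / a) *\<^sub>R h) / a ^ (DIM('a) - 1)) = dtrunc a x"
  proof
    fix h
    have "S.dcut ((1 / a) *\<^sub>R x) ((1 / a) *\<^sub>R h) = (1 / a) * S.dcut ((1 / a) *\<^sub>R x) h"
      using linear_cmul[OF has_derivative_linear[OF S.cut_deriv[of "(1 / a) *\<^sub>R x"]], of "1 / a" h] by simp
    then show "S.dcut ((1 / a) *\<^sub>R x) ((1 / a) *\<^sub>R h) / a ^ (DIM('a) - 1) = dtrunc a x h"
      using a by (simp add: dtrunc_def m)
  qed
  ultimately show "(trunc a has_derivative dtrunc a x) (at x)" by simp
  show "\<bar>dtrunc a x h\<bar> \<le> Ccut / a ^ DIM('a) * norm h"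
    using S.dcut_le[of "(1 / a) *\<^sub>R x" h] a by (simp add: dtrunc_def divide_right_mono)
  show "\<bar>dtrunc a x h - dtrunc a y h\<bar> \<le> Ccut / a ^ (DIM('a) + 1) * norm (x - y) * norm h"
  proof -
    have "\<bar>S.dcut ((1 / a) *\<^sub>R x) h - S.dcut ((1 / a) *\<^sub>R y) h\<bar> \<le> Ccut * norm ((1 / a) *\<^sub>R x - (1 / a) *\<^sub>R y) * norm h"
      by (rule S.dcut_lip)
    also have "norm ((1 / a) *\<^sub>R x - (1 / a) *\<^sub>R y) = norm (x - y) / a"
      using a by (simp add: scaleR_diff_right[symmetric])
    finally have "\<bar>S.dcut ((1 / a) *\<^sub>R x) h - S.dcut ((1 / a) *\<^sub>R y) h\<bar> / a ^ DIM('a) \<le> Ccut * (norm (x - y) / a) * norm h / a ^ DIM('a)"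
      using a by (intro divide_right_mono) auto
    also have "\<dots> = Ccut / a ^ (DIM('a) + 1) * norm (x - y) * norm h" by simp
    finally show ?thesis using a by (simp add: dtrunc_def diff_divide_distrib[symmetric])
  qed
  show "\<bar>K x - trunc a x\<bar> \<le> 3 * (A / norm x ^ (DIM('a) - 1))" if x: "x \<noteq> 0"
  proof -
    have "\<bar>a ^ (DIM('a) - 1) * K (a *\<^sub>R ((1 / a) *\<^sub>R x)) - S.cut ((1 / a) *\<^sub>R x)\<bar> \<le> 3 * (A / norm ((1 / a) *\<^sub>R x) ^ (DIM('a) - 1))"
      using x a by (intro S.cut_minus_le) auto
    then have "\<bar>a ^ (DIM('a) - 1) * K x - S.cut ((1 / a) *\<^sub>R x)\<bar> \<le> a ^ (DIM('a) - 1) * (3 * (A / norm x ^ (DIM('a) - 1)))"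
      using a by (simp add: n power_divide mult_ac)
    moreover have "\<bar>a ^ (DIM('a) - 1) * K x - S.cut ((1 / a) *\<^sub>R x)\<bar> = a ^ (DIM('a) - 1) * \<bar>K x - trunc a x\<bar>"
    proof -
      have "a ^ (DIM('a) - 1) * K x - S.cut ((1 / a) *\<^sub>R x) = a ^ (DIM('a) - 1) * (K x - trunc a x)"
        using a by (simp add: trunc_def right_diff_distrib)
      then show ?thesis using a by (simp add: abs_mult)
    qed
    ultimately have "a ^ (DIM('a) - 1) * \<bar>K x - trunc a x\<bar> \<le> a ^ (DIM('a) - 1) * (3 * (A / norm x ^ (DIM('a) - 1)))"
      by (simp only:)
    then show ?thesis by (rule mult_left_le_imp_le) (use a in simp)
  qed
qed

definition shell_kernel :: "'a \<Rightarrow> nat \<Rightarrow> 'a \<Rightarrow> real" where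
  "shell_kernel e n x = dtrunc (1 / 2 ^ Suc n) x e - dtrunc (1 / 2 ^ n) x e"

text \<open>Normalises both the height and the Lipschitz constant of the shell kernels to size 1 at
  radius 2/2^n; the added 1 keeps it positive.\<close>

definition \<alpha> :: real where
  "\<alpha> = Ccut * (2 ^ (DIM('a) + 1) + 1) * 2 ^ (DIM('a) + 1) + 1"

lemma \<alpha>_pos: "\<alpha> > 0" using Ccut_nonneg(1) by (simp add: \<alpha>_def add_nonneg_pos)

text \<open>The truncations at a and a/2 both agree with \<open>K\<close> outside the ball of radius
  2a, so the kernel is a derivative of a compactly supported function. This is the source of its
  mean zero.\<close>

lemma shell_kernel_osc:
  assumes e: "norm e \<le> 1"
  shows "osc_kernel (2 / 2 ^ n) 1 (\<lambda>x. shell_kernel e n x / \<alpha>)"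
proof -
  define a :: real where "a = 1 / 2 ^ n"
  have a: "a > 0" by (simp add: a_def)
  have shell_kernel: "shell_kernel e n x = dtrunc (a/2) x e - dtrunc a x e" for x by (simp add: shell_kernel_def a_def mult.commute)
  have \<rho>: "2 / 2 ^ n = 2 * a" by (simp add: a_def)
  have a2: "(a/2) > 0" using a by simp
  have lip: "\<bar>(dtrunc (a/2) x h - dtrunc a x h) - (dtrunc (a/2) y h - dtrunc a y h)\<bar> \<le> (Ccut * (2 ^ (DIM('a) + 1) + 1) / a ^ (DIM('a) + 1)) * norm (x - y) * norm h" for x y h
  proof -
    have "\<bar>(dtrunc (a/2) x h - dtrunc a x h) - (dtrunc (a/2) y h - dtrunc a y h)\<bar>
       \<le> \<bar>dtrunc (a/2) x h - dtrunc (a/2) y h\<bar> + \<bar>dtrunc a x h - dtrunc a y h\<bar>" by linarith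
    also have "\<dots> \<le> Ccut / (a/2) ^ (DIM('a) + 1) * norm (x - y) * norm h + Ccut / a ^ (DIM('a) + 1) * norm (x - y) * norm h"
      by (intro add_mono dtrunc_lip a a2)
    also have "\<dots> = (Ccut * (2 ^ (DIM('a) + 1) + 1) / a ^ (DIM('a) + 1)) * norm (x - y) * norm h"
      using a by (simp add: power_divide field_simps)
    finally show ?thesis .
  qed
  have supp: "shell_kernel e n x = 0" if "norm x > 2 * a" for x
    using dtrunc_high[OF a2, of x e] dtrunc_high[OF a, of x e] that a by (simp add: shell_kernel)
  have "(\<integral>x. dtrunc (a/2) x e - dtrunc a x e \<partial>lborel) = 0"
  proof (rule integral_derivative_bounded_support[where g = "\<lambda>x. trunc (a/2) x - trunc a x" and R = "2 * a"])
    show "((\<lambda>x. trunc (a/2) x - trunc a x) has_derivative (\<lambda>h. dtrunc (a/2) x h - dtrunc a x h)) (at x)" for x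
      by (intro has_derivative_diff trunc_deriv a a2)
    show "\<bar>(dtrunc (a/2) x h - dtrunc a x h) - (dtrunc (a/2) y h - dtrunc a y h)\<bar> \<le> (Ccut * (2 ^ (DIM('a) + 1) + 1) / a ^ (DIM('a) + 1)) * norm (x - y) * norm h" for x y h
      by (rule lip)
    show "trunc (a/2) x - trunc a x = 0" if "norm x > 2 * a" for x
      using trunc_high[OF a2, of x] trunc_high[OF a, of x] that a by simp
    show "dtrunc (a/2) x e - dtrunc a x e = 0" if "norm x > 2 * a" for x
      using supp[OF that] by (simp add: shell_kernel)
  qed (use a Ccut_nonneg(1) in auto)
  then have int0: "(\<integral>x. shell_kernel e n x \<partial>lborel) = 0" by (simp add: shell_kernel)
  show ?thesis
    unfolding osc_kernel_def \<rho>
  proof (intro conjI allI impI)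
    fix x :: 'a
    have "\<bar>shell_kernel e n x\<bar> \<le> \<bar>dtrunc (a/2) x e\<bar> + \<bar>dtrunc a x e\<bar>" unfolding shell_kernel by linarith
    also have "\<dots> \<le> Ccut / (a/2) ^ DIM('a) * norm e + Ccut / a ^ DIM('a) * norm e"
      by (intro add_mono dtrunc_le a a2)
    also have "\<dots> \<le> Ccut / (a/2) ^ DIM('a) * 1 + Ccut / a ^ DIM('a) * 1"
      using e a Ccut_nonneg(1) by (intro add_mono mult_left_mono) auto
    also have "\<dots> = Ccut * (2 ^ DIM('a) + 1) * 2 ^ DIM('a) / (2 * a) ^ DIM('a)"
      using a by (simp add: power_divide power_mult_distrib field_simps)
    also have "\<dots> \<le> \<alpha> / (2 * a) ^ DIM('a)"
    proof (rule divide_right_mono)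
      have "Ccut * (2 ^ DIM('a) + 1) * 2 ^ DIM('a) \<le> Ccut * (2 ^ (DIM('a) + 1) + 1) * 2 ^ (DIM('a) + 1)"
        using Ccut_nonneg(1) by (intro mult_mono mult_left_mono add_mono power_increasing) auto
      then show "Ccut * (2 ^ DIM('a) + 1) * 2 ^ DIM('a) \<le> \<alpha>" by (simp add: \<alpha>_def)
    qed (use a in auto)
    finally show "\<bar>shell_kernel e n x / \<alpha>\<bar> \<le> 1 / (2 * a) ^ DIM('a)"
      using \<alpha>_pos by (simp add: pos_divide_le_eq mult.commute)
  next
    fix x y :: 'a
    have "\<bar>shell_kernel e n x - shell_kernel e n y\<bar> \<le> (Ccut * (2 ^ (DIM('a) + 1) + 1) / a ^ (DIM('a) + 1)) * norm (x - y) * norm e"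
      unfolding shell_kernel by (rule lip)
    also have "\<dots> \<le> (Ccut * (2 ^ (DIM('a) + 1) + 1) / a ^ (DIM('a) + 1)) * norm (x - y) * 1"
      using e a Ccut_nonneg(1) by (intro mult_left_mono) auto
    also have "\<dots> = Ccut * (2 ^ (DIM('a) + 1) + 1) * 2 ^ (DIM('a) + 1) * (norm (x - y) / (2 * a) ^ (DIM('a) + 1))"
      using a by (simp add: power_mult_distrib)
    also have "\<dots> \<le> \<alpha> * (norm (x - y) / (2 * a) ^ (DIM('a) + 1))"
      using a by (intro mult_right_mono) (auto simp: \<alpha>_def)
    finally have "\<bar>(shell_kernel e n x - shell_kernel e n y) / \<alpha>\<bar> \<le> norm (x - y) / (2 * a) ^ (DIM('a) + 1)"
      using \<alpha>_pos by (simp add: pos_divide_le_eq mult.commute)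
    then show "\<bar>shell_kernel e n x / \<alpha> - shell_kernel e n y / \<alpha>\<bar> \<le> norm (x - y) / (2 * a) ^ (DIM('a) + 1)"
      by (simp add: diff_divide_distrib)
  qed (use supp int0 in auto)
qed

end

section \<open>Potentials of bounded densities\<close>

text \<open>Jensen's inequality on the unit interval: the nonnegative integral of the square of
  \<phi>' minus its mean is expanded.\<close>

lemma nn_integral_power2_FTC:
  fixes \<phi> :: "real \<Rightarrow> real"
  assumes d: "\<And>s. s \<in> {0..1} \<Longrightarrow> (\<phi> has_real_derivative \<phi>' s) (at s)"
    and c: "continuous_on UNIV \<phi>'"
  shows "ennreal ((\<phi> 1 - \<phi> 0)\<^sup>2) \<le> (\<integral>\<^sup>+s. ennreal ((\<phi>' s)\<^sup>2) * indicator {0..1} s \<partial>lborel)"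
proof -
  have [measurable]: "\<phi>' \<in> borel_measurable borel" by (rule borel_measurable_continuous_onI) fact
  have c1: "continuous_on {0..1} \<phi>'" by (rule continuous_on_subset[OF c]) auto
  define m where "m = \<phi> 1 - \<phi> 0"
  have I1: "(\<phi>' has_integral m) {0..1}"
    unfolding m_def by (rule fundamental_theorem_of_calculus)
      (auto simp: has_real_derivative_iff_has_vector_derivative[symmetric] intro!: has_field_derivative_at_within d)
  have i2: "(\<lambda>s. (\<phi>' s)\<^sup>2) integrable_on {0..1}"
    by (rule integrable_continuous_interval) (intro continuous_intros c1)
  define q where "q = integral {0..1} (\<lambda>s. (\<phi>' s)\<^sup>2)"
  have I2: "((\<lambda>s. (\<phi>' s)\<^sup>2) has_integral q) {0..1}" using i2 by (simp add: q_def has_integral_integral[symmetric])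
  have "((\<lambda>s. (\<phi>' s)\<^sup>2 - 2 * m * \<phi>' s + m\<^sup>2) has_integral (q - 2 * m * m + m\<^sup>2)) {0..1}"
    using has_integral_const_real[of "m\<^sup>2" 0 1]
    by (intro has_integral_add has_integral_diff I2 has_integral_mult_right I1) auto
  moreover have "0 \<le> (\<phi>' s)\<^sup>2 - 2 * m * \<phi>' s + m\<^sup>2" for s
    using zero_le_power2[of "\<phi>' s - m"] by (simp add: power2_diff algebra_simps)
  ultimately have "0 \<le> q - 2 * m * m + m\<^sup>2" by (rule has_integral_nonneg)
  then have "m\<^sup>2 \<le> q" by (simp add: power2_eq_square)
  moreover have "(\<integral>\<^sup>+s. ennreal (if s \<in> {0..1} then (\<phi>' s)\<^sup>2 else 0) \<partial>lborel) = ennreal q"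
  proof (rule nn_integral_has_integral_lborel)
    show "((\<lambda>s. if s \<in> {0..1} then (\<phi>' s)\<^sup>2 else 0) has_integral q) UNIV"
      using I2 by (simp only: has_integral_restrict_UNIV)
  qed auto
  moreover have "(\<integral>\<^sup>+s. ennreal (if s \<in> {0..1} then (\<phi>' s)\<^sup>2 else 0) \<partial>lborel) = (\<integral>\<^sup>+s. ennreal ((\<phi>' s)\<^sup>2) * indicator {0..1} s \<partial>lborel)"
    by (intro nn_integral_cong) (auto split: split_indicator)
  ultimately show ?thesis using ennreal_leI[of "m\<^sup>2" q] by (simp add: m_def[symmetric])
qed

lemma linear_square_le:
  fixes f :: "'a::euclidean_space \<Rightarrow> real"
  assumes "linear f"
  shows "(f h)\<^sup>2 \<le> (norm h)\<^sup>2 * (\<Sum>e\<in>Basis. (f e)\<^sup>2)"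
proof -
  have "f h = f (\<Sum>e\<in>Basis. (h \<bullet> e) *\<^sub>R e)" by (simp add: euclidean_representation)
  also have "\<dots> = (\<Sum>e\<in>Basis. (h \<bullet> e) * f e)" using assms by (simp add: linear_sum linear_cmul)
  finally have "(f h)\<^sup>2 \<le> (\<Sum>e\<in>Basis. (h \<bullet> e)\<^sup>2) * (\<Sum>e\<in>Basis. (f e)\<^sup>2)"
    by (simp only: Cauchy_Schwarz_ineq_sum)
  moreover have "(\<Sum>e\<in>Basis. (h \<bullet> e)\<^sup>2) = (norm h)\<^sup>2"
    using euclidean_inner[of h h] by (simp add: dot_square_norm power2_eq_square)
  ultimately show ?thesis by simp
qed

text \<open>The increment from y is integrated along the ray. After Tonelli, the slice at parameter
  \<open>s\<close> is an integral over the ball of radius s r with Jacobian s^-N, and the growth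
  hypothesis at that radius supplies s^N. This is why the energy is controlled on all balls about y
  and not only on the one of radius \<open>r\<close>.\<close>

lemma C1_oscillation_L2:
  fixes w :: "'a::euclidean_space \<Rightarrow> real"
  assumes w: "\<And>x. (w has_derivative V x) (at x)" and V: "\<And>h. continuous_on UNIV (\<lambda>x. V x h)"
    and M: "M \<ge> 0" "\<And>r. r > 0 \<Longrightarrow>
       (\<integral>\<^sup>+x. ennreal (\<Sum>e\<in>Basis. (V x e)\<^sup>2) * indicator (ball y r) x \<partial>lborel) \<le> ennreal (M * r ^ DIM('a))"
    and r: "r > 0"
  shows "(\<integral>\<^sup>+x. ennreal ((w x - w y)\<^sup>2) * indicator (ball y r) x \<partial>lborel) \<le> ennreal (M * r ^ (DIM('a) + 2))"
proof -
  define D where "D x = (\<Sum>e\<in>Basis. (V x e)\<^sup>2)" for x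
  have [measurable]: "D \<in> borel_measurable borel"
    unfolding D_def[abs_def] by (intro borel_measurable_continuous_onI continuous_intros V)
  have D0: "D x \<ge> 0" for x by (auto simp: D_def intro!: sum_nonneg)
  have V2: "(V x h)\<^sup>2 \<le> (norm h)\<^sup>2 * D x" for x h
    unfolding D_def by (rule linear_square_le[OF has_derivative_linear[OF w]])
  have pt: "ennreal ((w x - w y)\<^sup>2) \<le> (\<integral>\<^sup>+s. ennreal (r\<^sup>2) * (ennreal (D (y + s *\<^sub>R (x - y))) * indicator {0..1} s) \<partial>lborel)"
    if x: "x \<in> ball y r" for x
  proof -
    have Vl: "V z (x - y) = (\<Sum>e\<in>Basis. ((x - y) \<bullet> e) * V z e)" for z
    proof -
      have "V z (\<Sum>e\<in>Basis. ((x - y) \<bullet> e) *\<^sub>R e) = (\<Sum>e\<in>Basis. ((x - y) \<bullet> e) * V z e)"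
        using has_derivative_linear[OF w[of z]] by (simp add: linear_sum linear_cmul)
      then show ?thesis by (simp add: euclidean_representation)
    qed
    have "ennreal ((w (y + 1 *\<^sub>R (x - y)) - w (y + 0 *\<^sub>R (x - y)))\<^sup>2)
      \<le> (\<integral>\<^sup>+s. ennreal ((V (y + s *\<^sub>R (x - y)) (x - y))\<^sup>2) * indicator {0..1} s \<partial>lborel)"
    proof (rule nn_integral_power2_FTC)
      fix s
      have "((\<lambda>s. w (y + s *\<^sub>R (x - y))) has_derivative (\<lambda>t. V (y + s *\<^sub>R (x - y)) (t *\<^sub>R (x - y)))) (at s)"
        by (rule has_derivative_compose[OF _ w]) (auto intro!: derivative_eq_intros)
      moreover have "(\<lambda>t. V (y + s *\<^sub>R (x - y)) (t *\<^sub>R (x - y))) = (*) (V (y + s *\<^sub>R (x - y)) (x - y))"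
        using has_derivative_linear[OF w[of "y + s *\<^sub>R (x - y)"]] by (auto simp: linear_cmul fun_eq_iff)
      ultimately show "((\<lambda>s. w (y + s *\<^sub>R (x - y))) has_real_derivative V (y + s *\<^sub>R (x - y)) (x - y)) (at s)"
        by (simp add: has_field_derivative_def)
    next
      show "continuous_on UNIV (\<lambda>s. V (y + s *\<^sub>R (x - y)) (x - y))"
        by (rule continuous_on_compose2[OF V[of "x - y"]]) (auto intro!: continuous_intros)
    qed
    also have "\<dots> \<le> (\<integral>\<^sup>+s. ennreal (r\<^sup>2) * (ennreal (D (y + s *\<^sub>R (x - y))) * indicator {0..1} s) \<partial>lborel)"
    proof (rule nn_integral_mono)
      fix s :: real
      have "(norm (x - y))\<^sup>2 \<le> r\<^sup>2"
        using x by (intro power_mono) (auto simp: dist_norm norm_minus_commute)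
      then have "(V (y + s *\<^sub>R (x - y)) (x - y))\<^sup>2 \<le> r\<^sup>2 * D (y + s *\<^sub>R (x - y))"
        using V2[of "y + s *\<^sub>R (x - y)" "x - y"] mult_right_mono[OF _ D0] order_trans by blast
      then show "ennreal ((V (y + s *\<^sub>R (x - y)) (x - y))\<^sup>2) * indicator {0..1} s
         \<le> ennreal (r\<^sup>2) * (ennreal (D (y + s *\<^sub>R (x - y))) * indicator {0..1} s)"
        using D0 by (auto simp: ennreal_mult[symmetric] ennreal_leI split: split_indicator)
    qed
    finally show ?thesis by simp
  qed
  have "(\<integral>\<^sup>+x. ennreal ((w x - w y)\<^sup>2) * indicator (ball y r) x \<partial>lborel) \<le>
     (\<integral>\<^sup>+x. (\<integral>\<^sup>+s. ennreal (r\<^sup>2) * (ennreal (D (y + s *\<^sub>R (x - y))) * indicator {0..1} s) * indicator (ball y r) x \<partial>lborel) \<partial>lborel)"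
  proof (rule nn_integral_mono)
    fix x
    show "ennreal ((w x - w y)\<^sup>2) * indicator (ball y r) x
      \<le> (\<integral>\<^sup>+s. ennreal (r\<^sup>2) * (ennreal (D (y + s *\<^sub>R (x - y))) * indicator {0..1} s) * indicator (ball y r) x \<partial>lborel)"
      using pt[of x] by (cases "x \<in> ball y r") auto
  qed
  also have "\<dots> = (\<integral>\<^sup>+s. (\<integral>\<^sup>+x. ennreal (r\<^sup>2) * (ennreal (D (y + s *\<^sub>R (x - y))) * indicator {0..1} s) * indicator (ball y r) x \<partial>lborel) \<partial>lborel)"
    by (rule lborel_pair.Fubini') measurable
  also have "\<dots> \<le> (\<integral>\<^sup>+s. ennreal (M * r ^ (DIM('a) + 2)) * indicator {0..1} s \<partial>(lborel :: real measure))"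
  proof (rule nn_integral_mono_AE)
    \<comment> \<open>The parameter 0 is discarded because the dilation about y degenerates
      there.\<close>
    have "AE s in (lborel :: real measure). s \<noteq> 0" by (rule AE_lborel_singleton)
    then show "AE s in lborel. (\<integral>\<^sup>+x. ennreal (r\<^sup>2) * (ennreal (D (y + s *\<^sub>R (x - y))) * indicator {0..1} s) * indicator (ball y r) x \<partial>lborel)
        \<le> ennreal (M * r ^ (DIM('a) + 2)) * indicator {0..1} (s::real)"
    proof (rule AE_mp, intro AE_I2 impI)
      fix s :: real assume s0: "s \<noteq> 0"
      show "(\<integral>\<^sup>+x. ennreal (r\<^sup>2) * (ennreal (D (y + s *\<^sub>R (x - y))) * indicator {0..1} s) * indicator (ball y r) x \<partial>lborel)
        \<le> ennreal (M * r ^ (DIM('a) + 2)) * indicator {0..1} s"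
      proof (cases "s \<in> {0..1}")
        case True
        then have s: "s > 0" using s0 by auto
        have "ennreal (s ^ DIM('a)) * (\<integral>\<^sup>+x. ennreal (D (y + s *\<^sub>R (x - y))) * indicator (ball y r) x \<partial>lborel)
          = ennreal (\<bar>s\<bar> ^ DIM('a)) * (\<integral>\<^sup>+x. ennreal (D ((y - s *\<^sub>R y) + s *\<^sub>R x)) * indicator (ball y (s * r)) ((y - s *\<^sub>R y) + s *\<^sub>R x) \<partial>lborel)"
        proof -
          have e1: "(y - s *\<^sub>R y) + s *\<^sub>R x = y + s *\<^sub>R (x - y)" for x by (simp add: algebra_simps)
          have e2: "indicator (ball y (s * r)) (y + s *\<^sub>R (x - y)) = (indicator (ball y r) x :: ennreal)" for x
            using s by (auto simp: dist_norm norm_minus_commute split: split_indicator)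
          show ?thesis unfolding e1 e2 using s by simp
        qed
        also have "\<dots> = (\<integral>\<^sup>+x. ennreal (D x) * indicator (ball y (s * r)) x \<partial>lborel)"
          by (rule nn_integral_lborel_affine[symmetric]) (use s0 in auto)
        also have "\<dots> \<le> ennreal (M * (s * r) ^ DIM('a))"
          using M(2)[of "s * r"] s r by (simp add: D_def)
        also have "\<dots> = ennreal (s ^ DIM('a)) * ennreal (M * r ^ DIM('a))"
          using s r M(1) by (subst ennreal_mult[symmetric]) (auto simp: power_mult_distrib mult_ac)
        finally have "(\<integral>\<^sup>+x. ennreal (D (y + s *\<^sub>R (x - y))) * indicator (ball y r) x \<partial>lborel) \<le> ennreal (M * r ^ DIM('a))"
          using s by (subst (asm) ennreal_mult_le_mult_iff) auto
        then have "ennreal (r\<^sup>2) * (\<integral>\<^sup>+x. ennreal (D (y + s *\<^sub>R (x - y))) * indicator (ball y r) x \<partial>lborel) \<le> ennreal (r\<^sup>2) * ennreal (M * r ^ DIM('a))"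
          by (intro mult_left_mono) auto
        also have "\<dots> = ennreal (M * r ^ (DIM('a) + 2))"
          using M(1) r by (subst ennreal_mult[symmetric]) (auto simp: power_add power2_eq_square mult_ac)
        finally show ?thesis using True
          by (simp add: nn_integral_cmult[symmetric] mult.assoc)
      qed auto
    qed
  qed
  also have "\<dots> = ennreal (M * r ^ (DIM('a) + 2))" by (simp add: nn_integral_cmult_indicator)
  finally show ?thesis .
qed

lemma emeasure_oscillation_le:
  fixes w :: "'a::euclidean_space \<Rightarrow> real"
  assumes [measurable]: "w \<in> borel_measurable borel" and s: "s > 0" and M: "M \<ge> 0"
    and le: "(\<integral>\<^sup>+x. ennreal ((w x - w y)\<^sup>2) * indicator (ball y r) x \<partial>lborel) \<le> ennreal M"
  shows "emeasure lborel {x \<in> ball y r. s < \<bar>w x - w y\<bar>} \<le> ennreal (M / s\<^sup>2)"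
proof -
  let ?S = "{x \<in> ball y r. s < \<bar>w x - w y\<bar>}"
  have [measurable]: "?S \<in> sets borel" by measurable
  have "ennreal (s\<^sup>2) * emeasure lborel ?S = (\<integral>\<^sup>+x. ennreal (s\<^sup>2) * indicator ?S x \<partial>lborel)"
    by (simp add: nn_integral_cmult_indicator)
  also have "\<dots> \<le> (\<integral>\<^sup>+x. ennreal ((w x - w y)\<^sup>2) * indicator (ball y r) x \<partial>lborel)"
  proof (rule nn_integral_mono)
    fix x
    show "ennreal (s\<^sup>2) * indicator ?S x \<le> ennreal ((w x - w y)\<^sup>2) * indicator (ball y r) x"
    proof (cases "x \<in> ?S")
      case True
      then have "s\<^sup>2 \<le> \<bar>w x - w y\<bar>\<^sup>2" using s by (intro power_mono) auto
      then show ?thesis using True by (auto simp: ennreal_leI)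
    qed auto
  qed
  also have "\<dots> \<le> ennreal M" by fact
  also have "\<dots> = ennreal (s\<^sup>2) * ennreal (M / s\<^sup>2)"
    using s M by (subst ennreal_mult[symmetric]) auto
  finally show ?thesis using s by (subst (asm) ennreal_mult_le_mult_iff) auto
qed

text \<open>The quadratic Taylor remainder of the kernel is uniform in its argument, so integrating
  it against \<open>g\<close> gives the expansion, and thereby the derivative, of the
  convolution.\<close>

lemma
  fixes \<kappa> g :: "'a::euclidean_space \<Rightarrow> real"
  assumes \<kappa>: "\<And>x. (\<kappa> has_derivative D x) (at x)" "\<And>x. \<bar>\<kappa> x\<bar> \<le> M0"
    and D: "\<And>x h. \<bar>D x h\<bar> \<le> M1 * norm h"
    and lip: "\<And>x y h. \<bar>D x h - D y h\<bar> \<le> L * norm (x - y) * norm h" and L: "L \<ge> 0"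
    and g: "g \<in> bdd_int"
  shows conv_C1_taylor: "\<bar>conv \<kappa> g (x + h) - conv \<kappa> g x - conv (\<lambda>z. D z h) g x\<bar> \<le> L * (\<integral>y. \<bar>g y\<bar> \<partial>lborel) * (norm h)\<^sup>2"
    and conv_C1_linear: "linear (\<lambda>h. conv (\<lambda>z. D z h) g x)"
    and conv_C1_lip: "\<bar>conv (\<lambda>z. D z h) g x - conv (\<lambda>z. D z h) g x'\<bar> \<le> L * (\<integral>y. \<bar>g y\<bar> \<partial>lborel) * norm (x - x') * norm h"
    and conv_C1_deriv: "(conv \<kappa> g has_derivative (\<lambda>h. conv (\<lambda>z. D z h) g x)) (at x)"
proof -
  have kc: "continuous_on UNIV \<kappa>"
    by (intro continuous_at_imp_continuous_on ballI has_derivative_continuous[OF \<kappa>(1)])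
  have [measurable]: "\<kappa> \<in> borel_measurable borel" by (rule borel_measurable_continuous_onI[OF kc])
  have Dm[measurable]: "(\<lambda>z. D z h) \<in> borel_measurable borel" for h
    by (rule borel_measurable_continuous_onI, rule continuous_if_lipschitz[of _ "L * norm h"])
       (use lip[of _ h] in \<open>auto simp: mult_ac\<close>)
  note gi = bdd_intD(2)[OF g]
  have ik: "integrable lborel (\<lambda>y. \<kappa> (x - y) * g y)" for x
    by (rule integrable_mult_bounded(2)[OF gi, of _ M0]) (use \<kappa> in auto)
  have iD: "integrable lborel (\<lambda>y. D (x - y) h * g y)" for x h
    by (rule integrable_mult_bounded(2)[OF gi, of _ "M1 * norm h"]) (use D in auto)
  have bnd: "\<bar>\<integral>y. f y * g y \<partial>lborel\<bar> \<le> b * (\<integral>y. \<bar>g y\<bar> \<partial>lborel)"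
    if "integrable lborel (\<lambda>y. f y * g y)" "\<And>y. \<bar>f y\<bar> \<le> b" for f b
  proof -
    have "\<bar>\<integral>y. f y * g y \<partial>lborel\<bar> \<le> (\<integral>y. \<bar>f y * g y\<bar> \<partial>lborel)" by (rule integral_abs_bound)
    also have "\<dots> \<le> (\<integral>y. b * \<bar>g y\<bar> \<partial>lborel)"
      using that gi by (intro integral_mono integrable_abs) (auto simp: abs_mult intro!: mult_right_mono)
    finally show ?thesis by simp
  qed
  show tay: "\<bar>conv \<kappa> g (x + h) - conv \<kappa> g x - conv (\<lambda>z. D z h) g x\<bar> \<le> L * (\<integral>y. \<bar>g y\<bar> \<partial>lborel) * (norm h)\<^sup>2" for x h
  proof -
    have i: "integrable lborel (\<lambda>y. (\<kappa> (x + h - y) - \<kappa> (x - y) - D (x - y) h) * g y)"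
      unfolding left_diff_distrib by (intro Bochner_Integration.integrable_diff ik iD)
    have "conv \<kappa> g (x + h) - conv \<kappa> g x - conv (\<lambda>z. D z h) g x = (\<integral>y. (\<kappa> (x + h - y) - \<kappa> (x - y) - D (x - y) h) * g y \<partial>lborel)"
      unfolding left_diff_distrib conv_def by (simp add: ik iD)
    also have "\<bar>\<dots>\<bar> \<le> (L * (norm h)\<^sup>2) * (\<integral>y. \<bar>g y\<bar> \<partial>lborel)"
    proof (rule bnd[OF i])
      show "\<bar>\<kappa> (x + h - y) - \<kappa> (x - y) - D (x - y) h\<bar> \<le> L * (norm h)\<^sup>2" for y
        using C1_lipschitz_derivative_taylor[OF \<kappa>(1) lip L, of "x - y" h] by (simp add: algebra_simps)
    qed
    finally show ?thesis by (simp add: mult_ac)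
  qed
  show lin: "linear (\<lambda>h. conv (\<lambda>z. D z h) g x)" for x
  proof (rule linearI)
    fix h h' and c :: real
    have l: "linear (D z)" for z by (rule has_derivative_linear[OF \<kappa>(1)])
    show "conv (\<lambda>z. D z (h + h')) g x = conv (\<lambda>z. D z h) g x + conv (\<lambda>z. D z h') g x"
      by (simp add: conv_def linear_add[OF l] ring_distribs iD)
    show "conv (\<lambda>z. D z (c *\<^sub>R h)) g x = c *\<^sub>R conv (\<lambda>z. D z h) g x"
      by (simp add: conv_def linear_cmul[OF l] mult.assoc)
  qed
  show "\<bar>conv (\<lambda>z. D z h) g x - conv (\<lambda>z. D z h) g x'\<bar> \<le> L * (\<integral>y. \<bar>g y\<bar> \<partial>lborel) * norm (x - x') * norm h"
  proof -
    have i: "integrable lborel (\<lambda>y. (D (x - y) h - D (x' - y) h) * g y)"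
      unfolding left_diff_distrib by (intro Bochner_Integration.integrable_diff iD)
    have "conv (\<lambda>z. D z h) g x - conv (\<lambda>z. D z h) g x' = (\<integral>y. (D (x - y) h - D (x' - y) h) * g y \<partial>lborel)"
      unfolding left_diff_distrib conv_def by (simp add: iD)
    also have "\<bar>\<dots>\<bar> \<le> (L * norm (x - x') * norm h) * (\<integral>y. \<bar>g y\<bar> \<partial>lborel)"
    proof (rule bnd[OF i])
      show "\<bar>D (x - y) h - D (x' - y) h\<bar> \<le> L * norm (x - x') * norm h" for y
        using lip[of "x - y" h "x' - y"] by simp
    qed
    finally show ?thesis by (simp add: mult_ac)
  qed
  show "(conv \<kappa> g has_derivative (\<lambda>h. conv (\<lambda>z. D z h) g x)) (at x)"
    unfolding has_derivative_at
  proof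
    show "bounded_linear (\<lambda>h. conv (\<lambda>z. D z h) g x)"
      using lin by (simp add: linear_conv_bounded_linear)
    show "(\<lambda>h. norm (conv \<kappa> g (x + h) - conv \<kappa> g x - conv (\<lambda>z. D z h) g x) / norm h) \<midarrow>0\<rightarrow> 0"
    proof (rule Lim_null_comparison)
      show "\<forall>\<^sub>F h in at 0. norm (norm (conv \<kappa> g (x + h) - conv \<kappa> g x - conv (\<lambda>z. D z h) g x) / norm h) \<le> L * (\<integral>y. \<bar>g y\<bar> \<partial>lborel) * norm h"
      proof (rule always_eventually, rule allI)
        fix h
        show "norm (norm (conv \<kappa> g (x + h) - conv \<kappa> g x - conv (\<lambda>z. D z h) g x) / norm h) \<le> L * (\<integral>y. \<bar>g y\<bar> \<partial>lborel) * norm h"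
        proof (cases "h = 0")
          case False
          then show ?thesis using tay[of x h]
            by (simp add: pos_divide_le_eq power2_eq_square mult.assoc)
        qed simp
      qed
      show "((\<lambda>h. L * (\<integral>y. \<bar>g y\<bar> \<partial>lborel) * norm h) \<longlongrightarrow> 0) (at (0::'a))"
        by (rule tendsto_eq_intros tendsto_norm_zero tendsto_ident_at refl)+ simp
    qed
  qed
qed

lemma geometric_increments:
  fixes b :: "nat \<Rightarrow> real"
  assumes inc: "\<And>j. \<bar>b (Suc j) - b j\<bar> \<le> C * q ^ j" and q: "0 \<le> q" "q \<le> 1/2" and C: "C \<ge> 0"
  shows "\<bar>b j - b 0\<bar> \<le> 2 * C"
proof -
  have "\<bar>b j - b 0\<bar> \<le> C * (\<Sum>i<j. q ^ i)"
  proof (induction j)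
    case (Suc j)
    then show ?case using inc[of j] by (simp add: algebra_simps)
  qed simp
  also have "\<dots> \<le> C * (\<Sum>i<j. (1/2) ^ i)" using q C by (intro mult_left_mono sum_mono power_mono)
  also have "\<dots> \<le> C * 2" using C by (intro mult_left_mono) (simp_all add: geometric_sum)
  finally show ?thesis by (simp add: mult.commute)
qed

lemma geometric_increments_limit:
  fixes b :: "nat \<Rightarrow> real"
  assumes inc: "\<And>j. l0 \<le> j \<Longrightarrow> \<bar>b (Suc j) - b j\<bar> \<le> C * (1/4) ^ j" and C: "C \<ge> 0"
  shows "convergent b" "\<And>k. l0 \<le> k \<Longrightarrow> \<bar>lim b - b k\<bar> \<le> 2 * C * (1/4) ^ k"
proof -
  have le: "\<bar>b (k + j) - b k\<bar> \<le> 2 * (C * (1/4) ^ k)" if "l0 \<le> k" for k j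
  proof -
    have "\<bar>b (Suc (k + i)) - b (k + i)\<bar> \<le> (C * (1/4) ^ k) * (1/4) ^ i" for i
      using inc[of "k + i"] that by (simp add: power_add mult.assoc)
    then show ?thesis
      using geometric_increments[of "\<lambda>j. b (k + j)" "C * (1/4) ^ k" "1/4" j] C by simp
  qed
  have "Cauchy b"
  proof (rule metric_CauchyI)
    fix e :: real assume e: "e > 0"
    have "(\<lambda>k. 4 * C * (1/4) ^ k) \<longlonglongrightarrow> 4 * C * 0"
      by (intro tendsto_intros LIMSEQ_power_zero) auto
    then have "\<forall>\<^sub>F k in sequentially. 4 * C * (1/4) ^ k < e" using e by (auto dest: order_tendstoD(2))
    then obtain k1 where k1: "\<And>k. k \<ge> k1 \<Longrightarrow> 4 * C * (1/4) ^ k < e" by (auto simp: eventually_sequentially)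
    define k where "k = max k1 l0"
    have "dist (b m) (b n) < e" if "m \<ge> k" "n \<ge> k" for m n
    proof -
      have "\<bar>b m - b k\<bar> \<le> 2 * (C * (1/4) ^ k)" "\<bar>b n - b k\<bar> \<le> 2 * (C * (1/4) ^ k)"
        using le[of k "m - k"] le[of k "n - k"] that by (auto simp: k_def)
      then show ?thesis using k1[of k] by (simp add: dist_real_def k_def)
    qed
    then show "\<exists>M. \<forall>m\<ge>M. \<forall>n\<ge>M. dist (b m) (b n) < e" by blast
  qed
  then show conv: "convergent b" by (rule Cauchy_convergent)
  then have lim: "b \<longlonglongrightarrow> lim b" by (simp add: convergent_LIMSEQ_iff)
  show "\<bar>lim b - b k\<bar> \<le> 2 * C * (1/4) ^ k" if "l0 \<le> k" for k
  proof (rule tendsto_upperbound)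
    show "(\<lambda>j. \<bar>b (j + k) - b k\<bar>) \<longlonglongrightarrow> \<bar>lim b - b k\<bar>"
      by (intro tendsto_intros LIMSEQ_ignore_initial_segment lim)
    show "\<forall>\<^sub>F j in sequentially. \<bar>b (j + k) - b k\<bar> \<le> 2 * C * (1/4) ^ k"
      using le[OF that] by (auto simp: add.commute mult.assoc)
  qed simp
qed

section \<open>Truncated potentials and the convergence of their gradients\<close>

context critical_kernel begin

lemma trunc_bound:
  assumes a: "a > 0" shows "\<bar>trunc a x\<bar> \<le> 4 * (A / a ^ (DIM('a) - 1))"
proof (cases "norm x \<le> a")
  case False
  then have x: "x \<noteq> 0" using a by auto
  have "A / norm x ^ (DIM('a) - 1) \<le> A / a ^ (DIM('a) - 1)"
    using False a x nonneg by (intro divide_left_mono power_mono mult_pos_pos zero_less_power) auto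
  moreover have "\<bar>trunc a x\<bar> \<le> \<bar>K x\<bar> + \<bar>K x - trunc a x\<bar>" by linarith
  ultimately show ?thesis using K_le[OF x] trunc_minus_le[OF a x] by linarith
qed (use a nonneg in \<open>auto simp: trunc_low\<close>)

lemma trunc_measurable [measurable]: "a > 0 \<Longrightarrow> trunc a \<in> borel_measurable borel"
  by (intro borel_measurable_continuous_onI continuous_at_imp_continuous_on ballI has_derivative_continuous[OF trunc_deriv])

lemma dtrunc_continuous: "a > 0 \<Longrightarrow> continuous_on UNIV (\<lambda>x. dtrunc a x h)"
  by (rule continuous_if_lipschitz[of _ "Ccut / a ^ (DIM('a) + 1) * norm h"]) (use dtrunc_lip[of a] in \<open>auto simp: mult_ac\<close>)

lemma K_minus_trunc:
  assumes a: "a > 0"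
  shows "integrable lborel (\<lambda>z. K z - trunc a z)"
    "(\<integral>z. \<bar>K z - trunc a z\<bar> \<partial>lborel) \<le> 3 * A * (unit_ball_vol (real DIM('a)) * 2 ^ DIM('a) * (2 * a))"
proof -
  have [measurable]: "trunc a \<in> borel_measurable borel" using a by simp
  let ?b = "unit_ball_vol (real DIM('a)) * 2 ^ DIM('a) * (2 * a)"
  have "(\<integral>\<^sup>+z. ennreal \<bar>K z - trunc a z\<bar> \<partial>lborel) \<le>
     (\<integral>\<^sup>+(z::'a). ennreal (3 * A) * (ennreal (1 / norm (z - 0) ^ (DIM('a) - 1)) * indicator (ball 0 (2 * a)) z) \<partial>lborel)"
  proof (rule nn_integral_mono_AE)
    show "AE z::'a in lborel. ennreal \<bar>K z - trunc a z\<bar> \<le> ennreal (3 * A) * (ennreal (1 / norm (z - 0) ^ (DIM('a) - 1)) * indicator (ball 0 (2 * a)) z)"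
      using AE_lborel_singleton[of 0]
    proof (rule AE_mp, intro AE_I2 impI)
      fix z :: 'a assume z: "z \<noteq> 0"
      show "ennreal \<bar>K z - trunc a z\<bar> \<le> ennreal (3 * A) * (ennreal (1 / norm (z - 0) ^ (DIM('a) - 1)) * indicator (ball 0 (2 * a)) z)"
      proof (cases "norm z < 2 * a")
        case True
        then show ?thesis using trunc_minus_le[OF a z] nonneg
          by (simp add: ennreal_mult[symmetric] ennreal_leI)
      qed (use trunc_high[OF a, of z] in auto)
    qed
  qed
  also have "\<dots> = ennreal (3 * A) * (\<integral>\<^sup>+(z::'a). ennreal (1 / norm (z - 0) ^ (DIM('a) - 1)) * indicator (ball 0 (2 * a)) z \<partial>lborel)"
    by (rule nn_integral_cmult) measurable
  also have "\<dots> \<le> ennreal (3 * A) * ennreal ?b"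
    using a by (intro mult_left_mono nn_integral_inverse_power_ball_le) auto
  also have "\<dots> = ennreal (3 * A * ?b)" using nonneg a by (intro ennreal_mult[symmetric]) auto
  finally have le: "(\<integral>\<^sup>+z. ennreal \<bar>K z - trunc a z\<bar> \<partial>lborel) \<le> ennreal (3 * A * ?b)" .
  show i: "integrable lborel (\<lambda>z. K z - trunc a z)"
    by (rule integrableI_bounded) (use le in \<open>auto simp: less_top[symmetric] top_unique\<close>)
  have "ennreal (\<integral>z. \<bar>K z - trunc a z\<bar> \<partial>lborel) \<le> ennreal (3 * A * ?b)"
    using le by (subst nn_integral_eq_integral[symmetric]) (use i in auto)
  then show "(\<integral>z. \<bar>K z - trunc a z\<bar> \<partial>lborel) \<le> 3 * A * ?b"
    using nonneg a by (subst (asm) ennreal_le_iff) auto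
qed

text \<open>\<open>K\<close> splits into an integrable part near 0 and a bounded part, and either
  can be integrated against a function in L^1 \<inter> L^\<infinity>. The error of truncation at a
  is O(a) at every point, so the later telescoping holds everywhere.\<close>

lemma
  assumes g: "g \<in> bdd_int"
  shows conv_K_integrable: "integrable lborel (\<lambda>y. K (x - y) * g y)"
    and conv_trunc_tendsto: "(\<lambda>n. conv (trunc (1 / 2 ^ n)) g x) \<longlonglongrightarrow> conv K g x"
proof -
  note [measurable] = bdd_intD(1)[OF g]
  obtain M where M: "M \<ge> 0" "\<And>x. \<bar>g x\<bar> \<le> M" using bdd_intD(3)[OF g] by blast
  have ik: "integrable lborel (\<lambda>y. trunc a (x - y) * g y)" if "a > 0" for a
    using that trunc_bound[OF that] by (intro integrable_mult_bounded(2)[OF bdd_intD(2)[OF g]]) auto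
  have iS: "integrable lborel (\<lambda>y. K (x - y) - trunc a (x - y))" if a: "a > 0" for a
  proof -
    have [measurable]: "trunc a \<in> borel_measurable borel" using a by simp
    show ?thesis using K_minus_trunc(1)[OF a] integrable_lborel_reflect[of "\<lambda>z. K z - trunc a z" x] by simp
  qed
  have id: "integrable lborel (\<lambda>y. (K (x - y) - trunc a (x - y)) * g y)" if a: "a > 0" for a
    by (rule integrable_mult_bounded(1)[OF iS[OF a], of _ M]) (use M in auto)
  have "integrable lborel (\<lambda>y. (K (x - y) - trunc 1 (x - y)) * g y + trunc 1 (x - y) * g y)"
    by (rule Bochner_Integration.integrable_add[OF id ik]) auto
  then show iK: "integrable lborel (\<lambda>y. K (x - y) * g y)" by (simp add: algebra_simps)
  define c where "c = 3 * A * (unit_ball_vol (real DIM('a)) * 2 ^ DIM('a) * 2) * M"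
  have le: "\<bar>conv (trunc a) g x - conv K g x\<bar> \<le> c * a" if a: "a > 0" for a
  proof -
    have [measurable]: "trunc a \<in> borel_measurable borel" using a by simp
    have "conv K g x - conv (trunc a) g x = (\<integral>y. (K (x - y) - trunc a (x - y)) * g y \<partial>lborel)"
      unfolding conv_def left_diff_distrib by (simp add: iK ik[OF a])
    also have "\<bar>\<dots>\<bar> \<le> (\<integral>y. \<bar>(K (x - y) - trunc a (x - y)) * g y\<bar> \<partial>lborel)" by (rule integral_abs_bound)
    also have "\<dots> \<le> (\<integral>y. \<bar>K (x - y) - trunc a (x - y)\<bar> * M \<partial>lborel)"
    proof (rule integral_mono)
      show "integrable lborel (\<lambda>y. \<bar>(K (x - y) - trunc a (x - y)) * g y\<bar>)" by (rule integrable_abs) (rule id[OF a])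
      show "integrable lborel (\<lambda>y. \<bar>K (x - y) - trunc a (x - y)\<bar> * M)"
        by (rule integrable_mult_left) (rule integrable_abs[OF iS[OF a]])
      show "\<bar>(K (x - y) - trunc a (x - y)) * g y\<bar> \<le> \<bar>K (x - y) - trunc a (x - y)\<bar> * M" for y
        using M by (auto simp: abs_mult intro!: mult_left_mono)
    qed
    also have "\<dots> = (\<integral>y. \<bar>K y - trunc a y\<bar> \<partial>lborel) * M"
      using integral_lborel_reflect[of "\<lambda>z. \<bar>K z - trunc a z\<bar>" x] by simp
    also have "\<dots> \<le> 3 * A * (unit_ball_vol (real DIM('a)) * 2 ^ DIM('a) * (2 * a)) * M"
      using K_minus_trunc(2)[OF a] M by (intro mult_right_mono)
    finally show ?thesis by (simp add: c_def mult_ac abs_minus_commute)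
  qed
  have t: "(\<lambda>n. c * (1 / 2 ^ n)) \<longlonglongrightarrow> c * 0"
    using LIMSEQ_power_zero[of "1/2 :: real"] by (intro tendsto_intros) (simp add: power_one_over)
  have "(\<lambda>n. conv (trunc (1 / 2 ^ n)) g x - conv K g x) \<longlonglongrightarrow> 0"
    by (rule Lim_null_comparison[where g = "\<lambda>n. c * (1 / 2 ^ n)"]) (use t le[of "1 / 2 ^ _"] in \<open>auto intro!: always_eventually\<close>)
  then show "(\<lambda>n. conv (trunc (1 / 2 ^ n)) g x) \<longlonglongrightarrow> conv K g x" by (simp add: LIM_zero_iff)
qed

definition trunc_conv :: "('a \<Rightarrow> real) \<Rightarrow> nat \<Rightarrow> 'a \<Rightarrow> real" where
  "trunc_conv g n = conv (trunc (1 / 2 ^ n)) g"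

definition trunc_conv_deriv :: "('a \<Rightarrow> real) \<Rightarrow> nat \<Rightarrow> 'a \<Rightarrow> 'a \<Rightarrow> real" where
  "trunc_conv_deriv g n x h = conv (\<lambda>z. dtrunc (1 / 2 ^ n) z h) g x"

lemma
  assumes g: "g \<in> bdd_int"
  shows trunc_conv_taylor: "\<exists>C\<ge>0. \<forall>x h. \<bar>trunc_conv g n (x + h) - trunc_conv g n x - trunc_conv_deriv g n x h\<bar> \<le> C * (norm h)\<^sup>2"
    and trunc_conv_deriv_linear: "linear (trunc_conv_deriv g n x)"
    and trunc_conv_deriv_cont: "continuous_on UNIV (\<lambda>x. trunc_conv_deriv g n x h)"
    and trunc_conv_has_derivative: "(trunc_conv g n has_derivative trunc_conv_deriv g n x) (at x)"
proof -
  let ?a = "1 / 2 ^ n :: real"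
  have a: "?a > 0" by simp
  have L: "Ccut / ?a ^ (DIM('a) + 1) \<ge> 0" using Ccut_nonneg(1) by auto
  note * = trunc_deriv[OF a] trunc_bound[OF a] dtrunc_le[OF a] dtrunc_lip[OF a] L g
  show "\<exists>C\<ge>0. \<forall>x h. \<bar>trunc_conv g n (x + h) - trunc_conv g n x - trunc_conv_deriv g n x h\<bar> \<le> C * (norm h)\<^sup>2"
    unfolding trunc_conv_def trunc_conv_deriv_def
    by (rule exI[of _ "Ccut / ?a ^ (DIM('a) + 1) * (\<integral>y. \<bar>g y\<bar> \<partial>lborel)"], intro conjI allI conv_C1_taylor[OF *])
       (rule mult_nonneg_nonneg[OF L], simp)
  show "linear (trunc_conv_deriv g n x)" unfolding trunc_conv_deriv_def by (rule conv_C1_linear[OF *])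
  show "continuous_on UNIV (\<lambda>x. trunc_conv_deriv g n x h)" unfolding trunc_conv_deriv_def
    by (rule continuous_if_lipschitz[of _ "Ccut / ?a ^ (DIM('a) + 1) * (\<integral>y. \<bar>g y\<bar> \<partial>lborel) * norm h"])
       (use conv_C1_lip[OF *] in \<open>simp add: mult_ac\<close>)
  show "(trunc_conv g n has_derivative trunc_conv_deriv g n x) (at x)" unfolding trunc_conv_def trunc_conv_deriv_def by (rule conv_C1_deriv[OF *])
qed

definition grad_gap :: "('a \<Rightarrow> real) \<Rightarrow> nat \<Rightarrow> nat \<Rightarrow> 'a \<Rightarrow> real" where
  "grad_gap g m m' x = (\<Sum>e\<in>Basis. (trunc_conv_deriv g m' x e - trunc_conv_deriv g m x e)\<^sup>2)"

lemma grad_gap_cont: "g \<in> bdd_int \<Longrightarrow> continuous_on UNIV (grad_gap g m m')"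
  unfolding grad_gap_def by (intro continuous_intros trunc_conv_deriv_cont)

lemma grad_gap_nonneg: "grad_gap g m m' x \<ge> 0"
  unfolding grad_gap_def by (auto intro: sum_nonneg)

text \<open>The gradient increments telescope into convolutions with shell kernels, to which the
  convergence of almost orthogonal series applies in each coordinate direction.\<close>

lemma grad_gap_Cauchy:
  assumes g: "g \<in> bdd_int" and \<delta>: "\<delta> > 0"
  shows "\<exists>n0. \<forall>m m'. n0 \<le> m \<longrightarrow> m \<le> m' \<longrightarrow> (\<integral>\<^sup>+x. ennreal (grad_gap g m m' x) \<partial>lborel) \<le> ennreal \<delta>"
proof -
  \<comment> \<open>Shares \<delta> among the N coordinates and undoes the normalisation by
    \<alpha>.\<close>
  define \<delta>' where "\<delta>' = \<delta> / (real DIM('a) * \<alpha>\<^sup>2)"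
  have \<delta>': "\<delta>' > 0" using \<delta> \<alpha>_pos by (auto simp: \<delta>'_def)
  have e1: "norm e \<le> 1" if "e \<in> Basis" for e :: 'a using that by simp
  have knV: "(\<lambda>x. shell_kernel e i x / \<alpha>) \<in> bdd_int" if "e \<in> Basis" for e i
    using osc_kernel_bdd_int(1)[OF shell_kernel_osc[OF e1[OF that]]] by simp
  have cknV: "conv (\<lambda>x. shell_kernel e i x / \<alpha>) g \<in> bdd_int" if "e \<in> Basis" for e i
    by (rule conv_bdd_int[OF knV[OF that] g])
  have iD: "integrable lborel (\<lambda>y. dtrunc a (x - y) h * g y)" if a: "a > 0" for a x h
  proof (rule integrable_mult_bounded(2)[OF bdd_intD(2)[OF g]])
    have [measurable]: "(\<lambda>x. dtrunc a x h) \<in> borel_measurable borel"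
      using dtrunc_continuous[OF a] by (rule borel_measurable_continuous_onI)
    show "(\<lambda>y. dtrunc a (x - y) h) \<in> borel_measurable lborel" by measurable
    show "\<bar>dtrunc a (x - y) h\<bar> \<le> Ccut / a ^ DIM('a) * norm h" for y by (rule dtrunc_le[OF a])
  qed
  have step: "trunc_conv_deriv g (Suc i) x e - trunc_conv_deriv g i x e = \<alpha> * conv (\<lambda>x. shell_kernel e i x / \<alpha>) g x" for i x e
  proof -
    have "trunc_conv_deriv g (Suc i) x e - trunc_conv_deriv g i x e = conv (shell_kernel e i) g x"
      unfolding trunc_conv_deriv_def conv_def shell_kernel_def left_diff_distrib
      by (rule Bochner_Integration.integral_diff[symmetric]) (rule iD, simp)+
    also have "\<dots> = \<alpha> * conv (\<lambda>x. shell_kernel e i x / \<alpha>) g x"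
      using conv_cmult[of \<alpha> "\<lambda>x. shell_kernel e i x / \<alpha>" g x] \<alpha>_pos by simp
    finally show ?thesis .
  qed
  have tel: "trunc_conv_deriv g m' x e - trunc_conv_deriv g m x e = \<alpha> * (\<Sum>i\<in>{m..<m'}. conv (\<lambda>x. shell_kernel e i x / \<alpha>) g x)" if "m \<le> m'" for m m' x e
    using that
  proof (induction m' rule: dec_induct)
    case (step i)
    then show ?case using \<open>\<And>i x e. trunc_conv_deriv g (Suc i) x e - trunc_conv_deriv g i x e = \<alpha> * conv (\<lambda>x. shell_kernel e i x / \<alpha>) g x\<close>[of i x e]
      by (simp add: algebra_simps)
  qed simp
  have "\<exists>n0. \<forall>m m'. n0 \<le> m \<longrightarrow>
     ip (\<lambda>x. \<Sum>i\<in>{m..<m'}. conv (\<lambda>x. shell_kernel e i x / \<alpha>) g x) (\<lambda>x. \<Sum>i\<in>{m..<m'}. conv (\<lambda>x. shell_kernel e i x / \<alpha>) g x) \<le> \<delta>'"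
    if "e \<in> Basis" for e
    by (rule osc_series_Cauchy[of 2]) (use shell_kernel_osc[OF e1[OF that]] g \<delta>' in auto)
  then obtain N where N: "\<And>e m m'. e \<in> Basis \<Longrightarrow> N e \<le> m \<Longrightarrow>
     ip (\<lambda>x. \<Sum>i\<in>{m..<m'}. conv (\<lambda>x. shell_kernel e i x / \<alpha>) g x) (\<lambda>x. \<Sum>i\<in>{m..<m'}. conv (\<lambda>x. shell_kernel e i x / \<alpha>) g x) \<le> \<delta>'"
    by metis
  define n0 where "n0 = Max (N ` Basis)"
  have n0: "N e \<le> n0" if "e \<in> Basis" for e unfolding n0_def using that by (intro Max_ge) auto
  show ?thesis
  proof (intro exI[of _ n0] allI impI)
    fix m m' assume m: "n0 \<le> m" "m \<le> m'"
    define F where "F e x = (\<Sum>i\<in>{m..<m'}. conv (\<lambda>x. shell_kernel e i x / \<alpha>) g x)" for e x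
    have FV: "F e \<in> bdd_int" if "e \<in> Basis" for e
      unfolding F_def[abs_def] by (intro bdd_int_sum cknV that)
    have D: "grad_gap g m m' x = (\<Sum>e\<in>Basis. \<alpha>\<^sup>2 * (F e x * F e x))" for x
      unfolding grad_gap_def tel[OF m(2)] F_def by (simp add: power2_eq_square mult_ac)
    have i: "integrable lborel (grad_gap g m m')"
      unfolding D[abs_def] by (intro Bochner_Integration.integrable_sum integrable_mult_right bdd_int_mult_integrable FV)
    have "(\<integral>x. grad_gap g m m' x \<partial>lborel) = (\<Sum>e\<in>Basis. \<alpha>\<^sup>2 * ip (F e) (F e))"
      unfolding D ip_def using bdd_int_mult_integrable[OF FV FV] by (simp add: Bochner_Integration.integral_sum)
    also have "\<dots> \<le> (\<Sum>e\<in>(Basis :: 'a set). \<alpha>\<^sup>2 * \<delta>')"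
      unfolding F_def using N[OF _ order_trans[OF n0 m(1)]] by (intro sum_mono mult_left_mono) auto
    also have "\<dots> = \<delta>" using \<alpha>_pos by (simp add: \<delta>'_def)
    finally have "(\<integral>x. grad_gap g m m' x \<partial>lborel) \<le> \<delta>" .
    then show "(\<integral>\<^sup>+x. ennreal (grad_gap g m m' x) \<partial>lborel) \<le> ennreal \<delta>"
      using nn_integral_eq_integral[OF i] grad_gap_nonneg by (simp add: ennreal_leI)
  qed
qed

text \<open>Two facts follow from the control on all balls about y: the increments of the gradient
  at y itself decay like 4^-l, so they have a limit L, and the square of the oscillation of the l-th
  increment of the potential integrates to at most 16^-l r^(N+2). The potential is then a truncated
  one, differentiable in the ordinary sense, plus the sum of the later increments.\<close>

lemma good_part_at_point:
  fixes n :: "nat \<Rightarrow> nat"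
  assumes g: "g \<in> bdd_int" and n: "strict_mono n"
    and M: "\<And>l r. l0 \<le> l \<Longrightarrow> r > 0 \<Longrightarrow>
      (\<integral>\<^sup>+x. ennreal (grad_gap g (n l) (n (Suc l)) x) * indicator (ball y r) x \<partial>lborel) \<le> ennreal ((1/16) ^ l * r ^ DIM('a))"
  shows "\<exists>L. linear L \<and> weakly_diff (conv K g) y L"
proof -
  let ?\<omega> = "unit_ball_vol (real DIM('a))"
  have \<omega>: "?\<omega> > 0" by simp
  \<comment> \<open>A continuous function is bounded at y by its averages over small balls, and the
    hypothesis controls these.\<close>
  have DDy: "grad_gap g (n l) (n (Suc l)) y \<le> (1/16) ^ l / ?\<omega>" if l: "l0 \<le> l" for l
  proof (rule ccontr)
    assume "\<not> grad_gap g (n l) (n (Suc l)) y \<le> (1/16) ^ l / ?\<omega>"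
    then obtain c where c: "(1/16) ^ l / ?\<omega> < c" "c < grad_gap g (n l) (n (Suc l)) y" using dense not_le by metis
    have "isCont (grad_gap g (n l) (n (Suc l))) y"
      using grad_gap_cont[OF g] by (simp add: continuous_on_eq_continuous_at)
    then have "(grad_gap g (n l) (n (Suc l)) \<longlongrightarrow> grad_gap g (n l) (n (Suc l)) y) (nhds y)"
      by (simp add: continuous_within tendsto_at_iff_tendsto_nhds)
    then have "\<forall>\<^sub>F x in nhds y. c < grad_gap g (n l) (n (Suc l)) x" using c(2) by (rule order_tendstoD(1))
    then obtain r where r: "r > 0" "\<And>x. dist x y < r \<Longrightarrow> c < grad_gap g (n l) (n (Suc l)) x"
      by (auto simp: eventually_nhds_metric)
    have c0: "c > 0" using c(1) \<omega> by (auto intro: less_trans[rotated] divide_pos_pos)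
    have "ennreal (c * (?\<omega> * r ^ DIM('a))) = (\<integral>\<^sup>+x. ennreal c * indicator (ball y r) x \<partial>lborel)"
      using r c0 by (simp add: nn_integral_cmult_indicator emeasure_ball ennreal_mult)
    also have "\<dots> \<le> (\<integral>\<^sup>+x. ennreal (grad_gap g (n l) (n (Suc l)) x) * indicator (ball y r) x \<partial>lborel)"
      using r(2) by (intro nn_integral_mono) (auto simp: dist_commute less_imp_le intro!: ennreal_leI split: split_indicator)
    also have "\<dots> \<le> ennreal ((1/16) ^ l * r ^ DIM('a))" by (rule M[OF l r(1)])
    finally have "c * (?\<omega> * r ^ DIM('a)) \<le> (1/16) ^ l * r ^ DIM('a)"
      using r by (subst (asm) ennreal_le_iff) auto
    then have "c * ?\<omega> \<le> (1/16) ^ l" using r by (simp add: mult.assoc[symmetric])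
    then show False using c(1) \<omega> by (simp add: pos_divide_less_eq)
  qed
  define c0 where "c0 = sqrt (1 / ?\<omega>)"
  have c0: "c0 \<ge> 0" "c0\<^sup>2 = 1 / ?\<omega>" using \<omega> by (auto simp: c0_def)
  have Vinc: "\<bar>trunc_conv_deriv g (n (Suc l)) y h - trunc_conv_deriv g (n l) y h\<bar> \<le> (c0 * norm h) * (1/4) ^ l" if l: "l0 \<le> l" for l h
  proof (rule power2_le_imp_le)
    have "linear (\<lambda>h. trunc_conv_deriv g (n (Suc l)) y h - trunc_conv_deriv g (n l) y h)"
      by (intro linear_compose_sub trunc_conv_deriv_linear g)
    from linear_square_le[OF this, of h]
    have "(trunc_conv_deriv g (n (Suc l)) y h - trunc_conv_deriv g (n l) y h)\<^sup>2 \<le> (norm h)\<^sup>2 * grad_gap g (n l) (n (Suc l)) y" by (simp add: grad_gap_def)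
    also have "\<dots> \<le> (norm h)\<^sup>2 * ((1/16) ^ l / ?\<omega>)" by (intro mult_left_mono DDy l) auto
    also have "\<dots> = ((c0 * norm h) * (1/4) ^ l)\<^sup>2"
      using c0(2) by (simp add: power_mult_distrib power_even_eq[symmetric] power2_eq_square[of "1/4 :: real"] power_mult[symmetric] mult.commute[of l 2]) (simp add: power_mult power2_eq_square)
    finally show "\<bar>trunc_conv_deriv g (n (Suc l)) y h - trunc_conv_deriv g (n l) y h\<bar>\<^sup>2 \<le> ((c0 * norm h) * (1/4) ^ l)\<^sup>2" by simp
  qed (use c0 in auto)
  define L where "L h = lim (\<lambda>l. trunc_conv_deriv g (n l) y h)" for h
  have conv: "convergent (\<lambda>l. trunc_conv_deriv g (n l) y h)" for h
    by (rule geometric_increments_limit(1)[of l0 _ "c0 * norm h"]) (use Vinc c0 in auto)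
  have Llim: "(\<lambda>l. trunc_conv_deriv g (n l) y h) \<longlonglongrightarrow> L h" for h
    unfolding L_def using conv by (simp add: convergent_LIMSEQ_iff)
  have Lk: "\<bar>L h - trunc_conv_deriv g (n k) y h\<bar> \<le> 2 * (c0 * norm h) * (1/4) ^ k" if "l0 \<le> k" for h k
    unfolding L_def by (rule geometric_increments_limit(2)[of l0 _ "c0 * norm h"]) (use Vinc c0 that in auto)
  have Llin: "linear L"
  proof (rule linearI)
    fix h h' and c :: real
    have "(\<lambda>l. trunc_conv_deriv g (n l) y (h + h')) \<longlonglongrightarrow> L h + L h'"
      using tendsto_add[OF Llim Llim] by (simp add: linear_add[OF trunc_conv_deriv_linear[OF g]])
    then show "L (h + h') = L h + L h'" using LIMSEQ_unique Llim by blast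
    have "(\<lambda>l. trunc_conv_deriv g (n l) y (c *\<^sub>R h)) \<longlonglongrightarrow> c *\<^sub>R L h"
      using tendsto_scaleR[OF tendsto_const Llim] by (simp add: linear_cmul[OF trunc_conv_deriv_linear[OF g]])
    then show "L (c *\<^sub>R h) = c *\<^sub>R L h" using LIMSEQ_unique Llim by blast
  qed
  have Um[measurable]: "trunc_conv g k \<in> borel_measurable borel" for k
    by (intro borel_measurable_continuous_onI continuous_at_imp_continuous_on ballI has_derivative_continuous[OF trunc_conv_has_derivative[OF g]])
  have Ulim: "(\<lambda>l. trunc_conv g (n l) x) \<longlonglongrightarrow> conv K g x" for x
    using LIMSEQ_subseq_LIMSEQ[OF conv_trunc_tendsto[OF g] n] by (simp add: trunc_conv_def o_def)
  define W where "W l x = trunc_conv g (n (Suc l)) x - trunc_conv g (n l) x" for l x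
  have Wm: "W l \<in> borel_measurable borel" for l unfolding W_def[abs_def] by measurable
  have Wosc: "(\<integral>\<^sup>+x. ennreal ((W l x - W l y)\<^sup>2) * indicator (ball y r) x \<partial>lborel) \<le> ennreal ((1/16) ^ l * r ^ (DIM('a) + 2))"
    if "l0 \<le> l" "r > 0" for l r
  proof (rule C1_oscillation_L2)
    show "(W l has_derivative (\<lambda>h. trunc_conv_deriv g (n (Suc l)) x h - trunc_conv_deriv g (n l) x h)) (at x)" for x
      unfolding W_def[abs_def] by (intro has_derivative_diff trunc_conv_has_derivative g)
    show "continuous_on UNIV (\<lambda>x. trunc_conv_deriv g (n (Suc l)) x h - trunc_conv_deriv g (n l) x h)" for h
      by (intro continuous_intros trunc_conv_deriv_cont g)
    show "(\<integral>\<^sup>+x. ennreal (\<Sum>e\<in>Basis. (trunc_conv_deriv g (n (Suc l)) x e - trunc_conv_deriv g (n l) x e)\<^sup>2) * indicator (ball y r) x \<partial>lborel) \<le> ennreal ((1/16) ^ l * r ^ DIM('a))"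
      if "r > 0" for r using M[OF \<open>l0 \<le> l\<close> that] by (simp add: grad_gap_def)
  qed (use that in auto)
  have "weakly_diff (conv K g) y L"
  proof (rule weakly_diffI_L2[OF dim])
    fix \<epsilon> :: real assume \<epsilon>: "\<epsilon> > 0"
    have t1: "(\<lambda>k. 2 * c0 * (1/4) ^ k) \<longlonglongrightarrow> 2 * c0 * 0" by (intro tendsto_intros LIMSEQ_power_zero) auto
    have t2: "(\<lambda>k. 48 * (1/16) ^ k) \<longlonglongrightarrow> 48 * (0::real)" by (intro tendsto_intros LIMSEQ_power_zero) auto
    have "\<forall>\<^sub>F k in sequentially. 2 * c0 * (1/4) ^ k < \<epsilon> / 3 \<and> 48 * (1/16) ^ k < \<epsilon> \<and> l0 \<le> k"
      by (intro eventually_conj eventually_ge_at_top order_tendstoD(2)[OF t1] order_tendstoD(2)[OF t2]) (use \<epsilon> in auto)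
    \<comment> \<open>\<open>k\<close> fixes the truncation that serves as main term: the first
      condition makes the error of its gradient at y less than \<epsilon>/3 per unit length, the
      second bounds the exceptional measure, with 48 = 36 times 4/3.\<close>
    then obtain k where k: "2 * c0 * (1/4) ^ k < \<epsilon> / 3" "48 * (1/16) ^ k < \<epsilon>" "l0 \<le> k"
      by (auto simp: eventually_sequentially)
    obtain C where C: "C \<ge> 0" "\<And>x h. \<bar>trunc_conv g (n k) (x + h) - trunc_conv g (n k) x - trunc_conv_deriv g (n k) x h\<bar> \<le> C * (norm h)\<^sup>2"
      using trunc_conv_taylor[OF g] by blast
    define \<delta> where "\<delta> = \<epsilon> / (3 * (C + 1))"
    have \<delta>: "\<delta> > 0" "C * \<delta> \<le> \<epsilon> / 3" using C(1) \<epsilon> by (auto simp: \<delta>_def field_simps)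
    show "\<exists>\<delta>>0. \<forall>r s. 0 < r \<longrightarrow> r < \<delta> \<longrightarrow> \<epsilon> * r \<le> s \<longrightarrow>
       (\<exists>S\<in>sets borel. {x \<in> ball y r. s < \<bar>conv K g x - conv K g y - L (x - y)\<bar>} \<subseteq> S \<and>
          emeasure lborel S \<le> ennreal (\<epsilon> * r ^ (DIM('a) + 2) / s\<^sup>2))"
    proof (intro exI[of _ \<delta>] conjI allI impI)
      fix r s :: real assume r: "0 < r" "r < \<delta>" and s: "\<epsilon> * r \<le> s"
      have s0: "s > 0" using \<epsilon> r s by (meson less_le_trans mult_pos_pos)
      \<comment> \<open>The thresholds sum to s/3. Their squares decrease like 4^-j against energies
        16^-j, so the Chebyshev bounds 4^-j are summable.\<close>
      define \<sigma> where "\<sigma> j = s / 6 * (1/2) ^ j" for j :: nat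
      have \<sigma>: "\<sigma> j > 0" for j using s0 by (simp add: \<sigma>_def)
      define S where "S j = {x \<in> ball y r. \<sigma> j < \<bar>W (k + j) x - W (k + j) y\<bar>}" for j
      have Sm: "S j \<in> sets borel" for j unfolding S_def using Wm by measurable
      define E where "E = 36 * ((1/16) ^ k * r ^ (DIM('a) + 2)) / s\<^sup>2"
      have E0: "E \<ge> 0" using r s0 by (simp add: E_def)
      have ES: "emeasure lborel (S j) \<le> ennreal (E * (1/4) ^ j)" for j
      proof -
        have "emeasure lborel (S j) \<le> ennreal ((1/16) ^ (k + j) * r ^ (DIM('a) + 2) / (\<sigma> j)\<^sup>2)"
          unfolding S_def by (rule emeasure_oscillation_le[OF Wm \<sigma>]) (use Wosc k(3) r in auto)
        also have "(1/16) ^ (k + j) * r ^ (DIM('a) + 2) / (\<sigma> j)\<^sup>2 = E * (1/4) ^ j"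
        proof -
          have "(1/16::real) ^ j = (1/4) ^ j * (1/4) ^ j" by (simp add: power_mult_distrib[symmetric])
          moreover have "((1/2::real) ^ j)\<^sup>2 = (1/4) ^ j"
            by (simp add: power2_eq_square power_mult_distrib[symmetric])
          ultimately show ?thesis
            using s0 by (simp add: \<sigma>_def E_def power_mult_distrib power_divide power_add mult_ac)
        qed
        finally show ?thesis .
      qed
      show "\<exists>S\<in>sets borel. {x \<in> ball y r. s < \<bar>conv K g x - conv K g y - L (x - y)\<bar>} \<subseteq> S \<and>
          emeasure lborel S \<le> ennreal (\<epsilon> * r ^ (DIM('a) + 2) / s\<^sup>2)"
      proof (intro bexI[of _ "\<Union>j. S j"] conjI)
        show "(\<Union>j. S j) \<in> sets borel" using Sm by auto
        have "emeasure lborel (\<Union>j. S j) \<le> (\<Sum>j. emeasure lborel (S j))"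
          by (rule emeasure_subadditive_countably) (use Sm in auto)
        also have "\<dots> \<le> (\<Sum>j. ennreal (E * (1/4) ^ j))" by (intro suminf_le ES) auto
        also have "\<dots> = ennreal (E * (1 / (1 - 1/4)))"
        proof (rule suminf_ennreal_eq)
          show "(\<lambda>j. E * (1/4) ^ j) sums (E * (1 / (1 - 1/4)))"
            by (intro sums_mult geometric_sums) simp
        qed (use E0 in auto)
        also have "\<dots> \<le> ennreal (\<epsilon> * r ^ (DIM('a) + 2) / s\<^sup>2)"
        proof (rule ennreal_leI)
          have "E * (1 / (1 - 1/4)) = (48 * (1/16) ^ k) * (r ^ (DIM('a) + 2) / s\<^sup>2)" by (simp add: E_def)
          also have "\<dots> \<le> \<epsilon> * (r ^ (DIM('a) + 2) / s\<^sup>2)" using k(2) r by (intro mult_right_mono) auto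
          finally show "E * (1 / (1 - 1/4)) \<le> \<epsilon> * r ^ (DIM('a) + 2) / s\<^sup>2" by simp
        qed
        finally show "emeasure lborel (\<Union>j. S j) \<le> ennreal (\<epsilon> * r ^ (DIM('a) + 2) / s\<^sup>2)" .
        show "{x \<in> ball y r. s < \<bar>conv K g x - conv K g y - L (x - y)\<bar>} \<subseteq> (\<Union>j. S j)"
        proof (rule subsetI, rule ccontr)
          fix x assume x: "x \<in> {x \<in> ball y r. s < \<bar>conv K g x - conv K g y - L (x - y)\<bar>}" and nS: "x \<notin> (\<Union>j. S j)"
          have xr: "norm (x - y) < r" using x by (simp add: dist_norm norm_minus_commute)
          \<comment> \<open>Each of the claims 1, 2 and 3 spends a third of the level: on the later
            increments, on the Taylor remainder of the main term and on the error of its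
            gradient.\<close>
          define b where "b j = trunc_conv g (n (k + j)) x - trunc_conv g (n (k + j)) y" for j
          have "\<bar>b j - b 0\<bar> \<le> 2 * (s / 6)" for j
          proof (rule geometric_increments[of b "s / 6" "1/2"])
            fix j
            have "\<bar>W (k + j) x - W (k + j) y\<bar> \<le> \<sigma> j" using nS x by (force simp: S_def not_less)
            then show "\<bar>b (Suc j) - b j\<bar> \<le> s / 6 * (1/2) ^ j" by (simp add: b_def W_def \<sigma>_def algebra_simps)
          qed (use s0 in auto)
          moreover have "(\<lambda>j. \<bar>b j - b 0\<bar>) \<longlonglongrightarrow> \<bar>(conv K g x - conv K g y) - b 0\<bar>"
            unfolding b_def using LIMSEQ_ignore_initial_segment[OF Ulim, where k = k]
            by (intro tendsto_intros) (simp_all add: add.commute)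
          ultimately have 1: "\<bar>(conv K g x - conv K g y) - b 0\<bar> \<le> s / 3"
            by (intro LIMSEQ_le_const2[of "\<lambda>j. \<bar>b j - b 0\<bar>"]) auto
          have "\<bar>b 0 - trunc_conv_deriv g (n k) y (x - y)\<bar> \<le> C * (norm (x - y))\<^sup>2"
            using C(2)[of y "x - y"] by (simp add: b_def)
          also have "\<dots> \<le> C * (\<delta> * r)"
            using C(1) xr r unfolding power2_eq_square by (intro mult_left_mono mult_mono) auto
          also have "\<dots> = C * \<delta> * r" by simp
          also have "\<dots> \<le> \<epsilon> / 3 * r" using \<delta>(2) r by (intro mult_right_mono) auto
          finally have 2: "\<bar>b 0 - trunc_conv_deriv g (n k) y (x - y)\<bar> \<le> s / 3" using s by simp
          have "\<bar>L (x - y) - trunc_conv_deriv g (n k) y (x - y)\<bar> \<le> (2 * c0 * (1/4) ^ k) * norm (x - y)"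
            using Lk[OF k(3), of "x - y"] by (simp add: mult_ac)
          also have "\<dots> \<le> \<epsilon> / 3 * r" using k(1) xr c0 \<epsilon> by (intro mult_mono) auto
          finally have 3: "\<bar>L (x - y) - trunc_conv_deriv g (n k) y (x - y)\<bar> \<le> s / 3" using s by simp
          have "\<bar>conv K g x - conv K g y - L (x - y)\<bar> \<le> s" using 1 2 3 by linarith
          then show False using x by simp
        qed
      qed
    qed (rule \<delta>(1))
  qed
  with Llin show ?thesis by blast
qed

text \<open>The scales are so sparse that the l-th gradient increment has energy at most 1024^-l.
  The maximal function exceeds 16^-l only on a set of measure O(64^-l), and by Borel-Cantelli almost
  every y lies in finitely many of these sets.\<close>

lemma good_part:
  assumes g: "g \<in> bdd_int"
  shows "AE y in lborel. \<exists>L. linear L \<and> weakly_diff (conv K g) y L"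
proof -
  let ?c = "unit_ball_vol (real DIM('a)) * 5 ^ DIM('a)"
  have "\<exists>n0. \<forall>m m'. n0 \<le> m \<longrightarrow> m \<le> m' \<longrightarrow> (\<integral>\<^sup>+x. ennreal (grad_gap g m m' x) \<partial>lborel) \<le> ennreal ((1/1024) ^ l)" for l :: nat
    by (rule grad_gap_Cauchy[OF g]) simp
  then obtain N where N: "\<And>l m m'. N l \<le> m \<Longrightarrow> m \<le> m' \<Longrightarrow> (\<integral>\<^sup>+x. ennreal (grad_gap g m m' x) \<partial>lborel) \<le> ennreal ((1/1024) ^ l)"
    by metis
  \<comment> \<open>Partial sums dominate each \<open>N l\<close>, and the added 1 makes them
    strictly increasing.\<close>
  define n where "n l = (\<Sum>i\<le>l. N i + 1)" for l
  have n: "strict_mono n" by (rule strict_monoI_Suc) (simp add: n_def)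
  have nN: "N l \<le> n l" for l
  proof -
    have "N l + 1 \<le> n l" unfolding n_def by (rule member_le_sum) auto
    then show ?thesis by simp
  qed
  define \<nu> where "\<nu> l = density lborel (\<lambda>x. ennreal (grad_gap g (n l) (n (Suc l)) x))" for l
  have Dm[measurable]: "grad_gap g m m' \<in> borel_measurable borel" for m m'
    by (rule borel_measurable_continuous_onI[OF grad_gap_cont[OF g]])
  have sets: "sets (\<nu> l) = sets borel" for l by (simp add: \<nu>_def)
  have em: "emeasure (\<nu> l) A = (\<integral>\<^sup>+x. ennreal (grad_gap g (n l) (n (Suc l)) x) * indicator A x \<partial>lborel)" if "A \<in> sets borel" for l A
    unfolding \<nu>_def by (rule emeasure_density) (use that in auto)
  have tot: "emeasure (\<nu> l) UNIV \<le> ennreal ((1/1024) ^ l)" for l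
    using N[OF nN strict_mono_leD[OF n]] by (simp add: em)
  have fin: "finite_measure (\<nu> l)" for l
    using tot[of l] by (intro finite_measureI) (auto simp: \<nu>_def space_density top_unique)
  define A where "A l = large_ball_set (\<nu> l) ((1/16) ^ l)" for l
  have [measurable, simp]: "A l \<in> sets borel" for l
    unfolding A_def using open_large_ball_set[OF sets] by auto
  have Ale: "emeasure lborel (A l) \<le> ennreal (?c * (1/64) ^ l)" for l
  proof -
    have "emeasure lborel (A l) \<le> ennreal (?c / (1/16) ^ l) * emeasure (\<nu> l) UNIV"
      unfolding A_def by (rule emeasure_large_ball_set[OF sets fin]) simp
    also have "\<dots> \<le> ennreal (?c / (1/16) ^ l) * ennreal ((1/1024) ^ l)"
      by (intro mult_left_mono tot) auto
    also have "\<dots> = ennreal (?c / (1/16) ^ l * (1/1024) ^ l)"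
      by (subst ennreal_mult[symmetric]) auto
    also have "?c / (1/16) ^ l * (1/1024) ^ l = ?c * (1/64) ^ l"
    proof -
      have "(1/1024::real) ^ l = (1/16) ^ l * (1/64) ^ l" by (simp add: power_mult_distrib[symmetric])
      then show ?thesis by simp
    qed
    finally show ?thesis .
  qed
  have "AE y in lborel. eventually (\<lambda>l. y \<in> space lborel - A l) sequentially"
  proof (rule borel_cantelli_AE1)
    show "emeasure lborel (A l) < \<infinity>" for l using Ale[of l] by (auto simp: less_top[symmetric] top_unique)
    show "summable (\<lambda>l. measure lborel (A l))"
    proof (rule summable_comparison_test')
      show "summable (\<lambda>l. ?c * (1/64) ^ l)" by (intro summable_mult summable_geometric) auto
      show "norm (measure lborel (A l)) \<le> ?c * (1/64) ^ l" for l
        using Ale[of l] by (simp add: measure_def enn2real_leI)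
    qed
  qed simp
  then show ?thesis
  proof (rule AE_mp, intro AE_I2 impI)
    fix y assume "eventually (\<lambda>l. y \<in> space lborel - A l) sequentially"
    then obtain l0 where l0: "\<And>l. l0 \<le> l \<Longrightarrow> y \<notin> A l" by (auto simp: eventually_sequentially)
    show "\<exists>L. linear L \<and> weakly_diff (conv K g) y L"
    proof (rule good_part_at_point[OF g n])
      fix l r assume "l0 \<le> l" "(r::real) > 0"
      then have "emeasure (\<nu> l) (ball y r) \<le> ennreal ((1/16) ^ l * r ^ DIM('a))"
        using l0 unfolding A_def large_ball_set_def mem_Collect_eq not_ex de_Morgan_conj not_less
        by (metis not_le)
      then show "(\<integral>\<^sup>+x. ennreal (grad_gap g (n l) (n (Suc l)) x) * indicator (ball y r) x \<partial>lborel) \<le> ennreal ((1/16) ^ l * r ^ DIM('a))"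
        by (simp add: em)
    qed
  qed
qed

end

section \<open>Differences of the kernel at nearby poles\<close>

context critical_kernel begin

text \<open>The map \<xi> |-> K(\<xi> - z) - K(\<xi> - z') has derivative of size B |z - z'|/m^(N+1)
  by the Lipschitz bound on \<open>DK\<close>. The mean value inequality from y to x then gives a
  factor |z - z'| where the expansion at a single pole gives |x - y|.\<close>

lemma difference_taylor:
  assumes m: "m > 0" and seg: "\<And>\<xi> \<eta>. \<xi> \<in> closed_segment y x \<Longrightarrow> \<eta> \<in> closed_segment z z' \<Longrightarrow> m \<le> norm (\<xi> - \<eta>)"
  shows "\<bar>(K (x - z) - K (x - z')) - (K (y - z) - K (y - z')) - (DK (y - z) (x - y) - DK (y - z') (x - y))\<bar>
       \<le> 2 * (B / m ^ (DIM('a) + 1) * norm (z - z')) * norm (x - y)"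
proof -
  have D: "norm (DK (\<xi> - z) - DK (\<xi> - z')) \<le> B / m ^ (DIM('a) + 1) * norm (z - z')" if \<xi>: "\<xi> \<in> closed_segment y x" for \<xi>
  proof -
    have "norm (DK (\<xi> - z) - DK (\<xi> - z')) \<le> B / m ^ (DIM('a) + 1) * norm ((\<xi> - z) - (\<xi> - z'))"
    proof (rule DK_lip[OF m])
      fix q assume "q \<in> closed_segment (\<xi> - z) (\<xi> - z')"
      then obtain u where u: "0 \<le> u" "u \<le> 1" "q = (1 - u) *\<^sub>R (\<xi> - z) + u *\<^sub>R (\<xi> - z')" by (auto simp: in_segment)
      then have "q = \<xi> - ((1 - u) *\<^sub>R z + u *\<^sub>R z')" by (simp add: algebra_simps)
      moreover have "(1 - u) *\<^sub>R z + u *\<^sub>R z' \<in> closed_segment z z'" using u by (auto simp: in_segment)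
      ultimately show "m \<le> norm q" using seg[OF \<xi>] by blast
    qed
    then show ?thesis by (simp add: norm_minus_commute)
  qed
  let ?f' = "\<lambda>\<xi>. blinfun_apply (DK (\<xi> - z) - DK (\<xi> - z'))"
  let ?S = "closed_segment y x"
  have 1: "y + t *\<^sub>R (x - y) \<in> ?S" if "t \<in> {0..1}" for t
    using that by (auto simp: in_segment algebra_simps intro!: exI[of _ t])
  have 2: "((\<lambda>\<xi>. K (\<xi> - z) - K (\<xi> - z')) has_derivative ?f' \<xi>) (at \<xi> within ?S)" if \<xi>: "\<xi> \<in> ?S" for \<xi>
  proof -
    have nz: "\<xi> - z \<noteq> 0" "\<xi> - z' \<noteq> 0" using seg[OF \<xi>, of z] seg[OF \<xi>, of z'] m by auto
    have d: "((\<lambda>\<xi>. K (\<xi> - w)) has_derivative blinfun_apply (DK (\<xi> - w))) (at \<xi>)" if "\<xi> - w \<noteq> 0" for w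
    proof -
      have "((\<lambda>\<xi>. \<xi> - w) has_derivative (\<lambda>h. h)) (at \<xi>)" by (auto intro!: derivative_eq_intros)
      from has_derivative_compose[OF this K_deriv[OF that]] show ?thesis by simp
    qed
    have "?f' \<xi> = (\<lambda>h. DK (\<xi> - z) h - DK (\<xi> - z') h)" by (simp add: fun_eq_iff blinfun.diff_left)
    then show ?thesis
      using has_derivative_at_withinI[OF has_derivative_diff[OF d[OF nz(1)] d[OF nz(2)]]] by simp
  qed
  have 3: "onorm (?f' \<xi> - ?f' y) \<le> 2 * (B / m ^ (DIM('a) + 1) * norm (z - z'))" if \<xi>: "\<xi> \<in> ?S" for \<xi>
  proof -
    have "onorm (?f' \<xi> - ?f' y) = norm ((DK (\<xi> - z) - DK (\<xi> - z')) - (DK (y - z) - DK (y - z')))"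
      by (simp add: norm_blinfun.rep_eq minus_blinfun.rep_eq fun_diff_def)
    also have "\<dots> \<le> norm (DK (\<xi> - z) - DK (\<xi> - z')) + norm (DK (y - z) - DK (y - z'))"
      by (rule norm_triangle_ineq4)
    also have "\<dots> \<le> 2 * (B / m ^ (DIM('a) + 1) * norm (z - z'))" unfolding mult_2 by (intro add_mono D \<xi>) simp
    finally show ?thesis .
  qed
  have 4: "y \<in> ?S" by simp
  show ?thesis
    using differentiable_bound_linearization[where f = "\<lambda>\<xi>. K (\<xi> - z) - K (\<xi> - z')" and f' = ?f', OF 1 2 3 4]
    by (simp add: blinfun.diff_left mult_ac)
qed

text \<open>Displacing the pole gains d, and expanding separately at each pole gains r. The minimum
  tends to 0 with r for each fixed pole while staying below d, which permits dominated convergence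
  in the Marcinkiewicz integral.\<close>

lemma far_estimate:
  assumes \<rho>: "\<rho> = norm (y - z)" "\<rho> > 0" and d: "norm (z - z') \<le> d" "4 * d \<le> \<rho>" and x: "norm (x - y) < r" and far: "2 * r \<le> \<rho>"
  shows "\<bar>(K (x - z) - K (x - z')) - (K (y - z) - K (y - z')) - (DK (y - z) (x - y) - DK (y - z') (x - y))\<bar>
       \<le> 2 * B * 4 ^ (DIM('a) + 1) * r * (min d r / \<rho> ^ (DIM('a) + 1))"
proof -
  let ?R = "(K (x - z) - K (x - z')) - (K (y - z) - K (y - z')) - (DK (y - z) (x - y) - DK (y - z') (x - y))"
  let ?c = "B / (\<rho> / 4) ^ (DIM('a) + 1)"
  have r: "r > 0" using x norm_ge_zero[of "x - y"] by linarith
  have m: "\<rho> / 4 > 0" using \<rho> by simp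
  have c0: "?c \<ge> 0" using nonneg \<rho>(2) by auto
  \<comment> \<open>From 2r <= \<rho> and 4d <= \<rho>, displacing x and the pole leaves at least
    \<rho> - \<rho>/2 - \<rho>/4.\<close>
  have seg: "\<rho> / 4 \<le> norm (\<xi> - \<eta>)" if "\<xi> \<in> closed_segment y x" "\<eta> \<in> closed_segment z z'" for \<xi> \<eta>
  proof -
    have 1: "norm (\<xi> - y) \<le> norm (x - y)" using segment_bound1[OF that(1)] by simp
    have 2: "norm (\<eta> - z) \<le> norm (z' - z)" using segment_bound1[OF that(2)] by simp
    have "norm (y - z) \<le> norm (y - \<xi>) + norm (\<xi> - \<eta>) + norm (\<eta> - z)"
      using norm_triangle_ineq[of "(y - \<xi>) + (\<xi> - \<eta>)" "\<eta> - z"] norm_triangle_ineq[of "y - \<xi>" "\<xi> - \<eta>"] by simp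
    then show ?thesis using 1 2 d x far \<rho>(1) by (simp add: norm_minus_commute)
  qed
  have 1: "\<bar>?R\<bar> \<le> 2 * ?c * r * d"
  proof -
    have "\<bar>?R\<bar> \<le> 2 * (?c * norm (z - z')) * norm (x - y)" by (rule difference_taylor[OF m seg])
    also have "\<dots> \<le> 2 * (?c * d) * r"
    proof (intro mult_mono mult_left_mono)
      have "d \<ge> 0" using order_trans[OF norm_ge_zero d(1)] .
      then show "0 \<le> 2 * (?c * d)" using c0 by (intro mult_nonneg_nonneg) auto
      show "0 \<le> ?c * norm (z - z')" using c0 by (intro mult_nonneg_nonneg) auto
    qed (use c0 d x r in auto)
    finally show ?thesis by (simp add: mult_ac)
  qed
  have one: "\<bar>K (x - w) - K (y - w) - DK (y - w) (x - y)\<bar> \<le> ?c * r\<^sup>2" if w: "w \<in> closed_segment z z'" for w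
  proof -
    have "\<bar>K (x - w) - K (y - w) - DK (y - w) ((x - w) - (y - w))\<bar> \<le> ?c * (norm ((x - w) - (y - w)))\<^sup>2"
    proof (rule K_taylor[OF m])
      fix q assume "q \<in> closed_segment (y - w) (x - w)"
      then obtain u where u: "0 \<le> u" "u \<le> 1" "q = (1 - u) *\<^sub>R (y - w) + u *\<^sub>R (x - w)" by (auto simp: in_segment)
      then have "q = ((1 - u) *\<^sub>R y + u *\<^sub>R x) - w" by (simp add: algebra_simps)
      moreover have "(1 - u) *\<^sub>R y + u *\<^sub>R x \<in> closed_segment y x" using u by (auto simp: in_segment)
      ultimately show "\<rho> / 4 \<le> norm q" using seg[OF _ w] by blast
    qed
    also have "\<dots> \<le> ?c * r\<^sup>2" using c0 x by (intro mult_left_mono power_mono) auto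
    finally show ?thesis by simp
  qed
  have 2: "\<bar>?R\<bar> \<le> 2 * ?c * r * r"
    using one[of z] one[of z'] unfolding power2_eq_square by (simp add: mult.assoc)
  have "\<bar>?R\<bar> \<le> 2 * ?c * r * min d r" using 1 2 by (simp add: min_def)
  also have "\<dots> = 2 * B * 4 ^ (DIM('a) + 1) * r * (min d r / \<rho> ^ (DIM('a) + 1))"
    using \<rho>(2) by (simp add: power_divide)
  finally show ?thesis .
qed

lemma near_estimates:
  assumes \<rho>: "\<rho> = norm (y - z)" "\<rho> > 0" and d: "norm (z - z') \<le> d" "4 * d \<le> \<rho>"
  shows "\<bar>K (y - z) - K (y - z')\<bar> \<le> C * 4 ^ DIM('a) * \<rho> * (d / \<rho> ^ (DIM('a) + 1))"
    "\<bar>DK (y - z) h - DK (y - z') h\<bar> \<le> B * 4 ^ (DIM('a) + 1) * (d / \<rho> ^ (DIM('a) + 1)) * norm h"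
proof -
  have d0: "d \<ge> 0" using order_trans[OF norm_ge_zero d(1)] .
  have m: "\<rho> / 4 > 0" using \<rho> by simp
  have seg: "\<rho> / 4 \<le> norm q" if "q \<in> closed_segment (y - z) (y - z')" for q
  proof -
    have "norm (q - (y - z)) \<le> norm ((y - z') - (y - z))" using segment_bound1[OF that] by simp
    then have "norm (q - (y - z)) \<le> d" using d(1) by simp
    moreover have "norm (y - z) \<le> norm q + norm (q - (y - z))"
      using norm_triangle_sub[of "y - z" q] by (simp add: norm_minus_commute)
    ultimately show ?thesis using d(2) \<rho> by linarith
  qed
  have "\<bar>K (y - z) - K (y - z')\<bar> \<le> C / (\<rho> / 4) ^ DIM('a) * norm ((y - z) - (y - z'))" by (rule K_lip[OF m seg])
  also have "\<dots> \<le> C / (\<rho> / 4) ^ DIM('a) * d"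
    using d(1) nonneg \<rho>(2) by (intro mult_left_mono) (auto simp: norm_minus_commute)
  also have "\<dots> = C * 4 ^ DIM('a) * \<rho> * (d / \<rho> ^ (DIM('a) + 1))" using \<rho>(2) by (simp add: power_divide)
  finally show "\<bar>K (y - z) - K (y - z')\<bar> \<le> C * 4 ^ DIM('a) * \<rho> * (d / \<rho> ^ (DIM('a) + 1))" .
  have "\<bar>DK (y - z) h - DK (y - z') h\<bar> \<le> norm (DK (y - z) - DK (y - z')) * norm h"
    using norm_blinfun[of "DK (y - z) - DK (y - z')" h] by (simp add: blinfun.diff_left)
  also have "\<dots> \<le> (B / (\<rho> / 4) ^ (DIM('a) + 1) * norm ((y - z) - (y - z'))) * norm h"
    by (intro mult_right_mono DK_lip[OF m seg]) auto
  also have "\<dots> \<le> (B / (\<rho> / 4) ^ (DIM('a) + 1) * d) * norm h"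
    using d(1) nonneg \<rho>(2) by (intro mult_right_mono mult_left_mono) (auto simp: norm_minus_commute)
  also have "\<dots> = B * 4 ^ (DIM('a) + 1) * (d / \<rho> ^ (DIM('a) + 1)) * norm h" using \<rho>(2) by (simp add: power_divide)
  finally show "\<bar>DK (y - z) h - DK (y - z') h\<bar> \<le> B * 4 ^ (DIM('a) + 1) * (d / \<rho> ^ (DIM('a) + 1)) * norm h" .
qed

definition Cbad :: real where
  "Cbad = 2 * B * 4 ^ (DIM('a) + 1) + 2 * C * 4 ^ DIM('a)"

lemma Cbad_nonneg: "Cbad \<ge> 0" using nonneg by (simp add: Cbad_def)

text \<open>For distant poles \<open>far_estimate\<close> is enough. If the pole is within 2r of y,
  the point x may come arbitrarily close to it, so the kernel difference at x is left for a
  weak-type estimate, and only the terms at y are bounded.\<close>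

lemma remainder_estimate:
  assumes \<rho>: "y \<noteq> z" and d: "norm (z - z') \<le> d" "4 * d \<le> norm (y - z)" and x: "norm (x - y) < r"
  shows "\<bar>(K (x - z) - K (x - z')) - (K (y - z) - K (y - z')) - (DK (y - z) (x - y) - DK (y - z') (x - y))\<bar>
       \<le> Cbad * r * (min d r / norm (y - z) ^ (DIM('a) + 1)) + (if norm (y - z) < 2 * r then \<bar>K (x - z) - K (x - z')\<bar> else 0)"
proof -
  define \<rho> where "\<rho> = norm (y - z)"
  have \<rho>0: "\<rho> > 0" using \<rho> by (simp add: \<rho>_def)
  have r: "r > 0" using x norm_ge_zero[of "x - y"] by linarith
  have d0: "d \<ge> 0" using order_trans[OF norm_ge_zero d(1)] .
  let ?q = "min d r / \<rho> ^ (DIM('a) + 1)"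
  have q0: "?q \<ge> 0" using d0 r \<rho>0 by auto
  show ?thesis
  proof (cases "\<rho> < 2 * r")
    case False
    have "\<bar>(K (x - z) - K (x - z')) - (K (y - z) - K (y - z')) - (DK (y - z) (x - y) - DK (y - z') (x - y))\<bar>
       \<le> 2 * B * 4 ^ (DIM('a) + 1) * r * ?q"
      by (rule far_estimate[OF \<rho>_def \<rho>0 d(1) _ x]) (use d False in \<open>auto simp: \<rho>_def\<close>)
    also have "\<dots> \<le> Cbad * r * ?q"
      using nonneg r q0 by (intro mult_right_mono) (auto simp: Cbad_def)
    finally show ?thesis using False by (simp add: \<rho>_def)
  next
    case True
    \<comment> \<open>Here d <= \<rho>/4 < r/2.\<close>
    have mn: "min d r = d" using d True d0 by (simp add: \<rho>_def)
    have 1: "\<bar>K (y - z) - K (y - z')\<bar> \<le> C * 4 ^ DIM('a) * (2 * r) * ?q"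
    proof -
      have "\<bar>K (y - z) - K (y - z')\<bar> \<le> C * 4 ^ DIM('a) * \<rho> * ?q"
        unfolding mn by (rule near_estimates(1)[OF \<rho>_def \<rho>0 d(1)]) (use d in \<open>simp add: \<rho>_def\<close>)
      also have "\<dots> \<le> C * 4 ^ DIM('a) * (2 * r) * ?q"
        using True nonneg q0 by (intro mult_right_mono mult_left_mono) auto
      finally show ?thesis .
    qed
    have 2: "\<bar>DK (y - z) (x - y) - DK (y - z') (x - y)\<bar> \<le> B * 4 ^ (DIM('a) + 1) * r * ?q"
    proof -
      have "\<bar>DK (y - z) (x - y) - DK (y - z') (x - y)\<bar> \<le> B * 4 ^ (DIM('a) + 1) * ?q * norm (x - y)"
        unfolding mn by (rule near_estimates(2)[OF \<rho>_def \<rho>0 d(1)]) (use d in \<open>simp add: \<rho>_def\<close>)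
      also have "\<dots> \<le> B * 4 ^ (DIM('a) + 1) * ?q * r"
        using x nonneg q0 by (intro mult_left_mono mult_nonneg_nonneg) auto
      finally show ?thesis by (simp add: mult_ac)
    qed
    have 3: "0 \<le> B * 4 ^ (DIM('a) + 1) * r * ?q" using nonneg r q0 by (intro mult_nonneg_nonneg) auto
    have 4: "C * 4 ^ DIM('a) * (2 * r) * ?q + B * 4 ^ (DIM('a) + 1) * r * ?q \<le> Cbad * r * ?q"
    proof -
      define X where "X = B * 4 ^ (DIM('a) + 1) * r * ?q"
      define Y where "Y = C * 4 ^ DIM('a) * (2 * r) * ?q"
      have "Cbad * r * ?q = 2 * X + Y"
        unfolding Cbad_def X_def Y_def by (simp only: ring_distribs mult_ac)
      then show ?thesis using 3 unfolding X_def[symmetric] Y_def[symmetric] by linarith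
    qed
    have "\<bar>a - b - c\<bar> \<le> \<bar>a\<bar> + (\<bar>b\<bar> + \<bar>c\<bar>)" for a b c :: real by linarith
    then have "\<bar>(K (x - z) - K (x - z')) - (K (y - z) - K (y - z')) - (DK (y - z) (x - y) - DK (y - z') (x - y))\<bar>
       \<le> \<bar>K (x - z) - K (x - z')\<bar> + (\<bar>K (y - z) - K (y - z')\<bar> + \<bar>DK (y - z) (x - y) - DK (y - z') (x - y)\<bar>)" .
    also have "\<dots> \<le> \<bar>K (x - z) - K (x - z')\<bar> + Cbad * r * ?q"
      by (intro add_left_mono order_trans[OF add_mono[OF 1 2] 4])
    finally show ?thesis using True by (simp add: \<rho>_def[symmetric])
  qed
qed

text \<open>Off the origin the continuous derivatives of the truncations are eventually equal to
  \<open>DK\<close>; at the origin its arbitrary value is inserted.\<close>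

lemma DK_measurable [measurable]: "(\<lambda>x. DK x h) \<in> borel_measurable borel"
proof (rule borel_measurable_LIMSEQ_real)
  show "(\<lambda>n. if x = 0 then DK 0 h else dtrunc (1 / 2 ^ n) x h) \<longlonglongrightarrow> DK x h" for x
  proof (cases "x = 0")
    case False
    have "(\<lambda>n. 2 * (1/2) ^ n) \<longlonglongrightarrow> 2 * (0::real)" by (intro tendsto_intros LIMSEQ_power_zero) auto
    from order_tendstoD(2)[OF this, of "norm x"] have "\<forall>\<^sub>F n in sequentially. 2 * (1/2) ^ n < norm x" using False by simp
    then have "\<forall>\<^sub>F n in sequentially. dtrunc (1 / 2 ^ n) x h = DK x h"
      by (rule eventually_mono) (auto intro!: dtrunc_high simp: power_one_over)
    then show ?thesis using False by (simp add: tendsto_eventually)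
  qed simp
  show "(\<lambda>x. if x = 0 then DK 0 h else dtrunc (1 / 2 ^ n) x h) \<in> borel_measurable borel" for n
    using borel_measurable_continuous_onI[OF dtrunc_continuous[of "1 / 2 ^ n" h]] by simp
qed

end

section \<open>Smearing a measure on the open set where its maximal function is large\<close>

lemma unit_ball_vol_neq_0 [simp]: "n \<ge> 0 \<Longrightarrow> unit_ball_vol n \<noteq> 0"
  using unit_ball_vol_pos[of n] by linarith

text \<open>Testing on superlevel sets of finite volume shows that the Radon-Nikodym density is at
  most \<open>c\<close> almost everywhere. Its minimum with \<open>c\<close> is bounded everywhere,
  as membership in \<open>bdd_int\<close> demands.\<close>

lemma bounded_density:
  fixes \<gamma> :: "'a::euclidean_space measure"
  assumes sets: "sets \<gamma> = sets borel" and fin: "finite_measure \<gamma>" and c: "c \<ge> 0"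
    and le: "\<And>E. E \<in> sets borel \<Longrightarrow> emeasure \<gamma> E \<le> ennreal c * emeasure lborel E"
  obtains g where "g \<in> bdd_int" "\<And>x. 0 \<le> g x" "\<gamma> = density lborel (\<lambda>x. ennreal (g x))"
proof -
  interpret \<gamma>: finite_measure \<gamma> by fact
  have "absolutely_continuous lborel \<gamma>"
    using le sets unfolding absolutely_continuous_def null_sets_def by (auto simp: le_zero_eq) (metis le_zero_eq mult_zero_right)
  from sigma_finite_measure.Radon_Nikodym[OF _ this] sets
  obtain f where f[measurable]: "f \<in> borel_measurable lborel" and fd: "density lborel f = \<gamma>"
    by (auto intro: sigma_finite_lborel)
  have null: "{x. ennreal (c + 1 / Suc k) \<le> f x} \<inter> ball 0 (real n) \<in> null_sets lborel" for k n
  proof -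
    define S where "S = {x. ennreal (c + 1 / Suc k) \<le> f x} \<inter> ball 0 (real n)"
    have S[measurable]: "S \<in> sets borel" unfolding S_def by measurable
    have "emeasure lborel S \<le> emeasure lborel (ball (0::'a) (real n))" unfolding S_def by (intro emeasure_mono) auto
    then have "emeasure lborel S < \<infinity>" using emeasure_lborel_ball_finite[of "0::'a" "real n"] by (rule le_less_trans)
    then obtain e where e: "emeasure lborel S = ennreal e" "e \<ge> 0" by (cases "emeasure lborel S") auto
    have "ennreal (c + 1 / Suc k) * ennreal e = (\<integral>\<^sup>+x. ennreal (c + 1 / Suc k) * indicator S x \<partial>lborel)"
      by (subst nn_integral_cmult_indicator) (auto simp: e)
    also have "\<dots> \<le> (\<integral>\<^sup>+x. f x * indicator S x \<partial>lborel)"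
      by (intro nn_integral_mono) (auto simp: S_def split: split_indicator)
    also have "\<dots> = emeasure \<gamma> S" using S by (simp add: fd[symmetric] emeasure_density)
    also have "\<dots> \<le> ennreal c * ennreal e" using le[OF S] by (simp add: e)
    finally have "(c + 1 / Suc k) * e \<le> c * e"
      using c e(2) by (simp add: ennreal_mult[symmetric] ennreal_le_iff del: of_nat_Suc ennreal_plus)
    then have "1 / Suc k * e \<le> 0" by (simp add: algebra_simps del: of_nat_Suc)
    then have "e \<le> 0" by (simp add: field_simps del: of_nat_Suc)
    then show ?thesis using e S unfolding S_def[symmetric] by (auto simp: null_sets_def)
  qed
  have "AE x in lborel. \<forall>k n. \<not> (ennreal (c + 1 / Suc k) \<le> f x \<and> x \<in> ball 0 (real n))"
    unfolding AE_all_countable using AE_not_in[OF null] by (auto simp del: of_nat_Suc)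
  then have AE: "AE x in lborel. f x \<le> ennreal c"
  proof (rule AE_mp, intro AE_I2 impI)
    fix x assume h: "\<forall>k n. \<not> (ennreal (c + 1 / Suc k) \<le> f x \<and> x \<in> ball 0 (real n))"
    obtain n where n: "norm x < real n" using reals_Archimedean2 by blast
    have "f x \<le> ennreal (c + 1 / Suc k)" for k
    proof -
      have "\<not> ennreal (c + 1 / Suc k) \<le> f x" using h n by (auto simp del: of_nat_Suc)
      then show ?thesis by (simp add: not_le less_imp_le)
    qed
    moreover have "(\<lambda>k. ennreal (c + 1 / Suc k)) \<longlonglongrightarrow> ennreal (c + 0)"
      by (intro tendsto_ennrealI tendsto_intros LIMSEQ_Suc[OF lim_1_over_n])
    ultimately show "f x \<le> ennreal c" by (intro LIMSEQ_le_const) auto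
  qed
  define g where "g x = min (enn2real (f x)) c" for x
  have gm[measurable]: "g \<in> borel_measurable borel" unfolding g_def by measurable
  have g0: "0 \<le> g x" for x using c by (simp add: g_def)
  have "AE x in lborel. f x = ennreal (g x)"
    using AE
  proof (rule AE_mp, intro AE_I2 impI)
    fix x assume "f x \<le> ennreal c"
    then show "f x = ennreal (g x)" using c by (cases "f x") (auto simp: g_def min_def top_unique)
  qed
  then have gd: "\<gamma> = density lborel (\<lambda>x. ennreal (g x))"
    unfolding fd[symmetric] by (intro density_cong) auto
  have "(\<integral>\<^sup>+x. ennreal (g x) \<partial>lborel) = emeasure \<gamma> UNIV"
    unfolding gd by (subst emeasure_density) auto
  also have "\<dots> < \<infinity>" using \<gamma>.emeasure_finite[of UNIV] by (simp add: less_top[symmetric])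
  finally have "integrable lborel g" using g0 by (intro integrableI_nonneg) auto
  moreover have "\<bar>g x\<bar> \<le> c" for x using g0[of x] by (simp add: g_def)
  ultimately have "g \<in> bdd_int" unfolding bdd_int_def using gm by blast
  then show ?thesis using g0 gd by (rule that)
qed

text \<open>Off the large-ball set \<mu> has no singular part: for Vitali balls inside an open V
  around S, \<mu>(B_5r) <= t (5r)^N is a multiple of |B_r|, and V shrinks to S in measure. The
  factor 5^N is the price of the enlargement.\<close>

lemma emeasure_subset_small_ball_set_le:
  fixes \<mu> :: "'a::euclidean_space measure"
  assumes sets: "sets \<mu> = sets borel" and t: "t > 0" and S: "S \<in> sets borel" "S \<inter> large_ball_set \<mu> t = {}"
  shows "emeasure \<mu> S \<le> ennreal (5 ^ DIM('a) * t / unit_ball_vol (real DIM('a))) * emeasure lborel S"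
proof -
  let ?\<omega> = "unit_ball_vol (real DIM('a))"
  let ?c = "5 ^ DIM('a) * t / ?\<omega>"
  have le: "emeasure \<mu> S \<le> ennreal ?c * emeasure lborel V" if V: "open V" "S \<subseteq> V" for V
  proof -
    have "\<exists>r. 0 < r \<and> r \<le> 1 \<and> ball x r \<subseteq> V" if x: "x \<in> S" for x
    proof -
      have "x \<in> V" using x V(2) by blast
      then obtain r where "r > 0" "ball x r \<subseteq> V" using V(1) openE by blast
      then show ?thesis by (intro exI[of _ "min r 1"]) auto
    qed
    then obtain r where r: "\<And>x. x \<in> S \<Longrightarrow> 0 < r x \<and> r x \<le> 1" "\<And>x. x \<in> S \<Longrightarrow> ball x (r x) \<subseteq> V" by metis
    show ?thesis
    proof (rule vitali_compare[OF sets _ _ r])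
      show "emeasure \<mu> (ball x (5 * r x)) \<le> ennreal ?c * emeasure lborel (ball x (r x))" if x: "x \<in> S" for x
      proof -
        have "emeasure \<mu> (ball x (5 * r x)) \<le> ennreal (t * (5 * r x) ^ DIM('a))"
        proof -
          have "x \<notin> large_ball_set \<mu> t" using S(2) x by auto
          then show ?thesis using r(1)[OF x]
            unfolding large_ball_set_def mem_Collect_eq not_ex de_Morgan_conj not_less
            by (metis not_le mult_pos_pos zero_less_numeral)
        qed
        also have "\<dots> = ennreal ?c * emeasure lborel (ball x (r x))"
          using r(1)[OF x] t by (simp add: emeasure_ball ennreal_mult[symmetric] power_mult_distrib)
        finally show ?thesis .
      qed
    qed (use V in auto)
  qed
  show ?thesis
  proof (rule ennreal_le_epsilon)
    fix e :: real assume e: "e > 0"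
    define \<delta> where "\<delta> = e / ?c"
    have c0: "?c > 0" using t by simp
    have \<delta>: "\<delta> > 0" unfolding \<delta>_def by (rule divide_pos_pos[OF e c0])
    have \<delta>e: "?c * \<delta> = e"
      unfolding \<delta>_def by (simp only: times_divide_eq_right nonzero_mult_div_cancel_left[OF less_imp_neq[OF c0, symmetric]])
    have "S \<in> sets lebesgue" using S(1) by simp
    from sets_lebesgue_outer_open[OF this \<delta>]
    obtain V where V: "open V" "S \<subseteq> V" "emeasure lebesgue (V - S) < ennreal \<delta>" by metis
    have VS: "V - S \<in> sets lborel" using V(1) S(1) by auto
    have "emeasure \<mu> S \<le> ennreal ?c * emeasure lborel V" by (rule le[OF V(1,2)])
    also have "emeasure lborel V \<le> emeasure lborel S + emeasure lborel (V - S)"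
      using V(2) VS S(1) emeasure_subadditive[of S lborel "V - S"] by (simp add: Un_absorb1)
    also have "\<dots> \<le> emeasure lborel S + ennreal \<delta>"
      using V(3) VS by (intro add_left_mono) (simp add: less_imp_le)
    finally have "emeasure \<mu> S \<le> ennreal ?c * (emeasure lborel S + ennreal \<delta>)" by (simp add: mult_left_mono)
    also have "\<dots> = ennreal ?c * emeasure lborel S + ennreal e"
      unfolding distrib_left \<delta>e[symmetric]
      by (simp only: ennreal_mult[OF less_imp_le[OF c0] less_imp_le[OF \<delta>]])
    finally show "emeasure \<mu> S \<le> ennreal ?c * emeasure lborel S + ennreal e" .
  qed
qed

text \<open>The law of the displacement. Smearing becomes the image of a product measure under (z,
  \<zeta>) |-> z + d(z) \<zeta>, so integrals against \<mu> - \<gamma> are integrals of a difference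
  over a single measure space.\<close>

definition unit_uniform :: "'a::euclidean_space measure" where
  "unit_uniform = density lborel (\<lambda>\<zeta>. ennreal (1 / unit_ball_vol (real DIM('a))) * indicator (ball 0 1) \<zeta>)"

lemma sets_unit_uniform [simp, measurable_cong]: "sets unit_uniform = sets borel"
  by (simp add: unit_uniform_def)

lemma space_unit_uniform [simp]: "space unit_uniform = UNIV"
  by (simp add: unit_uniform_def)

lemma emeasure_unit_uniform_UNIV [simp]: "emeasure (unit_uniform :: 'a::euclidean_space measure) UNIV = 1"
proof -
  have "emeasure (unit_uniform :: 'a measure) UNIV = (\<integral>\<^sup>+\<zeta>. ennreal (1 / unit_ball_vol (real DIM('a))) * indicator (ball (0::'a) 1) \<zeta> \<partial>lborel)"
    unfolding unit_uniform_def by (subst emeasure_density) auto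
  also have "\<dots> = ennreal (1 / unit_ball_vol (real DIM('a))) * emeasure lborel (ball (0::'a) 1)"
    by (rule nn_integral_cmult_indicator) simp
  also have "\<dots> = 1"
    using unit_ball_vol_pos[of "real DIM('a)"] by (simp add: emeasure_ball ennreal_mult[symmetric] del: unit_ball_vol_pos)
  finally show ?thesis .
qed

lemma AE_unit_uniform: "AE \<zeta> in unit_uniform. norm \<zeta> < 1"
  unfolding unit_uniform_def by (subst AE_density) (auto split: split_indicator_asm)

lemma finite_measure_unit_uniform: "finite_measure (unit_uniform :: 'a::euclidean_space measure)"
  by (rule finite_measureI) simp

lemma nn_integral_unit_uniform_affine:
  fixes f :: "'a::euclidean_space \<Rightarrow> ennreal"
  assumes d: "d > 0" and [measurable]: "f \<in> borel_measurable borel"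
  shows "(\<integral>\<^sup>+\<zeta>. f (z + d *\<^sub>R \<zeta>) \<partial>unit_uniform) =
         (\<integral>\<^sup>+x. ennreal (1 / (unit_ball_vol (real DIM('a)) * d ^ DIM('a))) * indicator (ball z d) x * f x \<partial>lborel)"
proof -
  let ?\<omega> = "unit_ball_vol (real DIM('a))"
  have "(\<integral>\<^sup>+x. ennreal (1 / (?\<omega> * d ^ DIM('a))) * indicator (ball z d) x * f x \<partial>lborel)
    = ennreal (\<bar>d\<bar> ^ DIM('a)) * (\<integral>\<^sup>+\<zeta>. ennreal (1 / (?\<omega> * d ^ DIM('a))) * indicator (ball z d) (z + d *\<^sub>R \<zeta>) * f (z + d *\<^sub>R \<zeta>) \<partial>lborel)"
    by (rule nn_integral_lborel_affine) (use d in auto)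
  also have "\<dots> = (\<integral>\<^sup>+\<zeta>. ennreal (d ^ DIM('a)) * (ennreal (1 / (?\<omega> * d ^ DIM('a))) * indicator (ball z d) (z + d *\<^sub>R \<zeta>) * f (z + d *\<^sub>R \<zeta>)) \<partial>lborel)"
    using d by (subst nn_integral_cmult) auto
  also have "\<dots> = (\<integral>\<^sup>+\<zeta>. ennreal (1 / ?\<omega>) * indicator (ball 0 1) \<zeta> * f (z + d *\<^sub>R \<zeta>) \<partial>lborel)"
  proof (rule nn_integral_cong)
    fix \<zeta> :: 'a
    have 1: "indicator (ball z d) (z + d *\<^sub>R \<zeta>) = (indicator (ball 0 1) \<zeta> :: ennreal)"
      using d by (auto simp: dist_norm split: split_indicator)
    have 2: "ennreal (d ^ DIM('a)) * ennreal (1 / (?\<omega> * d ^ DIM('a))) = ennreal (1 / ?\<omega>)"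
      using d by (subst ennreal_mult[symmetric]) auto
    show "ennreal (d ^ DIM('a)) * (ennreal (1 / (?\<omega> * d ^ DIM('a))) * indicator (ball z d) (z + d *\<^sub>R \<zeta>) * f (z + d *\<^sub>R \<zeta>))
       = ennreal (1 / ?\<omega>) * indicator (ball 0 1) \<zeta> * f (z + d *\<^sub>R \<zeta>)"
      unfolding 1 2[symmetric] by (simp only: mult.assoc)
  qed
  also have "\<dots> = (\<integral>\<^sup>+\<zeta>. f (z + d *\<^sub>R \<zeta>) \<partial>unit_uniform)"
    unfolding unit_uniform_def by (rule nn_integral_density[symmetric]) auto
  finally show ?thesis by simp
qed

text \<open>\<open>ne\<close> secures a point of \<open>F\<close>: the distance to the empty set is
  0 by convention and would spread nothing.\<close>

locale smearing =
  fixes \<mu> :: "'a::euclidean_space measure" and t :: real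
  assumes sets_\<mu> [simp, measurable_cong]: "sets \<mu> = sets borel" and fin_\<mu>: "finite_measure \<mu>" and t: "t > 0"
    and ne: "- large_ball_set \<mu> t \<noteq> {}"
begin

definition "\<Omega> = large_ball_set \<mu> t"

text \<open>A quarter of the distance to \<open>F\<close>: a displacement shorter than this keeps
  points of \<Omega> inside \<Omega> and is at most |y - z|/4 for y in \<open>F\<close>.\<close>

definition "dF z = infdist z (- \<Omega>) / 4"

definition "\<gamma> = distr (\<mu> \<Otimes>\<^sub>M unit_uniform) borel (\<lambda>p. fst p + dF (fst p) *\<^sub>R snd p)"

sublocale \<mu>: finite_measure \<mu> by (rule fin_\<mu>)
sublocale \<sigma>: finite_measure "unit_uniform :: 'a measure" by (rule finite_measure_unit_uniform)
sublocale P: pair_sigma_finite \<mu> "unit_uniform :: 'a measure" ..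
sublocale Q: pair_sigma_finite \<mu> "lborel :: 'a measure" by (intro pair_sigma_finite.intro) (unfold_locales)

lemma space_\<mu> [simp]: "space \<mu> = UNIV"
  using sets_eq_imp_space_eq[OF sets_\<mu>] by simp

lemma open_\<Omega>: "open \<Omega>" unfolding \<Omega>_def by (rule open_large_ball_set) simp

lemma \<Omega>_measurable [measurable, simp]: "\<Omega> \<in> sets borel" using open_\<Omega> by auto

lemma F_ne: "- \<Omega> \<noteq> {}" using ne by (simp add: \<Omega>_def)

lemma dF_nonneg [simp]: "dF z \<ge> 0" by (simp add: dF_def infdist_nonneg)

lemma dF_lip: "\<bar>dF z - dF z'\<bar> \<le> norm (z - z') / 4"
  using infdist_triangle_abs[of z "- \<Omega>" z'] by (simp add: dF_def dist_norm diff_divide_distrib[symmetric])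

lemma dF_cont: "continuous_on UNIV dF"
  unfolding dF_def by (intro continuous_intros) auto

lemma dF_measurable [measurable]: "dF \<in> borel_measurable borel"
  by (rule borel_measurable_continuous_onI[OF dF_cont])

lemma dF_F: "z \<notin> \<Omega> \<Longrightarrow> dF z = 0" by (simp add: dF_def)

lemma dF_pos: "z \<in> \<Omega> \<Longrightarrow> dF z > 0"
proof -
  assume "z \<in> \<Omega>"
  moreover have "closed (- \<Omega>)" using open_\<Omega> by (simp add: closed_def)
  ultimately have "infdist z (- \<Omega>) \<noteq> 0" using in_closed_iff_infdist_zero[of "- \<Omega>" z] F_ne by auto
  then show ?thesis using infdist_nonneg[of z "- \<Omega>"] by (simp add: dF_def)
qed

lemma dF_le: "y \<notin> \<Omega> \<Longrightarrow> 4 * dF z \<le> norm (y - z)"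
  using infdist_le[of y "- \<Omega>" z] by (simp add: dF_def dist_norm norm_minus_commute)

lemma small_ball: "y \<notin> \<Omega> \<Longrightarrow> r > 0 \<Longrightarrow> emeasure \<mu> (ball y r) \<le> ennreal (t * r ^ DIM('a))"
  unfolding \<Omega>_def large_ball_set_def mem_Collect_eq not_ex de_Morgan_conj not_less by (metis not_le)

lemma T_measurable [measurable]: "(\<lambda>p. fst p + dF (fst p) *\<^sub>R snd p) \<in> borel_measurable (\<mu> \<Otimes>\<^sub>M unit_uniform)"
  by measurable

definition "Csm = (5 ^ DIM('a) + 8 ^ DIM('a)) * t / unit_ball_vol (real DIM('a))"

lemma Csm_nonneg: "Csm \<ge> 0" using t by (simp add: Csm_def)

text \<open>Only z with |z - x| < \<open>dF z\<close> contribute at x. As \<open>dF\<close> has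
  Lipschitz constant 1/4, its values at z and x are comparable, so with e = \<open>dF x\<close>
  these z lie within 6e of a nearest point y of \<open>F\<close>, where \<mu>(B_6e(y)) <= t (6e)^N.
  The resulting (5/4)^N 6^N is rounded up to 8^N.\<close>

lemma smear_kernel_le:
  "(\<integral>\<^sup>+z. ennreal (1 / (unit_ball_vol (real DIM('a)) * dF z ^ DIM('a))) * indicator (ball z (dF z)) x * indicator \<Omega> z \<partial>\<mu>)
     \<le> ennreal (8 ^ DIM('a) * t / unit_ball_vol (real DIM('a)))"
proof -
  let ?\<omega> = "unit_ball_vol (real DIM('a))"
  define e where "e = dF x"
  show ?thesis
  proof (cases "e > 0")
    case False
    have Z: "(ennreal (1 / (?\<omega> * dF z ^ DIM('a))) * indicator (ball z (dF z)) x * indicator \<Omega> z :: ennreal) = 0" for z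
    proof (cases "x \<in> ball z (dF z)")
      case True
      have "dF x = 0" using False dF_nonneg[of x] by (simp add: e_def)
      then have "dF z * 4 \<le> norm (z - x)" using dF_lip[of z x] by simp
      moreover have "norm (z - x) < dF z" using True by (simp add: dist_norm)
      ultimately have False using norm_ge_zero[of "z - x"] by linarith
      then show ?thesis ..
    qed simp
    show ?thesis unfolding Z by simp
  next
    case True
    obtain y where y: "y \<in> - \<Omega>" "infdist x (- \<Omega>) = dist x y"
      using infdist_attains_inf[of "- \<Omega>" x] open_\<Omega> F_ne by (auto simp: closed_def)
    have xy: "dist x y = 4 * e" using y(2) by (simp add: e_def dF_def)
    have "(\<integral>\<^sup>+z. ennreal (1 / (?\<omega> * dF z ^ DIM('a))) * indicator (ball z (dF z)) x * indicator \<Omega> z \<partial>\<mu>)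
       \<le> (\<integral>\<^sup>+z. ennreal ((5/4) ^ DIM('a) / (?\<omega> * e ^ DIM('a))) * indicator (ball y (6 * e)) z \<partial>\<mu>)"
    proof (rule nn_integral_mono)
      fix z
      show "ennreal (1 / (?\<omega> * dF z ^ DIM('a))) * indicator (ball z (dF z)) x * indicator \<Omega> z
        \<le> ennreal ((5/4) ^ DIM('a) / (?\<omega> * e ^ DIM('a))) * indicator (ball y (6 * e)) z"
      proof (cases "x \<in> ball z (dF z) \<and> z \<in> \<Omega>")
        case True
        then have zx: "norm (z - x) < dF z" by (simp add: dist_norm)
        have "dF z - dF x \<le> norm (z - x) / 4" "dF x - dF z \<le> norm (z - x) / 4"
            using abs_le_D1[OF dF_lip[of z x]] abs_le_D2[OF dF_lip[of z x]] by simp_all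
          then have 1: "e \<le> 5/4 * dF z" "3/4 * dF z \<le> e" using zx unfolding e_def by linarith+
        have dz: "dF z > 0" using zx norm_ge_zero[of "z - x"] by linarith
        have "dist y z \<le> dist x y + dist x z" by (metis dist_commute dist_triangle3 add.commute)
        then have "dist y z < 6 * e" using xy zx 1 by (simp add: dist_norm norm_minus_commute)
        moreover have "1 / (?\<omega> * dF z ^ DIM('a)) \<le> (5/4) ^ DIM('a) / (?\<omega> * e ^ DIM('a))"
        proof -
          have "e ^ DIM('a) \<le> (5/4 * dF z) ^ DIM('a)" using 1 \<open>e > 0\<close> by (intro power_mono) auto
          then show ?thesis using dz \<open>e > 0\<close> by (simp add: power_mult_distrib field_simps)
        qed
        ultimately show ?thesis using True by (auto intro: ennreal_leI)
      qed auto
    qed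
    also have "\<dots> = ennreal ((5/4) ^ DIM('a) / (?\<omega> * e ^ DIM('a))) * emeasure \<mu> (ball y (6 * e))"
      by (rule nn_integral_cmult_indicator) simp
    also have "\<dots> \<le> ennreal ((5/4) ^ DIM('a) / (?\<omega> * e ^ DIM('a))) * ennreal (t * (6 * e) ^ DIM('a))"
      using y True by (intro mult_left_mono small_ball) auto
    also have "\<dots> = ennreal ((5/4) ^ DIM('a) / (?\<omega> * e ^ DIM('a)) * (t * (6 * e) ^ DIM('a)))"
      using True t by (subst ennreal_mult[symmetric]) auto
    also have "(5/4) ^ DIM('a) / (?\<omega> * e ^ DIM('a)) * (t * (6 * e) ^ DIM('a)) = (5/4 * 6) ^ DIM('a) * t / ?\<omega>"
      unfolding power_mult_distrib[of "5/4" 6] power_mult_distrib[of 6 e] using True by simp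
    also have "ennreal \<dots> \<le> ennreal (8 ^ DIM('a) * t / ?\<omega>)"
      using t by (intro ennreal_leI divide_right_mono mult_right_mono power_mono) auto
    finally show ?thesis .
  qed
qed

text \<open>The mass on \<open>F\<close> is not moved and is bounded by the Vitali argument, which
  gives 5^N; the mass of \<Omega> is spread and has density bounded by
  \<open>smear_kernel_le\<close>, which gives 8^N.\<close>

lemma \<gamma>_le:
  assumes E[measurable]: "E \<in> sets borel"
  shows "emeasure \<gamma> E \<le> ennreal Csm * emeasure lborel E"
proof -
  let ?\<omega> = "unit_ball_vol (real DIM('a))"
  let ?k = "\<lambda>z x. ennreal (1 / (?\<omega> * dF z ^ DIM('a))) * indicator (ball z (dF z)) x * indicator \<Omega> z"
  have [measurable]: "Measurable.pred (\<mu> \<Otimes>\<^sub>M lborel) (\<lambda>p. snd p \<in> ball (fst p) (dF (fst p)))"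
    unfolding mem_ball by measurable
  have km[measurable]: "(\<lambda>p. ?k (fst p) (snd p)) \<in> borel_measurable (\<mu> \<Otimes>\<^sub>M lborel)"
    unfolding indicator_def by measurable
  have "emeasure \<gamma> E = (\<integral>\<^sup>+p. indicator E (fst p + dF (fst p) *\<^sub>R snd p) \<partial>(\<mu> \<Otimes>\<^sub>M unit_uniform))"
    unfolding \<gamma>_def using nn_integral_distr[OF T_measurable, of "indicator E"] by (simp add: nn_integral_indicator)
  also have "\<dots> = (\<integral>\<^sup>+z. (\<integral>\<^sup>+\<zeta>. indicator E (z + dF z *\<^sub>R \<zeta>) \<partial>unit_uniform) \<partial>\<mu>)"
    by (subst \<sigma>.nn_integral_fst[symmetric]) auto
  also have "\<dots> = (\<integral>\<^sup>+z. indicator (E - \<Omega>) z + (\<integral>\<^sup>+x. ?k z x * indicator E x \<partial>lborel) \<partial>\<mu>)"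
  proof (rule nn_integral_cong)
    fix z
    show "(\<integral>\<^sup>+\<zeta>. indicator E (z + dF z *\<^sub>R \<zeta>) \<partial>unit_uniform) = indicator (E - \<Omega>) z + (\<integral>\<^sup>+x. ?k z x * indicator E x \<partial>lborel)"
    proof (cases "z \<in> \<Omega>")
      case True
      then show ?thesis using nn_integral_unit_uniform_affine[OF dF_pos[OF True], of "indicator E" z] by simp
    next
      case False
      then show ?thesis by (simp add: dF_F indicator_def)
    qed
  qed
  also have "\<dots> = emeasure \<mu> (E - \<Omega>) + (\<integral>\<^sup>+z. (\<integral>\<^sup>+x. ?k z x * indicator E x \<partial>lborel) \<partial>\<mu>)"
  proof (subst nn_integral_add)
    show "(\<lambda>z. \<integral>\<^sup>+x. ?k z x * indicator E x \<partial>lborel) \<in> borel_measurable \<mu>"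
      using lborel.borel_measurable_nn_integral_fst[of "\<lambda>p. ?k (fst p) (snd p) * indicator E (snd p)" \<mu>] by simp
  qed auto
  also have "(\<integral>\<^sup>+z. (\<integral>\<^sup>+x. ?k z x * indicator E x \<partial>lborel) \<partial>\<mu>) = (\<integral>\<^sup>+x. (\<integral>\<^sup>+z. ?k z x * indicator E x \<partial>\<mu>) \<partial>lborel)"
    using Q.Fubini[of "\<lambda>p. ?k (fst p) (snd p) * indicator E (snd p)"] by simp
  also have "\<dots> \<le> (\<integral>\<^sup>+x. ennreal (8 ^ DIM('a) * t / ?\<omega>) * indicator E x \<partial>lborel)"
  proof (rule nn_integral_mono)
    fix x
    show "(\<integral>\<^sup>+z. ?k z x * indicator E x \<partial>\<mu>) \<le> ennreal (8 ^ DIM('a) * t / ?\<omega>) * indicator E x"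
      using smear_kernel_le[of x] by (cases "x \<in> E") auto
  qed
  also have "\<dots> = ennreal (8 ^ DIM('a) * t / ?\<omega>) * emeasure lborel E" by (rule nn_integral_cmult_indicator) simp
  also have "emeasure \<mu> (E - \<Omega>) \<le> ennreal (5 ^ DIM('a) * t / ?\<omega>) * emeasure lborel E"
  proof -
    have "emeasure \<mu> (E - \<Omega>) \<le> ennreal (5 ^ DIM('a) * t / ?\<omega>) * emeasure lborel (E - \<Omega>)"
      by (rule emeasure_subset_small_ball_set_le[OF sets_\<mu> t]) (auto simp: \<Omega>_def[symmetric])
    also have "\<dots> \<le> ennreal (5 ^ DIM('a) * t / ?\<omega>) * emeasure lborel E"
      by (intro mult_left_mono emeasure_mono) auto
    finally show ?thesis .
  qed
  finally have "emeasure \<gamma> E \<le> ennreal (5 ^ DIM('a) * t / ?\<omega>) * emeasure lborel E + ennreal (8 ^ DIM('a) * t / ?\<omega>) * emeasure lborel E"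
    by (simp add: add_right_mono)
  also have "\<dots> = (ennreal (5 ^ DIM('a) * t / ?\<omega>) + ennreal (8 ^ DIM('a) * t / ?\<omega>)) * emeasure lborel E"
    by (simp only: distrib_right)
  also have "ennreal (5 ^ DIM('a) * t / ?\<omega>) + ennreal (8 ^ DIM('a) * t / ?\<omega>) = ennreal Csm"
    using t by (subst ennreal_plus[symmetric]) (auto simp: Csm_def add_divide_distrib ring_distribs)
  finally show ?thesis .
qed

lemma sets_\<gamma> [simp]: "sets \<gamma> = sets borel" by (simp add: \<gamma>_def)

lemma finite_measure_P: "finite_measure (\<mu> \<Otimes>\<^sub>M (unit_uniform :: 'a measure))"
proof (rule finite_measureI)
  have "emeasure (\<mu> \<Otimes>\<^sub>M (unit_uniform :: 'a measure)) (UNIV \<times> UNIV) = emeasure \<mu> UNIV * emeasure (unit_uniform :: 'a measure) UNIV"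
    by (rule \<sigma>.emeasure_pair_measure_Times) auto
  then show "emeasure (\<mu> \<Otimes>\<^sub>M (unit_uniform :: 'a measure)) (space (\<mu> \<Otimes>\<^sub>M (unit_uniform :: 'a measure))) \<noteq> \<infinity>"
    using \<mu>.emeasure_finite[of UNIV] by (simp add: space_pair_measure)
qed

lemma finite_measure_\<gamma>: "finite_measure \<gamma>"
  unfolding \<gamma>_def by (rule finite_measure.finite_measure_distr[OF finite_measure_P T_measurable])

lemma smeared_density:
  obtains g where "g \<in> bdd_int" "\<And>x. 0 \<le> g x" "\<gamma> = density lborel (\<lambda>x. ennreal (g x))"
  using bounded_density[OF sets_\<gamma> finite_measure_\<gamma> Csm_nonneg \<gamma>_le] by blast

lemma nn_integral_P_fst:
  assumes [measurable]: "f \<in> borel_measurable borel"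
  shows "(\<integral>\<^sup>+p. f (fst p) \<partial>(\<mu> \<Otimes>\<^sub>M (unit_uniform :: 'a measure))) = (\<integral>\<^sup>+z. f z \<partial>\<mu>)"
  by (subst \<sigma>.nn_integral_fst[symmetric]) auto

lemma AE_P: "AE p in \<mu> \<Otimes>\<^sub>M (unit_uniform :: 'a measure). norm (snd p) < 1"
proof -
  have "AE z in \<mu>. AE \<zeta> in (unit_uniform :: 'a measure). norm (snd (z, \<zeta>)) < 1"
    by (rule AE_I2) (simp add: AE_unit_uniform)
  moreover have "{p \<in> space (\<mu> \<Otimes>\<^sub>M (unit_uniform :: 'a measure)). norm (snd p) < 1} \<in> sets (\<mu> \<Otimes>\<^sub>M unit_uniform)"
    by measurable
  ultimately show ?thesis by (intro P.AE_pair_measure)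
qed

text \<open>Mass of \<Omega> within 2r of y moves by less than r and remains in \<Omega>, so it is
  dominated by the smeared mass of the larger ball. This exchanges a possibly singular measure for
  Lebesgue measure, to which density points apply.\<close>

lemma mass_near_le:
  assumes y: "y \<notin> \<Omega>" and r: "r > 0"
  shows "emeasure \<mu> (\<Omega> \<inter> ball y (2 * r)) \<le> ennreal Csm * emeasure lborel (ball y (3 * r) \<inter> \<Omega>)"
proof -
  have "emeasure \<mu> (\<Omega> \<inter> ball y (2 * r)) = (\<integral>\<^sup>+p. indicator (\<Omega> \<inter> ball y (2 * r)) (fst p) \<partial>(\<mu> \<Otimes>\<^sub>M (unit_uniform :: 'a measure)))"
    by (subst nn_integral_P_fst) auto
  also have "\<dots> \<le> (\<integral>\<^sup>+p. indicator (ball y (3 * r) \<inter> \<Omega>) (fst p + dF (fst p) *\<^sub>R snd p) \<partial>(\<mu> \<Otimes>\<^sub>M unit_uniform))"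
    using AE_P
  proof (intro nn_integral_mono_AE, elim AE_mp, intro AE_I2 impI)
    fix p :: "'a \<times> 'a" assume p: "norm (snd p) < 1"
    obtain z \<zeta> where zz: "p = (z, \<zeta>)" by (cases p)
    show "indicator (\<Omega> \<inter> ball y (2 * r)) (fst p) \<le> (indicator (ball y (3 * r) \<inter> \<Omega>) (fst p + dF (fst p) *\<^sub>R snd p) :: ennreal)"
    proof (cases "z \<in> \<Omega> \<inter> ball y (2 * r)")
      case True
      have n: "norm (dF z *\<^sub>R \<zeta>) \<le> dF z" using p zz by (simp add: mult_left_le)
      have d: "dF z > 0" using True dF_pos by auto
      have "4 * dF z \<le> norm (y - z)" by (rule dF_le[OF y])
      then have "4 * dF z < 2 * r" using True by (simp add: dist_norm)
      moreover have "dist y (z + dF z *\<^sub>R \<zeta>) \<le> dist y z + norm (dF z *\<^sub>R \<zeta>)"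
        by (metis add_diff_cancel_left' dist_norm dist_triangle norm_minus_commute)
      ultimately have 1: "dist y (z + dF z *\<^sub>R \<zeta>) < 3 * r" using True n r by auto
      have "z + dF z *\<^sub>R \<zeta> \<in> \<Omega>"
      proof (rule ccontr)
        assume "z + dF z *\<^sub>R \<zeta> \<notin> \<Omega>"
        then have "4 * dF z \<le> norm (z + dF z *\<^sub>R \<zeta> - z)" by (rule dF_le)
        then show False using n d by simp
      qed
      then show ?thesis using 1 by (auto simp: zz split: split_indicator)
    qed (simp add: zz)
  qed
  also have "\<dots> = emeasure \<gamma> (ball y (3 * r) \<inter> \<Omega>)"
    unfolding \<gamma>_def using nn_integral_distr[OF T_measurable, of "indicator (ball y (3 * r) \<inter> \<Omega>)"] by (simp add: nn_integral_indicator)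
  also have "\<dots> \<le> ennreal Csm * emeasure lborel (ball y (3 * r) \<inter> \<Omega>)" by (rule \<gamma>_le) auto
  finally show ?thesis .
qed

text \<open>The integral over \<open>F\<close> is finite: by Tonelli, y in \<open>F\<close> keeps
  distance 4 \<open>dF z\<close> from z, and the tail integral of |y - z|^(-N-1) beyond it is a
  multiple of 1/\<open>dF z\<close>, which cancels the numerator. What remains is the total
  mass.\<close>

lemma AE_potential_finite:
  "AE y in lborel. y \<notin> \<Omega> \<longrightarrow> (\<integral>\<^sup>+z. ennreal (dF z / norm (y - z) ^ (DIM('a) + 1)) \<partial>\<mu>) < \<infinity>"
proof -
  let ?\<omega> = "unit_ball_vol (real DIM('a))"
  define G where "G y = (\<integral>\<^sup>+z. ennreal (dF z / norm (y - z) ^ (DIM('a) + 1)) \<partial>\<mu>)" for y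
  have [measurable]: "G \<in> borel_measurable borel"
    unfolding G_def by measurable
  have "(\<integral>\<^sup>+y. G y * indicator (- \<Omega>) y \<partial>lborel) = (\<integral>\<^sup>+y. (\<integral>\<^sup>+z. ennreal (dF z / norm (y - z) ^ (DIM('a) + 1)) * indicator (- \<Omega>) y \<partial>\<mu>) \<partial>lborel)"
    unfolding G_def by (intro nn_integral_cong nn_integral_multc[symmetric]) auto
  also have "\<dots> = (\<integral>\<^sup>+z. (\<integral>\<^sup>+y. ennreal (dF z / norm (y - z) ^ (DIM('a) + 1)) * indicator (- \<Omega>) y \<partial>lborel) \<partial>\<mu>)"
    using Q.Fubini[of "\<lambda>p. ennreal (dF (fst p) / norm (snd p - fst p) ^ (DIM('a) + 1)) * indicator (- \<Omega>) (snd p)"] by simp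
  also have "\<dots> \<le> (\<integral>\<^sup>+z. ennreal (?\<omega> * 2 ^ (DIM('a) + 1)) \<partial>\<mu>)"
  proof (rule nn_integral_mono)
    fix z
    show "(\<integral>\<^sup>+y. ennreal (dF z / norm (y - z) ^ (DIM('a) + 1)) * indicator (- \<Omega>) y \<partial>lborel) \<le> ennreal (?\<omega> * 2 ^ (DIM('a) + 1))"
    proof (cases "dF z = 0")
      case False
      then have d: "dF z > 0" using dF_nonneg[of z] by linarith
      have "(\<integral>\<^sup>+y. ennreal (dF z / norm (y - z) ^ (DIM('a) + 1)) * indicator (- \<Omega>) y \<partial>lborel)
        \<le> (\<integral>\<^sup>+y. ennreal (dF z) * (ennreal (1 / norm (y - z) ^ (DIM('a) + 1)) * indicator (- ball z (4 * dF z)) y) \<partial>lborel)"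
      proof (rule nn_integral_mono)
        fix y
        show "ennreal (dF z / norm (y - z) ^ (DIM('a) + 1)) * indicator (- \<Omega>) y
          \<le> ennreal (dF z) * (ennreal (1 / norm (y - z) ^ (DIM('a) + 1)) * indicator (- ball z (4 * dF z)) y)"
        proof (cases "y \<in> \<Omega>")
          case False
          then have "y \<in> - ball z (4 * dF z)" using dF_le[OF False, of z] by (simp add: dist_norm norm_minus_commute)
          then show ?thesis using False d by (simp add: ennreal_mult[symmetric])
        qed simp
      qed
      also have "\<dots> = ennreal (dF z) * (\<integral>\<^sup>+y. ennreal (1 / norm (y - z) ^ (DIM('a) + 1)) * indicator (- ball z (4 * dF z)) y \<partial>lborel)"
        by (rule nn_integral_cmult) measurable
      also have "\<dots> \<le> ennreal (dF z) * ennreal (?\<omega> * 2 ^ (DIM('a) + 1) / (4 * dF z))"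
        using d by (intro mult_left_mono nn_integral_inverse_power_outside_le) auto
      also have "\<dots> = ennreal (?\<omega> * 2 ^ (DIM('a) + 1) / 4)"
        using d by (subst ennreal_mult[symmetric]) auto
      also have "\<dots> \<le> ennreal (?\<omega> * 2 ^ (DIM('a) + 1))" by (intro ennreal_leI) auto
      finally show ?thesis .
    qed simp
  qed
  also have "\<dots> < \<infinity>"
  proof -
    have "emeasure \<mu> UNIV < top" using \<mu>.emeasure_finite[of UNIV] by (simp add: less_top[symmetric])
    then show ?thesis by (simp add: ennreal_mult_less_top)
  qed
  finally have "AE y in lborel. G y * indicator (- \<Omega>) y \<noteq> \<infinity>"
    by (intro nn_integral_PInf_AE) auto
  then show ?thesis
    by (rule AE_mp) (intro AE_I2, auto simp: G_def less_top)
qed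

end

section \<open>The potential of the difference between a measure and its smearing\<close>

lemma critical_small_level:
  assumes N: "DIM('a::euclidean_space) \<ge> 2" and r: "r > 0" and s: "s > 0" and \<epsilon>: "\<epsilon> > 0"
    and sr: "s \<le> \<epsilon> / max 1 (unit_ball_vol (real DIM('a))) * r"
  shows "unit_ball_vol (real DIM('a)) * r ^ DIM('a) \<le> (\<epsilon> * r ^ DIM('a) / s) powr (real DIM('a) / (real DIM('a) - 1))"
proof -
  let ?p = "real DIM('a) / (real DIM('a) - 1)" and ?\<omega> = "unit_ball_vol (real DIM('a))"
  have "?\<omega> \<le> max 1 ?\<omega> powr ?p"
    using powr_mono[of 1 ?p "max 1 ?\<omega>"] critical_exponent_ge_1[OF N] by auto
  also have "max 1 ?\<omega> \<le> \<epsilon> / (s / r)"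
  proof -
    have "max 1 ?\<omega> * s \<le> max 1 ?\<omega> * (\<epsilon> / max 1 ?\<omega> * r)" by (intro mult_left_mono sr) auto
    also have "\<dots> = \<epsilon> * r" by (simp add: max_def)
    finally have "max 1 ?\<omega> \<le> (\<epsilon> * r) / s" by (simp only: pos_le_divide_eq[OF s])
    then show ?thesis by simp
  qed
  then have "max 1 ?\<omega> powr ?p \<le> (\<epsilon> / (s / r)) powr ?p"
    using critical_exponent_ge_1[OF N] by (intro powr_mono2) auto
  finally have "?\<omega> * r ^ DIM('a) \<le> r ^ DIM('a) * (\<epsilon> / (s / r)) powr ?p"
    using r by (simp add: mult.commute)
  then show ?thesis unfolding critical_scaling[OF N r less_imp_le[OF \<epsilon>] s] .
qed

context critical_kernel begin

lemma K_set_le: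
  assumes E[measurable]: "E \<in> sets borel" and e: "emeasure lborel E = ennreal e" "e > 0"
  shows "(\<integral>\<^sup>+x. ennreal \<bar>K (x - z)\<bar> * indicator E x \<partial>lborel)
    \<le> ennreal (A * (unit_ball_vol (real DIM('a)) * 2 ^ DIM('a) + 1) * e powr (1 / real DIM('a)))"
proof -
  let ?b = "(unit_ball_vol (real DIM('a)) * 2 ^ DIM('a) + 1) * e powr (1 / real DIM('a))"
  have "(\<integral>\<^sup>+x. ennreal \<bar>K (x - z)\<bar> * indicator E x \<partial>lborel)
    \<le> (\<integral>\<^sup>+x. ennreal A * (ennreal (1 / norm (x - z) ^ (DIM('a) - 1)) * indicator E x) \<partial>lborel)"
  proof (rule nn_integral_mono_AE)
    show "AE x in lborel. ennreal \<bar>K (x - z)\<bar> * indicator E x \<le> ennreal A * (ennreal (1 / norm (x - z) ^ (DIM('a) - 1)) * indicator E x)"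
      using AE_lborel_singleton[of z]
    proof (rule AE_mp, intro AE_I2 impI)
      fix x assume "x \<noteq> z"
      then have "\<bar>K (x - z)\<bar> \<le> A / norm (x - z) ^ (DIM('a) - 1)" by (intro K_le) auto
      then show "ennreal \<bar>K (x - z)\<bar> * indicator E x \<le> ennreal A * (ennreal (1 / norm (x - z) ^ (DIM('a) - 1)) * indicator E x)"
        using nonneg by (auto simp: ennreal_mult[symmetric] ennreal_leI split: split_indicator)
    qed
  qed
  also have "\<dots> = ennreal A * (\<integral>\<^sup>+x. ennreal (1 / norm (x - z) ^ (DIM('a) - 1)) * indicator E x \<partial>lborel)"
    by (rule nn_integral_cmult) measurable
  also have "\<dots> \<le> ennreal A * ennreal ?b"
    by (intro mult_left_mono nn_integral_inverse_power_set_le E e) auto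
  also have "\<dots> = ennreal (A * ?b)" using nonneg by (intro ennreal_mult[symmetric]) auto
  finally show ?thesis by (simp add: mult.assoc)
qed

definition finite_potential :: "'a measure \<Rightarrow> 'a set" where
  "finite_potential \<nu> = {x. (\<integral>\<^sup>+z. ennreal \<bar>K (x - z)\<bar> \<partial>\<nu>) < \<infinity>}"

text \<open>Integrating the restricted estimate over \<nu> gives a weak-type bound for the potential
  of |K|; letting the level tend to infinity leaves measure 0 for the set of infinite
  potential.\<close>

lemma finite_potential_null:
  assumes [measurable_cong]: "sets \<nu> = sets borel" and "finite_measure \<nu>"
  shows "- finite_potential \<nu> \<in> null_sets lborel"
proof -
  interpret \<nu>: finite_measure \<nu> by fact
  interpret Q: pair_sigma_finite \<nu> "lborel :: 'a measure" by (intro pair_sigma_finite.intro) unfold_locales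
  let ?p = "real DIM('a) / (real DIM('a) - 1)"
  define f where "f x = (\<integral>\<^sup>+z. ennreal \<bar>K (x - z)\<bar> \<partial>\<nu>)" for x
  have fm[measurable]: "f \<in> borel_measurable borel" unfolding f_def by measurable
  define C' where "C' = A * (unit_ball_vol (real DIM('a)) * 2 ^ DIM('a) + 1) * measure \<nu> UNIV"
  have C'0: "C' \<ge> 0" using nonneg by (simp add: C'_def)
  have weak: "emeasure lborel {x. ennreal s < f x} \<le> ennreal ((C' / s) powr ?p)" if "s > 0" for s
  proof (rule weak_type_of_restricted_type[OF fm dim C'0 that])
    fix E :: "'a set" and e :: real
    assume E[measurable]: "E \<in> sets borel" and e: "emeasure lborel E = ennreal e" "e > 0"
    have "(\<integral>\<^sup>+x. f x * indicator E x \<partial>lborel) = (\<integral>\<^sup>+x. (\<integral>\<^sup>+z. ennreal \<bar>K (x - z)\<bar> * indicator E x \<partial>\<nu>) \<partial>lborel)"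
      unfolding f_def by (intro nn_integral_cong nn_integral_multc[symmetric]) measurable
    also have "\<dots> = (\<integral>\<^sup>+z. (\<integral>\<^sup>+x. ennreal \<bar>K (x - z)\<bar> * indicator E x \<partial>lborel) \<partial>\<nu>)"
      using Q.Fubini[of "\<lambda>p. ennreal \<bar>K (snd p - fst p)\<bar> * indicator E (snd p)"] by simp
    also have "\<dots> \<le> (\<integral>\<^sup>+z. ennreal (A * (unit_ball_vol (real DIM('a)) * 2 ^ DIM('a) + 1) * e powr (1 / real DIM('a))) \<partial>\<nu>)"
      by (intro nn_integral_mono K_set_le E e)
    also have "\<dots> = ennreal (A * (unit_ball_vol (real DIM('a)) * 2 ^ DIM('a) + 1) * e powr (1 / real DIM('a))) * emeasure \<nu> UNIV"
      using sets_eq_imp_space_eq[OF assms(1)] by simp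
    also have "\<dots> = ennreal (C' * e powr (1 / real DIM('a)))"
      using nonneg unfolding \<nu>.emeasure_eq_measure C'_def by (subst ennreal_mult[symmetric]) (auto simp: mult_ac)
    finally show "(\<integral>\<^sup>+x. f x * indicator E x \<partial>lborel) \<le> ennreal (C' * e powr (1 / real DIM('a)))" .
  qed
  have "- finite_potential \<nu> = {x. f x = \<infinity>}" by (auto simp: finite_potential_def f_def less_top[symmetric])
  moreover have "emeasure lborel {x. f x = \<infinity>} \<le> 0"
  proof (rule LIMSEQ_le_const)
    have "(\<lambda>n. C' * inverse (real (Suc n))) \<longlonglongrightarrow> C' * 0" by (intro tendsto_intros LIMSEQ_inverse_real_of_nat)
    then have "(\<lambda>n. (C' / real (Suc n)) powr ?p) \<longlonglongrightarrow> 0 powr ?p"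
      using critical_exponent_ge_1[OF dim] C'0
      by (intro tendsto_powr') (auto simp: divide_inverse)
    then show "(\<lambda>n. ennreal ((C' / real (Suc n)) powr ?p)) \<longlonglongrightarrow> 0"
      using tendsto_ennrealI by fastforce
    show "\<exists>N. \<forall>n\<ge>N. emeasure lborel {x. f x = \<infinity>} \<le> ennreal ((C' / real (Suc n)) powr ?p)"
    proof (intro exI allI impI)
      fix n :: nat
      have "emeasure lborel {x. f x = \<infinity>} \<le> emeasure lborel {x. ennreal (real (Suc n)) < f x}"
        by (intro emeasure_mono) (auto simp del: of_nat_Suc)
      also have "\<dots> \<le> ennreal ((C' / real (Suc n)) powr ?p)" by (rule weak) simp
      finally show "emeasure lborel {x. f x = \<infinity>} \<le> ennreal ((C' / real (Suc n)) powr ?p)" .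
    qed
  qed
  ultimately show ?thesis by (simp add: null_sets_def)
qed

end

section \<open>The bad part as an integral over the product of mass and displacement\<close>

locale smeared_kernel = critical_kernel K DK A B C + smearing \<mu> t
  for K :: "'a::euclidean_space \<Rightarrow> real" and DK A B C and \<mu> :: "'a measure" and t
begin

abbreviation "P2 \<equiv> \<mu> \<Otimes>\<^sub>M (unit_uniform :: 'a measure)"

definition "T p = fst p + dF (fst p) *\<^sub>R snd p"

lemma spread_measurable [measurable]: "T \<in> borel_measurable P2" unfolding T_def by measurable

text \<open>The change at x caused by moving a unit of mass from \<open>fst p\<close> to
  \<open>T p\<close>.\<close>

definition "H x p = K (x - fst p) - K (x - T p)"

lemma H_meas [measurable]: "H x \<in> borel_measurable P2" unfolding H_def by measurable

lemma H_meas_pair [measurable]: "(\<lambda>q. H (fst q) (snd q)) \<in> borel_measurable (lborel \<Otimes>\<^sub>M P2)"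
  unfolding H_def T_def by measurable

definition "bad_potential x = (\<integral>p. H x p \<partial>P2)"

definition "near y r x = (\<integral>\<^sup>+p. ennreal \<bar>H x p\<bar> * indicator (\<Omega> \<inter> ball y (2 * r)) (fst p) \<partial>P2)"

definition "Cw = 2 * (A * (unit_ball_vol (real DIM('a)) * 2 ^ DIM('a) + 1))"

lemma Cw_nonneg: "Cw \<ge> 0" using nonneg by (simp add: Cw_def)

lemma near_measurable [measurable]: "near y r \<in> borel_measurable borel"
proof -
  have sf: "sigma_finite_measure P2" by unfold_locales
  have "(\<lambda>q. ennreal \<bar>H (fst q) (snd q)\<bar> * indicator (\<Omega> \<inter> ball y (2 * r)) (fst (snd q))) \<in> borel_measurable (lborel \<Otimes>\<^sub>M P2)"
    by measurable
  from sigma_finite_measure.borel_measurable_nn_integral_fst[OF sf this] show ?thesis by (simp add: near_def[abs_def])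
qed

text \<open>The restricted estimate for each of the two poles, hence the factor 2 in
  \<open>Cw\<close>, is integrated over the mass concerned. Only the mass of \<Omega> in B_2r(y)
  enters, so its smallness passes to the weak norm.\<close>

lemma near_weak_type:
  assumes s: "s > 0" and \<beta>: "emeasure \<mu> (\<Omega> \<inter> ball y (2 * r)) \<le> ennreal \<beta>" "\<beta> \<ge> 0"
  shows "emeasure lborel {x. ennreal s < near y r x} \<le> ennreal ((Cw * \<beta> / s) powr (real DIM('a) / (real DIM('a) - 1)))"
proof (rule weak_type_of_restricted_type[OF near_measurable dim _ s])
  interpret fP: finite_measure P2 by (rule finite_measure_P)
  interpret PP: pair_sigma_finite "lborel :: 'a measure" P2 by (intro pair_sigma_finite.intro) unfold_locales
  show "Cw * \<beta> \<ge> 0" using Cw_nonneg \<beta>(2) by simp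
  fix E :: "'a set" and e :: real
  assume E[measurable]: "E \<in> sets borel" and e: "emeasure lborel E = ennreal e" "e > 0"
  let ?I = "\<lambda>p. indicator (\<Omega> \<inter> ball y (2 * r)) (fst p) :: ennreal"
  let ?b = "e powr (1 / real DIM('a))"
  have "(\<integral>\<^sup>+x. near y r x * indicator E x \<partial>lborel) = (\<integral>\<^sup>+x. (\<integral>\<^sup>+p. ennreal \<bar>H x p\<bar> * ?I p * indicator E x \<partial>P2) \<partial>lborel)"
    unfolding near_def by (intro nn_integral_cong nn_integral_multc[symmetric]) measurable
  also have "\<dots> = (\<integral>\<^sup>+p. (\<integral>\<^sup>+x. ennreal \<bar>H x p\<bar> * ?I p * indicator E x \<partial>lborel) \<partial>P2)"
    using PP.Fubini'[of "\<lambda>x p. ennreal \<bar>H x p\<bar> * ?I p * indicator E x"] by (simp add: case_prod_beta')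
  also have "\<dots> \<le> (\<integral>\<^sup>+p. ennreal (Cw * ?b) * ?I p \<partial>P2)"
  proof (rule nn_integral_mono)
    fix p
    have "(\<integral>\<^sup>+x. ennreal \<bar>H x p\<bar> * indicator E x \<partial>lborel)
       \<le> (\<integral>\<^sup>+x. ennreal \<bar>K (x - fst p)\<bar> * indicator E x + ennreal \<bar>K (x - T p)\<bar> * indicator E x \<partial>lborel)"
    proof (rule nn_integral_mono)
      fix x
      have "\<bar>H x p\<bar> \<le> \<bar>K (x - fst p)\<bar> + \<bar>K (x - T p)\<bar>" unfolding H_def by (rule abs_triangle_ineq4)
      then show "ennreal \<bar>H x p\<bar> * indicator E x \<le> ennreal \<bar>K (x - fst p)\<bar> * indicator E x + ennreal \<bar>K (x - T p)\<bar> * indicator E x"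
        by (auto simp: ennreal_plus[symmetric] ennreal_leI simp del: ennreal_plus split: split_indicator)
    qed
    also have "\<dots> = (\<integral>\<^sup>+x. ennreal \<bar>K (x - fst p)\<bar> * indicator E x \<partial>lborel) + (\<integral>\<^sup>+x. ennreal \<bar>K (x - T p)\<bar> * indicator E x \<partial>lborel)"
      by (rule nn_integral_add) measurable
    also have "\<dots> \<le> ennreal (A * (unit_ball_vol (real DIM('a)) * 2 ^ DIM('a) + 1) * ?b) + ennreal (A * (unit_ball_vol (real DIM('a)) * 2 ^ DIM('a) + 1) * ?b)"
      by (intro add_mono K_set_le E e)
    also have "\<dots> = ennreal (Cw * ?b)"
      using nonneg by (subst ennreal_plus[symmetric]) (auto simp: Cw_def)
    finally have le: "(\<integral>\<^sup>+x. ennreal \<bar>H x p\<bar> * indicator E x \<partial>lborel) \<le> ennreal (Cw * ?b)" .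
    show "(\<integral>\<^sup>+x. ennreal \<bar>H x p\<bar> * ?I p * indicator E x \<partial>lborel) \<le> ennreal (Cw * ?b) * ?I p"
      using le by (cases "fst p \<in> \<Omega> \<inter> ball y (2 * r)") auto
  qed
  also have "\<dots> = ennreal (Cw * ?b) * emeasure \<mu> (\<Omega> \<inter> ball y (2 * r))"
    using nn_integral_P_fst[of "\<lambda>z. ennreal (Cw * ?b) * indicator (\<Omega> \<inter> ball y (2 * r)) z"]
    by (simp add: nn_integral_cmult_indicator)
  also have "\<dots> \<le> ennreal (Cw * ?b) * ennreal \<beta>" by (intro mult_left_mono \<beta>) auto
  also have "\<dots> = ennreal (Cw * \<beta> * ?b)" using Cw_nonneg \<beta>(2) by (subst ennreal_mult[symmetric]) (auto simp: mult_ac)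
  finally show "(\<integral>\<^sup>+x. near y r x * indicator E x \<partial>lborel) \<le> ennreal (Cw * \<beta> * ?b)" .
qed

abbreviation "good_pts \<equiv> finite_potential \<mu>"

definition "\<tau> y r = (\<integral>\<^sup>+z. ennreal (min (dF z) r / norm (y - z) ^ (DIM('a) + 1)) \<partial>\<mu>)"

text \<open>Both potentials converge absolutely at x: that of \<mu> by the choice of x, that of
  \<gamma> because its density is in \<open>bdd_int\<close>. The product measure projects to \<mu>
  and maps to \<gamma>, so the decomposition is an identity at each such x.\<close>

lemma
  assumes g: "g \<in> bdd_int" "\<And>x. 0 \<le> g x" "\<gamma> = density lborel (\<lambda>x. ennreal (g x))" and x: "x \<in> good_pts"
  shows H_integrable: "integrable P2 (H x)"
    and decomposition: "(\<integral>z. K (x - z) \<partial>\<mu>) = bad_potential x + conv K g x"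
proof -
  note [measurable] = bdd_intD(1)[OF g(1)]
  have i1: "integrable P2 (\<lambda>p. K (x - fst p))"
  proof (rule integrableI_bounded)
    show "(\<integral>\<^sup>+p. norm (K (x - fst p)) \<partial>P2) < \<infinity>"
      using x nn_integral_P_fst[of "\<lambda>z. ennreal \<bar>K (x - z)\<bar>"] by (simp add: finite_potential_def)
  qed measurable
  have "integrable lborel (\<lambda>y. g y * K (x - y))" using conv_K_integrable[OF g(1), of x] by (simp add: mult.commute)
  then have i\<gamma>: "integrable \<gamma> (\<lambda>y. K (x - y))"
    unfolding g(3) using g(2) by (subst integrable_real_density) auto
  then have i2: "integrable P2 (\<lambda>p. K (x - T p))"
    unfolding \<gamma>_def T_def by (subst (asm) integrable_distr_eq) auto
  show "integrable P2 (H x)" unfolding H_def by (rule Bochner_Integration.integrable_diff[OF i1 i2])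
  have "(\<integral>p. K (x - T p) \<partial>P2) = (\<integral>y. K (x - y) \<partial>\<gamma>)"
    unfolding \<gamma>_def T_def by (rule integral_distr[symmetric]) auto
  also have "\<dots> = conv K g x"
    unfolding g(3) conv_def using g(2) by (subst integral_real_density) (auto simp: mult.commute)
  finally have 2: "(\<integral>p. K (x - T p) \<partial>P2) = conv K g x" .
  have "(\<integral>p. K (x - fst p) \<partial>P2) = (\<integral>z. (\<integral>\<zeta>. K (x - fst (z, \<zeta>)) \<partial>(unit_uniform :: 'a measure)) \<partial>\<mu>)"
    by (rule P.integral_fst'[symmetric, OF i1])
  also have "\<dots> = (\<integral>z. K (x - z) \<partial>\<mu>)" by (simp add: measure_def)
  finally have 1: "(\<integral>p. K (x - fst p) \<partial>P2) = (\<integral>z. K (x - z) \<partial>\<mu>)" .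
  show "(\<integral>z. K (x - z) \<partial>\<mu>) = bad_potential x + conv K g x"
    unfolding bad_potential_def H_def by (simp add: i1 i2 1 2)
qed

text \<open>Dominated convergence along r = 1/(k+1) with the full Marcinkiewicz integral as
  majorant; monotonicity in r covers the other radii.\<close>

lemma tau_tendsto:
  assumes y: "(\<integral>\<^sup>+z. ennreal (dF z / norm (y - z) ^ (DIM('a) + 1)) \<partial>\<mu>) < \<infinity>" and \<epsilon>: "\<epsilon> > 0"
  shows "\<exists>\<delta>>0. \<forall>r. 0 < r \<longrightarrow> r < \<delta> \<longrightarrow> \<tau> y r \<le> ennreal \<epsilon>"
proof -
  have mono: "\<tau> y r \<le> \<tau> y r'" if "r \<le> r'" for r r'
    unfolding \<tau>_def by (intro nn_integral_mono ennreal_leI divide_right_mono min.mono that) auto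
  have "(\<lambda>k. \<tau> y (1 / Suc k)) \<longlonglongrightarrow> (\<integral>\<^sup>+z. 0 \<partial>\<mu>)"
    unfolding \<tau>_def
  proof (rule nn_integral_dominated_convergence[where w = "\<lambda>z. ennreal (dF z / norm (y - z) ^ (DIM('a) + 1))"])
    show "AE z in \<mu>. ennreal (min (dF z) (1 / real (Suc j)) / norm (y - z) ^ (DIM('a) + 1)) \<le> ennreal (dF z / norm (y - z) ^ (DIM('a) + 1))" for j
      by (intro AE_I2 ennreal_leI divide_right_mono) auto
    show "AE z in \<mu>. (\<lambda>k. ennreal (min (dF z) (1 / real (Suc k)) / norm (y - z) ^ (DIM('a) + 1))) \<longlonglongrightarrow> 0"
    proof (rule AE_I2)
      fix z
      have l: "(\<lambda>k. 1 / real (Suc k)) \<longlonglongrightarrow> 0"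
        using LIMSEQ_inverse_real_of_nat by (simp only: inverse_eq_divide)
      have "(\<lambda>k. min (dF z) (1 / real (Suc k)) * (1 / norm (y - z) ^ (DIM('a) + 1))) \<longlonglongrightarrow> min (dF z) 0 * (1 / norm (y - z) ^ (DIM('a) + 1))"
        by (intro tendsto_mult tendsto_min tendsto_const l)
      then have "(\<lambda>k. min (dF z) (1 / real (Suc k)) / norm (y - z) ^ (DIM('a) + 1)) \<longlonglongrightarrow> min (dF z) 0 / norm (y - z) ^ (DIM('a) + 1)"
        by (simp only: times_divide_eq_right mult_1_right)
      then have "(\<lambda>k. ennreal (min (dF z) (1 / real (Suc k)) / norm (y - z) ^ (DIM('a) + 1))) \<longlonglongrightarrow> ennreal 0"
        by (intro tendsto_ennrealI) simp
      then show "(\<lambda>k. ennreal (min (dF z) (1 / real (Suc k)) / norm (y - z) ^ (DIM('a) + 1))) \<longlonglongrightarrow> 0" by simp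
    qed
  qed (use y in auto)
  then have "(\<lambda>k. \<tau> y (1 / Suc k)) \<longlonglongrightarrow> 0" by simp
  from order_tendstoD(2)[OF this, of "ennreal \<epsilon>"]
  have "\<forall>\<^sub>F k in sequentially. \<tau> y (1 / Suc k) < ennreal \<epsilon>" using \<epsilon> by simp
  then obtain k where k: "\<tau> y (1 / Suc k) < ennreal \<epsilon>" by (auto simp: eventually_sequentially)
  show ?thesis
  proof (intro exI[of _ "1 / real (Suc k)"] conjI allI impI)
    fix r assume "0 < r" "r < 1 / real (Suc k)"
    then have "\<tau> y r \<le> \<tau> y (1 / real (Suc k))" by (intro mono) simp
    then show "\<tau> y r \<le> ennreal \<epsilon>" using k by simp
  qed simp
qed

text \<open>The derivative at y taken formally under the integral; for y in \<open>F\<close>,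
  restriction to mass in \<Omega> keeps y distinct from \<open>fst p\<close>.\<close>

definition "bad_deriv y h = (\<integral>p. (if fst p \<in> \<Omega> then DK (y - fst p) h - DK (y - T p) h else 0) \<partial>P2)"

lemma spread_props:
  assumes "norm (snd p) < 1"
  shows "norm (fst p - T p) \<le> dF (fst p)" "fst p \<notin> \<Omega> \<Longrightarrow> T p = fst p"
  using assms by (auto simp: T_def dF_F mult_left_le)

text \<open>Integrating \<open>remainder_estimate\<close> bounds the error by
  \<open>Cbad * r * \<tau> y r\<close> plus \<open>near y r x\<close>. The first term is o(r) for
  every x in the ball; the second has a weak norm controlled by the mass of \<Omega> near y, which
  is o(r^N) at a density point.\<close>

lemma bad_part:
  assumes g: "g \<in> bdd_int" "\<And>x. 0 \<le> g x" "\<gamma> = density lborel (\<lambda>x. ennreal (g x))"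
    and y: "y \<notin> \<Omega>" "y \<in> good_pts" "(\<integral>\<^sup>+z. ennreal (dF z / norm (y - z) ^ (DIM('a) + 1)) \<partial>\<mu>) < \<infinity>"
    and dens: "\<And>\<epsilon>. \<epsilon> > 0 \<Longrightarrow> \<exists>\<delta>>0. \<forall>r. 0 < r \<and> r < \<delta> \<longrightarrow> emeasure lborel (ball y r \<inter> \<Omega>) \<le> ennreal (\<epsilon> * r ^ DIM('a))"
    and null: "- good_pts \<in> null_sets lborel"
  shows "linear (bad_deriv y)" "weakly_diff bad_potential y (bad_deriv y)"
proof -
  let ?h' = "\<lambda>h p. if fst p \<in> \<Omega> then DK (y - fst p) h - DK (y - T p) h else 0"
  have [measurable]: "(\<lambda>p. ?h' h p) \<in> borel_measurable P2" for h by measurable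
  define G where "G = (\<integral>\<^sup>+z. ennreal (dF z / norm (y - z) ^ (DIM('a) + 1)) \<partial>\<mu>)"
  have yz: "y \<noteq> z" if "z \<in> \<Omega>" for z using y(1) that by auto
  have h'le: "\<bar>?h' h p\<bar> \<le> (B * 4 ^ (DIM('a) + 1) * norm h) * (dF (fst p) / norm (y - fst p) ^ (DIM('a) + 1))"
    if "norm (snd p) < 1" for h p
  proof (cases "fst p \<in> \<Omega>")
    case True
    then show ?thesis
      using near_estimates(2)[OF refl _ spread_props(1)[OF that] dF_le[OF y(1)], of h] yz[OF True] by (simp add: mult_ac)
  qed (use nonneg in auto)
  have ih': "integrable P2 (?h' h)" for h
  proof (rule integrableI_bounded)
    let ?c = "B * 4 ^ (DIM('a) + 1) * norm h"
    have "(\<integral>\<^sup>+p. norm (?h' h p) \<partial>P2) \<le> (\<integral>\<^sup>+p. ennreal ?c * ennreal (dF (fst p) / norm (y - fst p) ^ (DIM('a) + 1)) \<partial>P2)"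
      using AE_P
    proof (intro nn_integral_mono_AE, elim AE_mp, intro AE_I2 impI)
      fix p :: "'a \<times> 'a" assume p: "norm (snd p) < 1"
      show "ennreal (norm (?h' h p)) \<le> ennreal ?c * ennreal (dF (fst p) / norm (y - fst p) ^ (DIM('a) + 1))"
        using ennreal_leI[OF h'le[OF p, of h]] nonneg by (subst ennreal_mult[symmetric]) auto
    qed
    also have "\<dots> = ennreal ?c * G"
      unfolding G_def using nn_integral_P_fst[of "\<lambda>z. ennreal ?c * ennreal (dF z / norm (y - z) ^ (DIM('a) + 1))"]
      by (simp add: nn_integral_cmult)
    also have "\<dots> < \<infinity>" using y(3) by (simp add: G_def ennreal_mult_less_top)
    finally show "(\<integral>\<^sup>+p. norm (?h' h p) \<partial>P2) < \<infinity>" .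
  qed measurable
  show "linear (bad_deriv y)"
  proof (rule linearI)
    fix h1 h2 and c :: real
    have "?h' (h1 + h2) p = ?h' h1 p + ?h' h2 p" for p by (simp add: blinfun.add_right)
    then show "bad_deriv y (h1 + h2) = bad_deriv y h1 + bad_deriv y h2" unfolding bad_deriv_def using ih' by simp
    have "?h' (c *\<^sub>R h1) p = c * ?h' h1 p" for p by (simp add: blinfun.scaleR_right algebra_simps)
    then show "bad_deriv y (c *\<^sub>R h1) = c *\<^sub>R bad_deriv y h1" unfolding bad_deriv_def by simp
  qed
  have rem: "ennreal \<bar>bad_potential x - bad_potential y - bad_deriv y (x - y)\<bar> \<le> ennreal (Cbad * r) * \<tau> y r + near y r x"
    if x: "x \<in> ball y r" "x \<in> good_pts" for x r
  proof -
    have xr: "norm (x - y) < r" using x by (simp add: dist_norm norm_minus_commute)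
    then have r: "r > 0" using norm_ge_zero[of "x - y"] by linarith
    note ix = H_integrable[OF g x(2)] and iy = H_integrable[OF g y(2)]
    have "bad_potential x - bad_potential y - bad_deriv y (x - y) = (\<integral>p. H x p - H y p - ?h' (x - y) p \<partial>P2)"
      unfolding bad_potential_def bad_deriv_def using ix iy ih'[of "x - y"] by simp
    moreover have ii: "integrable P2 (\<lambda>p. H x p - H y p - ?h' (x - y) p)"
      by (intro Bochner_Integration.integrable_diff ix iy ih')
    ultimately have "ennreal \<bar>bad_potential x - bad_potential y - bad_deriv y (x - y)\<bar> \<le> (\<integral>\<^sup>+p. norm (H x p - H y p - ?h' (x - y) p) \<partial>P2)"
      using integral_norm_bound_ennreal[OF ii] by (simp only: real_norm_def)
    also have "\<dots> \<le> (\<integral>\<^sup>+p. ennreal (Cbad * r) * ennreal (min (dF (fst p)) r / norm (y - fst p) ^ (DIM('a) + 1))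
         + ennreal \<bar>H x p\<bar> * indicator (\<Omega> \<inter> ball y (2 * r)) (fst p) \<partial>P2)"
      using AE_P
    proof (intro nn_integral_mono_AE, elim AE_mp, intro AE_I2 impI)
      fix p :: "'a \<times> 'a" assume p: "norm (snd p) < 1"
      let ?q = "min (dF (fst p)) r / norm (y - fst p) ^ (DIM('a) + 1)"
      have q0: "?q \<ge> 0" using r by auto
      show "ennreal (norm (H x p - H y p - ?h' (x - y) p)) \<le> ennreal (Cbad * r) * ennreal ?q + ennreal \<bar>H x p\<bar> * indicator (\<Omega> \<inter> ball y (2 * r)) (fst p)"
      proof (cases "fst p \<in> \<Omega>")
        case False
        then have "norm (H x p - H y p - ?h' (x - y) p) = 0" using spread_props(2)[OF p False] by (simp add: H_def)
        then show ?thesis by simp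
      next
        case True
        have "norm (H x p - H y p - ?h' (x - y) p) \<le> Cbad * r * ?q + (if norm (y - fst p) < 2 * r then \<bar>H x p\<bar> else 0)"
          using remainder_estimate[OF yz[OF True] spread_props(1)[OF p] dF_le[OF y(1)] xr] True
          by (simp only: H_def if_True real_norm_def)
        then have "ennreal (norm (H x p - H y p - ?h' (x - y) p)) \<le> ennreal (Cbad * r * ?q + (if norm (y - fst p) < 2 * r then \<bar>H x p\<bar> else 0))"
          by (rule ennreal_leI)
        also have "\<dots> = ennreal (Cbad * r) * ennreal ?q + ennreal \<bar>H x p\<bar> * indicator (\<Omega> \<inter> ball y (2 * r)) (fst p)"
        proof -
          have m: "ennreal (Cbad * r * ?q) = ennreal (Cbad * r) * ennreal ?q"
            using Cbad_nonneg r q0 by (intro ennreal_mult) auto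
          have "ennreal (Cbad * r * ?q + (if norm (y - fst p) < 2 * r then \<bar>H x p\<bar> else 0))
             = ennreal (Cbad * r * ?q) + ennreal (if norm (y - fst p) < 2 * r then \<bar>H x p\<bar> else 0)"
            using Cbad_nonneg r q0 by (intro ennreal_plus mult_nonneg_nonneg) auto
          then show ?thesis unfolding m using True by (auto simp: dist_norm)
        qed
        finally show ?thesis .
      qed
    qed
    also have "\<dots> = (\<integral>\<^sup>+p. ennreal (Cbad * r) * ennreal (min (dF (fst p)) r / norm (y - fst p) ^ (DIM('a) + 1)) \<partial>P2) + near y r x"
      unfolding near_def by (rule nn_integral_add) measurable
    also have "(\<integral>\<^sup>+p. ennreal (Cbad * r) * ennreal (min (dF (fst p)) r / norm (y - fst p) ^ (DIM('a) + 1)) \<partial>P2) = ennreal (Cbad * r) * \<tau> y r"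
      unfolding \<tau>_def using nn_integral_P_fst[of "\<lambda>z. ennreal (Cbad * r) * ennreal (min (dF z) r / norm (y - z) ^ (DIM('a) + 1))"]
      by (simp add: nn_integral_cmult)
    finally show ?thesis .
  qed
  show "weakly_diff bad_potential y (bad_deriv y)"
    unfolding weakly_diff_def
  proof (intro allI impI)
    let ?p = "real DIM('a) / (real DIM('a) - 1)" and ?\<omega> = "unit_ball_vol (real DIM('a))"
    fix \<epsilon> :: real assume \<epsilon>: "\<epsilon> > 0"
    \<comment> \<open>Makes the pointwise term at most s/2 at every level above the trivial
      range.\<close>
    define \<epsilon>1 where "\<epsilon>1 = \<epsilon> / max 1 ?\<omega> / (2 * (Cbad + 1))"
    have \<epsilon>1: "\<epsilon>1 > 0" using \<epsilon> Cbad_nonneg by (simp add: \<epsilon>1_def)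
    obtain \<delta>1 where \<delta>1: "\<delta>1 > 0" "\<And>r. 0 < r \<Longrightarrow> r < \<delta>1 \<Longrightarrow> \<tau> y r \<le> ennreal \<epsilon>1"
      using tau_tendsto[OF y(3) \<epsilon>1] by blast
    \<comment> \<open>Compensates the level s/2, the weak-type constant, the smearing constant and
      the radius 3r; the added ones keep the denominator positive.\<close>
    define \<epsilon>2 where "\<epsilon>2 = \<epsilon> / (2 * (Cw + 1) * (Csm + 1) * 3 ^ DIM('a))"
    have \<epsilon>2: "\<epsilon>2 > 0" using \<epsilon> Cw_nonneg Csm_nonneg by (simp add: \<epsilon>2_def)
    obtain \<delta>2 where \<delta>2: "\<delta>2 > 0" "\<And>r. 0 < r \<Longrightarrow> r < \<delta>2 \<Longrightarrow> emeasure lborel (ball y r \<inter> \<Omega>) \<le> ennreal (\<epsilon>2 * r ^ DIM('a))"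
      using dens[OF \<epsilon>2] by blast
    show "\<exists>\<delta>>0. \<forall>r s. 0 < r \<longrightarrow> r < \<delta> \<longrightarrow> 0 < s \<longrightarrow>
       (\<exists>S\<in>sets borel. {x \<in> ball y r. s < \<bar>bad_potential x - bad_potential y - bad_deriv y (x - y)\<bar>} \<subseteq> S \<and>
          emeasure lborel S \<le> ennreal ((\<epsilon> * r ^ DIM('a) / s) powr ?p))"
    \<comment> \<open>Density is used on the ball of radius 3r, hence \<delta>2/3.\<close>
    proof (intro exI[of _ "min \<delta>1 (\<delta>2 / 3)"] conjI allI impI)
      fix r s :: real assume r: "0 < r" "r < min \<delta>1 (\<delta>2 / 3)" and s: "0 < s"
      show "\<exists>S\<in>sets borel. {x \<in> ball y r. s < \<bar>bad_potential x - bad_potential y - bad_deriv y (x - y)\<bar>} \<subseteq> S \<and>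
          emeasure lborel S \<le> ennreal ((\<epsilon> * r ^ DIM('a) / s) powr ?p)"
      proof (cases "s \<le> \<epsilon> / max 1 ?\<omega> * r")
        case True
        have "?\<omega> * r ^ DIM('a) \<le> (\<epsilon> * r ^ DIM('a) / s) powr ?p"
          by (rule critical_small_level[OF dim r(1) s \<epsilon> True])
        then show ?thesis using r by (intro bexI[of _ "ball y r"]) (auto simp: emeasure_ball ennreal_leI)
      next
        case False
        define \<beta> where "\<beta> = Csm * (\<epsilon>2 * (3 * r) ^ DIM('a))"
        have \<beta>0: "\<beta> \<ge> 0" using Csm_nonneg \<epsilon>2 r by (simp add: \<beta>_def)
        have \<beta>: "emeasure \<mu> (\<Omega> \<inter> ball y (2 * r)) \<le> ennreal \<beta>"
        proof -
          have "emeasure \<mu> (\<Omega> \<inter> ball y (2 * r)) \<le> ennreal Csm * emeasure lborel (ball y (3 * r) \<inter> \<Omega>)"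
            by (rule mass_near_le[OF y(1) r(1)])
          also have "\<dots> \<le> ennreal Csm * ennreal (\<epsilon>2 * (3 * r) ^ DIM('a))"
            using r by (intro mult_left_mono \<delta>2(2)) auto
          also have "\<dots> = ennreal \<beta>" using Csm_nonneg \<epsilon>2 r by (simp add: \<beta>_def ennreal_mult)
          finally show ?thesis .
        qed
        \<comment> \<open>Points of divergent potential are put into the exceptional set: they form
          a null set, and the pointwise estimate does not apply to them.\<close>
        define S where "S = {x. ennreal (s / 2) < near y r x} \<union> - good_pts"
        have S1[measurable]: "{x. ennreal (s / 2) < near y r x} \<in> sets borel" by measurable
        have gp: "- good_pts \<in> sets borel" using null by auto
        show ?thesis
        proof (intro bexI[of _ S] conjI)
          show "S \<in> sets borel" unfolding S_def using S1 gp by (rule sets.Un)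
          show "{x \<in> ball y r. s < \<bar>bad_potential x - bad_potential y - bad_deriv y (x - y)\<bar>} \<subseteq> S"
          proof (rule subsetI, rule ccontr)
            fix x assume x: "x \<in> {x \<in> ball y r. s < \<bar>bad_potential x - bad_potential y - bad_deriv y (x - y)\<bar>}" and nS: "x \<notin> S"
            have gx: "x \<in> good_pts" and nx: "near y r x \<le> ennreal (s / 2)" using nS by (auto simp: S_def not_less)
            have "ennreal \<bar>bad_potential x - bad_potential y - bad_deriv y (x - y)\<bar> \<le> ennreal (Cbad * r) * \<tau> y r + near y r x"
              using x gx by (intro rem) auto
            also have "\<dots> \<le> ennreal (Cbad * r) * ennreal \<epsilon>1 + ennreal (s / 2)"
              using \<delta>1(2)[of r] r nx by (intro add_mono mult_left_mono) auto
            also have "\<dots> = ennreal (Cbad * r * \<epsilon>1 + s / 2)"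
              using Cbad_nonneg r \<epsilon>1 s by (simp add: ennreal_mult[symmetric] ennreal_plus[symmetric] del: ennreal_plus)
            finally have "\<bar>bad_potential x - bad_potential y - bad_deriv y (x - y)\<bar> \<le> Cbad * r * \<epsilon>1 + s / 2"
              using Cbad_nonneg r \<epsilon>1 s by (subst (asm) ennreal_le_iff) auto
            moreover have "Cbad * r * \<epsilon>1 \<le> s / 2"
            proof -
              have "Cbad * r * \<epsilon>1 = (Cbad / (Cbad + 1)) * (\<epsilon> / max 1 ?\<omega> * r) / 2"
                unfolding \<epsilon>1_def
                by (simp only: times_divide_eq_left times_divide_eq_right divide_divide_eq_left mult_ac)
              also have "\<dots> \<le> 1 * (\<epsilon> / max 1 ?\<omega> * r) / 2"
                using Cbad_nonneg \<epsilon> r by (intro divide_right_mono mult_right_mono) auto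
              also have "\<dots> \<le> s / 2" using False by simp
              finally show ?thesis .
            qed
            ultimately show False using x by simp
          qed
          have "emeasure lborel S \<le> emeasure lborel {x. ennreal (s / 2) < near y r x} + emeasure lborel (- good_pts)"
            unfolding S_def by (rule emeasure_subadditive) (use S1 gp in auto)
          also have "\<dots> = emeasure lborel {x. ennreal (s / 2) < near y r x}" using null by auto
          also have "\<dots> \<le> ennreal ((Cw * \<beta> / (s / 2)) powr ?p)"
            by (rule near_weak_type[OF _ \<beta> \<beta>0]) (use s in simp)
          also have "\<dots> \<le> ennreal ((\<epsilon> * r ^ DIM('a) / s) powr ?p)"
          proof (intro ennreal_leI powr_mono2)
            have "Cw * \<beta> / (s / 2) = (Cw / (Cw + 1)) * (Csm / (Csm + 1)) * (\<epsilon> * r ^ DIM('a) / s)"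
            proof -
              have alg: "cw * (cs * (e / (2 * a * b * q) * (q * x))) / (s / 2) = (cw / a) * (cs / b) * (e * x / s)"
                if "a > 0" "b > 0" "q > 0" for cw cs e a b q x :: real
                using that s by (simp add: field_simps)
              show ?thesis
                unfolding \<beta>_def \<epsilon>2_def power_mult_distrib
                by (rule alg) (use Cw_nonneg Csm_nonneg in auto)
            qed
            also have "\<dots> \<le> 1 * 1 * (\<epsilon> * r ^ DIM('a) / s)"
              using Cw_nonneg Csm_nonneg \<epsilon> r s by (intro mult_right_mono mult_mono) auto
            finally show "Cw * \<beta> / (s / 2) \<le> \<epsilon> * r ^ DIM('a) / s" by simp
          qed (use Cw_nonneg \<beta>0 s critical_exponent_ge_1[OF dim] in auto)
          finally show "emeasure lborel S \<le> ennreal ((\<epsilon> * r ^ DIM('a) / s) powr ?p)" .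
        qed
      qed
    qed (use \<delta>1 \<delta>2 in auto)
  qed
qed

end

section \<open>Potentials of finite positive measures\<close>

context critical_kernel begin

lemma potential_weakly_diff_off_large_balls:
  fixes \<nu> :: "'a measure"
  assumes sets: "sets \<nu> = sets borel" and fin: "finite_measure \<nu>" and t: "t > 0"
  shows "AE y in lborel. y \<notin> large_ball_set \<nu> t \<longrightarrow> y \<in> finite_potential \<nu> \<and> (\<exists>L. linear L \<and> weakly_diff (\<lambda>x. \<integral>z. K (x - z) \<partial>\<nu>) y L)"
proof (cases "- large_ball_set \<nu> t = {}")
  case True
  then show ?thesis by auto
next
  case False
  have "smearing \<nu> t" by (rule smearing.intro) (use sets fin t False in auto)
  then interpret smeared_kernel K DK A B C \<nu> t
    by (rule smeared_kernel.intro[OF critical_kernel_axioms])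
  obtain g where g: "g \<in> bdd_int" "\<And>x. 0 \<le> g x" "\<gamma> = density lborel (\<lambda>x. ennreal (g x))"
    using smeared_density by blast
  have null: "- finite_potential \<nu> \<in> null_sets lborel" by (rule finite_potential_null[OF sets fin])
  have "AE y in lborel. y \<in> finite_potential \<nu>" using AE_not_in[OF null] by simp
  moreover note good_part[OF g(1)] AE_potential_finite AE_density_point[OF \<Omega>_measurable]
  ultimately show ?thesis
  proof eventually_elim
    case (elim y)
    show ?case
    proof
      assume "y \<notin> large_ball_set \<nu> t"
      then have y: "y \<notin> \<Omega>" by (simp add: \<Omega>_def)
      have dens: "\<exists>\<delta>>0. \<forall>r. 0 < r \<and> r < \<delta> \<longrightarrow> emeasure lborel (ball y r \<inter> \<Omega>) \<le> ennreal (\<epsilon> * r ^ DIM('a))" if "\<epsilon> > 0" for \<epsilon>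
        using elim(4) y that by blast
      have pot: "(\<integral>\<^sup>+z. ennreal (dF z / norm (y - z) ^ (DIM('a) + 1)) \<partial>\<nu>) < \<infinity>" using elim(3) y by blast
      note bad = bad_part[OF g y elim(1) pot dens null]
      obtain L where L: "linear L" "weakly_diff (conv K g) y L" using elim(2) by blast
      have "weakly_diff (\<lambda>x. \<integral>z. K (x - z) \<partial>\<nu>) y (\<lambda>h. bad_deriv y h + L h)"
        by (rule weakly_diff_add[OF dim bad(2) L(2) null]) (use elim(1) decomposition[OF g] in auto)
      moreover have "linear (\<lambda>h. bad_deriv y h + L h)" by (rule linear_compose_add[OF bad(1) L(1)])
      ultimately show "y \<in> finite_potential \<nu> \<and> (\<exists>L. linear L \<and> weakly_diff (\<lambda>x. \<integral>z. K (x - z) \<partial>\<nu>) y L)" using elim(1) by blast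
    qed
  qed
qed

text \<open>The maximal function of a finite measure is finite almost everywhere, so the complements
  of the large-ball sets at the levels 1, 2, ... exhaust almost all points.\<close>

lemma potential_weakly_diff_AE:
  fixes \<nu> :: "'a measure"
  assumes sets: "sets \<nu> = sets borel" and fin: "finite_measure \<nu>"
  shows "AE y in lborel. y \<in> finite_potential \<nu> \<and> (\<exists>L. linear L \<and> weakly_diff (\<lambda>x. \<integral>z. K (x - z) \<partial>\<nu>) y L)"
proof -
  interpret \<nu>: finite_measure \<nu> by fact
  let ?X = "\<Inter>n. large_ball_set \<nu> (real (Suc n))"
  have [measurable]: "large_ball_set \<nu> s \<in> sets borel" for s
    using open_large_ball_set[OF sets] by auto
  have Xm: "?X \<in> sets lborel" by measurable
  define c where "c = unit_ball_vol (real DIM('a)) * 5 ^ DIM('a) * measure \<nu> UNIV"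
  have "emeasure lborel ?X \<le> 0"
  proof (rule LIMSEQ_le_const)
    have "(\<lambda>n. c * inverse (real (Suc n))) \<longlonglongrightarrow> c * 0" by (intro tendsto_intros LIMSEQ_inverse_real_of_nat)
    then show "(\<lambda>n. ennreal (c * inverse (real (Suc n)))) \<longlonglongrightarrow> 0" using tendsto_ennrealI by fastforce
    show "\<exists>N. \<forall>n\<ge>N. emeasure lborel ?X \<le> ennreal (c * inverse (real (Suc n)))"
    proof (intro exI allI impI)
      fix n :: nat
      have "emeasure lborel ?X \<le> emeasure lborel (large_ball_set \<nu> (real (Suc n)))"
        by (intro emeasure_mono) auto
      also have "\<dots> \<le> ennreal (unit_ball_vol (real DIM('a)) * 5 ^ DIM('a) / real (Suc n)) * emeasure \<nu> UNIV"
        by (rule emeasure_large_ball_set[OF sets fin]) simp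
      also have "\<dots> = ennreal (c * inverse (real (Suc n)))"
        unfolding \<nu>.emeasure_eq_measure c_def by (subst ennreal_mult[symmetric]) (auto simp: divide_inverse mult_ac simp del: of_nat_Suc)
      finally show "emeasure lborel ?X \<le> ennreal (c * inverse (real (Suc n)))" .
    qed
  qed
  then have "?X \<in> null_sets lborel" using Xm by (simp add: null_sets_def)
  then have "AE y in lborel. y \<notin> ?X" by (rule AE_not_in)
  moreover have "AE y in lborel. \<forall>n. y \<notin> large_ball_set \<nu> (real (Suc n)) \<longrightarrow>
     y \<in> finite_potential \<nu> \<and> (\<exists>L. linear L \<and> weakly_diff (\<lambda>x. \<integral>z. K (x - z) \<partial>\<nu>) y L)"
    unfolding AE_all_countable by (intro allI potential_weakly_diff_off_large_balls[OF sets fin]) simp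
  ultimately show ?thesis
    by eventually_elim blast
qed

end

lemma critical_kernel_of_C2:
  fixes K :: "'a::euclidean_space \<Rightarrow> real" and DK :: "'a \<Rightarrow> 'a \<Rightarrow>\<^sub>L real" and D2K :: "'a \<Rightarrow> 'a \<Rightarrow>\<^sub>L ('a \<Rightarrow>\<^sub>L real)"
  assumes N: "DIM('a) \<ge> 2" and AB: "A > 0" "B > 0"
    and K: "\<And>x. x \<noteq> 0 \<Longrightarrow> (K has_derivative blinfun_apply (DK x)) (at x)"
    and DK: "\<And>x. x \<noteq> 0 \<Longrightarrow> (DK has_derivative blinfun_apply (D2K x)) (at x)"
    and Kle: "\<And>x. x \<noteq> 0 \<Longrightarrow> \<bar>K x\<bar> \<le> A / norm x ^ (DIM('a) - 1)"
    and D2: "\<And>x. x \<noteq> 0 \<Longrightarrow> norm (D2K x) \<le> B / norm x ^ (DIM('a) + 1)"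
  shows "critical_kernel K DK A B (2 * A * (2 ^ (DIM('a) - 1) + 1) + B * 2 ^ DIM('a))"
proof -
  have lip: "norm (DK x - DK y) \<le> B / m ^ (DIM('a) + 1) * norm (x - y)"
    if m: "m > 0" and seg: "\<And>\<xi>. \<xi> \<in> closed_segment x y \<Longrightarrow> m \<le> norm \<xi>" for m x y
  proof (rule differentiable_bound[where S = "closed_segment x y" and f' = "\<lambda>x. blinfun_apply (D2K x)"])
    fix \<xi> assume \<xi>: "\<xi> \<in> closed_segment x y"
    then have \<xi>0: "\<xi> \<noteq> 0" "m \<le> norm \<xi>" using seg[OF \<xi>] m by auto
    show "(DK has_derivative blinfun_apply (D2K \<xi>)) (at \<xi> within closed_segment x y)"
      using DK[OF \<xi>0(1)] by (rule has_derivative_at_withinI)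
    have "onorm (blinfun_apply (D2K \<xi>)) = norm (D2K \<xi>)" by (simp add: norm_blinfun.rep_eq)
    also have "\<dots> \<le> B / norm \<xi> ^ (DIM('a) + 1)" by (rule D2) fact
    also have "\<dots> \<le> B / m ^ (DIM('a) + 1)"
      using \<xi>0 m AB by (intro divide_left_mono power_mono mult_pos_pos zero_less_power) auto
    finally show "onorm (blinfun_apply (D2K \<xi>)) \<le> B / m ^ (DIM('a) + 1)" .
  qed auto
  interpret critical_kernel0 K DK A B
    by unfold_locales (use N AB K Kle lip in auto)
  show ?thesis
    by unfold_locales (use AB DK_le_interpolated in auto)
qed

section \<open>Signed measures and approximate derivatives\<close>

lemma signed_measure_finite_additive:
  fixes \<mu> :: "'a::topological_space set \<Rightarrow> real"
  assumes \<mu>: "finite_signed_measure \<mu>" and A: "A \<in> sets borel" "B \<in> sets borel" "A \<inter> B = {}"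
  shows "\<mu> (A \<union> B) = \<mu> A + \<mu> B"
proof -
  define E where "E i = (if i = 0 then A else if i = 1 then B else {})" for i :: nat
  have "(\<lambda>i. \<mu> (E i)) sums \<mu> (\<Union>i. E i)"
  proof -
    have "range E \<subseteq> sets borel" using A by (auto simp: E_def)
    moreover have "disjoint_family E" using A(3) by (auto simp: disjoint_family_on_def E_def)
    ultimately show ?thesis using \<mu> unfolding finite_signed_measure_def by blast
  qed
  moreover have "(\<Union>i. E i) = A \<union> B"
    by (auto simp: E_def split: if_splits)
  moreover have "(\<lambda>i. \<mu> (E i)) sums (\<Sum>i\<in>{0, 1}. \<mu> (E i))"
    using \<mu> by (intro sums_finite) (auto simp: E_def finite_signed_measure_def)
  ultimately show ?thesis using sums_unique2 by (fastforce simp: E_def)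
qed

text \<open>Otherwise a set with subsets of arbitrarily large measure could be shrunk repeatedly to
  another such set, discarding each time a piece of measure above 1 in absolute value. The discarded
  pieces are disjoint, and the series of their measures cannot converge.\<close>

lemma signed_measure_bounded:
  fixes \<mu> :: "'a::topological_space set \<Rightarrow> real"
  assumes \<mu>: "finite_signed_measure \<mu>"
  shows "\<exists>M. \<forall>F\<in>sets borel. \<bar>\<mu> F\<bar> \<le> M"
proof (rule ccontr)
  define unb where "unb E \<longleftrightarrow> E \<in> sets borel \<and> (\<forall>M. \<exists>F\<in>sets borel. F \<subseteq> E \<and> \<bar>\<mu> F\<bar> > M)" for E
  note add = signed_measure_finite_additive[OF \<mu>]
  assume "\<not> (\<exists>M. \<forall>F\<in>sets borel. \<bar>\<mu> F\<bar> \<le> M)"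
  then have U: "unb UNIV" unfolding unb_def by (auto simp: not_le)
  have step: "\<exists>B. unb B \<and> B \<subseteq> E \<and> \<bar>\<mu> (E - B)\<bar> > 1" if E: "unb E" for E
  proof -
    have Em: "E \<in> sets borel" using E by (simp add: unb_def)
    \<comment> \<open>\<open>F\<close> and its complement in \<open>E\<close> both have measure
      above 1 in absolute value, so either can be discarded, and one of them is still
      unbounded.\<close>
    obtain F where F: "F \<in> sets borel" "F \<subseteq> E" "\<bar>\<mu> F\<bar> > \<bar>\<mu> E\<bar> + 1" using E unfolding unb_def by blast
    have EF: "E - F \<in> sets borel" using Em F by auto
    have "\<mu> E = \<mu> F + \<mu> (E - F)" using add[OF F(1) EF] F(2) by (simp add: Un_absorb1)
    then have 1: "\<bar>\<mu> (E - F)\<bar> > 1" using F(3) by linarith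
    have "unb F \<or> unb (E - F)"
    proof (rule ccontr)
      assume "\<not> (unb F \<or> unb (E - F))"
      then obtain M1 M2 where M: "\<And>G. G \<in> sets borel \<Longrightarrow> G \<subseteq> F \<Longrightarrow> \<bar>\<mu> G\<bar> \<le> M1"
          "\<And>G. G \<in> sets borel \<Longrightarrow> G \<subseteq> E - F \<Longrightarrow> \<bar>\<mu> G\<bar> \<le> M2"
        using F(1) EF unfolding unb_def by (meson not_le)
      obtain G where G: "G \<in> sets borel" "G \<subseteq> E" "\<bar>\<mu> G\<bar> > M1 + M2" using E unfolding unb_def by blast
      have "\<mu> G = \<mu> (G \<inter> F) + \<mu> (G - F)"
        using add[of "G \<inter> F" "G - F"] G F by (simp add: Int_Diff_Un Int_Diff_disjoint)
      moreover have "\<bar>\<mu> (G \<inter> F)\<bar> \<le> M1" by (rule M(1)) (use G F in auto)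
      moreover have "\<bar>\<mu> (G - F)\<bar> \<le> M2" by (rule M(2)) (use G F in auto)
      ultimately show False using G(3) by linarith
    qed
    then show ?thesis
    proof
      assume "unb F" then show ?thesis using F(2) 1 by blast
    next
      assume "unb (E - F)"
      moreover have "E - (E - F) = F" using F(2) by auto
      ultimately show ?thesis using F(3) by (intro exI[of _ "E - F"]) auto
    qed
  qed
  have "\<exists>B. \<forall>n. unb (B n) \<and> (B (Suc n) \<subseteq> B n \<and> \<bar>\<mu> (B n - B (Suc n))\<bar> > 1)"
    by (rule dependent_nat_choice) (use U step in auto)
  then obtain B where B: "\<And>n. unb (B n)" "\<And>n. B (Suc n) \<subseteq> B n" "\<And>n. \<bar>\<mu> (B n - B (Suc n))\<bar> > 1" by blast
  have dec: "B m \<subseteq> B n" if "n \<le> m" for n m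
    using B(2) that by (rule lift_Suc_antimono_le)
  have disj: "disjoint_family (\<lambda>n. B n - B (Suc n))"
    unfolding disjoint_family_on_def
  proof (intro ballI impI)
    fix m n :: nat assume "m \<noteq> n"
    then consider "Suc m \<le> n" | "Suc n \<le> m" by linarith
    then show "(B m - B (Suc m)) \<inter> (B n - B (Suc n)) = {}"
      using dec by cases blast+
  qed
  have "(\<lambda>n. \<mu> (B n - B (Suc n))) sums \<mu> (\<Union>n. B n - B (Suc n))"
  proof -
    have "range (\<lambda>n. B n - B (Suc n)) \<subseteq> sets borel" using B(1) unfolding unb_def by auto
    from \<mu>[unfolded finite_signed_measure_def, THEN conjunct2, rule_format, OF this disj]
    show ?thesis .
  qed
  then have "(\<lambda>n. \<mu> (B n - B (Suc n))) \<longlonglongrightarrow> 0" by (intro summable_LIMSEQ_zero) (auto simp: sums_iff)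
  then have "(\<lambda>n. \<bar>\<mu> (B n - B (Suc n))\<bar>) \<longlonglongrightarrow> 0" by (rule tendsto_rabs_zero)
  then have "1 \<le> (0::real)"
    by (rule LIMSEQ_le_const) (use B(3) in \<open>auto intro: less_imp_le\<close>)
  then show False by simp
qed

section \<open>Jordan decomposition and total variation\<close>

lemma sets_pos_variation [simp, measurable_cong]: "sets (pos_variation \<mu>) = sets borel"
  unfolding pos_variation_def using sets.sigma_sets_eq[of borel] by (simp add: sets_measure_of)

lemma sets_neg_variation [simp, measurable_cong]: "sets (neg_variation \<mu>) = sets borel"
  by (simp add: neg_variation_def)

lemma finite_pos_variation:
  fixes \<mu> :: "'a::topological_space set \<Rightarrow> real"
  assumes bd: "\<And>F. F \<in> sets borel \<Longrightarrow> \<bar>\<mu> F\<bar> \<le> M"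
  shows "finite_measure (pos_variation \<mu>)"
proof (rule finite_measureI)
  have "emeasure (pos_variation \<mu>) UNIV \<le> ennreal M"
  proof -
    have "(SUP F\<in>{F \<in> sets borel. F \<subseteq> UNIV}. ennreal (\<mu> F)) \<le> ennreal M"
      by (intro SUP_least ennreal_leI) (use order_trans[OF abs_ge_self bd] in auto)
    \<comment> \<open>\<open>emeasure_measure_of_conv\<close> yields the supremum or the default
      value 0; both lie below \<open>M\<close>.\<close>
    moreover have "(if P then X else 0) \<le> ennreal M" if "X \<le> ennreal M" for P X using that by simp
    ultimately show ?thesis unfolding pos_variation_def emeasure_measure_of_conv by blast
  qed
  then show "emeasure (pos_variation \<mu>) (space (pos_variation \<mu>)) \<noteq> \<infinity>"
    using sets_eq_imp_space_eq[OF sets_pos_variation[of \<mu>]] by (auto simp: top_unique)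
qed

lemma finite_neg_variation:
  assumes "\<And>F. F \<in> sets borel \<Longrightarrow> \<bar>\<mu> F\<bar> \<le> M"
  shows "finite_measure (neg_variation \<mu>)"
  unfolding neg_variation_def by (rule finite_pos_variation) (use assms in auto)

lemma emeasure_total_variation:
  assumes "A \<in> sets borel"
  shows "emeasure (total_variation \<mu>) A = emeasure (pos_variation \<mu>) A + emeasure (neg_variation \<mu>) A"
  unfolding total_variation_def
proof (rule emeasure_measure_of_sigma)
  show "sigma_algebra UNIV (sets borel)" using sets.sigma_algebra_axioms[of borel] by simp
  show "positive (sets borel) (\<lambda>E. emeasure (pos_variation \<mu>) E + emeasure (neg_variation \<mu>) E)"
    by (simp add: positive_def)
  show "countably_additive (sets borel) (\<lambda>E. emeasure (pos_variation \<mu>) E + emeasure (neg_variation \<mu>) E)"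
  proof (rule countably_additiveI)
    fix F :: "nat \<Rightarrow> 'a set" assume F: "range F \<subseteq> sets borel" "disjoint_family F" "(\<Union>i. F i) \<in> sets borel"
    show "(\<Sum>i. emeasure (pos_variation \<mu>) (F i) + emeasure (neg_variation \<mu>) (F i))
       = emeasure (pos_variation \<mu>) (\<Union>i. F i) + emeasure (neg_variation \<mu>) (\<Union>i. F i)"
      using F by (subst suminf_add[symmetric]) (auto simp: suminf_emeasure)
  qed
qed fact

lemma sets_total_variation [simp, measurable_cong]: "sets (total_variation \<mu>) = sets borel"
  unfolding total_variation_def using sets.sigma_sets_eq[of borel] by (simp add: sets_measure_of)

lemma nn_integral_total_variation:
  fixes f :: "'a::topological_space \<Rightarrow> ennreal"
  assumes f: "f \<in> borel_measurable borel"
  shows "(\<integral>\<^sup>+x. f x \<partial>total_variation \<mu>) = (\<integral>\<^sup>+x. f x \<partial>pos_variation \<mu>) + (\<integral>\<^sup>+x. f x \<partial>neg_variation \<mu>)"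
  using f
proof (induction rule: borel_measurable_induct)
  case (cong f g)
  then have "f = g" by (auto simp: fun_eq_iff)
  then show ?case using cong by simp
next
  case (set A)
  then show ?case by (simp add: emeasure_total_variation)
next
  case (mult u c)
  have [measurable]: "u \<in> borel_measurable borel" using mult by simp
  show ?case using mult by (simp add: nn_integral_cmult distrib_left)
next
  case (add u v)
  have [measurable]: "u \<in> borel_measurable borel" "v \<in> borel_measurable borel" using add by auto
  show ?case using add by (simp add: nn_integral_add ac_simps)
next
  case (seq U)
  have [measurable]: "\<And>i. U i \<in> borel_measurable borel" using seq by simp
  have SUP: "(\<integral>\<^sup>+x. (SUP i. U i) x \<partial>M) = (SUP i. \<integral>\<^sup>+x. U i x \<partial>M)" if [measurable_cong]: "sets M = sets borel" for M
    unfolding SUP_apply by (rule nn_integral_monotone_convergence_SUP) (use seq in auto)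
  have inc: "incseq (\<lambda>i. \<integral>\<^sup>+x. U i x \<partial>M)" for M
    using seq(3) by (auto simp: incseq_def le_fun_def intro!: nn_integral_mono)
  show ?case
    unfolding SUP[OF sets_total_variation] SUP[OF sets_pos_variation] SUP[OF sets_neg_variation]
    by (simp add: seq.IH ennreal_SUP_add[OF inc inc])
qed

text \<open>The derivative is defined by choice, so its value has to be identified. If D = D1 - D2
  is nonzero, then |D(x - y)| is at least a multiple of r on a ball of radius \<kappa> r inside
  B_r(y). There one of the two quotients exceeds a fixed \<epsilon>, so the two exceptional
  densities add up to at least \<kappa>^N.\<close>

lemma ap_derivative_unique:
  fixes v :: "'a::euclidean_space \<Rightarrow> real"
  assumes [measurable]: "v \<in> borel_measurable borel"
    and D1: "has_ap_derivative v D1 y" and D2: "has_ap_derivative v D2 y"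
  shows "D1 = D2"
proof (rule ccontr)
  let ?\<omega> = "unit_ball_vol (real DIM('a))"
  assume "D1 \<noteq> D2"
  define D where "D h = D1 h - D2 h" for h
  have l: "linear D1" "linear D2" using D1 D2 by (auto simp: has_ap_derivative_def)
  have lD: "linear D" unfolding D_def using l by (rule linear_compose_sub)
  have [measurable]: "D1 \<in> borel_measurable borel" "D2 \<in> borel_measurable borel"
    using l by (auto intro!: borel_measurable_continuous_onI linear_continuous_on simp: linear_conv_bounded_linear)
  obtain h0 where h0: "D h0 \<noteq> 0" using \<open>D1 \<noteq> D2\<close> by (auto simp: D_def fun_eq_iff)
  have h00: "h0 \<noteq> 0" using h0 linear_0[OF lD] by auto
  define e where "e = (1 / norm h0) *\<^sub>R h0"
  have e: "norm e = 1" "D e \<noteq> 0" using h00 h0 by (auto simp: e_def linear_cmul[OF lD])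
  define c where "c = \<bar>D e\<bar>"
  have c: "c > 0" using e by (simp add: c_def)
  obtain b where b: "b > 0" "\<And>x. norm (D x) \<le> b * norm x"
    using linear_bounded_pos[OF lD] by blast
  \<comment> \<open>1/4 keeps the ball inside B_r(y); c/(4b) keeps the perturbation of D(x - y)
    within half of its size r c/2 at the centre.\<close>
  define \<kappa> where "\<kappa> = min (1/4) (c / (4 * b))"
  have \<kappa>: "\<kappa> > 0" "\<kappa> \<le> 1/4" "b * \<kappa> \<le> c / 4" using b c by (auto simp: \<kappa>_def min_def field_simps)
  define W where "W D = (\<lambda>x. (v x - v y - D (x - y)) / norm (x - y))" for D
  define \<epsilon> where "\<epsilon> = c / 8"
  have \<epsilon>: "\<epsilon> > 0" using c by (simp add: \<epsilon>_def)
  define S where "S D = {x. \<epsilon> < \<bar>W D x\<bar>}" for D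
  have Sm: "S D1 \<in> sets borel" "S D2 \<in> sets borel" unfolding S_def W_def by measurable
  have lim: "((\<lambda>r. measure lebesgue (S D \<inter> ball y r) / measure lebesgue (ball y r)) \<longlongrightarrow> 0) (at_right 0)"
    if "has_ap_derivative v D y" for D
    using that \<epsilon> unfolding has_ap_derivative_def ap_lim_def S_def W_def by auto
  have sub: "ball (y + (r / 2) *\<^sub>R e) (\<kappa> * r) \<subseteq> (S D1 \<union> S D2) \<inter> ball y r" if r: "r > 0" for r
  proof
    fix x assume x: "x \<in> ball (y + (r / 2) *\<^sub>R e) (\<kappa> * r)"
    define k where "k = x - y - (r / 2) *\<^sub>R e"
    have k: "norm k < \<kappa> * r" using x by (simp add: k_def dist_norm norm_minus_commute algebra_simps)
    have xy: "x - y = (r / 2) *\<^sub>R e + k" by (simp add: k_def)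
    have "norm (x - y) \<le> r / 2 + norm k" unfolding xy using norm_triangle_ineq[of "(r / 2) *\<^sub>R e" k] e r by simp
    moreover have kr: "\<kappa> * r \<le> r / 4" using \<kappa>(2) r by simp
    ultimately have n: "norm (x - y) < 3 / 4 * r" using k by linarith
    have "D (x - y) = r / 2 * D e + D k" unfolding xy by (simp add: linear_add[OF lD] linear_cmul[OF lD])
    then have "\<bar>D (x - y)\<bar> \<ge> r / 2 * c - \<bar>D k\<bar>" using r by (simp add: c_def abs_mult[symmetric])
    moreover have "\<bar>D k\<bar> \<le> r * c / 4"
    proof -
      have "\<bar>D k\<bar> \<le> b * norm k" using b(2)[of k] by simp
      also have "\<dots> \<le> b * (\<kappa> * r)" using k b by (intro mult_left_mono) auto
      also have "\<dots> \<le> c / 4 * r" using mult_right_mono[OF \<kappa>(3), of r] r by simp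
      finally show ?thesis by (simp add: mult_ac)
    qed
    ultimately have big: "\<bar>D (x - y)\<bar> \<ge> r * c / 4" by simp
    have nz: "norm (x - y) > 0"
    proof (rule ccontr)
      assume "\<not> norm (x - y) > 0"
      then have "D (x - y) = 0" using linear_0[OF lD] by simp
      then show False using big mult_pos_pos[OF r c] by simp
    qed
    have "x \<in> S D1 \<union> S D2"
    proof (rule ccontr)
      assume "x \<notin> S D1 \<union> S D2"
      then have "\<bar>W D1 x\<bar> \<le> \<epsilon>" "\<bar>W D2 x\<bar> \<le> \<epsilon>" by (auto simp: S_def)
      then have w: "\<bar>W D2 x - W D1 x\<bar> \<le> 2 * \<epsilon>" by linarith
      have "W D2 x - W D1 x = D (x - y) / norm (x - y)"
        using nz by (simp add: W_def D_def diff_divide_distrib[symmetric])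
      with w have "\<bar>D (x - y)\<bar> \<le> 2 * \<epsilon> * norm (x - y)" using nz by (simp add: abs_divide pos_divide_le_eq)
      also have "\<dots> < 2 * \<epsilon> * (3 / 4 * r)" using n \<epsilon> by (intro mult_strict_left_mono) auto
      also have "\<dots> \<le> r * c / 4" using c r by (simp add: \<epsilon>_def field_simps)
      finally show False using big by simp
    qed
    then show "x \<in> (S D1 \<union> S D2) \<inter> ball y r" using n r by (simp add: dist_norm norm_minus_commute)
  qed
  have frac: "\<kappa> ^ DIM('a) \<le> measure lebesgue (S D1 \<inter> ball y r) / measure lebesgue (ball y r)
      + measure lebesgue (S D2 \<inter> ball y r) / measure lebesgue (ball y r)" if r: "r > 0" for r
  proof -
    have fm: "X \<inter> ball y r \<in> fmeasurable lborel" if "X \<in> sets borel" for X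
    proof -
      have "ball y r \<inter> X \<in> fmeasurable lborel"
        using that emeasure_lborel_ball_finite[of y r]
        by (intro fmeasurable_Int_fmeasurable) (auto simp: fmeasurable_def)
      then show ?thesis by (simp add: Int_commute)
    qed
    have ml: "measure lebesgue X = measure lborel X" if "X \<in> sets borel" for X
      using that by (simp add: measure_completion)
    have "?\<omega> * (\<kappa> * r) ^ DIM('a) = measure lborel (ball (y + (r / 2) *\<^sub>R e) (\<kappa> * r))"
      using \<kappa>(1) r by (simp add: content_ball)
    also have "\<dots> \<le> measure lborel ((S D1 \<inter> ball y r) \<union> (S D2 \<inter> ball y r))"
      using sub[OF r] Sm by (intro measure_mono_fmeasurable fmeasurable.Un fm) auto
    also have "\<dots> \<le> measure lborel (S D1 \<inter> ball y r) + measure lborel (S D2 \<inter> ball y r)"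
      using Sm by (intro measure_Un_le) auto
    finally have "?\<omega> * (\<kappa> * r) ^ DIM('a) / (?\<omega> * r ^ DIM('a)) \<le> (measure lborel (S D1 \<inter> ball y r) + measure lborel (S D2 \<inter> ball y r)) / (?\<omega> * r ^ DIM('a))"
      using r by (intro divide_right_mono) auto
    moreover have "?\<omega> * (\<kappa> * r) ^ DIM('a) / (?\<omega> * r ^ DIM('a)) = \<kappa> ^ DIM('a)"
      using r unit_ball_vol_pos[of "real DIM('a)"] by (simp add: power_mult_distrib del: unit_ball_vol_pos)
    ultimately show ?thesis
      using r Sm by (simp add: ml content_ball add_divide_distrib)
  qed
  have "((\<lambda>r. measure lebesgue (S D1 \<inter> ball y r) / measure lebesgue (ball y r)
      + measure lebesgue (S D2 \<inter> ball y r) / measure lebesgue (ball y r)) \<longlongrightarrow> 0 + 0) (at_right 0)"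
    by (intro tendsto_add lim D1 D2)
  then have "\<kappa> ^ DIM('a) \<le> 0 + 0"
    by (rule tendsto_lowerbound) (use frac in \<open>auto simp: eventually_at_right_field intro!: exI[of _ 1]\<close>)
  then show False using zero_less_power[OF \<kappa>(1), of "DIM('a)"] by linarith
qed

text \<open>Outside the ball of radius \<theta> r the quotient exceeds \<epsilon> only where the
  remainder exceeds \<epsilon> \<theta> r, and the weak expansion bounds the measure of that set;
  the small ball occupies the fraction \<theta>^N.\<close>

lemma weakly_diff_imp_has_ap_derivative:
  fixes v :: "'a::euclidean_space \<Rightarrow> real"
  assumes N: "DIM('a) \<ge> 2" and L: "linear L" and weakly_diff: "weakly_diff v y L"
  shows "has_ap_derivative v L y"
  unfolding has_ap_derivative_def ap_lim_def
proof (intro conjI allI impI)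
  let ?\<omega> = "unit_ball_vol (real DIM('a))" and ?p = "real DIM('a) / (real DIM('a) - 1)"
  have \<omega>: "?\<omega> > 0" by simp
  show "linear L" by fact
  fix \<epsilon> :: real assume \<epsilon>: "\<epsilon> > 0"
  let ?X = "{x. \<epsilon> < \<bar>(v x - v y - L (x - y)) / norm (x - y) - 0\<bar>}"
  let ?f = "\<lambda>r. measure lebesgue (?X \<inter> ball y r) / measure lebesgue (ball y r)"
  show "(?f \<longlongrightarrow> 0) (at_right 0)"
  proof (rule tendstoI)
    fix \<eta> :: real assume \<eta>: "\<eta> > 0"
    define \<theta> where "\<theta> = min 1 (\<eta> / 4)"
    have \<theta>: "\<theta> > 0" "\<theta> ^ DIM('a) \<le> \<eta> / 4"
    proof -
      show "\<theta> > 0" using \<eta> by (simp add: \<theta>_def)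
      have "\<theta> ^ DIM('a) \<le> \<theta> ^ 1" using \<eta> N by (intro power_decreasing) (auto simp: \<theta>_def)
      then show "\<theta> ^ DIM('a) \<le> \<eta> / 4" by (simp add: \<theta>_def)
    qed
    \<comment> \<open>\<epsilon>'/(\<epsilon> \<theta>) is then a number at most 1, which raising to
      the power p >= 1 does not increase.\<close>
    define \<epsilon>' where "\<epsilon>' = \<epsilon> * \<theta> * min 1 (?\<omega> * \<eta> / 4)"
    have m0: "min 1 (?\<omega> * \<eta> / 4) > 0" using \<omega> \<eta> by simp
    have \<epsilon>': "\<epsilon>' > 0" using \<epsilon> \<theta> m0 unfolding \<epsilon>'_def by (intro mult_pos_pos)
    obtain \<delta> where \<delta>: "\<delta> > 0" "\<And>r s. 0 < r \<Longrightarrow> r < \<delta> \<Longrightarrow> 0 < s \<Longrightarrow>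
       (\<exists>S\<in>sets borel. {x \<in> ball y r. s < \<bar>v x - v y - L (x - y)\<bar>} \<subseteq> S \<and>
          emeasure lborel S \<le> ennreal ((\<epsilon>' * r ^ DIM('a) / s) powr ?p))"
      using weakly_diff[unfolded weakly_diff_def, rule_format, OF \<epsilon>'] by blast
    have "?f r < \<eta>" if r: "0 < r" "r < \<delta>" for r
    proof -
      have s: "\<epsilon> * (\<theta> * r) > 0" using \<epsilon> \<theta> r by simp
      obtain S where S: "S \<in> sets borel" "{x \<in> ball y r. \<epsilon> * (\<theta> * r) < \<bar>v x - v y - L (x - y)\<bar>} \<subseteq> S"
          "emeasure lborel S \<le> ennreal ((\<epsilon>' * r ^ DIM('a) / (\<epsilon> * (\<theta> * r))) powr ?p)"
        using \<delta>(2)[OF r s] by blast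
      have "(\<epsilon>' * r ^ DIM('a) / (\<epsilon> * (\<theta> * r))) powr ?p = r ^ DIM('a) * (\<epsilon>' / (\<epsilon> * (\<theta> * r) / r)) powr ?p"
        by (rule critical_scaling[OF N r(1) less_imp_le[OF \<epsilon>'] s])
      also have "\<epsilon>' / (\<epsilon> * (\<theta> * r) / r) = min 1 (?\<omega> * \<eta> / 4)"
        using \<epsilon> \<theta> r by (simp add: \<epsilon>'_def)
      also have "min 1 (?\<omega> * \<eta> / 4) powr ?p \<le> min 1 (?\<omega> * \<eta> / 4) powr 1"
        using critical_exponent_ge_1[OF N] m0 by (intro powr_mono') auto
      also have "\<dots> \<le> ?\<omega> * \<eta> / 4" using m0 by simp
      finally have eS: "(\<epsilon>' * r ^ DIM('a) / (\<epsilon> * (\<theta> * r))) powr ?p \<le> r ^ DIM('a) * (?\<omega> * \<eta> / 4)"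
        using r by simp
      have sub: "?X \<inter> ball y r \<subseteq> ball y (\<theta> * r) \<union> S"
      proof
        fix x assume x: "x \<in> ?X \<inter> ball y r"
        show "x \<in> ball y (\<theta> * r) \<union> S"
        proof (cases "x \<in> ball y (\<theta> * r)")
          case False
          then have n: "\<theta> * r \<le> norm (x - y)" by (simp add: dist_norm norm_minus_commute)
          then have n0: "norm (x - y) > 0" using \<theta> r by (meson less_le_trans mult_pos_pos)
          have "\<epsilon> * norm (x - y) < \<bar>v x - v y - L (x - y)\<bar>"
            using x n0 by (simp add: abs_divide pos_less_divide_eq)
          moreover have "\<epsilon> * (\<theta> * r) \<le> \<epsilon> * norm (x - y)" using n \<epsilon> by simp
          ultimately show ?thesis using S(2) x by auto
        qed simp
      qed
      have "emeasure lebesgue (?X \<inter> ball y r) \<le> emeasure lebesgue (ball y (\<theta> * r) \<union> S)"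
        using sub S(1) by (intro emeasure_mono) auto
      also have "\<dots> \<le> emeasure lebesgue (ball y (\<theta> * r)) + emeasure lebesgue S"
        using S(1) by (intro emeasure_subadditive) auto
      also have "\<dots> = emeasure lborel (ball y (\<theta> * r)) + emeasure lborel S"
        using S(1) by simp
      also have "\<dots> \<le> ennreal (?\<omega> * (\<theta> * r) ^ DIM('a)) + ennreal (r ^ DIM('a) * (?\<omega> * \<eta> / 4))"
        using \<theta> r by (intro add_mono order_trans[OF S(3) ennreal_leI[OF eS]]) (simp add: emeasure_ball)
      also have "\<dots> = ennreal (?\<omega> * (\<theta> * r) ^ DIM('a) + r ^ DIM('a) * (?\<omega> * \<eta> / 4))"
        using \<theta> r \<eta> by (intro ennreal_plus[symmetric]) auto
      finally have "measure lebesgue (?X \<inter> ball y r) \<le> ?\<omega> * (\<theta> * r) ^ DIM('a) + r ^ DIM('a) * (?\<omega> * \<eta> / 4)"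
        unfolding measure_def using \<theta> r \<eta> by (intro enn2real_leI) auto
      also have "\<dots> = (\<theta> ^ DIM('a) + \<eta> / 4) * (?\<omega> * r ^ DIM('a))"
        by (simp add: power_mult_distrib algebra_simps)
      also have "\<dots> \<le> (\<eta> / 2) * (?\<omega> * r ^ DIM('a))"
        using \<theta>(2) r by (intro mult_right_mono) auto
      finally have le: "measure lebesgue (?X \<inter> ball y r) / (?\<omega> * r ^ DIM('a)) \<le> \<eta> / 2"
        using r by (simp add: pos_divide_le_eq)
      have b: "measure lebesgue (ball y r) = ?\<omega> * r ^ DIM('a)"
        using r by (simp add: measure_completion content_ball)
      have "?f r \<le> \<eta> / 2" unfolding b by (rule le)
      then show ?thesis using \<eta> by linarith
    qed
    then show "\<forall>\<^sub>F r in at_right 0. dist (?f r) 0 < \<eta>"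
      using \<delta>(1) by (auto simp: eventually_at_right_field intro!: exI[of _ \<delta>])
  qed
qed

text \<open>The weak expansion bounds every level of the quasinorm of the remainder by \<epsilon>
  r^N, while the quasinorm of 1 is at least c r^(N-1); the quotient divided by r is then at most
  \<epsilon>/c.\<close>

lemma weakly_diff_imp_weak_Lp_differentiable:
  fixes v :: "'a::euclidean_space \<Rightarrow> real"
  assumes N: "DIM('a) \<ge> 2" and v: "v \<in> borel_measurable borel" and L: "linear L" and weakly_diff: "weakly_diff v y L"
  shows "weak_Lp_differentiable (real DIM('a) / (real DIM('a) - 1)) v y"
proof -
  let ?\<omega> = "unit_ball_vol (real DIM('a))" and ?p = "real DIM('a) / (real DIM('a) - 1)"
  have \<omega>: "?\<omega> > 0" by simp
  have p: "?p > 0" using critical_exponent_ge_1[OF N] by linarith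
  have ap: "has_ap_derivative v L y" by (rule weakly_diff_imp_has_ap_derivative[OF N L weakly_diff])
  have apd: "ap_derivative v y = L"
    unfolding ap_derivative_def
    by (rule some_equality[where P = "\<lambda>D. has_ap_derivative v D y"]) (rule ap, rule ap_derivative_unique[OF v _ ap])
  have R: "v x - ap_taylor1 v y x = v x - v y - L (x - y)" for x by (simp add: ap_taylor1_def apd)
  define c where "c = 1/2 * ?\<omega> powr (1 / ?p)"
  have c: "c > 0" using \<omega> by (simp add: c_def)
  obtain m where m: "DIM('a) = Suc m" "m > 0" using N by (cases "DIM('a)") auto
  have one: "ennreal (c * r ^ m) \<le> weak_Lp_seminorm ?p (ball y r) (\<lambda>x. 1)" if r: "r > 0" for r
  proof -
    \<comment> \<open>Superlevel sets are strict, so a level below 1 is taken to capture the whole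
      ball.\<close>
    have "{x \<in> ball y r. 1/2 < \<bar>1::real\<bar>} = ball y r" by auto
    then have "ennreal (1/2) * ennreal_powr (emeasure lebesgue {x \<in> ball y r. 1/2 < \<bar>1::real\<bar>}) (1 / ?p)
       = ennreal (1/2) * ennreal ((?\<omega> * r ^ DIM('a)) powr (1 / ?p))"
      using r by (simp add: ennreal_powr_def emeasure_ball)
    also have "(?\<omega> * r ^ DIM('a)) powr (1 / ?p) = ?\<omega> powr (1 / ?p) * r ^ m"
    proof -
      have "(r ^ DIM('a)) powr (1 / ?p) = r powr (real DIM('a) * (1 / ?p))"
        using r by (simp add: powr_realpow[symmetric] powr_powr)
      also have "real DIM('a) * (1 / ?p) = real m" using m by simp
      finally show ?thesis using r by (simp add: powr_mult powr_realpow)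
    qed
    also have "ennreal (1/2) * ennreal (?\<omega> powr (1 / ?p) * r ^ m) = ennreal (c * r ^ m)"
      using r by (subst ennreal_mult[symmetric]) (auto simp: c_def)
    finally show ?thesis
      unfolding weak_Lp_seminorm_def by (intro SUP_upper2[of "1/2"]) auto
  qed
  have "((\<lambda>r. ennreal (1 / r) * (weak_Lp_seminorm ?p (ball y r) (\<lambda>x. v x - ap_taylor1 v y x) /
            weak_Lp_seminorm ?p (ball y r) (\<lambda>x. 1))) \<longlongrightarrow> 0) (at_right 0)"
  proof (rule order_tendstoI)
    fix a :: ennreal assume "0 < a"
    then obtain \<eta> where \<eta>: "\<eta> > 0" "ennreal \<eta> < a"
      by (metis dense ennreal_cases ennreal_less_zero_iff less_top_ennreal not_less_iff_gr_or_eq order_less_trans top.not_eq_extremum)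
    define \<epsilon> where "\<epsilon> = c * \<eta>"
    have \<epsilon>: "\<epsilon> > 0" using c \<eta> by (simp add: \<epsilon>_def)
    obtain \<delta> where \<delta>: "\<delta> > 0" "\<And>r s. 0 < r \<Longrightarrow> r < \<delta> \<Longrightarrow> 0 < s \<Longrightarrow>
       (\<exists>S\<in>sets borel. {x \<in> ball y r. s < \<bar>v x - v y - L (x - y)\<bar>} \<subseteq> S \<and>
          emeasure lborel S \<le> ennreal ((\<epsilon> * r ^ DIM('a) / s) powr ?p))"
      using weakly_diff[unfolded weakly_diff_def, rule_format, OF \<epsilon>] by blast
    have "ennreal (1 / r) * (weak_Lp_seminorm ?p (ball y r) (\<lambda>x. v x - ap_taylor1 v y x) /
            weak_Lp_seminorm ?p (ball y r) (\<lambda>x. 1)) < a" if r: "0 < r" "r < \<delta>" for r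
    proof -
      have "weak_Lp_seminorm ?p (ball y r) (\<lambda>x. v x - ap_taylor1 v y x) \<le> ennreal (\<epsilon> * r ^ DIM('a))"
        unfolding weak_Lp_seminorm_def R
      proof (rule SUP_least)
        fix s :: real assume "s \<in> {0<..}"
        then have s: "s > 0" by simp
        let ?X = "{x \<in> ball y r. s < \<bar>v x - v y - L (x - y)\<bar>}"
        let ?q = "\<epsilon> * r ^ DIM('a) / s"
        have q0: "?q \<ge> 0" using \<epsilon> r s by simp
        obtain S where S: "S \<in> sets borel" "?X \<subseteq> S" "emeasure lborel S \<le> ennreal (?q powr ?p)"
          using \<delta>(2)[OF r s] by blast
        have "emeasure lebesgue ?X \<le> emeasure lebesgue S" using S by (intro emeasure_mono) auto
        also have "\<dots> \<le> ennreal (?q powr ?p)" using S by simp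
        finally have X: "emeasure lebesgue ?X \<le> ennreal (?q powr ?p)" .
        then have fin: "emeasure lebesgue ?X \<noteq> \<infinity>" by (auto simp: top_unique)
        have "enn2real (emeasure lebesgue ?X) \<le> ?q powr ?p" using X by (intro enn2real_leI) auto
        then have "enn2real (emeasure lebesgue ?X) powr (1 / ?p) \<le> (?q powr ?p) powr (1 / ?p)"
          using p by (intro powr_mono2) auto
        also have "\<dots> = ?q"
        proof -
          have "q * (1 / q) = 1" if "q > 0" for q :: real using that by simp
          then have "(?q powr ?p) powr (1 / ?p) = ?q powr 1" using p by (simp only: powr_powr)
          also have "\<dots> = ?q" by (rule powr_one[OF q0])
          finally show ?thesis .
        qed
        finally have "ennreal_powr (emeasure lebesgue ?X) (1 / ?p) \<le> ennreal ?q"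
          using fin by (simp add: ennreal_powr_def ennreal_leI)
        then have "ennreal s * ennreal_powr (emeasure lebesgue ?X) (1 / ?p) \<le> ennreal s * ennreal ?q"
          by (intro mult_left_mono) auto
        also have "\<dots> = ennreal (\<epsilon> * r ^ DIM('a))" using s q0 by (subst ennreal_mult[symmetric]) auto
        finally show "ennreal s * ennreal_powr (emeasure lebesgue ?X) (1 / ?p) \<le> ennreal (\<epsilon> * r ^ DIM('a))" .
      qed
      also have "\<dots> = ennreal (c * r ^ m) * ennreal (\<eta> * r)"
        using c \<eta> r by (subst ennreal_mult[symmetric]) (auto simp: \<epsilon>_def m mult_ac)
      also have "\<dots> \<le> weak_Lp_seminorm ?p (ball y r) (\<lambda>x. 1) * ennreal (\<eta> * r)"
        by (intro mult_right_mono one r) auto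
      finally have "weak_Lp_seminorm ?p (ball y r) (\<lambda>x. v x - ap_taylor1 v y x) / weak_Lp_seminorm ?p (ball y r) (\<lambda>x. 1) \<le> ennreal (\<eta> * r)"
        by (intro divide_le_posI_ennreal) (use one[OF r(1)] c r in \<open>auto simp: mult.commute intro: less_le_trans[rotated]\<close>)
      then have "ennreal (1 / r) * (weak_Lp_seminorm ?p (ball y r) (\<lambda>x. v x - ap_taylor1 v y x) / weak_Lp_seminorm ?p (ball y r) (\<lambda>x. 1))
         \<le> ennreal (1 / r) * ennreal (\<eta> * r)" by (intro mult_left_mono) auto
      also have "\<dots> = ennreal \<eta>" using r \<eta> by (subst ennreal_mult[symmetric]) auto
      finally show ?thesis using \<eta>(2) by simp
    qed
    then show "\<forall>\<^sub>F r in at_right 0. ennreal (1 / r) * (weak_Lp_seminorm ?p (ball y r) (\<lambda>x. v x - ap_taylor1 v y x) /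
            weak_Lp_seminorm ?p (ball y r) (\<lambda>x. 1)) < a"
      using \<delta>(1) by (auto simp: eventually_at_right_field intro!: exI[of _ \<delta>])
  qed simp
  then show ?thesis
    unfolding weak_Lp_differentiable_def ap_differentiable_def using ap by blast
qed

theorem theorem1p3:
  fixes K :: "real ^ 'n \<Rightarrow> real"
    and DK :: "real ^ 'n \<Rightarrow> ((real ^ 'n) \<Rightarrow>\<^sub>L real)"
    and D2K :: "real ^ 'n \<Rightarrow> ((real ^ 'n) \<Rightarrow>\<^sub>L ((real ^ 'n) \<Rightarrow>\<^sub>L real))"
    and \<mu> :: "(real ^ 'n) set \<Rightarrow> real"
    and A B :: real
  assumes "CARD('n) \<ge> 2"
    and "A > 0" and "B > 0"
    and "\<And>x. x \<noteq> 0 \<Longrightarrow> (K has_derivative blinfun_apply (DK x)) (at x)"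
    and "\<And>x. x \<noteq> 0 \<Longrightarrow> (DK has_derivative blinfun_apply (D2K x)) (at x)"
    and "continuous_on (UNIV - {0}) D2K"
    and "\<And>x. x \<noteq> 0 \<Longrightarrow> \<bar>K x\<bar> \<le> A / norm x ^ (CARD('n) - 1)"
    and "\<And>x. x \<noteq> 0 \<Longrightarrow> norm (D2K x) \<le> B / norm x ^ (CARD('n) + 1)"
    and "finite_signed_measure \<mu>"
  shows "AE y in lebesgue.
           convolution_defined K \<mu> y \<and>
           weak_Lp_differentiable (real CARD('n) / (real CARD('n) - 1)) (convolve K \<mu>) y"
proof -
  have dim_eq: "DIM(real ^ 'n) = CARD('n)" by simp
  interpret critical_kernel K DK A B "2 * A * (2 ^ (DIM(real ^ 'n) - 1) + 1) + B * 2 ^ DIM(real ^ 'n)"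
    by (rule critical_kernel_of_C2[where D2K = D2K]) (use assms in auto)
  obtain M where M: "\<And>F. F \<in> sets borel \<Longrightarrow> \<bar>\<mu> F\<bar> \<le> M"
    using signed_measure_bounded[OF assms(9)] by blast
  define P where "P = pos_variation \<mu>"
  define Q where "Q = neg_variation \<mu>"
  have [measurable_cong]: "sets P = sets borel" "sets Q = sets borel" by (simp_all add: P_def Q_def)
  interpret P: finite_measure P unfolding P_def by (rule finite_pos_variation) (rule M)
  interpret Q: finite_measure Q unfolding Q_def by (rule finite_neg_variation) (rule M)
  define u where "u x = (\<integral>z. K (x - z) \<partial>P)" for x
  define w where "w x = (\<integral>z. K (x - z) \<partial>Q)" for x
  have v: "convolve K \<mu> x = u x + - w x" for x
    by (simp add: convolve_def signed_integral_def u_def w_def P_def Q_def)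
  have [measurable]: "u \<in> borel_measurable borel" "w \<in> borel_measurable borel"
    unfolding u_def w_def by measurable
  have vm: "convolve K \<mu> \<in> borel_measurable borel"
    unfolding v[abs_def] by measurable
  have "AE y in lborel. y \<in> finite_potential P \<and> (\<exists>L. linear L \<and> weakly_diff u y L)"
    unfolding u_def by (rule potential_weakly_diff_AE) (simp_all add: P_def P.finite_measure_axioms[unfolded P_def])
  moreover have "AE y in lborel. y \<in> finite_potential Q \<and> (\<exists>L. linear L \<and> weakly_diff w y L)"
    unfolding w_def by (rule potential_weakly_diff_AE) (simp_all add: Q_def Q.finite_measure_axioms[unfolded Q_def])
  ultimately have "AE y in lborel. convolution_defined K \<mu> y \<and>
           weak_Lp_differentiable (real DIM(real ^ 'n) / (real DIM(real ^ 'n) - 1)) (convolve K \<mu>) y"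
  proof eventually_elim
    case (elim y)
    then obtain L1 L2 where L: "linear L1" "weakly_diff u y L1" "linear L2" "weakly_diff w y L2" by blast
    have "(\<lambda>z. ennreal \<bar>K (y - z)\<bar>) \<in> borel_measurable borel" by measurable
    from nn_integral_total_variation[OF this, of \<mu>]
    have "convolution_defined K \<mu> y"
      using elim by (simp add: convolution_defined_def finite_potential_def P_def Q_def)
    \<comment> \<open>The identity \<open>v\<close> holds at every x, because the integrals on its
      two sides take the same default values; hence the empty exceptional set.\<close>
    moreover have "weakly_diff (convolve K \<mu>) y (\<lambda>h. L1 h + - L2 h)"
      by (rule weakly_diff_add[OF dim L(2) weakly_diff_uminus[OF L(4)], of "{}"]) (auto simp: v)
    moreover have "linear (\<lambda>h. L1 h + - L2 h)"
      using linear_compose_sub[OF L(1,3)] by simp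
    ultimately show ?case
      using weakly_diff_imp_weak_Lp_differentiable[OF dim vm] by blast
  qed
  then show ?thesis
    unfolding dim_eq by (rule AE_completion)
qed

end
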